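(* Let $\lambda>0$ and let $\psi:\mathbb{R}\to\,]0,\infty[$ be a Borel function such that $\int_x^\infty\psi(z)e^{-\lambda z}dz<\infty$ for all $x\in\mathbb{R}$ and $\int_0^\infty\psi(z)e^{-\lambda z}dz=1$. Let $$\Phi(y)=1-e^{\lambda y}\int_y^\infty\psi(z)e^{-\lambda z}dz,\qquad\varphi(y)=\psi(y)-\lambda e^{\lambda y}\int_y^\infty\psi(z)e^{-\lambda z}dz,$$ and let $Q_0^{\lambda,\varphi}$ be the probability measure on $(\Omega,\mathcal{F}_\infty)$ such that, for all $t\ge0$ and $\Gamma_t\in\mathcal{F}_t$, $Q_0^{\lambda,\varphi}(\Gamma_t)=E_0[1_{\Gamma_t}M_t^{\lambda,\varphi}]$, where $$M_t^{\lambda,\varphi}=\Big\{(1-\Phi(S_t))\cosh(\lambda(S_t-X_t))+\varphi(S_t)\frac{\sinh(\lambda(S_t-X_t))}{\lambda}\Big\}e^{-\lambda^2t/2}.$$ Then $$Q_0^{\lambda,\varphi}(\cdot)=\int_0^\infty Q_0^{\lambda,(y)}(\cdot)\,e^{-\lambda y}\psi(y)\,dy.$$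
   Context: $\Omega=\mathcal{C}(\mathbb{R}_+,\mathbb{R})$ is the canonical space, $(X_t)_{t\ge0}$ the coordinate process, $\mathcal{F}_t=\sigma(X_s;0\le s\le t)$, $\mathcal{F}_\infty=\sigma(X_s;s\ge0)$; $P_0$ is the Wiener measure started at $0$, with expectation $E_0$. $S_t=\sup_{0\le u\le t}X_u$, $T_x=\inf\{t\ge0;X_t=x\}$. The process $(M_t^{\lambda,\varphi})$ is a $P_0$-martingale with $M_0^{\lambda,\varphi}=1-\Phi(0)=1$. For $\lambda>0$, $x>0$, $Q_0^{\lambda,(x)}$ is the unique probability measure on the canonical space such that: $(X_t;0\le t\le T_x)$ is distributed as a Brownian motion with drift $\lambda$, started at $0$ and stopped at its first hitting time of $x$; $(x-X_{t+T_x};t\ge0)$ is distributed as $(Z_t^{(\lambda)};t\ge0)$ under $P_0$, where $Z^{(\lambda)}$ is the non-negative solution of $Z_t^{(\lambda)}=X_t+\lambda\int_0^t\coth(\lambda Z_u^{(\lambda)})\,du$; and these two processes are independent. *)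

theory Defs
  imports "HOL-Probability.Probability"
begin

section \<open>The canonical space\<close>

text \<open>A path is represented by a function on the reals that is continuous on the nonnegative
  half-line and \<open>undefined\<close> at negative times, so that the elements of \<open>paths\<close> correspond
  one-to-one to the real continuous functions on the nonnegative half-line.\<close>

definition paths :: "(real \<Rightarrow> real) set" where
  "paths = {w \<in> extensional {0..}. continuous_on {0..} w}"

definition path_algebra :: "real set \<Rightarrow> (real \<Rightarrow> real) measure" where
  "path_algebra I = sigma paths {{w \<in> paths. w s \<in> A} | s A. s \<in> I \<and> A \<in> sets borel}"

abbreviation F_upto :: "real \<Rightarrow> (real \<Rightarrow> real) measure" where
  "F_upto t \<equiv> path_algebra {0..t}"

abbreviation F_inf :: "(real \<Rightarrow> real) measure" where
  "F_inf \<equiv> path_algebra {0..}"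

definition running_sup :: "real \<Rightarrow> (real \<Rightarrow> real) \<Rightarrow> real" where
  "running_sup t w = (SUP u\<in>{0..t}. w u)"

definition hitting_time :: "real \<Rightarrow> (real \<Rightarrow> real) \<Rightarrow> ereal" where
  "hitting_time x w = (INF t\<in>{t. 0 \<le> t \<and> w t = x}. ereal t)"

definition wiener_measure :: "(real \<Rightarrow> real) measure \<Rightarrow> bool" where
  "wiener_measure P \<longleftrightarrow>
     prob_space P \<and> sets P = sets F_inf \<and>
     (AE w in P. w 0 = 0) \<and>
     (\<forall>s t. 0 \<le> s \<and> s < t \<longrightarrow>
        distributed P lborel (\<lambda>w. w t - w s) (normal_density 0 (sqrt (t - s))) \<and>
        prob_space.indep_set P (sets (F_upto s))
          (sets (vimage_algebra paths (\<lambda>w. w t - w s) borel)))"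

section \<open>The measure attached to a martingale of the supremum\<close>

definition Phi_of :: "real \<Rightarrow> (real \<Rightarrow> real) \<Rightarrow> real \<Rightarrow> real" where
  "Phi_of lam psi y = 1 - exp (lam * y) * (LINT z:{y..}|lborel. psi z * exp (- lam * z))"

definition phi_of :: "real \<Rightarrow> (real \<Rightarrow> real) \<Rightarrow> real \<Rightarrow> real" where
  "phi_of lam psi y =
     psi y - lam * exp (lam * y) * (LINT z:{y..}|lborel. psi z * exp (- lam * z))"

definition sup_martingale ::
  "real \<Rightarrow> (real \<Rightarrow> real) \<Rightarrow> (real \<Rightarrow> real) \<Rightarrow> real \<Rightarrow> (real \<Rightarrow> real) \<Rightarrow> real" where
  "sup_martingale lam Phi phi t w =
     ((1 - Phi (running_sup t w)) * cosh (lam * (running_sup t w - w t))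
      + phi (running_sup t w) * (sinh (lam * (running_sup t w - w t)) / lam))
     * exp (- (lam\<^sup>2 * t / 2))"

text \<open>Taking the whole space for \<open>G\<close> below shows that \<open>M t\<close> has Bochner integral 1,
  hence is integrable: the convention that the integral of a non-integrable function is 0
  is never used.\<close>

definition has_martingale_density ::
  "(real \<Rightarrow> real) measure \<Rightarrow> (real \<Rightarrow> (real \<Rightarrow> real) \<Rightarrow> real) \<Rightarrow> (real \<Rightarrow> real) measure \<Rightarrow> bool" where
  "has_martingale_density P M Q \<longleftrightarrow>
     prob_space Q \<and> sets Q = sets F_inf \<and>
     (\<forall>t\<ge>0. \<forall>G\<in>sets (F_upto t). measure Q G = (LINT w|P. indicator G w * M t w))"

section \<open>Brownian motion with drift up to a level, followed by a coth process\<close>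

definition coth :: "real \<Rightarrow> real" where
  "coth r = cosh r / sinh r"

text \<open>The mathematical convention is that coth is infinite at 0, so that finiteness of the drift
  forces a solution to be positive at almost every time. Since division by zero gives
  \<open>coth 0 = 0\<close> here, that positivity is required explicitly. The noise is additive, so the
  equation is imposed path by path.\<close>

definition coth_process ::
  "(real \<Rightarrow> real) measure \<Rightarrow> real \<Rightarrow> ((real \<Rightarrow> real) \<Rightarrow> (real \<Rightarrow> real)) \<Rightarrow> bool" where
  "coth_process P lam Z \<longleftrightarrow>
     Z \<in> measurable P F_inf \<and>
     (AE w in P.
        (\<forall>t\<ge>0. Z w t \<ge> 0) \<and>
        (AE u in lborel. u \<ge> 0 \<longrightarrow> Z w u > 0) \<and>
        (\<forall>t\<ge>0. set_integrable lborel {0..t} (\<lambda>u. coth (lam * Z w u)) \<and>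
               Z w t = w t + lam * (LINT u:{0..t}|lborel. coth (lam * Z w u))))"

definition add_drift :: "real \<Rightarrow> (real \<Rightarrow> real) \<Rightarrow> (real \<Rightarrow> real)" where
  "add_drift lam w = (\<lambda>t\<in>{0..}. w t + lam * t)"

definition stopped_path :: "real \<Rightarrow> (real \<Rightarrow> real) \<Rightarrow> (real \<Rightarrow> real)" where
  "stopped_path x w = (\<lambda>t\<in>{0..}. w (real_of_ereal (min (ereal t) (hitting_time x w))))"

text \<open>On paths that never hit \<open>x\<close> the next definition takes the hitting time to be
  \<open>real_of_ereal \<infinity> = 0\<close>. These paths do not matter for \<open>drift_coth_law\<close>: the law
  of the stopped path prescribed there gives them probability 0, since the drift and the level
  are positive.\<close>

definition post_hitting_path :: "real \<Rightarrow> (real \<Rightarrow> real) \<Rightarrow> (real \<Rightarrow> real)" where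
  "post_hitting_path x w = (\<lambda>t\<in>{0..}. x - w (t + real_of_ereal (hitting_time x w)))"

definition drift_coth_law ::
  "(real \<Rightarrow> real) measure \<Rightarrow> ((real \<Rightarrow> real) \<Rightarrow> (real \<Rightarrow> real)) \<Rightarrow> real \<Rightarrow> real
     \<Rightarrow> (real \<Rightarrow> real) measure \<Rightarrow> bool" where
  "drift_coth_law P Z lam x Q \<longleftrightarrow>
     prob_space Q \<and> sets Q = sets F_inf \<and>
     distr Q F_inf (stopped_path x) = distr P F_inf (\<lambda>w. stopped_path x (add_drift lam w)) \<and>
     distr Q F_inf (post_hitting_path x) = distr P F_inf Z \<and>
     prob_space.indep_var Q F_inf (stopped_path x) F_inf (post_hitting_path x)"

end

theory Submission
  imports Defs
begin

text \<open>Write \<open>M\<^sub>T\<close> as \<open>exp (\<lambda> X\<^sub>T - \<lambda>\<^sup>2 T / 2)\<close> times the tail at \<open>S\<^sub>T\<close> of the mixing density, plus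
  \<open>\<psi> (S\<^sub>T) sinh (\<lambda> (S\<^sub>T - X\<^sub>T)) / \<lambda> exp (- \<lambda>\<^sup>2 T / 2)\<close>. By the Cameron--Martin formula the first summand is the
  mixture of the laws \<open>Q\<^sup>y\<close> on \<open>{T < T\<^sub>y}\<close>, where they only involve a Brownian motion with drift. The second
  has to account for \<open>{T\<^sub>y \<le> T}\<close>. There, the event \<open>y \<le> S\<^sub>T < y + d\<close> is split by the strong Markov property at
  \<open>T\<^sub>y\<close> into the path before \<open>T\<^sub>y\<close> and a Brownian path killed at height \<open>d\<close> and weighted by
  \<open>sinh (\<lambda> (d - X))\<close>. Under this weight (a Doob transform) \<open>d - X\<close> solves the coth equation started at \<open>d\<close>,
  and since the drift is decreasing it stays within \<open>d\<close> of the solution \<open>Z\<close> started at 0; letting \<open>d \<rightarrow> 0\<close>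
  disintegrates the second summand over the level \<open>y\<close>. That the noise driving \<open>d - X\<close> is a Brownian motion is
  checked, without stochastic integrals, on characteristic functions of its increments, through a complex
  Feynman--Kac identity obtained by time discretisation.\<close>

section \<open>Measurability on path space\<close>

text \<open>Conditioning on S_T = y means conditioning on a null event. It is replaced by windows
  [y, y + d): a window has weight of order \<open>sinh (lam * d)\<close>, in it the path after the
  passage is matched with y - Z up to an error d, and the levels y whose window contains a given S_T
  form an interval of length d. Dividing by \<open>sinh (lam * d)\<close> and letting d tend to 0
  yields Lebesgue measure in y and the factor 1 / \<lambda> of the martingale. Errors of size d must
  be harmless, so laws are compared on products of ramps, which are Lipschitz in finitely many
  coordinates. The discretisation works because the Gaussian mean of a complex exponential times
  sinh is again a sinh, at a complex point. The discrete process is an exact martingale, and only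
  pathwise convergence and domination remain. The comparison is a coupling: the noise of the killed
  motion has the Wiener law under the transform, so the given map \<open>Z\<close> can be applied to
  it and both processes are driven by one path. Passage times are capped at a finite horizon T, on
  which the drift has a density.\<close>

lemma path_algebra_gen: "{{w \<in> paths. w s \<in> A} | s A. s \<in> I \<and> A \<in> sets borel} \<subseteq> Pow paths"
  by auto

lemma space_path_algebra [simp]: "space (path_algebra I) = paths"
  unfolding path_algebra_def by (simp add: space_measure_of_conv)

lemma sets_path_algebra:
  "sets (path_algebra I) = sigma_sets paths {{w \<in> paths. w s \<in> A} | s A. s \<in> I \<and> A \<in> sets borel}"
  unfolding path_algebra_def by (simp add: path_algebra_gen)

lemma measurable_coordinate:
  assumes "s \<in> I"
  shows "(\<lambda>w. w s) \<in> borel_measurable (path_algebra I)"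
proof (rule measurableI)
  fix A :: "real set" assume "A \<in> sets borel"
  then have "{w \<in> paths. w s \<in> A} \<in> sets (path_algebra I)"
    unfolding sets_path_algebra using assms by (intro sigma_sets.Basic) blast
  also have "{w \<in> paths. w s \<in> A} = (\<lambda>w. w s) -` A \<inter> space (path_algebra I)" by auto
  finally show "(\<lambda>w. w s) -` A \<inter> space (path_algebra I) \<in> sets (path_algebra I)" .
qed simp

lemma measurable_path_algebraI:
  assumes "\<And>x. x \<in> space M \<Longrightarrow> f x \<in> paths"
    and "\<And>s. s \<in> I \<Longrightarrow> (\<lambda>x. f x s) \<in> borel_measurable M"
  shows "f \<in> measurable M (path_algebra I)"
  unfolding path_algebra_def
proof (rule measurable_measure_of[OF path_algebra_gen])
  fix y assume "y \<in> {{w \<in> paths. w s \<in> A} | s A. s \<in> I \<and> A \<in> sets borel}"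
  then obtain s A where sA: "y = {w \<in> paths. w s \<in> A}" "s \<in> I" "A \<in> sets borel" by auto
  have "f -` y \<inter> space M = (\<lambda>x. f x s) -` A \<inter> space M" using assms(1) sA by auto
  also have "\<dots> \<in> sets M" using assms(2)[OF sA(2)] sA(3) by (rule measurable_sets)
  finally show "f -` y \<inter> space M \<in> sets M" .
qed (use assms in auto)

lemma measurable_path_algebra_mono: "I \<subseteq> J \<Longrightarrow> (\<lambda>w. w) \<in> measurable (path_algebra J) (path_algebra I)"
  by (rule measurable_path_algebraI) (auto intro: measurable_coordinate)

lemma sets_path_algebra_mono: "I \<subseteq> J \<Longrightarrow> sets (path_algebra I) \<subseteq> sets (path_algebra J)"
proof
  fix A assume "I \<subseteq> J" "A \<in> sets (path_algebra I)"
  then have "(\<lambda>w. w) -` A \<inter> space (path_algebra J) \<in> sets (path_algebra J)"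
    by (intro measurable_sets[OF measurable_path_algebra_mono])
  moreover have "(\<lambda>w. w) -` A \<inter> space (path_algebra J) = A"
    using sets.sets_into_space[OF \<open>A \<in> sets (path_algebra I)\<close>] by auto
  ultimately show "A \<in> sets (path_algebra J)" by simp
qed

lemma paths_continuous: "w \<in> paths \<Longrightarrow> continuous_on {0..} w"
  by (simp add: paths_def)

lemma paths_tendsto:
  assumes "w \<in> paths" "\<And>n. 0 \<le> u n" "u \<longlonglongrightarrow> s"
  shows "(\<lambda>n. w (u n)) \<longlonglongrightarrow> w s"
proof -
  have "0 \<le> s" using assms(2,3) by (intro LIMSEQ_le_const) auto
  then show ?thesis
    using continuous_on_tendsto_compose[OF paths_continuous[OF assms(1)] assms(3)] assms(2) by auto
qed

lemma floor_grid_tendsto: "(\<lambda>n. real_of_int \<lfloor>real (Suc n) * x\<rfloor> / real (Suc n)) \<longlonglongrightarrow> x"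
proof (rule tendsto_sandwich[where f="\<lambda>n. x - 1 / real (Suc n)" and h="\<lambda>_. x"])
  show "\<forall>\<^sub>F n in sequentially. x - 1 / real (Suc n) \<le> real_of_int \<lfloor>real (Suc n) * x\<rfloor> / real (Suc n)"
  proof (intro always_eventually allI)
    fix n
    have "x - 1 / real (Suc n) = (real (Suc n) * x - 1) / real (Suc n)" by (simp add: diff_divide_distrib)
    also have "\<dots> \<le> real_of_int \<lfloor>real (Suc n) * x\<rfloor> / real (Suc n)" by (intro divide_right_mono) linarith+
    finally show "x - 1 / real (Suc n) \<le> real_of_int \<lfloor>real (Suc n) * x\<rfloor> / real (Suc n)" .
  qed
  show "\<forall>\<^sub>F n in sequentially. real_of_int \<lfloor>real (Suc n) * x\<rfloor> / real (Suc n) \<le> x"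
    by (intro always_eventually allI) (simp add: divide_le_eq mult.commute)
  show "(\<lambda>n. x - 1 / real (Suc n)) \<longlonglongrightarrow> x"
    using tendsto_diff[OF tendsto_const[of x] LIMSEQ_inverse_real_of_nat] by (simp add: inverse_eq_divide)
qed simp

text \<open>By continuity the time g x may be rounded down to a grid. The rounded time takes
  countably many values and stays in {0..g x}, so only coordinates in I are read; rounding up could
  leave I.\<close>

lemma measurable_eval:
  assumes f: "f \<in> measurable N (path_algebra I)" and g: "g \<in> borel_measurable N"
    and gI: "\<And>x. x \<in> space N \<Longrightarrow> 0 \<le> g x \<and> {0..g x} \<subseteq> I"
  shows "(\<lambda>x. f x (g x)) \<in> borel_measurable N"
proof -
  define s where "s n x = real_of_int \<lfloor>real (Suc n) * g x\<rfloor> / real (Suc n)" for n x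
  \<comment> \<open>The test for membership in I makes every integer index yield a measurable
    function; at the index that is evaluated, the grid time does lie in I.\<close>
  define e where "e n i x = (if real_of_int i / real (Suc n) \<in> I then f x (real_of_int i / real (Suc n)) else 0)"
    for n i x
  have s: "0 \<le> s n x" "s n x \<le> g x" if "x \<in> space N" for n x
    using gI[OF that] by (auto simp: s_def divide_le_eq mult.commute)
  have e: "(\<lambda>x. e n (\<lfloor>real (Suc n) * g x\<rfloor>) x) \<in> borel_measurable N" for n
  proof (rule measurable_compose_countable)
    show "e n i \<in> borel_measurable N" for i
      using measurable_compose[OF f measurable_coordinate, of "real_of_int i / real (Suc n)"]
      by (cases "real_of_int i / real (Suc n) \<in> I") (simp_all add: e_def[abs_def] del: of_nat_Suc)
  qed (use g in measurable)
  have "(\<lambda>x. f x (s n x)) \<in> borel_measurable N" for n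
  proof (subst measurable_cong)
    fix x assume x: "x \<in> space N"
    with s[OF x, of n] gI[OF x] have "s n x \<in> I" by auto
    then show "f x (s n x) = e n (\<lfloor>real (Suc n) * g x\<rfloor>) x" by (simp add: e_def s_def del: of_nat_Suc)
  qed (rule e)
  moreover have "(\<lambda>n. f x (s n x)) \<longlonglongrightarrow> f x (g x)" if "x \<in> space N" for x
  proof (rule paths_tendsto[where w="f x" and s="g x"])
    show "f x \<in> paths" using measurable_space[OF f that] by simp
    show "(\<lambda>n. s n x) \<longlonglongrightarrow> g x" unfolding s_def by (rule floor_grid_tendsto)
  qed (use s[OF that] in simp)
  ultimately show ?thesis by (rule borel_measurable_LIMSEQ_real[rotated])
qed

lemma measurable_eval_inf:
  assumes "f \<in> measurable N F_inf" "g \<in> borel_measurable N" "\<And>x. x \<in> space N \<Longrightarrow> 0 \<le> g x"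
  shows "(\<lambda>x. f x (g x)) \<in> borel_measurable N"
  by (rule measurable_eval[where I="{0..}" and f=f and g=g]) (use assms in auto)

section \<open>Running supremum, first passage, stopping and shifting\<close>


lemma running_sup_attained:
  assumes "w \<in> paths" "0 \<le> t"
  obtains u where "0 \<le> u" "u \<le> t" "running_sup t w = w u" "\<And>v. 0 \<le> v \<Longrightarrow> v \<le> t \<Longrightarrow> w v \<le> w u"
proof -
  have "continuous_on {0..t} w" by (rule continuous_on_subset[OF paths_continuous[OF assms(1)]]) auto
  then have "\<exists>u\<in>{0..t}. \<forall>v\<in>{0..t}. w v \<le> w u"
    using assms(2) by (intro continuous_attains_sup) auto
  then obtain u where u: "u \<in> {0..t}" "\<forall>v\<in>{0..t}. w v \<le> w u" by blast
  have "running_sup t w = w u"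
    unfolding running_sup_def using u by (intro cSup_eq_maximum) auto
  with u that show ?thesis by auto
qed

lemma running_sup_ge:
  assumes "w \<in> paths" "0 \<le> u" "u \<le> t"
  shows "w u \<le> running_sup t w"
proof -
  have t: "0 \<le> t" using assms by linarith
  show ?thesis
  proof (rule running_sup_attained[OF assms(1) t])
    fix v assume "running_sup t w = w v" "\<And>u. 0 \<le> u \<Longrightarrow> u \<le> t \<Longrightarrow> w u \<le> w v"
    then show ?thesis using assms by simp
  qed
qed

lemma running_sup_le_iff:
  assumes "w \<in> paths" "0 \<le> t"
  shows "running_sup t w \<le> c \<longleftrightarrow> (\<forall>u\<in>{0..t}. w u \<le> c)"
proof (rule running_sup_attained[OF assms])
  fix v assume v: "0 \<le> v" "v \<le> t" "running_sup t w = w v" "\<And>u. 0 \<le> u \<Longrightarrow> u \<le> t \<Longrightarrow> w u \<le> w v"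
  show ?thesis unfolding v(3)
  proof safe
    fix u assume "w v \<le> c" "u \<in> {0..t}"
    then show "w u \<le> c" using v(4)[of u] by simp
  qed (use v in auto)
qed

lemma running_sup_less_iff:
  assumes "w \<in> paths" "0 \<le> t"
  shows "running_sup t w < c \<longleftrightarrow> (\<forall>u\<in>{0..t}. w u < c)"
proof (rule running_sup_attained[OF assms])
  fix v assume v: "0 \<le> v" "v \<le> t" "running_sup t w = w v" "\<And>u. 0 \<le> u \<Longrightarrow> u \<le> t \<Longrightarrow> w u \<le> w v"
  show ?thesis unfolding v(3)
  proof safe
    fix u assume "w v < c" "u \<in> {0..t}"
    then show "w u < c" using v(4)[of u] by simp
  qed (use v in auto)
qed

lemma running_sup_ge_iff:
  assumes "w \<in> paths" "0 \<le> t"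
  shows "y \<le> running_sup t w \<longleftrightarrow> (\<exists>u\<in>{0..t}. y \<le> w u)"
proof -
  have "\<not> running_sup t w < y \<longleftrightarrow> \<not> (\<forall>u\<in>{0..t}. w u < y)" using running_sup_less_iff[OF assms, of y] by simp
  then show ?thesis by (simp add: not_less)
qed

lemma running_sup_cong:
  assumes "\<And>u. 0 \<le> u \<Longrightarrow> u \<le> t \<Longrightarrow> w u = w' u"
  shows "running_sup t w = running_sup t w'"
  unfolding running_sup_def using assms by (intro SUP_cong) auto

text \<open>Scaling the rationals of {0..1} by t, rather than taking the rationals below t, makes
  the index set independent of t. This is what allows random times in the measurability
  proof.\<close>

lemma running_sup_rational:
  assumes w: "w \<in> paths" and t: "0 \<le> t"
  shows "running_sup t w = (SUP q\<in>{0..1} \<inter> \<rat>. w (q * t))"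
proof -
  obtain u where u: "0 \<le> u" "u \<le> t" "running_sup t w = w u" "\<And>v. 0 \<le> v \<Longrightarrow> v \<le> t \<Longrightarrow> w v \<le> w u"
    by (rule running_sup_attained[OF w t]) blast
  define q where "q = u / t"
  have q: "q \<in> {0..1}" "q * t = u" using u t by (auto simp: q_def divide_le_eq_1)
  define s where "s n = real_of_int \<lfloor>real (Suc n) * q\<rfloor> / real (Suc n)" for n
  have s: "s n \<in> {0..1} \<inter> \<rat>" for n
  proof -
    have "real_of_int \<lfloor>real (Suc n) * q\<rfloor> \<le> real (Suc n) * q" by linarith
    also have "\<dots> \<le> real (Suc n)" using q by (intro mult_left_le) auto
    finally show ?thesis using q by (auto simp: s_def divide_le_eq_1)
  qed
  have le: "w (r * t) \<le> running_sup t w" if "r \<in> {0..1}" for r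
    using that t by (intro running_sup_ge[OF w]) (auto simp: mult_left_le_one_le)
  have bdd: "bdd_above ((\<lambda>q. w (q * t)) ` ({0..1} \<inter> \<rat>))"
    by (rule bdd_aboveI[where M="running_sup t w"]) (use le in auto)
  have "(\<lambda>n. s n * t) \<longlonglongrightarrow> q * t"
    unfolding s_def by (intro tendsto_mult floor_grid_tendsto tendsto_const)
  then have "(\<lambda>n. s n * t) \<longlonglongrightarrow> u" unfolding q(2) .
  moreover have "0 \<le> s n * t" for n using s[of n] t by simp
  ultimately have "(\<lambda>n. w (s n * t)) \<longlonglongrightarrow> w u"
    by (rule paths_tendsto[OF w, rotated])
  moreover have "w (s n * t) \<le> (SUP q\<in>{0..1} \<inter> \<rat>. w (q * t))" for n
    by (rule cSUP_upper[OF s bdd])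
  ultimately have "w u \<le> (SUP q\<in>{0..1} \<inter> \<rat>. w (q * t))"
    by (meson LIMSEQ_le_const2)
  moreover have "(SUP q\<in>{0..1} \<inter> \<rat>. w (q * t)) \<le> running_sup t w"
  proof (rule cSUP_least)
    show "{0..1} \<inter> \<rat> \<noteq> ({} :: real set)" using s[of 0] by blast
    show "w (q * t) \<le> running_sup t w" if "q \<in> {0..1} \<inter> \<rat>" for q by (rule le) (use that in blast)
  qed
  ultimately show ?thesis using u(3) by simp
qed

lemma measurable_running_sup:
  assumes f: "f \<in> measurable N (path_algebra I)" and g: "g \<in> borel_measurable N"
    and gI: "\<And>x. x \<in> space N \<Longrightarrow> 0 \<le> g x \<and> {0..g x} \<subseteq> I"
  shows "(\<lambda>x. running_sup (g x) (f x)) \<in> borel_measurable N"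
proof (subst measurable_cong)
  fix x assume x: "x \<in> space N"
  then show "running_sup (g x) (f x) = (SUP q\<in>{0..1} \<inter> \<rat>. f x (q * g x))"
    using gI[OF x] measurable_space[OF f x] by (intro running_sup_rational) auto
next
  show "(\<lambda>x. SUP q\<in>{0..1} \<inter> \<rat>. f x (q * g x)) \<in> borel_measurable N"
  proof (rule borel_measurable_cSUP)
    show "countable ({0..1::real} \<inter> \<rat>)" using countable_rat by (rule countable_Int2)
    fix q :: real assume "q \<in> {0..1} \<inter> \<rat>"
    then show "(\<lambda>x. f x (q * g x)) \<in> borel_measurable N"
    proof (intro measurable_eval[OF f, where g="\<lambda>x. q * g x"])
      fix x assume x: "x \<in> space N" and q: "q \<in> {0..1} \<inter> \<rat>"
      have "0 \<le> q * g x" "q * g x \<le> g x" using q gI[OF x] by (auto simp: mult_left_le_one_le)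
      then show "0 \<le> q * g x \<and> {0..q * g x} \<subseteq> I" using gI[OF x] by force
    qed (use g in measurable)
  next
    fix x assume x: "x \<in> space N"
    have p: "f x \<in> paths" using measurable_space[OF f x] by simp
    show "bdd_above ((\<lambda>q. f x (q * g x)) ` ({0..1} \<inter> \<rat>))"
      using gI[OF x] by (intro bdd_aboveI[where M="running_sup (g x) (f x)"])
        (auto intro!: running_sup_ge[OF p] simp: mult_left_le_one_le)
  qed
qed

lemma measurable_running_sup_inf [measurable (raw)]:
  assumes "f \<in> measurable N F_inf" "g \<in> borel_measurable N" "\<And>x. x \<in> space N \<Longrightarrow> 0 \<le> g x"
  shows "(\<lambda>x. running_sup (g x) (f x)) \<in> borel_measurable N"
  by (rule measurable_running_sup[where I="{0..}"]) (use assms in auto)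

text \<open>Inserting T keeps the set nonempty, so the passage time is real and at most T, unlike
  \<open>hitting_time\<close>. The two agree on paths from 0 that reach the level by time T
  (\<open>hitting_time_eq_tau\<close>).\<close>

definition tau :: "real \<Rightarrow> real \<Rightarrow> (real \<Rightarrow> real) \<Rightarrow> real" where
  "tau T y w = Inf (insert T {u \<in> {0..T}. y \<le> w u})"

definition stop :: "real \<Rightarrow> (real \<Rightarrow> real) \<Rightarrow> (real \<Rightarrow> real)" where
  "stop s w = (\<lambda>u\<in>{0..}. w (min u s))"

definition shift :: "real \<Rightarrow> (real \<Rightarrow> real) \<Rightarrow> (real \<Rightarrow> real)" where
  "shift s w = (\<lambda>u\<in>{0..}. w (s + u) - w s)"

lemma stop_apply [simp]: "0 \<le> u \<Longrightarrow> stop s w u = w (min u s)"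
  by (simp add: stop_def)

lemma shift_apply [simp]: "0 \<le> u \<Longrightarrow> shift s w u = w (s + u) - w s"
  by (simp add: shift_def)

lemma stop_paths [intro]:
  assumes "w \<in> paths" "0 \<le> s"
  shows "stop s w \<in> paths"
proof -
  have "continuous_on {0..} (\<lambda>u. w (min u s))"
    by (rule continuous_on_compose2[OF paths_continuous[OF assms(1)]])
       (use assms in \<open>auto intro!: continuous_intros\<close>)
  then have "continuous_on {0..} (stop s w)" by (rule continuous_on_eq) simp
  then show ?thesis by (simp add: paths_def stop_def)
qed

lemma shift_paths [intro]:
  assumes "w \<in> paths" "0 \<le> s"
  shows "shift s w \<in> paths"
proof -
  have "continuous_on {0..} (\<lambda>u. w (s + u) - w s)"
    by (intro continuous_on_diff continuous_on_const continuous_on_compose2[OF paths_continuous[OF assms(1)]])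
       (use assms in \<open>auto intro!: continuous_intros\<close>)
  then have "continuous_on {0..} (shift s w)" by (rule continuous_on_eq) simp
  then show ?thesis by (simp add: paths_def shift_def)
qed

lemma measurable_stop:
  assumes f: "f \<in> measurable N (path_algebra I)" and g: "g \<in> borel_measurable N"
    and gI: "\<And>x. x \<in> space N \<Longrightarrow> 0 \<le> g x \<and> {0..g x} \<subseteq> I"
  shows "(\<lambda>x. stop (g x) (f x)) \<in> measurable N F_inf"
proof (rule measurable_path_algebraI)
  fix x assume "x \<in> space N"
  then show "stop (g x) (f x) \<in> paths" using gI measurable_space[OF f] by auto
next
  fix s :: real assume s: "s \<in> {0..}"
  then have "(\<lambda>x. f x (min s (g x))) \<in> borel_measurable N"
  proof (intro measurable_eval[OF f, where g="\<lambda>x. min s (g x)"])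
    fix x assume x: "x \<in> space N"
    then show "0 \<le> min s (g x) \<and> {0..min s (g x)} \<subseteq> I" using gI[OF x] s by force
  qed (use g in measurable)
  then show "(\<lambda>x. stop (g x) (f x) s) \<in> borel_measurable N" using s by simp
qed

lemma measurable_stop_inf [measurable (raw)]:
  assumes "f \<in> measurable N F_inf" "g \<in> borel_measurable N" "\<And>x. x \<in> space N \<Longrightarrow> 0 \<le> g x"
  shows "(\<lambda>x. stop (g x) (f x)) \<in> measurable N F_inf"
  by (rule measurable_stop[where I="{0..}"]) (use assms in auto)

lemma measurable_shift [measurable (raw)]:
  assumes f [measurable]: "f \<in> measurable N F_inf" and g [measurable]: "g \<in> borel_measurable N"
    and g0: "\<And>x. x \<in> space N \<Longrightarrow> 0 \<le> g x"
  shows "(\<lambda>x. shift (g x) (f x)) \<in> measurable N F_inf"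
proof (rule measurable_path_algebraI)
  fix x assume "x \<in> space N"
  then show "shift (g x) (f x) \<in> paths" using g0 measurable_space[OF f] by auto
next
  fix s :: real assume s: "s \<in> {0..}"
  have "(\<lambda>x. f x (g x + s) - f x (g x)) \<in> borel_measurable N"
    using g0 s by (intro borel_measurable_diff measurable_eval_inf[OF f, where g="\<lambda>x. g x + s"] measurable_eval_inf[OF f g]) auto
  then show "(\<lambda>x. shift (g x) (f x) s) \<in> borel_measurable N" using s by simp
qed

lemma tau_bounds:
  assumes "0 \<le> T"
  shows "0 \<le> tau T y w" "tau T y w \<le> T"
proof -
  show "0 \<le> tau T y w" unfolding tau_def using assms by (intro cInf_greatest) auto
  show "tau T y w \<le> T" unfolding tau_def
    by (intro cInf_lower) (use assms in \<open>auto intro!: bdd_belowI[where m=0]\<close>)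
qed

lemma tau_le:
  assumes "0 \<le> u" "u \<le> T" "y \<le> w u"
  shows "tau T y w \<le> u"
  unfolding tau_def using assms
  by (intro cInf_lower) (auto intro!: bdd_belowI[where m=0])

lemma before_tau:
  assumes "0 \<le> u" "u < tau T y w" "0 \<le> T"
  shows "w u < y"
  using tau_le[of u T y w] tau_bounds(2)[of T y w] assms by force

text \<open>By continuity the times at or above the level form a closed set, which contains its
  infimum.\<close>

lemma tau_attained:
  assumes w: "w \<in> paths" and u: "0 \<le> u" "u \<le> T" "y \<le> w u"
  shows "y \<le> w (tau T y w)"
proof -
  let ?A = "{u \<in> {0..T}. y \<le> w u}"
  have c: "closed ?A"
  proof -
    have "?A = {0..T} \<inter> w -` {y..}" by auto
    moreover have "continuous_on {0..T} w" by (rule continuous_on_subset[OF paths_continuous[OF w]]) auto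
    ultimately show ?thesis by (simp add: continuous_closed_preimage)
  qed
  have ne: "?A \<noteq> {}" "bdd_below ?A" using u by (auto intro!: bdd_belowI[where m=0])
  have "Inf ?A \<in> ?A" by (rule closed_contains_Inf[OF ne c])
  moreover have "Inf ?A \<le> u" using ne(2) u by (intro cInf_lower) auto
  moreover have "tau T y w = min T (Inf ?A)"
    unfolding tau_def using ne by (subst cInf_insert) (auto simp: inf_min)
  ultimately show ?thesis using u by auto
qed

lemma tau_hits:
  assumes w: "w \<in> paths" "w 0 \<le> y" and u: "0 \<le> u" "u \<le> T" "y \<le> w u"
  shows "w (tau T y w) = y"
proof (rule antisym)
  let ?t = "tau T y w"
  have T: "0 \<le> T" using u by simp
  show "w ?t \<le> y"
  proof (cases "?t = 0")
    case False
    then have t: "0 < ?t" using tau_bounds(1)[OF T, of y w] by simp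
    \<comment> \<open>Times increasing strictly to the passage: there the path is still below the
      level, so its limit is at most the level.\<close>
    define s where "s n = ?t * (1 - 1 / real (Suc n))" for n
    have s0: "0 \<le> s n" "s n < ?t" for n using t by (auto simp: s_def field_simps)
    have "s \<longlonglongrightarrow> ?t * (1 - 0)" unfolding s_def
      by (intro tendsto_intros LIMSEQ_inverse_real_of_nat[unfolded inverse_eq_divide])
    then have "s \<longlonglongrightarrow> ?t" by simp
    then have "(\<lambda>n. w (s n)) \<longlonglongrightarrow> w ?t" by (rule paths_tendsto[OF w(1) s0(1)])
    then show ?thesis
      by (rule LIMSEQ_le_const2) (use before_tau[OF s0 T] in \<open>auto intro!: less_imp_le\<close>)
  qed (use w in simp)
qed (rule tau_attained[OF w(1) u])

text \<open>The stopping-time property in pathwise form. If the level is never reached, the passage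
  time is T, hence T \<le> s and the two paths agree on all of {0..T}.\<close>

lemma tau_cong:
  assumes eq: "\<And>u. 0 \<le> u \<Longrightarrow> u \<le> s \<Longrightarrow> w u = w' u" and w: "w \<in> paths" "tau T y w \<le> s" "0 \<le> T"
  shows "tau T y w' = tau T y w"
proof -
  let ?A = "\<lambda>w. {u \<in> {0..T}. y \<le> w u}"
  have b: "0 \<le> tau T y w" "tau T y w \<le> T" using tau_bounds[OF w(3)] by auto
  show ?thesis
  proof (cases "?A w = {}")
    case True
    then have "tau T y w = T" unfolding tau_def by (simp only: cInf_singleton)
    then have "?A w' = ?A w" using eq w(2) by auto
    then show ?thesis by (simp add: tau_def)
  next
    case False
    then have "y \<le> w (tau T y w)" using tau_attained[OF w(1)] by force
    then have "y \<le> w' (tau T y w)" using eq[of "tau T y w"] w(2) b by simp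
    then have "tau T y w' \<le> tau T y w" using b by (intro tau_le[where u="tau T y w"])
    moreover have "tau T y w' \<ge> tau T y w"
    proof (rule ccontr)
      assume "\<not> ?thesis"
      then have l: "tau T y w' < tau T y w" by simp
      have "\<exists>u\<in>insert T (?A w'). u < tau T y w"
        using l[unfolded tau_def[of T y w']] by (subst (asm) cInf_less_iff) (auto intro!: bdd_belowI[where m=0] w)
      then obtain u where u: "0 \<le> u" "y \<le> w' u" "u < tau T y w" using b by auto
      then have "y \<le> w u" using eq[of u] w by auto
      then show False using before_tau[OF u(1,3) w(3)] by simp
    qed
    ultimately show ?thesis by simp
  qed
qed

text \<open>At t = T the equivalence would fail, since T is also the value given to paths that stay
  below the level.\<close>

lemma tau_le_iff:
  assumes w: "w \<in> paths" and T: "0 \<le> T" and t: "0 \<le> t" "t < T"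
  shows "tau T y w \<le> t \<longleftrightarrow> y \<le> running_sup t w"
proof
  assume a: "tau T y w \<le> t"
  have "\<exists>u\<in>insert T {u \<in> {0..T}. y \<le> w u}. u < T"
  proof (rule ccontr)
    assume "\<not> ?thesis"
    then have "insert T {u \<in> {0..T}. y \<le> w u} = {T}" by force
    then have "tau T y w = T" unfolding tau_def by (simp only: cInf_singleton)
    then show False using a t(2) by simp
  qed
  then obtain u where "0 \<le> u" "u \<le> T" "y \<le> w u" by auto
  then have "y \<le> w (tau T y w)" by (rule tau_attained[OF w])
  then show "y \<le> running_sup t w" using running_sup_ge[OF w tau_bounds(1)[OF T] a] by simp
next
  assume "y \<le> running_sup t w"
  then obtain u where "u \<in> {0..t}" "y \<le> w u" using running_sup_ge_iff[OF w t(1)] by auto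
  then show "tau T y w \<le> t" using tau_le[of u T y w] t by auto
qed

lemma measurable_tau [measurable (raw)]:
  assumes f [measurable]: "f \<in> measurable N F_inf" and g [measurable]: "g \<in> borel_measurable N" and T: "0 \<le> T"
  shows "(\<lambda>x. tau T (g x) (f x)) \<in> borel_measurable N"
proof (subst borel_measurable_iff_le, rule allI)
  fix t
  have p: "x \<in> space N \<Longrightarrow> f x \<in> paths" for x using measurable_space[OF f] by simp
  consider "t < 0" | "T \<le> t" | "0 \<le> t" "t < T" by linarith
  then show "{x \<in> space N. tau T (g x) (f x) \<le> t} \<in> sets N"
  proof cases
    case 1
    then have "{x \<in> space N. tau T (g x) (f x) \<le> t} = {}" using tau_bounds(1)[OF T] by (auto simp: not_le intro: less_le_trans)
    then show ?thesis by (simp only: sets.empty_sets)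
  next
    case 2
    then have "{x \<in> space N. tau T (g x) (f x) \<le> t} = space N" using tau_bounds(2)[OF T] by (auto intro: order_trans)
    then show ?thesis by simp
  next
    case 3
    then have "{x \<in> space N. tau T (g x) (f x) \<le> t} = {x \<in> space N. g x \<le> running_sup t (f x)}"
      using p by (auto simp: tau_le_iff[OF _ T])
    also have "\<dots> \<in> sets N" using 3 by measurable
    finally show ?thesis .
  qed
qed

section \<open>Uniqueness of the law of Brownian motion, and the Markov property\<close>

definition gauss :: "real measure" where
  "gauss = density lborel (\<lambda>x. ennreal (std_normal_density x))"

lemma sets_gauss [measurable_cong, simp]: "sets gauss = sets borel"
  by (simp add: gauss_def)

lemma space_gauss [simp]: "space gauss = UNIV"
  by (simp add: gauss_def)

lemma prob_space_gauss: "prob_space gauss"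
  unfolding gauss_def by (rule prob_space_normal_density) simp

interpretation gauss: prob_space gauss by (rule prob_space_gauss)

lemma distr_gauss_scale:
  assumes "0 < v"
  shows "distr gauss borel (\<lambda>z. v * z) = density lborel (\<lambda>x. ennreal (normal_density 0 v x))"
proof -
  have "distributed gauss lborel (\<lambda>z. z) (\<lambda>x. ennreal (std_normal_density x))"
    unfolding distributed_def by (auto simp: gauss_def distr_id2)
  then have "distributed gauss lborel (\<lambda>z. (v * z - 0) / v) (\<lambda>x. ennreal (std_normal_density x))"
    using assms by simp
  then have "distributed gauss lborel (\<lambda>z. v * z) (\<lambda>x. ennreal (normal_density 0 v x))"
    using gauss.normal_standard_normal_convert[OF assms, of "\<lambda>z. v * z" 0] by simp
  then have "distr gauss lborel (\<lambda>z. v * z) = density lborel (\<lambda>x. ennreal (normal_density 0 v x))"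
    by (rule distributed_distr_eq_density)
  moreover have "distr gauss lborel (\<lambda>z. v * z) = distr gauss borel (\<lambda>z. v * z)" by (rule distr_cong) auto
  ultimately show ?thesis by simp
qed

text \<open>The filtration is that of the coordinates, while Y may be any adapted process, so the
  driving noise of a transformed measure is treated like the coordinate process. Writing the
  increment law as an image of \<open>gauss\<close> under scaling includes the case s = t.\<close>

definition is_BM :: "(real \<Rightarrow> real) measure \<Rightarrow> (real \<Rightarrow> (real \<Rightarrow> real) \<Rightarrow> real) \<Rightarrow> bool" where
  "is_BM M Y \<longleftrightarrow> prob_space M \<and> sets M = sets F_inf \<and>
     (\<forall>t\<ge>0. Y t \<in> borel_measurable (F_upto t)) \<and> (AE w in M. Y 0 w = 0) \<and>
     (\<forall>s t G A. 0 \<le> s \<longrightarrow> s \<le> t \<longrightarrow> G \<in> sets (F_upto s) \<longrightarrow> A \<in> sets borel \<longrightarrow>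
        emeasure M (G \<inter> {w \<in> paths. Y t w - Y s w \<in> A}) =
        emeasure M G * emeasure gauss {z. sqrt (t - s) * z \<in> A})"

lemma F_upto_le: "f \<in> measurable (F_upto s) N \<Longrightarrow> s \<le> t \<Longrightarrow> f \<in> measurable (F_upto t) N"
  by (rule measurable_compose[OF measurable_path_algebra_mono[of "{0..s}" "{0..t}"]]) auto

lemma F_upto_F_inf:
  assumes "f \<in> measurable (F_upto s) N" "sets M = sets F_inf"
  shows "f \<in> measurable M N"
proof -
  have "f \<in> measurable F_inf N"
    by (rule measurable_compose[OF measurable_path_algebra_mono[of "{0..s}" "{0..}"] assms(1)]) auto
  then show ?thesis unfolding measurable_cong_sets[OF assms(2) refl] .
qed

text \<open>The identity in \<open>is_BM\<close> is a product formula on rectangles, so it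
  determines the joint law of the past and the increment.\<close>

lemma pair_distr_id_gauss_eq:
  assumes M: "is_BM M Y" and st: "0 \<le> s" "s \<le> t"
  shows "distr M (F_upto s \<Otimes>\<^sub>M borel) (\<lambda>w. (w, Y t w - Y s w)) =
    distr M (F_upto s) (\<lambda>w. w) \<Otimes>\<^sub>M distr gauss borel (\<lambda>z. sqrt (t - s) * z)"
proof (rule sym, rule pair_measure_eqI)
  interpret prob_space M using M by (simp add: is_BM_def)
  have sM: "sets M = sets F_inf" and spM: "space M = paths"
    using M by (auto simp: is_BM_def dest: sets_eq_imp_space_eq)
  have id: "(\<lambda>w. w) \<in> measurable M (F_upto s)" by (rule F_upto_F_inf[OF measurable_ident_sets[OF refl] sM])
  have Y: "Y u \<in> borel_measurable M" if "0 \<le> u" for u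
    using M that by (intro F_upto_F_inf[OF _ sM]) (auto simp: is_BM_def)
  have D: "(\<lambda>w. Y t w - Y s w) \<in> borel_measurable M" using st by (intro borel_measurable_diff Y) auto
  have J: "(\<lambda>w. (w, Y t w - Y s w)) \<in> measurable M (F_upto s \<Otimes>\<^sub>M borel)"
    by (intro measurable_Pair id D)
  interpret D1: prob_space "distr M (F_upto s) (\<lambda>w. w)" by (rule prob_space_distr[OF id])
  interpret D2: prob_space "distr gauss borel (\<lambda>z. sqrt (t - s) * z)" by (rule gauss.prob_space_distr) auto
  show "sigma_finite_measure (distr M (F_upto s) (\<lambda>w. w))" by (rule D1.sigma_finite_measure)
  show "sigma_finite_measure (distr gauss borel (\<lambda>z. sqrt (t - s) * z))" by (rule D2.sigma_finite_measure)
  show "sets (distr M (F_upto s) (\<lambda>w. w) \<Otimes>\<^sub>M distr gauss borel (\<lambda>z. sqrt (t - s) * z)) =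
    sets (distr M (F_upto s \<Otimes>\<^sub>M borel) (\<lambda>w. (w, Y t w - Y s w)))"
    by (simp cong: sets_pair_measure_cong)
  fix G A assume GA: "G \<in> sets (distr M (F_upto s) (\<lambda>w. w))" "A \<in> sets (distr gauss borel (\<lambda>z. sqrt (t - s) * z))"
  then have G: "G \<in> sets (F_upto s)" and A: "A \<in> sets borel" by auto
  have Gp: "G \<subseteq> paths" using sets.sets_into_space[OF G] by simp
  have "emeasure (distr M (F_upto s \<Otimes>\<^sub>M borel) (\<lambda>w. (w, Y t w - Y s w))) (G \<times> A) =
    emeasure M (G \<inter> {w \<in> paths. Y t w - Y s w \<in> A})"
    using G A by (subst emeasure_distr[OF J]) (auto intro!: arg_cong[where f="emeasure M"] simp: spM)
  also have "\<dots> = emeasure M G * emeasure gauss {z. sqrt (t - s) * z \<in> A}"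
    using M G A st by (simp add: is_BM_def)
  also have "emeasure M G = emeasure (distr M (F_upto s) (\<lambda>w. w)) G"
    using G Gp by (subst emeasure_distr[OF id]) (auto intro!: arg_cong[where f="emeasure M"] simp: spM)
  also have "emeasure gauss {z. sqrt (t - s) * z \<in> A} = emeasure (distr gauss borel (\<lambda>z. sqrt (t - s) * z)) A"
    using A by (subst emeasure_distr) (auto intro!: arg_cong[where f="emeasure gauss"])
  finally show "emeasure (distr M (F_upto s) (\<lambda>w. w)) G * emeasure (distr gauss borel (\<lambda>z. sqrt (t - s) * z)) A =
    emeasure (distr M (F_upto s \<Otimes>\<^sub>M borel) (\<lambda>w. (w, Y t w - Y s w))) (G \<times> A)" by simp
qed

lemma is_BM_basic:
  assumes "is_BM M Y"
  shows "prob_space M" "sets M = sets F_inf" "space M = paths"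
    "\<And>t. 0 \<le> t \<Longrightarrow> Y t \<in> borel_measurable (F_upto t)" "AE w in M. Y 0 w = 0"
  using assms by (auto simp: is_BM_def dest: sets_eq_imp_space_eq)

lemma is_BM_increment:
  assumes M: "is_BM M Y" and st: "0 \<le> s" "s \<le> t"
    and f: "f \<in> borel_measurable (F_upto s \<Otimes>\<^sub>M borel)"
  shows "(\<integral>\<^sup>+w. f (w, Y t w - Y s w) \<partial>M) = (\<integral>\<^sup>+w. \<integral>\<^sup>+z. f (w, sqrt (t - s) * z) \<partial>gauss \<partial>M)"
proof -
  note b = is_BM_basic[OF M]
  have id: "(\<lambda>w. w) \<in> measurable M (F_upto s)" by (rule F_upto_F_inf[OF measurable_ident_sets[OF refl] b(2)])
  have D: "(\<lambda>w. Y t w - Y s w) \<in> borel_measurable M"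
    using st b(4)[of t] b(4)[of s] by (intro borel_measurable_diff F_upto_F_inf[OF _ b(2)]) auto
  interpret D2: prob_space "distr gauss borel (\<lambda>z. sqrt (t - s) * z)" by (rule gauss.prob_space_distr) auto
  have f': "f \<in> borel_measurable (distr M (F_upto s) (\<lambda>w. w) \<Otimes>\<^sub>M distr gauss borel (\<lambda>z. sqrt (t - s) * z))"
    using f by (simp cong: measurable_cong_sets sets_pair_measure_cong)
  have "(\<integral>\<^sup>+w. f (w, Y t w - Y s w) \<partial>M) =
    integral\<^sup>N (distr M (F_upto s \<Otimes>\<^sub>M borel) (\<lambda>w. (w, Y t w - Y s w))) f"
    using f by (subst nn_integral_distr) (auto intro!: measurable_Pair id D)
  also have "\<dots> = (\<integral>\<^sup>+w. \<integral>\<^sup>+z. f (w, z) \<partial>distr gauss borel (\<lambda>z. sqrt (t - s) * z) \<partial>distr M (F_upto s) (\<lambda>w. w))"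
    unfolding pair_distr_id_gauss_eq[OF M st] by (rule D2.nn_integral_fst[OF f', symmetric])
  also have "\<dots> = (\<integral>\<^sup>+w. \<integral>\<^sup>+z. f (w, sqrt (t - s) * z) \<partial>gauss \<partial>distr M (F_upto s) (\<lambda>w. w))"
  proof (rule nn_integral_cong)
    fix w assume "w \<in> space (distr M (F_upto s) (\<lambda>w. w))"
    then have "w \<in> space (F_upto s)" by simp
    then have "(\<lambda>z. f (w, z)) \<in> borel_measurable borel" using f by (rule measurable_Pair2[rotated])
    then show "(\<integral>\<^sup>+z. f (w, z) \<partial>distr gauss borel (\<lambda>z. sqrt (t - s) * z)) = (\<integral>\<^sup>+z. f (w, sqrt (t - s) * z) \<partial>gauss)"
      by (subst nn_integral_distr) auto
  qed
  also have "\<dots> = (\<integral>\<^sup>+w. \<integral>\<^sup>+z. f (w, sqrt (t - s) * z) \<partial>gauss \<partial>M)"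
  proof (rule nn_integral_distr[OF id])
    have "(\<lambda>(w, z). f (w, sqrt (t - s) * z)) \<in> borel_measurable (F_upto s \<Otimes>\<^sub>M gauss)"
      using f by (auto simp: split_beta' intro!: measurable_compose[OF _ f])
    then show "(\<lambda>w. \<integral>\<^sup>+z. f (w, sqrt (t - s) * z) \<partial>gauss) \<in> borel_measurable (distr M (F_upto s) (\<lambda>w. w))"
      using gauss.borel_measurable_nn_integral[of "\<lambda>w z. f (w, sqrt (t - s) * z)"] by simp
  qed
  finally show ?thesis .
qed

text \<open>Iterated Gaussian kernels: the value at \<open>x\<close> of the expectation of
  \<open>f\<^sub>1 (x + Y t\<^sub>1 - Y s) * \<dots> * f\<^sub>n (x + Y t\<^sub>n - Y s)\<close> for a Brownian motion \<open>Y\<close> and times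
  \<open>s \<le> t\<^sub>1 \<le> \<dots> \<le> t\<^sub>n\<close>.\<close>

fun kern :: "real \<Rightarrow> (real \<times> (real \<Rightarrow> ennreal)) list \<Rightarrow> real \<Rightarrow> ennreal" where
  "kern s [] x = 1"
| "kern s ((t, f) # l) x = (\<integral>\<^sup>+z. f (x + sqrt (t - s) * z) * kern t l (x + sqrt (t - s) * z) \<partial>gauss)"

lemma measurable_kern:
  "\<forall>p\<in>set l. snd p \<in> borel_measurable borel \<Longrightarrow> kern s l \<in> borel_measurable borel"
proof (induction l arbitrary: s)
  case Nil
  have "kern s [] = (\<lambda>_. 1)" by (rule ext) simp
  then show ?case by simp
next
  case (Cons p l)
  obtain t f where p: "p = (t, f)" by (cases p)
  have f [measurable]: "f \<in> borel_measurable borel" and l [measurable]: "kern t l \<in> borel_measurable borel"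
    using Cons p by auto
  have "kern s (p # l) = (\<lambda>x. \<integral>\<^sup>+z. f (x + sqrt (t - s) * z) * kern t l (x + sqrt (t - s) * z) \<partial>gauss)"
    by (rule ext) (simp add: p)
  also have "\<dots> \<in> borel_measurable borel" by measurable
  finally show ?case .
qed

lemma kern_shift: "kern (s + c) (map (\<lambda>(t, f). (t + c, f)) l) x = kern s l x"
  by (induction l arbitrary: s x) auto

text \<open>Peel off the earliest time t: the factor read there joins g and the position there
  replaces A, both known at time t. For this induction the prefactor and the starting position have
  to be arbitrary functions of the past.\<close>

lemma is_BM_kern:
  assumes M: "is_BM M Y"
  shows "0 \<le> s \<Longrightarrow> sorted (s # map fst l) \<Longrightarrow> \<forall>p\<in>set l. snd p \<in> borel_measurable borel \<Longrightarrow>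
    g \<in> borel_measurable (F_upto s) \<Longrightarrow> A \<in> borel_measurable (F_upto s) \<Longrightarrow>
    (\<integral>\<^sup>+w. g w * (\<Prod>(t, f)\<leftarrow>l. f (A w + (Y t w - Y s w))) \<partial>M) = (\<integral>\<^sup>+w. g w * kern s l (A w) \<partial>M)"
proof (induction l arbitrary: s g A)
  case (Cons p l)
  obtain t f where p: "p = (t, f)" by (cases p)
  note b = is_BM_basic[OF M]
  have st: "0 \<le> s" "s \<le> t" "0 \<le> t" and so: "sorted (t # map fst l)" using Cons.prems by (auto simp: p)
  have f [measurable]: "f \<in> borel_measurable borel" and ml: "\<forall>p\<in>set l. snd p \<in> borel_measurable borel"
    using Cons.prems p by auto
  note k [measurable] = measurable_kern[OF ml, of t]
  note gs = Cons.prems(4,5)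
  have gt: "g \<in> borel_measurable (F_upto t)" "A \<in> borel_measurable (F_upto t)" "Y s \<in> borel_measurable (F_upto t)"
    "Y t \<in> borel_measurable (F_upto t)"
    using F_upto_le[OF gs(1) st(2)] F_upto_le[OF gs(2) st(2)] F_upto_le[OF b(4)[OF st(1)] st(2)] b(4)[OF st(3)] by auto
  have A1: "(\<lambda>w. A w + (Y t w - Y s w)) \<in> borel_measurable (F_upto t)" using gt by measurable
  have g1: "(\<lambda>w. g w * f (A w + (Y t w - Y s w))) \<in> borel_measurable (F_upto t)" using gt by measurable
  have "(\<integral>\<^sup>+w. g w * (\<Prod>(t, f)\<leftarrow>p # l. f (A w + (Y t w - Y s w))) \<partial>M) =
    (\<integral>\<^sup>+w. (g w * f (A w + (Y t w - Y s w))) *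
       (\<Prod>(t', f)\<leftarrow>l. f ((A w + (Y t w - Y s w)) + (Y t' w - Y t w))) \<partial>M)"
    by (simp add: p mult.assoc algebra_simps)
  also have "\<dots> = (\<integral>\<^sup>+w. (g w * f (A w + (Y t w - Y s w))) * kern t l (A w + (Y t w - Y s w)) \<partial>M)"
    by (rule Cons.IH[OF st(3) so ml g1 A1])
  also have "\<dots> = (\<integral>\<^sup>+w. (\<lambda>(w, d). g w * (f (A w + d) * kern t l (A w + d))) (w, Y t w - Y s w) \<partial>M)"
    by (simp add: mult.assoc)
  also have "\<dots> = (\<integral>\<^sup>+w. \<integral>\<^sup>+z. (\<lambda>(w, d). g w * (f (A w + d) * kern t l (A w + d))) (w, sqrt (t - s) * z) \<partial>gauss \<partial>M)"
  proof (rule is_BM_increment[OF M st(1,2)])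
    note [measurable] = gs
    show "(\<lambda>(w, d). g w * (f (A w + d) * kern t l (A w + d))) \<in> borel_measurable (F_upto s \<Otimes>\<^sub>M borel)"
      by measurable
  qed
  also have "\<dots> = (\<integral>\<^sup>+w. g w * kern s (p # l) (A w) \<partial>M)"
  proof (rule nn_integral_cong)
    fix w
    have "(\<lambda>z. f (A w + sqrt (t - s) * z) * kern t l (A w + sqrt (t - s) * z)) \<in> borel_measurable gauss"
      by measurable
    then show "(\<integral>\<^sup>+z. (\<lambda>(w, d). g w * (f (A w + d) * kern t l (A w + d))) (w, sqrt (t - s) * z) \<partial>gauss) =
      g w * kern s (p # l) (A w)"
      by (simp add: p nn_integral_cmult)
  qed
  finally show ?case .
qed simp

section \<open>Cylinder sets and uniqueness in law\<close>

definition cyl :: "(real \<times> real) list \<Rightarrow> (real \<Rightarrow> real) set" where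
  "cyl l = {w \<in> paths. \<forall>p\<in>set l. w (fst p) < snd p}"

text \<open>Strict upper bounds give a generator that is stable under intersection, and their
  indicators are increasing limits of ramps.\<close>

definition cyls :: "(real \<Rightarrow> real) set set" where
  "cyls = {cyl l | l. \<forall>p\<in>set l. 0 \<le> fst p}"

text \<open>Concatenating lists loses the order of the times, and the iterated kernels move forward
  in time.\<close>

lemma cyls_sorted:
  assumes "C \<in> cyls"
  obtains l where "C = cyl l" "sorted (0 # map fst l)"
proof -
  obtain l where l: "C = cyl l" "\<forall>p\<in>set l. 0 \<le> fst p" using assms by (auto simp: cyls_def)
  have "C = cyl (sort_key fst l)" using l by (simp add: cyl_def)
  moreover have "sorted (0 # map fst (sort_key fst l))" using l(2) by auto
  ultimately show ?thesis by (rule that)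
qed

lemma cylsI: "\<forall>p\<in>set l. 0 \<le> fst p \<Longrightarrow> cyl l \<in> cyls"
  by (auto simp: cyls_def)

lemma cyls_Pow: "cyls \<subseteq> Pow paths"
  by (auto simp: cyls_def cyl_def)

lemma Int_stable_cyls: "Int_stable cyls"
proof (rule Int_stableI)
  fix a b assume "a \<in> cyls" "b \<in> cyls"
  then obtain l m where lm: "a = cyl l" "b = cyl m" "\<forall>p\<in>set l. 0 \<le> fst p" "\<forall>p\<in>set m. 0 \<le> fst p"
    by (auto simp: cyls_def)
  then have "a \<inter> b = cyl (l @ m)" by (auto simp: cyl_def)
  then show "a \<inter> b \<in> cyls" using lm cylsI[of "l @ m"] by auto
qed

lemma paths_cyls: "paths \<in> cyls"
  using cylsI[of "[]"] by (simp add: cyl_def)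

lemma measurable_F_inf_eval: "0 \<le> t \<Longrightarrow> (\<lambda>w. w t) \<in> borel_measurable F_inf"
  by (rule measurable_coordinate) simp

lemma cyls_F_inf: "cyls \<subseteq> sets F_inf"
proof
  fix C assume "C \<in> cyls"
  then obtain l where l: "C = cyl l" "\<forall>p\<in>set l. 0 \<le> fst p" by (auto simp: cyls_def)
  have "{w \<in> space F_inf. \<forall>p\<in>set l. w (fst p) < snd p} \<in> sets F_inf"
  proof (intro sets.sets_Collect_finite_All)
    fix p assume "p \<in> set l"
    then have "(\<lambda>w. w (fst p)) \<in> borel_measurable F_inf" using l by (intro measurable_F_inf_eval) auto
    then show "{w \<in> space F_inf. w (fst p) < snd p} \<in> sets F_inf" by measurable
  qed simp
  then show "C \<in> sets F_inf" using l by (simp add: cyl_def)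
qed

lemma sets_F_inf_cyls: "sets F_inf = sigma_sets paths cyls"
proof
  show "sigma_sets paths cyls \<subseteq> sets F_inf"
    using sets.sigma_sets_subset[OF cyls_F_inf] by simp
  define S where "S = sigma paths cyls"
  have S: "space S = paths" "sets S = sigma_sets paths cyls" using cyls_Pow by (auto simp: S_def)
  have m: "(\<lambda>w. w) \<in> measurable S F_inf"
  proof (rule measurable_path_algebraI)
    fix t :: real assume t: "t \<in> {0..}"
    show "(\<lambda>w. w t) \<in> borel_measurable S"
    proof (subst borel_measurable_iff_less, intro allI)
      fix c
      have "{w \<in> space S. w t < c} = cyl [(t, c)]" by (auto simp: S cyl_def)
      also have "\<dots> \<in> sets S" using t cylsI[of "[(t, c)]"] by (auto simp: S)
      finally show "{w \<in> space S. w t < c} \<in> sets S" .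
    qed
  qed (simp add: S)
  show "sets F_inf \<subseteq> sigma_sets paths cyls"
  proof
    fix A assume A: "A \<in> sets F_inf"
    have "(\<lambda>w. w) -` A \<inter> space S \<in> sets S" by (rule measurable_sets[OF m A])
    moreover have "(\<lambda>w. w) -` A \<inter> space S = A" using sets.sets_into_space[OF A] by (auto simp: S)
    ultimately show "A \<in> sigma_sets paths cyls" by (simp add: S)
  qed
qed

lemma measure_eqI_cyls:
  assumes "sets M = sets F_inf" "sets N = sets F_inf" "finite_measure M"
    and "\<And>l. sorted (0 # map fst l) \<Longrightarrow> emeasure M (cyl l) = emeasure N (cyl l)"
  shows "M = N"
proof (rule measure_eqI_generator_eq[OF Int_stable_cyls cyls_Pow, where A="\<lambda>_. paths"])
  interpret finite_measure M by fact
  show "emeasure M paths \<noteq> \<infinity>" by simp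
  fix X assume "X \<in> cyls"
  then show "emeasure M X = emeasure N X" using assms(4) by (auto elim!: cyls_sorted)
qed (use assms paths_cyls in \<open>auto simp: sets_F_inf_cyls\<close>)

definition ind_list :: "(real \<times> real) list \<Rightarrow> (real \<times> (real \<Rightarrow> ennreal)) list" where
  "ind_list l = map (\<lambda>(t, c). (t, indicator {..<c})) l"

lemma fst_ind_list [simp]: "map fst (ind_list l) = map fst l"
  by (auto simp: ind_list_def)

lemma measurable_ind_list: "\<forall>p\<in>set (ind_list l). snd p \<in> borel_measurable borel"
  by (auto simp: ind_list_def)

lemma prod_ind_list: "w \<in> paths \<Longrightarrow> (\<Prod>(t, f)\<leftarrow>ind_list l. f (w t)) = indicator (cyl l) w"
proof (induction l)
  case (Cons p l)
  then show ?case by (cases p) (auto simp: ind_list_def cyl_def indicator_def)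
qed (simp add: ind_list_def cyl_def)

text \<open>The right-hand side mentions neither the measure nor the process, which is the reason
  for uniqueness in law. Since \<open>Y 0\<close> is almost surely 0, values are increments from
  time 0.\<close>

lemma is_BM_cyl:
  assumes M: "is_BM M Y" and f: "f \<in> measurable M F_inf" "AE w in M. \<forall>t\<ge>0. f w t = Y t w"
    and l: "sorted (0 # map fst l)"
  shows "emeasure M (f -` cyl l \<inter> space M) = kern 0 (ind_list l) 0"
proof -
  note b = is_BM_basic[OF M]
  interpret prob_space M by (rule b)
  have C: "cyl l \<in> sets F_inf" using l cyls_F_inf cylsI[of l] by auto
  have "emeasure M (f -` cyl l \<inter> space M) = (\<integral>\<^sup>+w. indicator (f -` cyl l \<inter> space M) w \<partial>M)"
    using measurable_sets[OF f(1) C] by simp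
  also have "\<dots> = (\<integral>\<^sup>+w. 1 * (\<Prod>(t, f)\<leftarrow>ind_list l. f (0 + (Y t w - Y 0 w))) \<partial>M)"
  proof (rule nn_integral_cong_AE)
    show "AE w in M. indicator (f -` cyl l \<inter> space M) w = 1 * (\<Prod>(t, f)\<leftarrow>ind_list l. f (0 + (Y t w - Y 0 w)))"
      using b(5) f(2) AE_space
    proof eventually_elim
      case (elim w)
      have "f w \<in> paths" using measurable_space[OF f(1)] elim by simp
      then have "indicator (f -` cyl l \<inter> space M) w = (\<Prod>(t, g)\<leftarrow>ind_list l. g (f w t))"
        using elim by (subst prod_ind_list) (auto simp: indicator_def)
      also have "\<dots> = (\<Prod>(t, g)\<leftarrow>ind_list l. g (0 + (Y t w - Y 0 w)))"
        using elim l by (intro arg_cong[where f=prod_list] map_cong refl) (auto simp: ind_list_def)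
      finally show ?case by simp
    qed
  qed
  also have "\<dots> = (\<integral>\<^sup>+w. 1 * kern 0 (ind_list l) 0 \<partial>M)"
    by (rule is_BM_kern[OF M, where A="\<lambda>_. 0"]) (use l measurable_ind_list in auto)
  also have "\<dots> = kern 0 (ind_list l) 0" by (simp add: emeasure_space_1)
  finally show ?thesis .
qed

lemma is_BM_unique:
  assumes "is_BM M Y" "f \<in> measurable M F_inf" "AE w in M. \<forall>t\<ge>0. f w t = Y t w"
    and "is_BM M' Y'" "f' \<in> measurable M' F_inf" "AE w in M'. \<forall>t\<ge>0. f' w t = Y' t w"
  shows "distr M F_inf f = distr M' F_inf f'"
proof (rule measure_eqI_cyls)
  interpret prob_space M by (rule is_BM_basic[OF assms(1)])
  show "finite_measure (distr M F_inf f)" using prob_space_distr[OF assms(2)] by (simp add: prob_space_def)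
  fix l :: "(real \<times> real) list" assume l: "sorted (0 # map fst l)"
  then have C: "cyl l \<in> sets F_inf" using cyls_F_inf cylsI[of l] by auto
  show "emeasure (distr M F_inf f) (cyl l) = emeasure (distr M' F_inf f') (cyl l)"
    using is_BM_cyl[OF assms(1-3) l] is_BM_cyl[OF assms(4-6) l] C assms(2,5) by (simp add: emeasure_distr)
qed auto

lemma wiener_is_BM:
  assumes W: "wiener_measure P"
  shows "is_BM P (\<lambda>t w. w t)"
  unfolding is_BM_def
proof (intro conjI allI impI)
  have sP: "sets P = sets F_inf" and spP: "space P = paths"
    using W by (auto simp: wiener_measure_def dest: sets_eq_imp_space_eq)
  show "prob_space P" using W by (simp add: wiener_measure_def)
  interpret prob_space P by fact
  show "sets P = sets F_inf" "AE w in P. w 0 = 0" using W by (auto simp: wiener_measure_def)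
  show "(\<lambda>w. w t) \<in> borel_measurable (F_upto t)" if "0 \<le> t" for t using that by (intro measurable_coordinate) auto
  fix s t :: real and G A assume st: "0 \<le> s" "s \<le> t" and G: "G \<in> sets (F_upto s)" and A: "A \<in> sets (borel :: real measure)"
  have GP: "G \<in> sets P" using G sets_path_algebra_mono[of "{0..s}" "{0..}"] sP st by auto
  have Gp: "G \<subseteq> paths" using sets.sets_into_space[OF G] by simp
  show "emeasure P (G \<inter> {w \<in> paths. w t - w s \<in> A}) = emeasure P G * emeasure gauss {z. sqrt (t - s) * z \<in> A}"
  \<comment> \<open>\<open>wiener_measure\<close> speaks of s < t. For s = t the increment is 0, and
    the event is either G or empty.\<close>
  proof (cases "s = t")
    case True
    have "G \<inter> {w \<in> paths. 0 \<in> A} = (if 0 \<in> A then G else {})" using Gp by auto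
    then show ?thesis using True gauss.emeasure_space_1 by auto
  next
    case False
    then have "s < t" using st by simp
    then have d: "distributed P lborel (\<lambda>w. w t - w s) (normal_density 0 (sqrt (t - s)))"
      and i: "indep_set (sets (F_upto s)) (sets (vimage_algebra paths (\<lambda>w. w t - w s) borel))"
      using W st by (auto simp: wiener_measure_def)
    have B: "{w \<in> paths. w t - w s \<in> A} = (\<lambda>w. w t - w s) -` A \<inter> paths" by auto
    have Bv: "{w \<in> paths. w t - w s \<in> A} \<in> sets (vimage_algebra paths (\<lambda>w. w t - w s) borel)"
      unfolding B using A by (rule in_vimage_algebra)
    then have BP: "{w \<in> paths. w t - w s \<in> A} \<in> sets P" using indep_setD_ev2[OF i] by auto
    have "emeasure P (G \<inter> {w \<in> paths. w t - w s \<in> A}) = emeasure P G * emeasure P {w \<in> paths. w t - w s \<in> A}"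
      using indep_setD[OF i G Bv] by (simp add: emeasure_eq_measure ennreal_mult)
    also have "emeasure P {w \<in> paths. w t - w s \<in> A} = emeasure (distr P lborel (\<lambda>w. w t - w s)) A"
      using A distributed_measurable[OF d] by (subst emeasure_distr) (auto simp: B spP)
    also have "distr P lborel (\<lambda>w. w t - w s) = distr gauss borel (\<lambda>z. sqrt (t - s) * z)"
      using distributed_distr_eq_density[OF d] distr_gauss_scale[of "sqrt (t - s)"] \<open>s < t\<close> by simp
    also have "emeasure \<dots> A = emeasure gauss {z. sqrt (t - s) * z \<in> A}"
    proof (subst emeasure_distr[OF _ A])
      show "(\<lambda>z. sqrt (t - s) * z) \<in> borel_measurable gauss" by measurable
    qed (auto intro!: arg_cong[where f="emeasure gauss"])
    finally show ?thesis .
  qed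
qed

lemma measurable_wiener:
  assumes "wiener_measure P" shows "measurable P N = measurable F_inf N"
  using assms by (intro measurable_cong_sets) (auto simp: wiener_measure_def)

text \<open>Both sides are read off one iterated kernel. Only time differences enter it, by
  \<open>kern_shift\<close>, so starting at s or at 0 gives the same value.\<close>

lemma markov:
  assumes W: "wiener_measure P" and s: "0 \<le> s" and G: "G \<in> sets (F_upto s)"
    and l: "sorted (0 # map fst l)" and f: "\<forall>p\<in>set l. snd p \<in> borel_measurable borel"
  shows "(\<integral>\<^sup>+w. indicator G w * (\<Prod>(t, f)\<leftarrow>l. f (w (s + t) - w s)) \<partial>P) =
    emeasure P G * (\<integral>\<^sup>+w. (\<Prod>(t, f)\<leftarrow>l. f (w t)) \<partial>P)"
proof -
  note M = wiener_is_BM[OF W]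
  note b = is_BM_basic[OF M]
  interpret prob_space P by (rule b)
  have GP: "G \<in> sets P" using G sets_path_algebra_mono[of "{0..s}" "{0..}"] b(2) s by auto
  let ?l = "map (\<lambda>(t, f). (t + s, f)) l"
  have fst: "map fst ?l = map (\<lambda>t. t + s) (map fst l)" by (auto simp: split_beta')
  have "(\<integral>\<^sup>+w. indicator G w * (\<Prod>(t, f)\<leftarrow>l. f (w (s + t) - w s)) \<partial>P) =
    (\<integral>\<^sup>+w. indicator G w * (\<Prod>(t, f)\<leftarrow>?l. f (0 + (w t - w s))) \<partial>P)"
    by (simp add: split_beta' comp_def add.commute)
  also have "\<dots> = (\<integral>\<^sup>+w. indicator G w * kern s ?l 0 \<partial>P)"
  proof (rule is_BM_kern[OF M s, where A="\<lambda>_. 0"])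
    show "sorted (s # map fst ?l)" unfolding fst using l by (auto simp: sorted_map elim: sorted_wrt_mono_rel[rotated])
  qed (use f G in \<open>auto simp: split_beta'\<close>)
  also have "\<dots> = emeasure P G * kern 0 l 0"
    using GP kern_shift[of 0 s l 0] by (simp add: nn_integral_multc)
  also have "kern 0 l 0 = (\<integral>\<^sup>+w. 1 * kern 0 l 0 \<partial>P)" by (simp add: emeasure_space_1)
  also have "\<dots> = (\<integral>\<^sup>+w. 1 * (\<Prod>(t, f)\<leftarrow>l. f (0 + (w t - w 0))) \<partial>P)"
    by (rule is_BM_kern[OF M, where A="\<lambda>_. 0", symmetric]) (use f l in auto)
  also have "\<dots> = (\<integral>\<^sup>+w. (\<Prod>(t, f)\<leftarrow>l. f (w t)) \<partial>P)"
    using b(5) by (intro nn_integral_cong_AE) (auto simp: split_beta')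
  finally show ?thesis .
qed

section \<open>Test functionals\<close>

text \<open>A piecewise linear lower approximation of the indicator of {..<c}. Its Lipschitz
  constant m is the price of moving one coordinate of the path.\<close>

definition ramp :: "nat \<Rightarrow> real \<Rightarrow> real \<Rightarrow> real" where
  "ramp m c x = min 1 (max 0 (real m * (c - x)))"

definition test_fun :: "nat \<Rightarrow> (real \<times> real) list \<Rightarrow> (real \<Rightarrow> real) \<Rightarrow> real" where
  "test_fun m l w = (\<Prod>p\<leftarrow>l. ramp m (snd p) (w (fst p)))"

lemma ramp_bounds: "0 \<le> ramp m c x" "ramp m c x \<le> 1"
  by (auto simp: ramp_def)

lemma ramp_lipschitz: "\<bar>ramp m c x - ramp m c y\<bar> \<le> real m * \<bar>x - y\<bar>"
proof -
  have "\<bar>min 1 (max 0 a) - min 1 (max 0 b)\<bar> \<le> \<bar>a - b\<bar>" for a b :: real by (auto simp: min_def max_def)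
  from this[of "real m * (c - x)" "real m * (c - y)"]
  have "\<bar>ramp m c x - ramp m c y\<bar> \<le> \<bar>real m * (c - x) - real m * (c - y)\<bar>" unfolding ramp_def .
  also have "\<dots> = \<bar>real m * (y - x)\<bar>" by (simp add: algebra_simps)
  also have "\<dots> = real m * \<bar>x - y\<bar>" by (simp add: abs_mult abs_minus_commute)
  finally show ?thesis .
qed

lemma continuous_ramp: "isCont (ramp m c) x"
  unfolding ramp_def by (intro continuous_intros)

lemma measurable_ramp [measurable]: "ramp m c \<in> borel_measurable borel"
  unfolding ramp_def by measurable

lemma ramp_tendsto: "(\<lambda>m. ramp m c x) \<longlonglongrightarrow> indicator {..<c} x"
proof (cases "x < c")
  case True
  obtain k :: nat where k: "1 / (c - x) < real k" using reals_Archimedean2 by blast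
  have "ramp m c x = 1" if "k \<le> m" for m
  proof -
    have "1 \<le> real k * (c - x)" using k True by (simp add: field_simps)
    also have "\<dots> \<le> real m * (c - x)" using True that by (intro mult_right_mono) auto
    finally show ?thesis by (simp add: ramp_def)
  qed
  then have "\<forall>\<^sub>F m in sequentially. ramp m c x = 1" by (auto simp: eventually_sequentially)
  then show ?thesis using True by (simp add: tendsto_eventually)
next
  case False
  then have "real m * (c - x) \<le> 0" for m by (intro mult_nonneg_nonpos) auto
  then have "ramp m c x = 0" for m by (simp add: ramp_def max_absorb1)
  then show ?thesis using False by simp
qed

lemma test_fun_Nil [simp]: "test_fun m [] w = 1"
  by (simp add: test_fun_def)

lemma test_fun_Cons [simp]: "test_fun m (p # l) w = ramp m (snd p) (w (fst p)) * test_fun m l w"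
  by (simp add: test_fun_def)

lemma test_fun_bounds: "0 \<le> test_fun m l w" "test_fun m l w \<le> 1"
proof -
  have "0 \<le> test_fun m l w \<and> test_fun m l w \<le> 1"
    by (induction l) (auto simp: ramp_bounds intro!: mult_le_one)
  then show "0 \<le> test_fun m l w" "test_fun m l w \<le> 1" by auto
qed

lemma test_fun_cong: "(\<And>p. p \<in> set l \<Longrightarrow> w (fst p) = w' (fst p)) \<Longrightarrow> test_fun m l w = test_fun m l w'"
  by (induction l) auto

text \<open>Replacing one factor at a time costs at most m * e each, since the other factors lie in
  {0..1}.\<close>

lemma test_fun_lipschitz:
  assumes "\<And>p. p \<in> set l \<Longrightarrow> \<bar>w (fst p) - w' (fst p)\<bar> \<le> e"
  shows "\<bar>test_fun m l w - test_fun m l w'\<bar> \<le> real (length l) * real m * e"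
  using assms
proof (induction l)
  case (Cons p l)
  let ?r = "\<lambda>w. ramp m (snd p) (w (fst p))" and ?t = "test_fun m l"
  have "\<bar>?r w - ?r w'\<bar> \<le> real m * \<bar>w (fst p) - w' (fst p)\<bar>" by (rule ramp_lipschitz)
  also have "\<dots> \<le> real m * e" using Cons.prems by (intro mult_left_mono) auto
  finally have 1: "\<bar>?r w - ?r w'\<bar> \<le> real m * e" .
  have 2: "\<bar>?t w - ?t w'\<bar> \<le> real (length l) * real m * e" using Cons by auto
  have "test_fun m (p # l) w - test_fun m (p # l) w' = (?r w - ?r w') * ?t w + ?r w' * (?t w - ?t w')"
    by (simp add: algebra_simps)
  also have "\<bar>\<dots>\<bar> \<le> \<bar>?r w - ?r w'\<bar> * \<bar>?t w\<bar> + \<bar>?r w'\<bar> * \<bar>?t w - ?t w'\<bar>"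
    using abs_triangle_ineq[of "(?r w - ?r w') * ?t w" "?r w' * (?t w - ?t w')"] by (simp only: abs_mult)
  also have "\<dots> \<le> \<bar>?r w - ?r w'\<bar> * 1 + 1 * \<bar>?t w - ?t w'\<bar>"
    using test_fun_bounds[of m l w] ramp_bounds[of m "snd p" "w' (fst p)"]
    by (intro add_mono mult_left_mono mult_right_mono) auto
  finally show ?case using 1 2 by (simp add: algebra_simps)
qed simp

lemma test_fun_tendsto:
  assumes "\<And>p. p \<in> set l \<Longrightarrow> (\<lambda>n. w n (fst p)) \<longlonglongrightarrow> v (fst p)"
  shows "(\<lambda>n. test_fun m l (w n)) \<longlonglongrightarrow> test_fun m l v"
  using assms
proof (induction l)
  case (Cons p l)
  have "(\<lambda>n. ramp m (snd p) (w n (fst p))) \<longlonglongrightarrow> ramp m (snd p) (v (fst p))"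
    by (rule isCont_tendsto_compose[OF continuous_ramp]) (use Cons.prems in auto)
  with Cons show ?case by (auto intro!: tendsto_mult)
qed simp

lemma test_fun_tendsto_indicator:
  assumes "w \<in> paths"
  shows "(\<lambda>m. test_fun m l w) \<longlonglongrightarrow> indicator (cyl l) w"
proof (induction l)
  case Nil
  then show ?case using assms by (simp add: cyl_def)
next
  case (Cons p l)
  have "(\<lambda>m. test_fun m (p # l) w) \<longlonglongrightarrow> indicator {..<snd p} (w (fst p)) * indicator (cyl l) w"
    using tendsto_mult[OF ramp_tendsto[of "snd p" "w (fst p)"] Cons] by simp
  also have "indicator {..<snd p} (w (fst p)) * indicator (cyl l) w = (indicator (cyl (p # l)) w :: real)"
    using assms by (auto simp: cyl_def indicator_def)
  finally show ?case .
qed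

lemma measurable_test_fun:
  assumes "\<And>p. p \<in> set l \<Longrightarrow> (\<lambda>x. f x (fst p)) \<in> borel_measurable M"
  shows "(\<lambda>x. test_fun m l (f x)) \<in> borel_measurable M"
  using assms
proof (induction l)
  case (Cons p l)
  have [measurable]: "(\<lambda>x. f x (fst p)) \<in> borel_measurable M" "(\<lambda>x. test_fun m l (f x)) \<in> borel_measurable M"
    using Cons by auto
  show ?case by simp
qed simp

lemma measurable_test_fun_inf:
  assumes "f \<in> measurable M F_inf" "\<forall>p\<in>set l. 0 \<le> fst p"
  shows "(\<lambda>x. test_fun m l (f x)) \<in> borel_measurable M"
  using assms by (intro measurable_test_fun measurable_compose[OF assms(1) measurable_F_inf_eval]) auto

definition ramp_list :: "nat \<Rightarrow> (real \<times> real) list \<Rightarrow> (real \<times> (real \<Rightarrow> ennreal)) list" where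
  "ramp_list m l = map (\<lambda>p. (fst p, \<lambda>x. ennreal (ramp m (snd p) x))) l"

lemma fst_ramp_list [simp]: "map fst (ramp_list m l) = map fst l"
  by (simp add: ramp_list_def)

lemma measurable_ramp_list: "\<forall>p\<in>set (ramp_list m l). snd p \<in> borel_measurable borel"
  by (auto simp: ramp_list_def)

lemma prod_ramp_list: "(\<Prod>(t, f)\<leftarrow>ramp_list m l. f (w t)) = ennreal (test_fun m l w)"
  by (induction l) (auto simp: ramp_list_def ennreal_mult ramp_bounds test_fun_bounds)

lemma nn_integral_test_fun_tendsto:
  assumes "sets M = sets F_inf" "finite_measure M" "\<forall>p\<in>set l. 0 \<le> fst p"
  shows "(\<lambda>m. \<integral>\<^sup>+w. ennreal (test_fun m l w) \<partial>M) \<longlonglongrightarrow> emeasure M (cyl l)"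
proof -
  interpret finite_measure M by fact
  have sp: "space M = paths" using assms(1) by (auto dest: sets_eq_imp_space_eq)
  have C: "cyl l \<in> sets M" using cylsI[OF assms(3)] cyls_F_inf assms(1) by auto
  have m: "(\<lambda>w. w) \<in> measurable M F_inf" using assms(1) by (rule measurable_ident_sets)
  have "(\<lambda>m. \<integral>\<^sup>+w. ennreal (test_fun m l w) \<partial>M) \<longlonglongrightarrow> (\<integral>\<^sup>+w. indicator (cyl l) w \<partial>M)"
  proof (rule nn_integral_dominated_convergence[where w="\<lambda>_. 1"])
    show "(\<lambda>w. ennreal (test_fun i l w)) \<in> borel_measurable M" for i
      using measurable_test_fun_inf[OF m assms(3)] by measurable
    show "AE w in M. ennreal (test_fun j l w) \<le> 1" for j
      using test_fun_bounds by (intro AE_I2) auto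
    show "AE w in M. (\<lambda>i. ennreal (test_fun i l w)) \<longlonglongrightarrow> indicator (cyl l) w"
    proof (rule AE_I2)
      fix w assume "w \<in> space M"
      then have "(\<lambda>i. ennreal (test_fun i l w)) \<longlonglongrightarrow> ennreal (indicator (cyl l) w)"
        using sp by (intro tendsto_ennrealI test_fun_tendsto_indicator) simp
      then show "(\<lambda>i. ennreal (test_fun i l w)) \<longlonglongrightarrow> indicator (cyl l) w" by (simp add: ennreal_indicator)
    qed
  qed (use C in \<open>auto simp: emeasure_eq_measure\<close>)
  then show ?thesis using C by simp
qed

text \<open>Letting the slope tend to infinity recovers the masses of the cylinder sets, and these
  determine a finite measure.\<close>

lemma measure_eqI_test_fun:
  assumes "sets M = sets F_inf" "sets N = sets F_inf" "finite_measure M" "finite_measure N"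
    and eq: "\<And>m l. sorted (0 # map fst l) \<Longrightarrow>
      (\<integral>\<^sup>+w. ennreal (test_fun m l w) \<partial>M) = (\<integral>\<^sup>+w. ennreal (test_fun m l w) \<partial>N)"
  shows "M = N"
proof (rule measure_eqI_cyls[OF assms(1-3)])
  fix l :: "(real \<times> real) list" assume l: "sorted (0 # map fst l)"
  then have "\<forall>p\<in>set l. 0 \<le> fst p" by auto
  with nn_integral_test_fun_tendsto[OF assms(1,3), of l] nn_integral_test_fun_tendsto[OF assms(2,4), of l]
  show "emeasure M (cyl l) = emeasure N (cyl l)"
    using LIMSEQ_unique by (simp add: eq[OF l])
qed

section \<open>The strong Markov property\<close>

text \<open>The last clause says that \<open>\<tau> \<le> s\<close> is decided, and \<open>\<tau>\<close> then computed, by the path up to time \<open>s\<close>: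
  a pathwise form of being a stopping time.\<close>

definition path_stopping :: "real \<Rightarrow> ((real \<Rightarrow> real) \<Rightarrow> real) \<Rightarrow> bool" where
  "path_stopping T \<tau> \<longleftrightarrow> \<tau> \<in> borel_measurable F_inf \<and> (\<forall>w\<in>paths. 0 \<le> \<tau> w \<and> \<tau> w \<le> T) \<and>
     (\<forall>w\<in>paths. \<forall>s\<ge>0. \<tau> w \<le> s \<or> \<tau> (stop s w) \<le> s \<longrightarrow> \<tau> (stop s w) = \<tau> w)"

lemma path_stopping_const: "0 \<le> s \<Longrightarrow> path_stopping s (\<lambda>_. s)"
  by (simp add: path_stopping_def)

lemma path_stopping_tau:
  assumes T: "0 \<le> T"
  shows "path_stopping T (tau T y)"
  unfolding path_stopping_def
proof (intro conjI ballI allI impI)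
  have "(\<lambda>w. tau T y w) \<in> borel_measurable F_inf" using T by (intro measurable_tau) auto
  then show "tau T y \<in> borel_measurable F_inf" by simp
  fix w s assume w: "w \<in> paths" and s: "0 \<le> (s :: real)" and "tau T y w \<le> s \<or> tau T y (stop s w) \<le> s"
  from this(3) show "tau T y (stop s w) = tau T y w"
  proof
    assume "tau T y w \<le> s"
    then show ?thesis using w T by (intro tau_cong[of s w]) auto
  next
    assume "tau T y (stop s w) \<le> s"
    then show ?thesis using w s T by (intro tau_cong[of s "stop s w", symmetric]) auto
  qed
qed (use tau_bounds[OF T] in auto)

lemma stop_stop: "0 \<le> s \<Longrightarrow> stop s (stop t w) = stop (min s t) w"
  by (auto simp: stop_def min.assoc)

text \<open>For a fixed event of the stopped path, the law of the shifted path under P restricted to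
  that event is compared with a multiple of P on ramps. The time is approximated from above by grid
  times, the Markov property is applied on each grid cell, and continuity of the paths removes the
  grid.\<close>

lemma strong_markov:
  assumes W: "wiener_measure P" and tau: "path_stopping T \<tau>"
  shows "distr P (F_inf \<Otimes>\<^sub>M F_inf) (\<lambda>w. (stop (\<tau> w) w, shift (\<tau> w) w)) = distr P F_inf (\<lambda>w. stop (\<tau> w) w) \<Otimes>\<^sub>M P"
proof (rule sym, rule pair_measure_eqI)
  note M = wiener_is_BM[OF W]
  note b = is_BM_basic[OF M]
  interpret prob_space P by (rule b)
  have t0: "\<And>w. w \<in> paths \<Longrightarrow> 0 \<le> \<tau> w" and tT: "\<And>w. w \<in> paths \<Longrightarrow> \<tau> w \<le> T"
    and ts: "\<And>w s. w \<in> paths \<Longrightarrow> 0 \<le> s \<Longrightarrow> \<tau> w \<le> s \<or> \<tau> (stop s w) \<le> s \<Longrightarrow> \<tau> (stop s w) = \<tau> w"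
    and tmF [measurable]: "\<tau> \<in> borel_measurable F_inf"
    using tau by (auto simp: path_stopping_def)
  have idP [measurable]: "(\<lambda>w. w) \<in> measurable P F_inf" using b(2) by (rule measurable_ident_sets)
  have tmP [measurable]: "\<tau> \<in> borel_measurable P" using tmF measurable_wiener[OF W] by simp
  have st: "(\<lambda>w. stop (\<tau> w) w) \<in> measurable P F_inf" "(\<lambda>w. stop (\<tau> w) w) \<in> measurable F_inf F_inf"
    using t0 b(3) by (auto intro!: measurable_stop_inf)
  have sh: "(\<lambda>w. shift (\<tau> w) w) \<in> measurable P F_inf" using t0 b(3) by (intro measurable_shift) auto
  have J: "(\<lambda>w. (stop (\<tau> w) w, shift (\<tau> w) w)) \<in> measurable P (F_inf \<Otimes>\<^sub>M F_inf)" by (intro measurable_Pair st sh)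
  interpret D1: prob_space "distr P F_inf (\<lambda>w. stop (\<tau> w) w)" by (rule prob_space_distr[OF st(1)])
  show "sigma_finite_measure (distr P F_inf (\<lambda>w. stop (\<tau> w) w))" "sigma_finite_measure P" by unfold_locales
  show "sets (distr P F_inf (\<lambda>w. stop (\<tau> w) w) \<Otimes>\<^sub>M P) =
    sets (distr P (F_inf \<Otimes>\<^sub>M F_inf) (\<lambda>w. (stop (\<tau> w) w, shift (\<tau> w) w)))"
    using b(2) by (simp cong: sets_pair_measure_cong)
  fix A B assume A': "A \<in> sets (distr P F_inf (\<lambda>w. stop (\<tau> w) w))" and B: "B \<in> sets P"
  then have A: "A \<in> sets F_inf" by simp
  define A1 where "A1 = {w \<in> paths. stop (\<tau> w) w \<in> A}"
  have A1e: "A1 = (\<lambda>w. stop (\<tau> w) w) -` A \<inter> space P" by (auto simp: A1_def b(3))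
  have A1 [measurable]: "A1 \<in> sets P" unfolding A1e using st(1) A by (rule measurable_sets)

  define L where "L = density P (indicator A1)"
  have L: "sets L = sets P" "space L = paths" by (auto simp: L_def b(3))
  have finL: "finite_measure L"
    by (rule finite_measureI) (simp add: L_def emeasure_density emeasure_eq_measure nn_integral_multc)
  have shL: "(\<lambda>w. shift (\<tau> w) w) \<in> measurable L F_inf" using sh L(1) by (simp cong: measurable_cong_sets)
  have main: "distr L F_inf (\<lambda>w. shift (\<tau> w) w) = scale_measure (emeasure P A1) P"
  proof (rule measure_eqI_test_fun)
    interpret L: finite_measure L by fact
    show "finite_measure (distr L F_inf (\<lambda>w. shift (\<tau> w) w))" by (rule L.finite_measure_distr[OF shL])
    show "finite_measure (scale_measure (emeasure P A1) P)"
      by (rule finite_measureI) (simp add: emeasure_eq_measure ennreal_mult_eq_top_iff)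
    show "sets (scale_measure (emeasure P A1) P) = sets F_inf" using b(2) by simp
    fix m and l :: "(real \<times> real) list" assume l: "sorted (0 # map fst l)"
    then have l0: "\<forall>p\<in>set l. 0 \<le> fst p" by auto
    define I where "I = (\<integral>\<^sup>+w. ennreal (test_fun m l w) \<partial>P)"
    \<comment> \<open>Rounding strictly up: at the grid time the value of \<tau> and the path
      stopped at \<tau> are already known.\<close>
    define g where "g n w = (real_of_int \<lfloor>real (Suc n) * \<tau> w\<rfloor> + 1) / real (Suc n)" for n w
    have g_lim: "(\<lambda>n. g n w) \<longlonglongrightarrow> \<tau> w" for w
    proof -
      have "(\<lambda>n. real_of_int \<lfloor>real (Suc n) * \<tau> w\<rfloor> / real (Suc n) + 1 / real (Suc n)) \<longlonglongrightarrow> \<tau> w + 0"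
        by (intro tendsto_add floor_grid_tendsto LIMSEQ_inverse_real_of_nat[unfolded inverse_eq_divide])
      then show ?thesis by (simp add: g_def add_divide_distrib del: of_nat_Suc)
    qed
    have g0: "0 \<le> g n w" if "w \<in> paths" for n w using t0[OF that] by (simp add: g_def)
    have gm [measurable]: "g n \<in> borel_measurable P" for n unfolding g_def by measurable
    have step: "(\<integral>\<^sup>+w. indicator A1 w * ennreal (test_fun m l (shift (g n w) w)) \<partial>P) = emeasure P A1 * I" for n
    proof -
      let ?N = "real (Suc n)"
      \<comment> \<open>As \<tau> \<le> T, the index floor (N \<tau>) + 1 of the grid cell never
        exceeds K.\<close>
      define K where "K = nat \<lfloor>?N * T\<rfloor> + 1"
      define G where "G k = {w \<in> A1. \<lfloor>?N * \<tau> w\<rfloor> + 1 = int k}" for k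
      \<comment> \<open>The cell belongs to the past of its grid time because it is the preimage of
        an event under stopping there. The two inclusions use the two alternatives in the last
        clause of \<open>path_stopping\<close>.\<close>
      have GF: "G k \<in> sets (F_upto (real k / ?N))" if k: "1 \<le> k" for k
      proof -
        let ?s = "real k / ?N"
        let ?D = "{v \<in> paths. stop (\<tau> v) v \<in> A \<and> \<lfloor>?N * \<tau> v\<rfloor> + 1 = int k}"
        have "(\<lambda>w. stop (\<tau> w) w) -` A \<inter> space F_inf \<in> sets F_inf" by (rule measurable_sets[OF st(2) A])
        moreover have "{v \<in> space F_inf. \<lfloor>?N * \<tau> v\<rfloor> + 1 = int k} \<in> sets F_inf" by measurable
        moreover have "?D = ((\<lambda>w. stop (\<tau> w) w) -` A \<inter> space F_inf) \<inter> {v \<in> space F_inf. \<lfloor>?N * \<tau> v\<rfloor> + 1 = int k}" by auto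
        ultimately have D: "?D \<in> sets F_inf" by (simp only: sets.Int)
        have s0: "0 \<le> ?s" by simp
        have le: "\<tau> v \<le> ?s" if "\<lfloor>?N * \<tau> v\<rfloor> + 1 = int k" for v
        proof -
          have "?N * \<tau> v \<le> real k" using that by linarith
          then show ?thesis by (simp add: pos_le_divide_eq mult.commute del: of_nat_Suc)
        qed
        have eq: "stop (\<tau> v) v = stop (\<tau> (stop ?s v)) (stop ?s v)" if "v \<in> paths" "\<tau> v \<le> ?s \<or> \<tau> (stop ?s v) \<le> ?s" for v
        proof -
          have "\<tau> (stop ?s v) = \<tau> v" by (rule ts[OF that(1) s0 that(2)])
          with that show ?thesis using t0[OF that(1)] by (simp add: stop_stop min_absorb1 del: of_nat_Suc)
        qed
        have "G k = stop ?s -` ?D \<inter> space (F_upto ?s)"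
        proof (intro set_eqI iffI)
          fix w assume w: "w \<in> G k"
          then have p: "w \<in> paths" and f: "\<lfloor>?N * \<tau> w\<rfloor> + 1 = int k" by (auto simp: G_def A1_def)
          have p1: "stop ?s w \<in> paths" using p s0 by auto
          have t: "\<tau> (stop ?s w) = \<tau> w" by (rule ts[OF p s0]) (use le[OF f] in blast)
          have f1: "\<lfloor>?N * \<tau> (stop ?s w)\<rfloor> + 1 = int k" unfolding t by (rule f)
          have "stop (\<tau> w) w = stop (\<tau> (stop ?s w)) (stop ?s w)" by (rule eq[OF p]) (use le[OF f] in blast)
          then have "stop (\<tau> (stop ?s w)) (stop ?s w) \<in> A" using w unfolding G_def A1_def by (metis (lifting) mem_Collect_eq)
          with p p1 f1 show "w \<in> stop ?s -` ?D \<inter> space (F_upto ?s)"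
            by (simp only: space_path_algebra vimage_eq Int_iff mem_Collect_eq)
        next
          fix w assume "w \<in> stop ?s -` ?D \<inter> space (F_upto ?s)"
          then have p': "w \<in> paths" and a: "stop (\<tau> (stop ?s w)) (stop ?s w) \<in> A"
            and f: "\<lfloor>?N * \<tau> (stop ?s w)\<rfloor> + 1 = int k" by auto
          have t: "\<tau> (stop ?s w) = \<tau> w" by (rule ts[OF p' s0]) (use le[OF f] in blast)
          have "stop (\<tau> w) w = stop (\<tau> (stop ?s w)) (stop ?s w)" by (rule eq[OF p']) (use le[OF f] in blast)
          then have "stop (\<tau> w) w \<in> A" using a by metis
          then show "w \<in> G k" using p' f t by (simp add: G_def A1_def del: of_nat_Suc)
        qed
        moreover have "stop ?s \<in> measurable (F_upto ?s) F_inf"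
          using measurable_stop[OF measurable_ident_sets[OF refl] borel_measurable_const, of "{0..?s}" ?s] s0 by simp
        ultimately show ?thesis using D by (simp only: measurable_sets)
      qed
      have GP: "G k \<in> sets P" if "1 \<le> k" for k
        using GF[OF that] sets_path_algebra_mono[of "{0..real k / ?N}" "{0..}"] b(2) by auto
      have k: "\<exists>!k. k \<in> {1..K} \<and> w \<in> G k" if "w \<in> A1" for w
      proof (rule ex1I[where a="nat (\<lfloor>?N * \<tau> w\<rfloor> + 1)"])
        have p: "w \<in> paths" using that by (simp add: A1_def)
        have n: "0 \<le> \<lfloor>?N * \<tau> w\<rfloor>" using t0[OF p] by simp
        have "\<lfloor>?N * \<tau> w\<rfloor> \<le> \<lfloor>?N * T\<rfloor>" using tT[OF p] by (intro floor_mono mult_left_mono) auto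
        with n have "nat (\<lfloor>?N * \<tau> w\<rfloor> + 1) \<le> K" using n unfolding K_def by linarith
        note a = this
        have c: "1 \<le> nat (\<lfloor>?N * \<tau> w\<rfloor> + 1)" "\<lfloor>?N * \<tau> w\<rfloor> + 1 = int (nat (\<lfloor>?N * \<tau> w\<rfloor> + 1))" using n by linarith+
        have "w \<in> G (nat (\<lfloor>?N * \<tau> w\<rfloor> + 1))" unfolding G_def using that c(2) by blast
        with a c(1) show "nat (\<lfloor>?N * \<tau> w\<rfloor> + 1) \<in> {1..K} \<and> w \<in> G (nat (\<lfloor>?N * \<tau> w\<rfloor> + 1))"
          by (simp only: atLeastAtMost_iff simp_thms)
      qed (auto simp: G_def)
      have ind: "(\<Sum>k=1..K. indicator (G k) w) = (indicator A1 w :: ennreal)" for w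
      proof (cases "w \<in> A1")
        case True
        then obtain k where k1: "k \<in> {1..K}" "w \<in> G k" "\<And>j. j \<in> {1..K} \<Longrightarrow> w \<in> G j \<Longrightarrow> j = k" using k by blast
        have "(\<Sum>j=1..K. indicator (G j) w) = (\<Sum>j=1..K. if j = k then 1 else 0 :: ennreal)"
        proof (rule sum.cong[OF refl])
          fix j assume j: "j \<in> {1..K}"
          show "indicator (G j) w = (if j = k then 1 else 0 :: ennreal)"
          proof (cases "j = k")
            case False
            then have "w \<notin> G j" using k1(3)[OF j] by blast
            with False show ?thesis by simp
          qed (simp add: k1(2))
        qed
        also have "\<dots> = 1" by (subst sum.delta) (use k1(1) in simp_all)
        finally show ?thesis using True by simp
      qed (auto simp: G_def)
      have tm: "(\<lambda>w. ennreal (test_fun m l (shift s w))) \<in> borel_measurable P" if "0 \<le> s" for s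
      proof -
        have "(\<lambda>w. shift s w) \<in> measurable P F_inf" using that by (intro measurable_shift) auto
        from measurable_test_fun_inf[OF this l0, of m] show ?thesis by measurable
      qed
      have "(\<integral>\<^sup>+w. indicator A1 w * ennreal (test_fun m l (shift (g n w) w)) \<partial>P) =
        (\<integral>\<^sup>+w. (\<Sum>k=1..K. indicator (G k) w * ennreal (test_fun m l (shift (real k / ?N) w))) \<partial>P)"
      proof (rule nn_integral_cong)
        fix w
        have "indicator (G k) w * ennreal (test_fun m l (shift (g n w) w)) =
          indicator (G k) w * ennreal (test_fun m l (shift (real k / ?N) w))" for k
        proof (cases "w \<in> G k")
          case True
          then have "\<lfloor>?N * \<tau> w\<rfloor> + 1 = int k" unfolding G_def by blast
          then have "real_of_int \<lfloor>?N * \<tau> w\<rfloor> + 1 = real k" by linarith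
          then show ?thesis by (simp add: g_def del: of_nat_Suc)
        qed simp
        then show "indicator A1 w * ennreal (test_fun m l (shift (g n w) w)) =
          (\<Sum>k=1..K. indicator (G k) w * ennreal (test_fun m l (shift (real k / ?N) w)))"
          by (simp only: ind[symmetric] sum_distrib_right)
      qed
      also have "\<dots> = (\<Sum>k=1..K. \<integral>\<^sup>+w. indicator (G k) w * ennreal (test_fun m l (shift (real k / ?N) w)) \<partial>P)"
        using GP tm by (intro nn_integral_sum borel_measurable_times borel_measurable_indicator) auto
      also have "\<dots> = (\<Sum>k=1..K. emeasure P (G k) * I)"
      proof (rule sum.cong[OF refl])
        fix k assume k: "k \<in> {1..K}"
        have "(\<integral>\<^sup>+w. indicator (G k) w * ennreal (test_fun m l (shift (real k / ?N) w)) \<partial>P) =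
          (\<integral>\<^sup>+w. indicator (G k) w * (\<Prod>(t, f)\<leftarrow>ramp_list m l. f (w (real k / ?N + t) - w (real k / ?N))) \<partial>P)"
        proof (intro nn_integral_cong arg_cong2[where f="(*)"] refl)
          fix w
          have "test_fun m l (shift (real k / ?N) w) = test_fun m l (\<lambda>t. w (real k / ?N + t) - w (real k / ?N))"
            using l0 by (intro test_fun_cong) auto
          then show "ennreal (test_fun m l (shift (real k / ?N) w)) =
            (\<Prod>(t, f)\<leftarrow>ramp_list m l. f (w (real k / ?N + t) - w (real k / ?N)))"
            by (simp only: prod_ramp_list[where w="\<lambda>t. w (real k / ?N + t) - w (real k / ?N)"])
        qed
        also have "\<dots> = emeasure P (G k) * I"
          unfolding I_def prod_ramp_list[symmetric]
          using k GF l measurable_ramp_list by (intro markov[OF W]) auto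
        finally show "(\<integral>\<^sup>+w. indicator (G k) w * ennreal (test_fun m l (shift (real k / ?N) w)) \<partial>P) = emeasure P (G k) * I" .
      qed
      also have "\<dots> = (\<Sum>k=1..K. emeasure P (G k)) * I" by (simp add: sum_distrib_right)
      also have "(\<Sum>k=1..K. emeasure P (G k)) = (\<integral>\<^sup>+w. (\<Sum>k=1..K. indicator (G k) w) \<partial>P)"
        using GP by (subst nn_integral_sum) auto
      also have "\<dots> = emeasure P A1" unfolding ind using A1 by simp
      finally show ?thesis .
    qed
    have "(\<lambda>n. \<integral>\<^sup>+w. indicator A1 w * ennreal (test_fun m l (shift (g n w) w)) \<partial>P) \<longlonglongrightarrow>
      (\<integral>\<^sup>+w. indicator A1 w * ennreal (test_fun m l (shift (\<tau> w) w)) \<partial>P)"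
    proof (rule nn_integral_dominated_convergence[where w="\<lambda>_. 1"])
      have tm: "(\<lambda>w. ennreal (test_fun m l (shift (h w) w))) \<in> borel_measurable P"
        if "h \<in> borel_measurable P" "\<And>w. w \<in> paths \<Longrightarrow> 0 \<le> h w" for h
      proof -
        have "(\<lambda>w. shift (h w) w) \<in> measurable P F_inf" using that b(3) by (intro measurable_shift) auto
        from measurable_test_fun_inf[OF this l0, of m] show ?thesis by measurable
      qed
      show "(\<lambda>w. indicator A1 w * ennreal (test_fun m l (shift (g n w) w))) \<in> borel_measurable P" for n
        using tm[OF gm g0] by measurable
      show "(\<lambda>w. indicator A1 w * ennreal (test_fun m l (shift (\<tau> w) w))) \<in> borel_measurable P"
        using tm[OF tmP t0] by measurable
      show "AE w in P. indicator A1 w * ennreal (test_fun m l (shift (g j w) w)) \<le> 1" for j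
        using test_fun_bounds by (intro AE_I2) (auto simp: indicator_def)
      show "AE w in P. (\<lambda>n. indicator A1 w * ennreal (test_fun m l (shift (g n w) w))) \<longlonglongrightarrow>
        indicator A1 w * ennreal (test_fun m l (shift (\<tau> w) w))"
      proof (rule AE_I2)
        fix w assume "w \<in> space P"
        then have p: "w \<in> paths" using b(3) by simp
        have "(\<lambda>n. test_fun m l (shift (g n w) w)) \<longlonglongrightarrow> test_fun m l (shift (\<tau> w) w)"
        proof (rule test_fun_tendsto)
          fix q assume "q \<in> set l"
          then have q: "0 \<le> fst q" using l0 by simp
          have "(\<lambda>n. w (g n w + fst q)) \<longlonglongrightarrow> w (\<tau> w + fst q)"
            by (rule paths_tendsto[OF p]) (use g0[OF p] q in \<open>auto intro!: tendsto_add g_lim\<close>)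
          moreover have "(\<lambda>n. w (g n w)) \<longlonglongrightarrow> w (\<tau> w)"
            by (rule paths_tendsto[OF p g0[OF p] g_lim])
          ultimately show "(\<lambda>n. shift (g n w) w (fst q)) \<longlonglongrightarrow> shift (\<tau> w) w (fst q)"
            using q by (simp add: tendsto_diff)
        qed
        then have "(\<lambda>n. ennreal (test_fun m l (shift (g n w) w))) \<longlonglongrightarrow> ennreal (test_fun m l (shift (\<tau> w) w))"
          by (rule tendsto_ennrealI)
        then show "(\<lambda>n. indicator A1 w * ennreal (test_fun m l (shift (g n w) w))) \<longlonglongrightarrow>
          indicator A1 w * ennreal (test_fun m l (shift (\<tau> w) w))"
          by (cases "w \<in> A1") auto
      qed
    qed (auto simp: emeasure_space_1)
    from this[unfolded step] have lim: "(\<integral>\<^sup>+w. indicator A1 w * ennreal (test_fun m l (shift (\<tau> w) w)) \<partial>P) = emeasure P A1 * I"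
      by (rule LIMSEQ_unique[OF _ tendsto_const])
    have tmF': "(\<lambda>w. ennreal (test_fun m l w)) \<in> borel_measurable F_inf"
      using measurable_test_fun_inf[OF measurable_ident_sets[OF refl] l0, of m] by measurable
    have "(\<integral>\<^sup>+w. ennreal (test_fun m l w) \<partial>distr L F_inf (\<lambda>w. shift (\<tau> w) w)) =
      (\<integral>\<^sup>+w. ennreal (test_fun m l (shift (\<tau> w) w)) \<partial>L)"
      using tmF' by (intro nn_integral_distr[OF shL]) simp
    also have "\<dots> = (\<integral>\<^sup>+w. indicator A1 w * ennreal (test_fun m l (shift (\<tau> w) w)) \<partial>P)"
      unfolding L_def using measurable_compose[OF sh tmF'] by (intro nn_integral_density) auto
    also have "\<dots> = (\<integral>\<^sup>+w. ennreal (test_fun m l w) \<partial>scale_measure (emeasure P A1) P)"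
      unfolding lim I_def using tmF' measurable_wiener[OF W] by (subst nn_integral_scale_measure) auto
    finally show "(\<integral>\<^sup>+w. ennreal (test_fun m l w) \<partial>distr L F_inf (\<lambda>w. shift (\<tau> w) w)) =
      (\<integral>\<^sup>+w. ennreal (test_fun m l w) \<partial>scale_measure (emeasure P A1) P)" .
  qed simp
  have BF: "B \<in> sets F_inf" using B b(2) by simp
  have shB: "(\<lambda>w. shift (\<tau> w) w) -` B \<inter> space P \<in> sets P" using sh BF by (rule measurable_sets)
  have "emeasure (distr P F_inf (\<lambda>w. stop (\<tau> w) w)) A * emeasure P B = emeasure (scale_measure (emeasure P A1) P) B"
    using A B st(1) by (simp add: emeasure_distr A1e)
  also have "\<dots> = emeasure L ((\<lambda>w. shift (\<tau> w) w) -` B \<inter> space L)"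
    unfolding main[symmetric] using BF by (rule emeasure_distr[OF shL])
  also have "\<dots> = emeasure P (A1 \<inter> ((\<lambda>w. shift (\<tau> w) w) -` B \<inter> space P))"
    using shB by (simp add: L_def emeasure_density flip: indicator_inter_arith)
  also have "A1 \<inter> ((\<lambda>w. shift (\<tau> w) w) -` B \<inter> space P) = (\<lambda>w. (stop (\<tau> w) w, shift (\<tau> w) w)) -` (A \<times> B) \<inter> space P"
    by (auto simp: A1e)
  also have "emeasure P \<dots> = emeasure (distr P (F_inf \<Otimes>\<^sub>M F_inf) (\<lambda>w. (stop (\<tau> w) w, shift (\<tau> w) w))) (A \<times> B)"
    using A BF by (intro emeasure_distr[symmetric] J) auto
  finally show "emeasure (distr P F_inf (\<lambda>w. stop (\<tau> w) w)) A * emeasure P B =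
    emeasure (distr P (F_inf \<Otimes>\<^sub>M F_inf) (\<lambda>w. (stop (\<tau> w) w, shift (\<tau> w) w))) (A \<times> B)" .
qed

section \<open>Gaussian integrals\<close>

lemma integral_gauss:
  fixes f :: "real \<Rightarrow> 'a :: {banach, second_countable_topology}"
  assumes "f \<in> borel_measurable borel"
  shows "integral\<^sup>L gauss f = (LINT z|lborel. std_normal_density z *\<^sub>R f z)"
    and "integrable gauss f \<longleftrightarrow> integrable lborel (\<lambda>z. std_normal_density z *\<^sub>R f z)"
  unfolding gauss_def using assms by (auto intro!: integral_density simp: integrable_density)

text \<open>Completing the square absorbs the real part of a into a translation of the density; the
  imaginary part leaves the characteristic function of the normal law.\<close>

lemma gauss_complex_exp:
  fixes a :: complex
  shows "integrable gauss (\<lambda>z. exp (complex_of_real z * a))" (is ?I)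
    and "(LINT z|gauss. exp (complex_of_real z * a)) = exp (a\<^sup>2 / 2)" (is ?E)
proof -
  define c b where "c = Re a" and "b = Im a"
  have a: "a = complex_of_real c + \<i> * complex_of_real b" by (simp add: c_def b_def complex_eq)
  have m [measurable]: "(\<lambda>z. exp (complex_of_real z * a)) \<in> borel_measurable borel"
    by (intro borel_measurable_continuous_onI continuous_intros)
  have std: "std_normal_density z * exp (c * z) = exp (c\<^sup>2 / 2) * std_normal_density (z - c)" for z
    unfolding normal_density_def by (simp add: exp_add[symmetric] power2_eq_square field_simps)
  have eq: "std_normal_density z *\<^sub>R exp (complex_of_real z * a) =
    complex_of_real (exp (c\<^sup>2 / 2)) * (std_normal_density (z - c) *\<^sub>R iexp (b * z))" for z
  proof -
    have "exp (complex_of_real z * a) = complex_of_real (exp (c * z)) * iexp (b * z)"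
      unfolding a by (simp add: exp_of_real[symmetric] exp_add[symmetric] algebra_simps)
    then have "std_normal_density z *\<^sub>R exp (complex_of_real z * a) =
      complex_of_real (std_normal_density z * exp (c * z)) * iexp (b * z)" by (simp add: scaleR_conv_of_real)
    then show ?thesis unfolding std by (simp add: scaleR_conv_of_real)
  qed
  have iexp_meas [measurable]: "(\<lambda>z. iexp (b * z)) \<in> borel_measurable borel"
    by (intro borel_measurable_continuous_onI continuous_intros)
  have i0: "integrable lborel (\<lambda>z. std_normal_density z *\<^sub>R iexp (b * z))"
  proof (rule Bochner_Integration.integrable_bound[of lborel std_normal_density])
    show "integrable lborel std_normal_density" by (rule integrable_normal_density) simp
  qed (auto simp: norm_exp_i_times normal_density_nonneg)
  have iadd: "iexp (b * (z + c)) = iexp (b * c) * iexp (b * z)" for z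
    by (simp add: exp_add[symmetric] algebra_simps)
  have i0': "integrable lborel (\<lambda>z. std_normal_density z *\<^sub>R iexp (b * (z + c)))"
  proof -
    have "integrable lborel (\<lambda>z. iexp (b * c) * (std_normal_density z *\<^sub>R iexp (b * z)))"
      by (intro integrable_mult_right i0)
    then show ?thesis unfolding iadd by (simp only: mult_scaleR_right)
  qed
  have i1: "integrable lborel (\<lambda>z. std_normal_density (z - c) *\<^sub>R iexp (b * z))"
    using i0' lborel_integrable_real_affine_iff[of 1 "\<lambda>z. std_normal_density (z - c) *\<^sub>R iexp (b * z)" c]
    by (simp add: add.commute)
  show ?I unfolding integral_gauss(2)[OF m] eq by (intro integrable_mult_right i1)
  have "(LINT z|lborel. std_normal_density (z - c) *\<^sub>R iexp (b * z)) =
    (LINT z|lborel. std_normal_density z *\<^sub>R iexp (b * (z + c)))"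
    using lborel_integral_real_affine[of 1 "\<lambda>z. std_normal_density (z - c) *\<^sub>R iexp (b * z)" c]
    by (simp add: add.commute)
  also have "\<dots> = (LINT z|lborel. iexp (b * c) * (std_normal_density z *\<^sub>R iexp (b * z)))"
    unfolding iadd by (simp only: mult_scaleR_right)
  also have "\<dots> = iexp (b * c) * (LINT z|gauss. iexp (b * z))"
    by (simp only: integral_mult_right_zero integral_gauss(1)[OF iexp_meas])
  also have "(LINT z|gauss. iexp (b * z)) = char std_normal_distribution b"
    by (simp add: char_def gauss_def)
  also have "\<dots> = exp (- (complex_of_real b)\<^sup>2 / 2)"
    by (simp add: char_std_normal_distribution exp_of_real[symmetric])
  finally have "(LINT z|gauss. exp (complex_of_real z * a)) =
    complex_of_real (exp (c\<^sup>2 / 2)) * (iexp (b * c) * exp (- (complex_of_real b)\<^sup>2 / 2))"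
    unfolding integral_gauss(1)[OF m] eq by (simp only: integral_mult_right_zero)
  also have "\<dots> = exp (complex_of_real (c\<^sup>2 / 2) + (\<i> * complex_of_real (b * c) + - (complex_of_real b)\<^sup>2 / 2))"
    by (simp only: exp_of_real exp_add)
  also have "complex_of_real (c\<^sup>2 / 2) + (\<i> * complex_of_real (b * c) + - (complex_of_real b)\<^sup>2 / 2) = a\<^sup>2 / 2"
    unfolding a by (simp add: power2_eq_square field_simps)
  finally show ?E .
qed

lemma gauss_exp:
  shows "integrable gauss (\<lambda>z. exp (c * z))"
    and "(LINT z|gauss. exp (c * z)) = exp (c\<^sup>2 / 2)"
    and "(\<integral>\<^sup>+z. ennreal (exp (c * z)) \<partial>gauss) = ennreal (exp (c\<^sup>2 / 2))"
proof -
  have e: "exp (c * z) = Re (exp (complex_of_real z * complex_of_real c))" for z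
    by (metis Re_complex_of_real exp_of_real mult.commute of_real_mult)
  show i: "integrable gauss (\<lambda>z. exp (c * z))"
    unfolding e by (intro integrable_Re gauss_complex_exp)
  have "(LINT z|gauss. exp (c * z)) = Re (exp ((complex_of_real c)\<^sup>2 / 2))"
    unfolding e by (subst integral_Re) (simp_all only: gauss_complex_exp)
  also have "(complex_of_real c)\<^sup>2 / 2 = complex_of_real (c\<^sup>2 / 2)" by simp
  finally show I: "(LINT z|gauss. exp (c * z)) = exp (c\<^sup>2 / 2)" by (simp only: exp_of_real Re_complex_of_real)
  show "(\<integral>\<^sup>+z. ennreal (exp (c * z)) \<partial>gauss) = ennreal (exp (c\<^sup>2 / 2))"
    using nn_integral_eq_integral[OF i] I by simp
qed

text \<open>By symmetry the two closed half-lines have equal mass, and together they cover the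
  line.\<close>

lemma gauss_half: "1 / 2 \<le> emeasure gauss {0..}"
proof -
  have "emeasure gauss {..0} = (\<integral>\<^sup>+z. ennreal (std_normal_density z) * indicator {..0} z \<partial>lborel)"
    by (simp add: gauss_def emeasure_density)
  also have "\<dots> = (\<integral>\<^sup>+z. ennreal (std_normal_density (- z)) * indicator {..0} (- z) \<partial>lborel)"
    by (subst nn_integral_real_affine[where c="-1" and t=0]) auto
  also have "\<dots> = (\<integral>\<^sup>+z. ennreal (std_normal_density z) * indicator {0..} z \<partial>lborel)"
    by (intro nn_integral_cong) (auto simp: normal_density_def indicator_def)
  also have "\<dots> = emeasure gauss {0..}" by (simp add: gauss_def emeasure_density)
  finally have eq: "emeasure gauss {..0} = emeasure gauss {0..}" .
  have "1 = emeasure gauss (space gauss)" by (simp only: gauss.emeasure_space_1)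
  also have "\<dots> \<le> emeasure gauss ({..0} \<union> {0..})" by (intro emeasure_mono) auto
  also have "\<dots> \<le> emeasure gauss {..0} + emeasure gauss {0..}" by (intro emeasure_subadditive) auto
  finally have "1 \<le> ennreal (measure gauss {0..}) + ennreal (measure gauss {0..})"
    unfolding eq by (simp only: gauss.emeasure_eq_measure)
  then have "ennreal 1 \<le> ennreal (measure gauss {0..} + measure gauss {0..})"
    by (subst ennreal_plus) simp_all
  then have "1 \<le> measure gauss {0..} + measure gauss {0..}"
    by (subst (asm) ennreal_le_iff) simp_all
  then have "1 / 2 \<le> measure gauss {0..}" by simp
  then have "ennreal (1 / 2) \<le> emeasure gauss {0..}" unfolding gauss.emeasure_eq_measure by (rule ennreal_leI)
  moreover have "ennreal (1 / 2) = 1 / 2" by (subst divide_ennreal[symmetric]) simp_all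
  ultimately show ?thesis by (simp only:)
qed

lemma gauss_no_atoms: "v \<noteq> 0 \<Longrightarrow> emeasure gauss {z. v * z = c} = 0"
proof -
  assume "v \<noteq> 0"
  then have "{z. v * z = c} = {c / v}" by (auto simp: field_simps)
  moreover have "emeasure gauss {c / v} = 0"
  proof -
    have "emeasure gauss {c / v} = (\<integral>\<^sup>+z. ennreal (std_normal_density z) * indicator {c / v} z \<partial>lborel)"
      unfolding gauss_def by (rule emeasure_density) auto
    also have "\<dots> = (\<integral>\<^sup>+z. 0 \<partial>(lborel :: real measure))"
    proof (rule nn_integral_cong_AE)
      show "AE z in lborel. ennreal (std_normal_density z) * indicator {c / v} z = 0"
        using AE_lborel_singleton[of "c / v"] by eventually_elim simp
    qed
    finally show ?thesis by simp
  qed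
  ultimately show ?thesis by simp
qed

text \<open>Two numbers with the same upper bounds are equal, and a bound on {0..t} is a bound on
  {0..s} together with one on {s..t}.\<close>

lemma sup_shift:
  assumes w: "w \<in> paths" and s: "0 \<le> s" "s \<le> t"
  shows "running_sup t w = max (running_sup s w) (w s + running_sup (t - s) (shift s w))"
proof -
  have sh: "shift s w \<in> paths" using w s by auto
  have "running_sup t w \<le> c \<longleftrightarrow> max (running_sup s w) (w s + running_sup (t - s) (shift s w)) \<le> c" for c
  proof -
    have "w s + running_sup (t - s) (shift s w) \<le> c \<longleftrightarrow> (\<forall>u\<in>{0..t - s}. w (s + u) \<le> c)"
      using running_sup_le_iff[OF sh, of "t - s" "c - w s"] s by (auto simp: algebra_simps)
    also have "\<dots> \<longleftrightarrow> (\<forall>u\<in>{s..t}. w u \<le> c)"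
    proof safe
      fix u assume "\<forall>u\<in>{0..t - s}. w (s + u) \<le> c" "u \<in> {s..t}"
      then show "w u \<le> c" by (auto dest!: bspec[where x="u - s"])
    qed auto
    finally have 1: "w s + running_sup (t - s) (shift s w) \<le> c \<longleftrightarrow> (\<forall>u\<in>{s..t}. w u \<le> c)" .
    have "{0..t} = {0..s} \<union> {s..t}" using s by auto
    then show ?thesis using 1 running_sup_le_iff[OF w, of s c] running_sup_le_iff[OF w, of t c] s by auto
  qed
  then show ?thesis by (metis order_antisym order_refl)
qed

section \<open>Wiener measure\<close>

locale wiener =
  fixes P :: "(real \<Rightarrow> real) measure"
  assumes wiener: "wiener_measure P"
begin

lemma BM: "is_BM P (\<lambda>t w. w t)"
  by (rule wiener_is_BM[OF wiener])

sublocale prob_space P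
  by (rule is_BM_basic[OF BM])

lemma P_paths [simp]: "emeasure P paths = 1"
  using emeasure_space_1 is_BM_basic(3)[OF BM] by simp

lemmas sets_P [measurable_cong] = is_BM_basic(2)[OF BM]
  and space_P [simp] = is_BM_basic(3)[OF BM]
  and start_0 = is_BM_basic(5)[OF BM]

lemma AE_paths: "AE w in P. w \<in> paths"
  using AE_space[of P] unfolding space_P .

lemma measurable_P: "measurable P N = measurable F_inf N"
  by (rule measurable_wiener[OF wiener])

lemma ident_P: "(\<lambda>w. w) \<in> measurable P F_inf"
  unfolding measurable_P by simp

lemma coord_P: "0 \<le> t \<Longrightarrow> (\<lambda>w. w t) \<in> borel_measurable P"
  unfolding measurable_P by (rule measurable_F_inf_eval)

lemma sup_P: "0 \<le> t \<Longrightarrow> (\<lambda>w. running_sup t w) \<in> borel_measurable P"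
  using ident_P by (intro measurable_running_sup_inf) auto

section \<open>Increments and the strong Markov property as integral identities\<close>

lemma increment_prob:
  assumes "0 \<le> s" "s \<le> t" "G \<in> sets (F_upto s)" "A \<in> sets borel"
  shows "emeasure P (G \<inter> {w \<in> paths. w t - w s \<in> A}) = emeasure P G * emeasure gauss {z. sqrt (t - s) * z \<in> A}"
  using BM assms unfolding is_BM_def by blast

lemma integral_increment:
  fixes f :: "_ \<Rightarrow> 'b :: {banach, second_countable_topology}"
  assumes st: "0 \<le> s" "s \<le> t" and f: "f \<in> borel_measurable (F_upto s \<Otimes>\<^sub>M borel)"
    and i: "integrable P (\<lambda>w. f (w, w t - w s))"
  shows "(LINT w|P. f (w, w t - w s)) = (LINT w|P. LINT z|gauss. f (w, sqrt (t - s) * z))"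
proof -
  have id: "(\<lambda>w. w) \<in> measurable P (F_upto s)" by (rule F_upto_F_inf[OF measurable_ident_sets[OF refl] sets_P])
  have D: "(\<lambda>w. w t - w s) \<in> borel_measurable P"
    using st by (intro borel_measurable_diff coord_P) auto
  let ?J = "\<lambda>w. (w, w t - w s)" and ?g = "distr gauss borel (\<lambda>z. sqrt (t - s) * z)"
  have J: "?J \<in> measurable P (F_upto s \<Otimes>\<^sub>M borel)" by (intro measurable_Pair id D)
  interpret D1: prob_space "distr P (F_upto s) (\<lambda>w. w)" by (rule prob_space_distr[OF id])
  interpret D2: prob_space ?g by (rule gauss.prob_space_distr) auto
  interpret pair_prob_space "distr P (F_upto s) (\<lambda>w. w)" ?g ..
  note eq = pair_distr_id_gauss_eq[OF BM st]
  have i': "integrable (distr P (F_upto s) (\<lambda>w. w) \<Otimes>\<^sub>M ?g) f"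
    unfolding eq[symmetric] using i by (subst integrable_distr_eq[OF J f])
  have "(LINT w|P. f (w, w t - w s)) = integral\<^sup>L (distr P (F_upto s \<Otimes>\<^sub>M borel) ?J) f"
    using f by (rule integral_distr[OF J, symmetric])
  also have "\<dots> = (LINT w|distr P (F_upto s) (\<lambda>w. w). LINT z|?g. f (w, z))"
    unfolding eq by (rule integral_fst'[OF i', symmetric])
  also have "\<dots> = (LINT w|distr P (F_upto s) (\<lambda>w. w). LINT z|gauss. f (w, sqrt (t - s) * z))"
  proof (rule Bochner_Integration.integral_cong[OF refl])
    fix w assume "w \<in> space (distr P (F_upto s) (\<lambda>w. w))"
    then have "w \<in> space (F_upto s)" by simp
    then have "(\<lambda>z. f (w, z)) \<in> borel_measurable borel" using f by (rule measurable_Pair2[rotated])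
    then show "(LINT z|?g. f (w, z)) = (LINT z|gauss. f (w, sqrt (t - s) * z))"
      by (subst integral_distr) auto
  qed
  also have "\<dots> = (LINT w|P. LINT z|gauss. f (w, sqrt (t - s) * z))"
  proof (rule integral_distr[OF id])
    have "(\<lambda>p. f (fst p, sqrt (t - s) * snd p)) \<in> borel_measurable (F_upto s \<Otimes>\<^sub>M gauss)"
      by (rule measurable_compose[OF _ f]) measurable
    then show "(\<lambda>w. LINT z|gauss. f (w, sqrt (t - s) * z)) \<in> borel_measurable (F_upto s)"
      by (intro gauss.borel_measurable_lebesgue_integral) (simp add: split_beta')
  qed
  finally show ?thesis .
qed

lemma nn_integral_markov:
  assumes tau: "path_stopping T \<tau>" and f: "f \<in> borel_measurable (F_inf \<Otimes>\<^sub>M F_inf)"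
  shows "(\<integral>\<^sup>+w. f (stop (\<tau> w) w, shift (\<tau> w) w) \<partial>P) = (\<integral>\<^sup>+w. \<integral>\<^sup>+v. f (stop (\<tau> w) w, v) \<partial>P \<partial>P)"
proof -
  have t: "\<tau> \<in> borel_measurable P" "\<And>w. w \<in> paths \<Longrightarrow> 0 \<le> \<tau> w"
    using tau by (auto simp: path_stopping_def measurable_P)
  have st: "(\<lambda>w. stop (\<tau> w) w) \<in> measurable P F_inf" using t ident_P by (intro measurable_stop_inf) auto
  have sh: "(\<lambda>w. shift (\<tau> w) w) \<in> measurable P F_inf" using t ident_P by (intro measurable_shift) auto
  have f': "f \<in> borel_measurable (distr P F_inf (\<lambda>w. stop (\<tau> w) w) \<Otimes>\<^sub>M P)"
    using f sets_P by (simp cong: measurable_cong_sets sets_pair_measure_cong)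
  have f2: "(\<lambda>(x, y). f (x, y)) \<in> borel_measurable (F_inf \<Otimes>\<^sub>M P)"
    using f sets_P by (simp cong: measurable_cong_sets sets_pair_measure_cong)
  have "(\<integral>\<^sup>+w. f (stop (\<tau> w) w, shift (\<tau> w) w) \<partial>P) =
    integral\<^sup>N (distr P (F_inf \<Otimes>\<^sub>M F_inf) (\<lambda>w. (stop (\<tau> w) w, shift (\<tau> w) w))) f"
    using f by (subst nn_integral_distr) (auto intro!: measurable_Pair st sh)
  also have "\<dots> = (\<integral>\<^sup>+a. \<integral>\<^sup>+v. f (a, v) \<partial>P \<partial>distr P F_inf (\<lambda>w. stop (\<tau> w) w))"
    unfolding strong_markov[OF wiener tau] by (rule nn_integral_fst[OF f', symmetric])
  also have "\<dots> = (\<integral>\<^sup>+w. \<integral>\<^sup>+v. f (stop (\<tau> w) w, v) \<partial>P \<partial>P)"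
    using borel_measurable_nn_integral[OF f2] by (intro nn_integral_distr[OF st]) simp
  finally show ?thesis .
qed

lemma integral_markov:
  fixes f :: "_ \<Rightarrow> 'b :: {banach, second_countable_topology}"
  assumes tau: "path_stopping T \<tau>" and f: "f \<in> borel_measurable (F_inf \<Otimes>\<^sub>M F_inf)"
    and i: "integrable P (\<lambda>w. f (stop (\<tau> w) w, shift (\<tau> w) w))"
  shows "(LINT w|P. f (stop (\<tau> w) w, shift (\<tau> w) w)) = (LINT w|P. LINT v|P. f (stop (\<tau> w) w, v))"
proof -
  have t: "\<tau> \<in> borel_measurable P" "\<And>w. w \<in> paths \<Longrightarrow> 0 \<le> \<tau> w"
    using tau by (auto simp: path_stopping_def measurable_P)
  have st: "(\<lambda>w. stop (\<tau> w) w) \<in> measurable P F_inf" using t ident_P by (intro measurable_stop_inf) auto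
  have sh: "(\<lambda>w. shift (\<tau> w) w) \<in> measurable P F_inf" using t ident_P by (intro measurable_shift) auto
  have J: "(\<lambda>w. (stop (\<tau> w) w, shift (\<tau> w) w)) \<in> measurable P (F_inf \<Otimes>\<^sub>M F_inf)" by (intro measurable_Pair st sh)
  have f2: "(\<lambda>(x, y). f (x, y)) \<in> borel_measurable (F_inf \<Otimes>\<^sub>M P)"
    using f sets_P by (simp cong: measurable_cong_sets sets_pair_measure_cong)
  have f3: "(\<lambda>x. LINT v|P. f (x, v)) \<in> borel_measurable F_inf"
    by (rule borel_measurable_lebesgue_integral[OF f2])
  interpret D1: prob_space "distr P F_inf (\<lambda>w. stop (\<tau> w) w)" by (rule prob_space_distr[OF st])
  interpret pair_prob_space "distr P F_inf (\<lambda>w. stop (\<tau> w) w)" P ..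
  have i': "integrable (distr P F_inf (\<lambda>w. stop (\<tau> w) w) \<Otimes>\<^sub>M P) f"
    unfolding strong_markov[OF wiener tau, symmetric] using i by (subst integrable_distr_eq[OF J f])
  have "(LINT w|P. f (stop (\<tau> w) w, shift (\<tau> w) w)) =
    integral\<^sup>L (distr P (F_inf \<Otimes>\<^sub>M F_inf) (\<lambda>w. (stop (\<tau> w) w, shift (\<tau> w) w))) f"
    using f by (rule integral_distr[OF J, symmetric])
  also have "\<dots> = (LINT a|distr P F_inf (\<lambda>w. stop (\<tau> w) w). LINT v|P. f (a, v))"
    unfolding strong_markov[OF wiener tau] by (rule integral_fst'[OF i', symmetric])
  also have "\<dots> = (LINT w|P. LINT v|P. f (stop (\<tau> w) w, v))"
    by (rule integral_distr[OF st f3])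
  finally show ?thesis .
qed

section \<open>Exponential moments and the distribution of the supremum\<close>

lemma nn_integral_exp:
  assumes "0 \<le> t"
  shows "(\<integral>\<^sup>+w. ennreal (exp (c * w t)) \<partial>P) = ennreal (exp (c\<^sup>2 * t / 2))"
proof -
  have "(\<integral>\<^sup>+w. ennreal (exp (c * w t)) \<partial>P) = (\<integral>\<^sup>+w. (\<lambda>(w, d). ennreal (exp (c * d))) (w, w t - w 0) \<partial>P)"
    using start_0 by (intro nn_integral_cong_AE) auto
  also have "\<dots> = (\<integral>\<^sup>+w. \<integral>\<^sup>+z. ennreal (exp ((c * sqrt t) * z)) \<partial>gauss \<partial>P)"
    using assms by (subst is_BM_increment[OF BM]) (auto simp: mult.assoc)
  also have "\<dots> = ennreal (exp (c\<^sup>2 * t / 2))"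
    unfolding gauss_exp using assms by (simp add: emeasure_space_1 power_mult_distrib)
  finally show ?thesis .
qed

lemma integrable_exp: "0 \<le> t \<Longrightarrow> integrable P (\<lambda>w. exp (c * w t))"
  using nn_integral_exp[of t c] coord_P[of t] by (intro integrableI_nn_integral_finite[where x="exp (c\<^sup>2 * t / 2)"]) auto

text \<open>An inequality rather than an equality because at r = 0 the probability is 1.\<close>

lemma coord_half: "0 \<le> r \<Longrightarrow> 1 / 2 \<le> emeasure P {w \<in> paths. 0 \<le> w r}"
proof -
  assume r: "0 \<le> r"
  have "emeasure P {w \<in> paths. 0 \<le> w r} = emeasure P (paths \<inter> {w \<in> paths. w r - w 0 \<in> {0..}})"
    using start_0 coord_P[OF r] coord_P[of 0]
    by (intro emeasure_eq_AE) (auto elim!: eventually_mono simp del: space_P simp: space_P[symmetric])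
  also have "\<dots> = emeasure P paths * emeasure gauss {z. sqrt (r - 0) * z \<in> {0..}}"
    using r sets.top[of "F_upto 0"] by (intro increment_prob) auto
  also have "emeasure P paths = 1" using emeasure_space_1 by simp
  also have "1 * emeasure gauss {z. sqrt (r - 0) * z \<in> {0..}} \<ge> emeasure gauss {0..}"
    using r by (simp, intro emeasure_mono) auto
  finally show ?thesis using gauss_half by (rule order_trans[rotated])
qed

text \<open>One half of the reflection principle: once the path has reached a, it is at or above a
  at time t with probability at least 1/2, by the strong Markov property.\<close>

lemma maximal_inequality:
  assumes t: "0 \<le> t"
  shows "emeasure P {w \<in> paths. a \<le> running_sup t w} \<le> 2 * emeasure P {w \<in> paths. a \<le> w t}"
proof -
  have ps: "path_stopping t (tau t a)" by (rule path_stopping_tau[OF t])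
  note tb = tau_bounds[OF t]
  \<comment> \<open>The first argument is the path stopped at the passage. Its value at t is the
    value at the passage, and this is at least a exactly when the level has been reached.\<close>
  define f :: "(real \<Rightarrow> real) \<times> (real \<Rightarrow> real) \<Rightarrow> ennreal"
    where "f p = (if a \<le> fst p t \<and> 0 \<le> snd p (t - tau t a (fst p)) then 1 else 0)" for p
  have taum: "(\<lambda>p. tau t a (fst p)) \<in> borel_measurable (F_inf \<Otimes>\<^sub>M F_inf)"
    using t by (intro measurable_tau) auto
  have m1: "(\<lambda>p. fst p t) \<in> borel_measurable (F_inf \<Otimes>\<^sub>M F_inf)"
    by (rule measurable_compose[OF measurable_fst measurable_F_inf_eval[OF t]])
  have m2: "(\<lambda>p. snd p (t - tau t a (fst p))) \<in> borel_measurable (F_inf \<Otimes>\<^sub>M F_inf)"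
    by (rule measurable_eval_inf[where f=snd]) (use taum tb in auto)
  have f: "f \<in> borel_measurable (F_inf \<Otimes>\<^sub>M F_inf)"
    unfolding f_def using m1 m2 by measurable
  have st: "tau t a (stop (tau t a w) w) = tau t a w" if "w \<in> paths" for w
    using ps tb that by (simp add: path_stopping_def)
  have ge: "a \<le> stop (tau t a w) w t \<longleftrightarrow> a \<le> running_sup t w" if w: "w \<in> paths" for w
  proof
    assume "a \<le> stop (tau t a w) w t"
    then have "a \<le> w (tau t a w)" using t tb by (simp add: min_absorb2)
    then show "a \<le> running_sup t w" using running_sup_ge[OF w tb] by (rule order_trans)
  next
    assume "a \<le> running_sup t w"
    then obtain u where "u \<in> {0..t}" "a \<le> w u" using running_sup_ge_iff[OF w t] by auto
    then show "a \<le> stop (tau t a w) w t" using t tb tau_attained[OF w, of u t a] by (simp add: min_absorb2)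
  qed
  let ?S = "{w \<in> paths. a \<le> running_sup t w}"
  have S: "?S \<in> sets P" using sup_P[OF t] by (simp del: space_P add: space_P[symmetric])
  have "emeasure P ?S = 2 * (1 / 2 * emeasure P ?S)"
    unfolding mult.assoc[symmetric] ennreal_times_divide by simp
  also have "1 / 2 * emeasure P ?S = (\<integral>\<^sup>+w. 1 / 2 * indicator ?S w \<partial>P)"
    using S by (simp add: nn_integral_cmult)
  also have "\<dots> \<le> (\<integral>\<^sup>+w. \<integral>\<^sup>+v. f (stop (tau t a w) w, v) \<partial>P \<partial>P)"
  proof (rule nn_integral_mono)
    fix w assume "w \<in> space P"
    then have w: "w \<in> paths" by simp
    let ?r = "t - tau t a w"
    have r: "0 \<le> ?r" using tb by simp
    have "(\<integral>\<^sup>+v. f (stop (tau t a w) w, v) \<partial>P) = (\<integral>\<^sup>+v. indicator ?S w * indicator {v \<in> paths. 0 \<le> v ?r} v \<partial>P)"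
      unfolding f_def fst_conv snd_conv ge[OF w] st[OF w] using w
      by (intro nn_integral_cong) (simp add: indicator_def)
    also have "\<dots> = indicator ?S w * emeasure P {v \<in> paths. 0 \<le> v ?r}"
      using coord_P[OF r] by (simp add: nn_integral_cmult del: space_P add: space_P[symmetric])
    also have "\<dots> \<ge> indicator ?S w * (1 / 2)" by (intro mult_left_mono coord_half r) simp
    finally show "1 / 2 * indicator ?S w \<le> (\<integral>\<^sup>+v. f (stop (tau t a w) w, v) \<partial>P)" by (simp add: mult.commute)
  qed
  also have "\<dots> = (\<integral>\<^sup>+w. f (stop (tau t a w) w, shift (tau t a w) w) \<partial>P)"
    by (rule nn_integral_markov[OF ps f, symmetric])
  also have "\<dots> \<le> (\<integral>\<^sup>+w. indicator {w \<in> paths. a \<le> w t} w \<partial>P)"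
  proof (rule nn_integral_mono)
    fix w assume "w \<in> space P"
    then have w: "w \<in> paths" by simp
    show "f (stop (tau t a w) w, shift (tau t a w) w) \<le> indicator {w \<in> paths. a \<le> w t} w"
      unfolding f_def fst_conv snd_conv st[OF w] using w t tb[of a w] by (simp add: indicator_def min_absorb2)
  qed
  also have "\<dots> = emeasure P {w \<in> paths. a \<le> w t}"
    using coord_P[OF t] by (simp del: space_P add: space_P[symmetric])
  finally show ?thesis by (simp add: mult_left_mono)
qed

text \<open>The Chernoff bound at time t, transferred to the supremum by the maximal
  inequality.\<close>

lemma sup_tail:
  assumes t: "0 \<le> t" and c: "0 \<le> c"
  shows "emeasure P {w \<in> paths. a \<le> running_sup t w} \<le> ennreal (2 * exp (c\<^sup>2 * t / 2 - c * a))"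
proof -
  have "emeasure P {w \<in> paths. a \<le> w t} = (\<integral>\<^sup>+w. indicator {w \<in> paths. a \<le> w t} w \<partial>P)"
    using coord_P[OF t] by (simp del: space_P add: space_P[symmetric])
  also have "\<dots> \<le> (\<integral>\<^sup>+w. ennreal (exp (- c * a)) * ennreal (exp (c * w t)) \<partial>P)"
    using c by (intro nn_integral_mono)
      (auto simp: indicator_def ennreal_mult[symmetric] exp_add[symmetric] mult_left_mono ennreal_1[symmetric] simp del: ennreal_1)
  also have "\<dots> = ennreal (exp (- c * a)) * ennreal (exp (c\<^sup>2 * t / 2))"
    using coord_P[OF t] by (simp add: nn_integral_cmult nn_integral_exp[OF t])
  also have "\<dots> = ennreal (exp (c\<^sup>2 * t / 2 - c * a))"
    by (simp add: ennreal_mult[symmetric] exp_add[symmetric] algebra_simps)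
  finally have "2 * emeasure P {w \<in> paths. a \<le> w t} \<le> 2 * ennreal (exp (c\<^sup>2 * t / 2 - c * a))"
    by (rule mult_left_mono) simp
  also have "\<dots> = ennreal (2 * exp (c\<^sup>2 * t / 2 - c * a))" by (simp add: ennreal_mult)
  finally show ?thesis using maximal_inequality[OF t] by (rule order_trans[rotated])
qed

lemma integrable_exp_sup:
  assumes t: "0 \<le> t" and c: "0 < c"
  shows "integrable P (\<lambda>w. exp (c * running_sup t w))"
proof (rule integrableI_bounded)
  show "(\<lambda>w. exp (c * running_sup t w)) \<in> borel_measurable P" using sup_P[OF t] by measurable
  let ?S = "\<lambda>k. {w \<in> paths. real k \<le> running_sup t w}"
  have S: "?S k \<in> sets P" for k using sup_P[OF t] by (simp del: space_P add: space_P[symmetric])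
  \<comment> \<open>Cut at the integer levels k. The tail bound with parameter 2 c beats the growth
    exp (c (k + 1)) and leaves a geometric series of ratio exp (- c).\<close>
  define C where "C = 2 * exp ((2 * c)\<^sup>2 * t / 2) * exp c"
  have "(\<integral>\<^sup>+w. ennreal (norm (exp (c * running_sup t w))) \<partial>P) \<le>
    (\<integral>\<^sup>+w. 1 + (\<Sum>k. ennreal (exp (c * (real k + 1))) * indicator (?S k) w) \<partial>P)"
  proof (rule nn_integral_mono)
    fix w assume "w \<in> space P"
    then have w: "w \<in> paths" by simp
    show "ennreal (norm (exp (c * running_sup t w))) \<le>
      1 + (\<Sum>k. ennreal (exp (c * (real k + 1))) * indicator (?S k) w)" (is "?l \<le> 1 + suminf ?g")
    proof (cases "0 \<le> running_sup t w")
      case True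
      define k where "k = nat \<lfloor>running_sup t w\<rfloor>"
      have k: "real k \<le> running_sup t w" "running_sup t w \<le> real k + 1" using True by (auto simp: k_def)
      have "?l \<le> ?g k" using k w c by (auto intro!: ennreal_leI)
      also have "\<dots> = sum ?g {k}" by (subst sum.insert) auto
      also have "\<dots> \<le> suminf ?g" by (rule sum_le_suminf[OF summableI]) auto
      also have "\<dots> \<le> 1 + suminf ?g" by simp
      finally show ?thesis .
    next
      case False
      then have "c * running_sup t w \<le> 0" using c by (simp add: mult_le_0_iff)
      then have "?l \<le> 1" by (simp add: ennreal_le_1)
      also have "1 \<le> 1 + suminf ?g" by simp
      finally show ?thesis .
    qed
  qed
  also have "\<dots> = 1 + (\<Sum>k. ennreal (exp (c * (real k + 1))) * emeasure P (?S k))"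
    using S by (simp add: nn_integral_add nn_integral_suminf nn_integral_cmult emeasure_space_1)
  also have "\<dots> \<le> 1 + (\<Sum>k. ennreal (C * exp (- c) ^ k))"
  proof (intro add_left_mono suminf_le summableI)
    fix k
    have "ennreal (exp (c * (real k + 1))) * emeasure P (?S k) \<le>
      ennreal (exp (c * (real k + 1))) * ennreal (2 * exp ((2 * c)\<^sup>2 * t / 2 - 2 * c * real k))"
      using c by (intro mult_left_mono sup_tail t) auto
    also have "\<dots> = ennreal (C * exp (- c) ^ k)"
      unfolding C_def by (simp add: ennreal_mult[symmetric] exp_add[symmetric] exp_of_nat_mult[symmetric] algebra_simps)
    finally show "ennreal (exp (c * (real k + 1))) * emeasure P (?S k) \<le> ennreal (C * exp (- c) ^ k)" .
  qed
  also have "\<dots> < \<infinity>"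
  proof -
    have "summable (\<lambda>k. C * exp (- c) ^ k)" using c by (intro summable_mult summable_geometric) simp
    moreover have "0 \<le> C * exp (- c) ^ k" for k by (simp add: C_def)
    ultimately have "(\<Sum>k. ennreal (C * exp (- c) ^ k)) \<noteq> top" by (rule ennreal_suminf_neq_top)
    then show ?thesis unfolding infinity_ennreal_def less_top[symmetric] by simp
  qed
  finally show "(\<integral>\<^sup>+w. ennreal (norm (exp (c * running_sup t w))) \<partial>P) < \<infinity>" .
qed

text \<open>Cut at a short time s. Reaching x before s has small probability; otherwise the supremum
  is w s plus an independent supremum, and w s has no atoms. This removes the one case in which
  neither pathwise limit of the discretised functional applies.\<close>

lemma sup_no_atom:
  assumes t: "0 \<le> t" and x: "0 < x"
  shows "AE w in P. running_sup t w \<noteq> x"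
proof (cases "t = 0")
  case True
  have "AE w in P. w 0 = 0" by (rule start_0)
  then show ?thesis by eventually_elim (use x in \<open>simp add: True running_sup_def\<close>)
next
  case False
  then have t: "0 < t" using t by simp
  let ?A = "{w \<in> paths. running_sup t w = x}"
  have A: "?A \<in> sets P" using sup_P[of t] t by (simp del: space_P add: space_P[symmetric])
  have bound: "emeasure P ?A \<le> ennreal (2 * exp (1 / 2 - c * x))" if c: "0 < c" "1 / c\<^sup>2 < t" for c
  proof -
    \<comment> \<open>Chosen so that \<open>c\<^sup>2 * s / 2 = 1 / 2\<close>: the tail bound
      becomes a constant times exp (- c x), which vanishes as c grows.\<close>
    define s where "s = 1 / c\<^sup>2"
    have s: "0 < s" "s < t" using c by (auto simp: s_def)
    have ps: "path_stopping s (\<lambda>_. s)" using s by (intro path_stopping_const) simp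
    let ?B = "{w \<in> paths. x \<le> running_sup s w}"
    let ?f = "\<lambda>p. indicator {p. fst p s + running_sup (t - s) (snd p) = x} p :: ennreal"
    have m1: "(\<lambda>p. fst p s) \<in> borel_measurable (F_inf \<Otimes>\<^sub>M F_inf)"
      using s by (intro measurable_compose[OF measurable_fst measurable_F_inf_eval]) simp
    have m2: "(\<lambda>p. running_sup (t - s) (snd p)) \<in> borel_measurable (F_inf \<Otimes>\<^sub>M F_inf)"
      using s by (intro measurable_running_sup_inf) auto
    have f: "?f \<in> borel_measurable (F_inf \<Otimes>\<^sub>M F_inf)" using m1 m2 by measurable
    have "emeasure P ?A \<le> (\<integral>\<^sup>+w. indicator ?B w + ?f (stop s w, shift s w) \<partial>P)"
    proof (subst nn_integral_indicator[OF A, symmetric], rule nn_integral_mono)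
      fix w assume "w \<in> space P"
      then have w: "w \<in> paths" by simp
      show "indicator ?A w \<le> indicator ?B w + ?f (stop s w, shift s w)"
        using w s sup_shift[OF w, of s t] by (auto simp: indicator_def max_def split: if_splits)
    qed
    also have "\<dots> = emeasure P ?B + (\<integral>\<^sup>+w. ?f (stop s w, shift s w) \<partial>P)"
    proof (subst nn_integral_add)
      have "(\<lambda>w. (stop s w, shift s w)) \<in> measurable P (F_inf \<Otimes>\<^sub>M F_inf)"
        using ident_P s by (intro measurable_Pair measurable_stop_inf measurable_shift) auto
      from measurable_compose[OF this f] show "(\<lambda>w. ?f (stop s w, shift s w)) \<in> borel_measurable P" .
    qed (use sup_P[of s] s in \<open>simp_all del: space_P add: space_P[symmetric]\<close>)
    also have "(\<integral>\<^sup>+w. ?f (stop s w, shift s w) \<partial>P) = (\<integral>\<^sup>+w. \<integral>\<^sup>+v. ?f (stop s w, v) \<partial>P \<partial>P)"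
      by (rule nn_integral_markov[OF ps f])
    \<comment> \<open>Integrating over the first piece with the second one fixed: the event then
      asks a Gaussian variable to take a single value.\<close>
    also have "\<dots> = (\<integral>\<^sup>+v. \<integral>\<^sup>+w. ?f (stop s w, v) \<partial>P \<partial>P)"
    proof -
      interpret pair_sigma_finite P P ..
      have "(\<lambda>p. (stop s (fst p), snd p)) \<in> measurable (P \<Otimes>\<^sub>M P) (F_inf \<Otimes>\<^sub>M F_inf)"
        using ident_P s by (intro measurable_Pair measurable_stop_inf measurable_compose[OF measurable_fst ident_P] measurable_compose[OF measurable_snd ident_P]) auto
      from measurable_compose[OF this f] show ?thesis by (intro Fubini'[symmetric]) (simp add: split_beta')
    qed
    also have "\<dots> = (\<integral>\<^sup>+v. 0 \<partial>P)"
    proof (rule nn_integral_cong)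
      fix v
      have "(\<integral>\<^sup>+w. ?f (stop s w, v) \<partial>P) = (\<integral>\<^sup>+w. indicator (paths \<inter> {w \<in> paths. w s - w 0 \<in> {x - running_sup (t - s) v}}) w \<partial>P)"
      proof (rule nn_integral_cong_AE)
        show "AE w in P. ?f (stop s w, v) = indicator (paths \<inter> {w \<in> paths. w s - w 0 \<in> {x - running_sup (t - s) v}}) w"
          using start_0 AE_paths by eventually_elim (use s in \<open>auto simp: indicator_def\<close>)
      qed
      also have "\<dots> = emeasure P (paths \<inter> {w \<in> paths. w s - w 0 \<in> {x - running_sup (t - s) v}})"
        using coord_P[of s] coord_P[of 0] s by (subst nn_integral_indicator) (auto simp del: space_P simp: space_P[symmetric])
      also have "\<dots> = emeasure P paths * emeasure gauss {z. sqrt (s - 0) * z \<in> {x - running_sup (t - s) v}}"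
        using s sets.top[of "F_upto 0"] by (intro increment_prob) auto
      also have "\<dots> = 0" using gauss_no_atoms[of "sqrt s"] s by simp
      finally show "(\<integral>\<^sup>+w. ?f (stop s w, v) \<partial>P) = 0" .
    qed
    also have "emeasure P ?B + (\<integral>\<^sup>+v. 0 \<partial>P) = emeasure P ?B" by simp
    also have "\<dots> \<le> ennreal (2 * exp (c\<^sup>2 * s / 2 - c * x))" using s c by (intro sup_tail) auto
    also have "c\<^sup>2 * s / 2 = 1 / 2" using c by (simp add: s_def)
    finally show ?thesis .
  qed
  obtain N :: nat where N: "1 / t < real N" using reals_Archimedean2 by blast
  have "measure P ?A \<le> 2 * exp (1 / 2) * exp (- x) ^ n" if n: "N \<le> n" for n
  proof -
    have "0 < 1 / t" using t by simp
    then have n0: "1 / t < real n" "0 < real n" using N n by linarith+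
    then have "1 / real n < t" using t by (simp add: field_simps)
    moreover have "1 / (real n)\<^sup>2 \<le> 1 / real n"
      using n0 by (intro divide_left_mono) (auto simp: power2_eq_square)
    ultimately have "ennreal (measure P ?A) \<le> ennreal (2 * exp (1 / 2 - real n * x))"
      using bound[of "real n"] n0 by (simp add: emeasure_eq_measure)
    then have "measure P ?A \<le> 2 * exp (1 / 2 - real n * x)" by (simp add: ennreal_le_iff)
    also have "\<dots> = 2 * exp (1 / 2) * exp (- x) ^ n"
    proof -
      have "1 / 2 - real n * x = 1 / 2 + real n * (- x)" by simp
      then show ?thesis by (simp only: exp_add exp_of_nat_mult mult.assoc)
    qed
    finally show ?thesis .
  qed
  moreover have "(\<lambda>n. 2 * exp (1 / 2) * exp (- x) ^ n) \<longlonglongrightarrow> 2 * exp (1 / 2) * 0"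
    using x by (intro tendsto_intros LIMSEQ_realpow_zero) auto
  ultimately have "measure P ?A \<le> 2 * exp (1 / 2) * 0" by (meson LIMSEQ_le_const)
  then have "emeasure P ?A = 0" by (simp add: emeasure_eq_measure measure_le_0_iff)
  then have "AE w in P. w \<notin> ?A" using A by (intro AE_not_in) auto
  then show ?thesis using AE_paths by eventually_elim simp
qed

end

section \<open>Change of measure\<close>

lemma iexp_bounded_integrable:
  assumes "integrable M g" "h \<in> borel_measurable M"
  shows "integrable M (\<lambda>x. complex_of_real (g x) * iexp (h x))"
proof (rule Bochner_Integration.integrable_bound[OF assms(1)])
  have [measurable]: "g \<in> borel_measurable M" "h \<in> borel_measurable M" using assms by auto
  show "(\<lambda>x. complex_of_real (g x) * iexp (h x)) \<in> borel_measurable M" by measurable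
  show "AE x in M. norm (complex_of_real (g x) * iexp (h x)) \<le> norm (g x)"
    by (simp add: norm_mult)
qed

lemma char_gauss_scale:
  "(LINT z|gauss. iexp (u * (v * z))) = complex_of_real (exp (- (u * v)\<^sup>2 / 2))"
proof -
  have "(LINT z|gauss. iexp (u * (v * z))) = (LINT z|gauss. exp (complex_of_real z * (\<i> * complex_of_real (u * v))))"
    by (simp add: mult.commute mult.left_commute)
  also have "\<dots> = exp ((\<i> * complex_of_real (u * v))\<^sup>2 / 2)" by (rule gauss_complex_exp)
  also have "(\<i> * complex_of_real (u * v))\<^sup>2 / 2 = complex_of_real (- (u * v)\<^sup>2 / 2)" by (simp add: power_mult_distrib)
  finally show ?thesis by (simp only: exp_of_real)
qed

context wiener
begin

section \<open>Girsanov's theorem by characteristic functions\<close>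

lemma measurable_F_P: "f \<in> measurable (F_upto s) N \<Longrightarrow> f \<in> measurable P N"
  by (rule F_upto_F_inf[OF _ sets_P])

lemma F_upto_P: "G \<in> sets (F_upto s) \<Longrightarrow> G \<in> sets P"
  using sets_path_algebra_mono[of "{0..s}" "{0..}"] sets_P by auto

text \<open>The hypothesis \<open>mart\<close> is the martingale property of D times the compensated
  complex exponential of B. It fixes the characteristic function of each increment of B under the
  new measure, given any event of the past, and Levy's uniqueness theorem makes the increment
  Gaussian and independent of the past. After T the density is frozen and B moves like w.\<close>

lemma girsanov:
  fixes D B :: "real \<Rightarrow> (real \<Rightarrow> real) \<Rightarrow> real"
  assumes T: "0 \<le> T"
    and D_meas: "\<And>t. 0 \<le> t \<Longrightarrow> t \<le> T \<Longrightarrow> D t \<in> borel_measurable (F_upto t)"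
    and D_nonneg: "\<And>t w. 0 \<le> t \<Longrightarrow> t \<le> T \<Longrightarrow> w \<in> paths \<Longrightarrow> 0 \<le> D t w"
    and D_int: "\<And>t. 0 \<le> t \<Longrightarrow> t \<le> T \<Longrightarrow> integrable P (D t)"
    and D0: "(LINT w|P. D 0 w) = 1"
    and B_meas: "\<And>t. 0 \<le> t \<Longrightarrow> B t \<in> borel_measurable (F_upto t)"
    and B0: "AE w in P. B 0 w = 0"
    and B_after: "\<And>u w. T \<le> u \<Longrightarrow> w \<in> paths \<Longrightarrow> B u w = B T w + (w u - w T)"
    and mart: "\<And>s t G u. 0 \<le> s \<Longrightarrow> s \<le> t \<Longrightarrow> t \<le> T \<Longrightarrow> G \<in> sets (F_upto s) \<Longrightarrow>
      (LINT w|P. complex_of_real (indicator G w * D t w) * iexp (u * (B t w - B s w))) =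
      complex_of_real ((LINT w|P. indicator G w * D s w) * exp (- u\<^sup>2 * (t - s) / 2))"
  shows "is_BM (density P (\<lambda>w. ennreal (D T w))) B"
proof -
  let ?M = "density P (\<lambda>w. ennreal (D T w))"
  have D_P: "D t \<in> borel_measurable P" if "0 \<le> t" "t \<le> T" for t
    by (rule measurable_F_P[OF D_meas[OF that]])
  have B_P: "B t \<in> borel_measurable P" if "0 \<le> t" for t
    by (rule measurable_F_P[OF B_meas[OF that]])
  have GD_int: "integrable P (\<lambda>w. indicator G w * D t w)" if "G \<in> sets P" "0 \<le> t" "t \<le> T" for G t
    using integrable_mult_indicator[OF that(1) D_int[OF that(2,3)]] by simp
  \<comment> \<open>At u = 0 the hypothesis \<open>mart\<close> says that D itself is a
    martingale.\<close>
  have GD_mart: "(LINT w|P. indicator G w * D t w) = (LINT w|P. indicator G w * D s w)"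
    if st: "0 \<le> s" "s \<le> t" "t \<le> T" and G: "G \<in> sets (F_upto s)" for s t G
  proof -
    have "complex_of_real (LINT w|P. indicator G w * D t w) = complex_of_real (LINT w|P. indicator G w * D s w)"
      using mart[OF st G, of 0] by (simp del: of_real_mult)
    then show ?thesis by (simp only: of_real_eq_iff)
  qed
  have M_eq: "emeasure ?M G = ennreal (LINT w|P. indicator G w * D T w)" if G: "G \<in> sets P" for G
  proof -
    have "emeasure ?M G = (\<integral>\<^sup>+w. ennreal (D T w) * indicator G w \<partial>P)"
      using D_P[OF T] G by (intro emeasure_density) auto
    also have "\<dots> = (\<integral>\<^sup>+w. ennreal (indicator G w * D T w) \<partial>P)"
      by (intro nn_integral_cong) (auto simp: indicator_def)
    also have "\<dots> = ennreal (LINT w|P. indicator G w * D T w)"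
      using T D_nonneg by (intro nn_integral_eq_integral GD_int G AE_I2) auto
    finally show ?thesis .
  qed
  have "(LINT w|P. indicator paths w * D T w) = 1"
  proof -
    have "(LINT w|P. indicator paths w * D T w) = (LINT w|P. indicator paths w * D 0 w)"
      using T sets.top[of "F_upto 0"] by (intro GD_mart) auto
    also have "\<dots> = (LINT w|P. D 0 w)" by (intro Bochner_Integration.integral_cong) auto
    finally show ?thesis using D0 by simp
  qed
  then have prob: "prob_space ?M"
    using M_eq[of paths] sets.top[of P] by (intro prob_spaceI) simp
  have key: "(LINT w|P. complex_of_real (indicator G w * D T w) * iexp (u * (B t w - B s w))) =
      complex_of_real ((LINT w|P. indicator G w * D T w) * exp (- u\<^sup>2 * (t - s) / 2))"
    if st: "0 \<le> s" "s \<le> t" and G: "G \<in> sets (F_upto s)" for s t G u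
  proof -
    have key1: "(LINT w|P. complex_of_real (indicator G w * D T w) * iexp (u * (B t w - B s w))) =
      complex_of_real ((LINT w|P. indicator G w * D T w) * exp (- u\<^sup>2 * (t - s) / 2))"
      if tT: "0 \<le> s" "s \<le> t" "t \<le> T" "G \<in> sets (F_upto s)" for s t
    proof -
      have t: "0 \<le> t" using tT by simp
      have id: "(\<lambda>w. w) \<in> measurable (density P (\<lambda>w. ennreal (D r w))) (F_upto t)" for r
        by (rule F_upto_F_inf[OF measurable_ident_sets[OF refl]]) (simp add: sets_P)
      \<comment> \<open>On the past of t the density at T may be replaced by the density at t, its
        conditional expectation. This reduces the identity at T to \<open>mart\<close>.\<close>
      have eq: "distr (density P (\<lambda>w. ennreal (D T w))) (F_upto t) (\<lambda>w. w) =
        distr (density P (\<lambda>w. ennreal (D t w))) (F_upto t) (\<lambda>w. w)"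
      proof (rule measure_eqI)
        fix A assume "A \<in> sets (distr (density P (\<lambda>w. ennreal (D T w))) (F_upto t) (\<lambda>w. w))"
        then have A: "A \<in> sets (F_upto t)" by simp
        have Ap: "A \<inter> paths = A" using sets.sets_into_space[OF A] by auto
        have e: "emeasure (distr (density P (\<lambda>w. ennreal (D r w))) (F_upto t) (\<lambda>w. w)) A =
          ennreal (LINT w|P. indicator A w * D r w)" if r: "0 \<le> r" "r \<le> T" for r
        proof -
          have "emeasure (distr (density P (\<lambda>w. ennreal (D r w))) (F_upto t) (\<lambda>w. w)) A =
            emeasure (density P (\<lambda>w. ennreal (D r w))) A"
            using A by (subst emeasure_distr[OF id]) (auto simp: Ap)
          also have "\<dots> = (\<integral>\<^sup>+w. ennreal (indicator A w * D r w) \<partial>P)"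
            using D_P[OF r] F_upto_P[OF A]
            by (subst emeasure_density) (auto intro!: nn_integral_cong simp: indicator_def)
          also have "\<dots> = ennreal (LINT w|P. indicator A w * D r w)"
            using r D_nonneg by (intro nn_integral_eq_integral GD_int F_upto_P[OF A] AE_I2) auto
          finally show ?thesis .
        qed
        show "emeasure (distr (density P (\<lambda>w. ennreal (D T w))) (F_upto t) (\<lambda>w. w)) A =
          emeasure (distr (density P (\<lambda>w. ennreal (D t w))) (F_upto t) (\<lambda>w. w)) A"
          using e[of T] e[of t] GD_mart[OF t tT(3) order_refl A] T t tT(3) by simp
      qed simp
      define h where "h w = complex_of_real (indicator G w) * iexp (u * (B t w - B s w))" for w
      have Gt: "G \<in> sets (F_upto t)" using tT sets_path_algebra_mono[of "{0..s}" "{0..t}"] by auto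
      have Bst: "B t \<in> borel_measurable (F_upto t)" "B s \<in> borel_measurable (F_upto t)"
        using B_meas[OF t] F_upto_le[OF B_meas[OF tT(1)] tT(2)] by auto
      have h [measurable]: "h \<in> borel_measurable (F_upto t)"
        unfolding h_def using Gt Bst by measurable
      have I: "(LINT w|P. complex_of_real (indicator G w * D r w) * iexp (u * (B t w - B s w))) =
        integral\<^sup>L (distr (density P (\<lambda>w. ennreal (D r w))) (F_upto t) (\<lambda>w. w)) h" if r: "0 \<le> r" "r \<le> T" for r
      proof -
        have "integral\<^sup>L (distr (density P (\<lambda>w. ennreal (D r w))) (F_upto t) (\<lambda>w. w)) h =
          integral\<^sup>L (density P (\<lambda>w. ennreal (D r w))) h"
          by (rule integral_distr[OF id h])
        also have "\<dots> = (LINT w|P. D r w *\<^sub>R h w)"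
          using measurable_F_P[OF h] D_P[OF r] D_nonneg[OF r] by (intro integral_density AE_I2) auto
        also have "\<dots> = (LINT w|P. complex_of_real (indicator G w * D r w) * iexp (u * (B t w - B s w)))"
          by (simp add: h_def scaleR_conv_of_real mult.assoc mult.left_commute)
        finally show ?thesis by simp
      qed
      have "(LINT w|P. complex_of_real (indicator G w * D T w) * iexp (u * (B t w - B s w))) =
        (LINT w|P. complex_of_real (indicator G w * D t w) * iexp (u * (B t w - B s w)))"
        using I[of T] I[of t] eq T t tT by simp
      also have "\<dots> = complex_of_real ((LINT w|P. indicator G w * D s w) * exp (- u\<^sup>2 * (t - s) / 2))"
        by (rule mart[OF tT])
      also have "(LINT w|P. indicator G w * D s w) = (LINT w|P. indicator G w * D T w)"
        using tT by (intro GD_mart[symmetric]) auto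
      finally show ?thesis .
    qed
    show ?thesis
    proof (cases "t \<le> T")
      case True
      then show ?thesis using st G by (intro key1) auto
    next
      case False
      \<comment> \<open>For t > T the increment is split at r. Up to r it is covered by
        \<open>key1\<close>, or is 0 when s \<ge> T; from r on it is an increment of w, independent
        of the past.\<close>
      define r where "r = max s T"
      have r: "0 \<le> r" "s \<le> r" "r \<le> t" "T \<le> r" using st T False by (auto simp: r_def)
      have kr: "(LINT w|P. complex_of_real (indicator G w * D T w) * iexp (u * (B r w - B s w))) =
        complex_of_real ((LINT w|P. indicator G w * D T w) * exp (- u\<^sup>2 * (r - s) / 2))"
      proof (cases "s \<le> T")
        case True
        then have "r = T" by (simp add: r_def)
        then show ?thesis using key1[of s T] st G True by simp
      next
        case False
        then have "r = s" by (simp add: r_def)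
        then show ?thesis by (simp del: of_real_mult)
      qed
      have GP: "G \<in> sets P" by (rule F_upto_P[OF G])
      have Gr: "G \<in> sets (F_upto r)" using G r sets_path_algebra_mono[of "{0..s}" "{0..r}"] by auto
      have mr: "D T \<in> borel_measurable (F_upto r)" "B r \<in> borel_measurable (F_upto r)" "B s \<in> borel_measurable (F_upto r)"
        using F_upto_le[OF D_meas[OF T order_refl] r(4)] B_meas[OF r(1)] F_upto_le[OF B_meas[OF st(1)] r(2)] by auto
      define f where "f p = (complex_of_real (indicator G (fst p) * D T (fst p)) * iexp (u * (B r (fst p) - B s (fst p)))) *
        iexp (u * snd p)" for p :: "(real \<Rightarrow> real) \<times> real"
      have m1: "(\<lambda>w. complex_of_real (indicator G w * D T w) * iexp (u * (B r w - B s w))) \<in> borel_measurable (F_upto r)"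
        using mr Gr by measurable
      have f: "f \<in> borel_measurable (F_upto r \<Otimes>\<^sub>M borel)"
        unfolding f_def using measurable_compose[OF measurable_fst m1] by measurable
      have inc: "(LINT w|P. complex_of_real (indicator G w * D T w) * iexp (u * (B t w - B s w))) = (LINT w|P. f (w, w t - w r))"
      proof (intro Bochner_Integration.integral_cong refl)
        fix w assume "w \<in> space P"
        then have w: "w \<in> paths" by simp
        have "B t w - B s w = (B r w - B s w) + (w t - w r)"
          using B_after[OF _ w, of t] B_after[OF r(4) w] r by simp
        then have "iexp (u * (B t w - B s w)) = iexp (u * (B r w - B s w)) * iexp (u * (w t - w r))"
          by (simp only: distrib_left of_real_add exp_add)
        then show "complex_of_real (indicator G w * D T w) * iexp (u * (B t w - B s w)) = f (w, w t - w r)"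
          by (simp only: f_def fst_conv snd_conv mult.assoc)
      qed
      have "integrable P (\<lambda>w. complex_of_real (indicator G w * D T w) * iexp (u * (B r w - B s w) + u * (w t - w r)))"
        using r st by (intro iexp_bounded_integrable GD_int GP T order_refl borel_measurable_add borel_measurable_times borel_measurable_diff borel_measurable_const B_P coord_P) auto
      then have i: "integrable P (\<lambda>w. f (w, w t - w r))"
        by (simp only: f_def fst_conv snd_conv of_real_add distrib_left exp_add mult.assoc)
      have "(LINT w|P. f (w, w t - w r)) = (LINT w|P. LINT z|gauss. f (w, sqrt (t - r) * z))"
        by (rule integral_increment[OF r(1,3) f i])
      also have "\<dots> = (LINT w|P. complex_of_real (indicator G w * D T w) * iexp (u * (B r w - B s w)) *
          complex_of_real (exp (- (u * sqrt (t - r))\<^sup>2 / 2)))"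
        by (simp only: f_def fst_conv snd_conv integral_mult_right_zero char_gauss_scale)
      also have "\<dots> = complex_of_real ((LINT w|P. indicator G w * D T w) * exp (- u\<^sup>2 * (r - s) / 2)) *
          complex_of_real (exp (- (u * sqrt (t - r))\<^sup>2 / 2))"
        by (simp only: integral_mult_left_zero kr)
      also have "\<dots> = complex_of_real ((LINT w|P. indicator G w * D T w) * (exp (- u\<^sup>2 * (r - s) / 2) * exp (- (u * sqrt (t - r))\<^sup>2 / 2)))"
        by (simp only: of_real_mult mult.assoc)
      also have "exp (- u\<^sup>2 * (r - s) / 2) * exp (- (u * sqrt (t - r))\<^sup>2 / 2) = exp (- u\<^sup>2 * (t - s) / 2)"
        using r by (simp add: exp_add[symmetric] power_mult_distrib field_simps)
      finally show ?thesis using inc by simp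
    qed
  qed
  show ?thesis
    unfolding is_BM_def
  proof (intro conjI allI impI)
    show "prob_space ?M" by (rule prob)
    show "sets ?M = sets F_inf" by (simp add: sets_P)
    show "B t \<in> borel_measurable (F_upto t)" if "0 \<le> t" for t by (rule B_meas[OF that])
    show "AE w in ?M. B 0 w = 0"
      using B0 D_P[OF T] by (subst AE_density) (auto elim: eventually_mono)
    fix s t G A assume st: "0 \<le> s" "s \<le> t" and G: "G \<in> sets (F_upto s)" and A: "A \<in> sets (borel :: real measure)"
    interpret M: prob_space ?M by (rule prob)
    define X where "X w = B t w - B s w" for w
    have X [measurable]: "X \<in> borel_measurable P"
      unfolding X_def[abs_def] using st by (intro borel_measurable_diff B_P) auto
    have GP [measurable]: "G \<in> sets P" by (rule F_upto_P[OF G])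
    have DP [measurable]: "D T \<in> borel_measurable P" by (rule D_P[OF T order_refl])
    have Gp: "G \<subseteq> paths" using sets.sets_into_space[OF G] by simp
    define c where "c = (LINT w|P. indicator G w * D T w)"
    have c0: "0 \<le> c" unfolding c_def using T D_nonneg by (intro Bochner_Integration.integral_nonneg) auto
    have MG: "emeasure ?M G = ennreal c" unfolding c_def by (rule M_eq[OF GP])
    show "emeasure ?M (G \<inter> {w \<in> paths. B t w - B s w \<in> A}) = emeasure ?M G * emeasure gauss {z. sqrt (t - s) * z \<in> A}"
    proof (cases "c = 0")
      case True
      have "emeasure ?M (G \<inter> {w \<in> paths. B t w - B s w \<in> A}) \<le> emeasure ?M G"
        using GP by (intro emeasure_mono) auto
      then show ?thesis using MG True by simp
    next
      case False
      then have c: "0 < c" using c0 by simp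
      \<comment> \<open>Density of the new measure conditioned on G, for which G must have positive
        mass; hence the separate case c = 0.\<close>
      define h where "h w = indicator G w * D T w / c" for w
      have h [measurable]: "h \<in> borel_measurable P" unfolding h_def by measurable
      have h0: "w \<in> space P \<Longrightarrow> 0 \<le> h w" for w using c D_nonneg[OF T order_refl] by (auto simp: h_def)
      have h_int: "integrable P h" unfolding h_def using GD_int[OF GP T order_refl] by simp
      have h1: "(LINT w|P. h w) = 1" unfolding h_def using c by (simp add: c_def)
      let ?N = "distr (density P (\<lambda>w. ennreal (h w))) borel X"
      let ?g = "distr gauss borel (\<lambda>z. sqrt (t - s) * z)"
      have Xd: "X \<in> borel_measurable (density P (\<lambda>w. ennreal (h w)))" by simp
      have "(\<integral>\<^sup>+w. ennreal (h w) \<partial>P) = 1"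
        using h_int h0 h1 by (subst nn_integral_eq_integral) auto
      then have "prob_space (density P (\<lambda>w. ennreal (h w)))"
      proof (intro prob_spaceI)
        assume e: "(\<integral>\<^sup>+w. ennreal (h w) \<partial>P) = 1"
        have "emeasure (density P (\<lambda>w. ennreal (h w))) (space P) = (\<integral>\<^sup>+w. ennreal (h w) * indicator (space P) w \<partial>P)"
          by (rule emeasure_density) measurable
        also have "\<dots> = (\<integral>\<^sup>+w. ennreal (h w) \<partial>P)" by (intro nn_integral_cong) (simp del: space_P)
        finally show "emeasure (density P (\<lambda>w. ennreal (h w))) (space (density P (\<lambda>w. ennreal (h w)))) = 1"
          unfolding space_density e .
      qed
      then interpret H: prob_space "density P (\<lambda>w. ennreal (h w))" .
      have "prob_space ?N" "prob_space ?g"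
        by (rule H.prob_space_distr[OF Xd], rule gauss.prob_space_distr) auto
      then have rd: "real_distribution ?N" "real_distribution ?g"
        by (auto simp: real_distribution_def real_distribution_axioms_def)
      have "char ?N u = char ?g u" for u
      proof -
        have "char ?N u = (LINT w|density P (\<lambda>w. ennreal (h w)). iexp (u * X w))"
          unfolding char_def by (rule integral_distr[OF Xd]) measurable
        also have "\<dots> = (LINT w|P. h w *\<^sub>R iexp (u * X w))"
          using h0 by (intro integral_density AE_I2) auto
        also have "\<dots> = (LINT w|P. complex_of_real (indicator G w * D T w) * iexp (u * X w) / complex_of_real c)"
          unfolding h_def by (simp add: scaleR_conv_of_real)
        also have "\<dots> = complex_of_real (c * exp (- u\<^sup>2 * (t - s) / 2)) / complex_of_real c"
          unfolding integral_divide_zero X_def using key[OF st G, of u] by (simp only: c_def)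
        also have "\<dots> = complex_of_real (exp (- (u * sqrt (t - s))\<^sup>2 / 2))"
          using c st by (simp add: power_mult_distrib)
        also have "\<dots> = char ?g u"
          unfolding char_def char_gauss_scale[symmetric] by (rule integral_distr[symmetric]) measurable
        finally show ?thesis .
      qed
      then have "?N = ?g" by (intro Levy_uniqueness rd) (auto simp: fun_eq_iff)
      then have "emeasure ?N A = emeasure ?g A" by simp
      moreover have "emeasure ?g A = emeasure gauss {z. sqrt (t - s) * z \<in> A}"
        using A by (subst emeasure_distr) (auto intro!: arg_cong[where f="emeasure gauss"])
      moreover have "ennreal c * emeasure ?N A = emeasure ?M (G \<inter> {w \<in> paths. B t w - B s w \<in> A})"
      proof -
        have XA: "X -` A \<inter> space P \<in> sets P" using X A by (rule measurable_sets)
        have "emeasure ?N A = (\<integral>\<^sup>+w. ennreal (h w) * indicator (X -` A \<inter> space P) w \<partial>P)"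
          using A XA by (subst emeasure_distr[OF Xd]) (auto simp: emeasure_density)
        then have "ennreal c * emeasure ?N A = (\<integral>\<^sup>+w. ennreal c * (ennreal (h w) * indicator (X -` A \<inter> space P) w) \<partial>P)"
          using XA by (simp add: nn_integral_cmult)
        also have "\<dots> = (\<integral>\<^sup>+w. ennreal (D T w) * indicator (G \<inter> (X -` A \<inter> space P)) w \<partial>P)"
          using c by (intro nn_integral_cong) (auto simp: indicator_def h_def ennreal_mult'[symmetric])
        also have "\<dots> = emeasure ?M (G \<inter> (X -` A \<inter> space P))"
          using GP XA by (intro emeasure_density[symmetric]) auto
        also have "G \<inter> (X -` A \<inter> space P) = G \<inter> {w \<in> paths. B t w - B s w \<in> A}"
          by (auto simp: X_def)
        finally show ?thesis .
      qed
      ultimately show ?thesis unfolding MG by simp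
    qed
  qed
qed

section \<open>The Cameron-Martin formula on a finite horizon\<close>

definition drift_upto :: "real \<Rightarrow> real \<Rightarrow> (real \<Rightarrow> real) \<Rightarrow> (real \<Rightarrow> real)" where
  "drift_upto lam T w = (\<lambda>t\<in>{0..}. w t + lam * min t T)"

lemma drift_upto_paths:
  assumes "w \<in> paths" shows "drift_upto lam T w \<in> paths"
proof -
  have "continuous_on {0..} (\<lambda>t. w t + lam * min t T)"
    by (intro continuous_intros paths_continuous[OF assms])
  then have "continuous_on {0..} (drift_upto lam T w)" by (rule continuous_on_eq) (simp add: drift_upto_def)
  then show ?thesis by (simp add: paths_def drift_upto_def)
qed

lemma measurable_drift_upto: "drift_upto lam T \<in> measurable F_inf F_inf"
proof (rule measurable_path_algebraI)
  fix s :: real assume "s \<in> {0..}"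
  then show "(\<lambda>w. drift_upto lam T w s) \<in> borel_measurable F_inf"
    using measurable_F_inf_eval[of s] by (simp add: drift_upto_def)
qed (simp add: drift_upto_paths)

text \<open>The drift stops at T because only on a finite horizon does the law with drift have a
  density. \<open>girsanov\<close> shows that removing the drift under the density gives back the
  Wiener law; inserting the drift again yields the formula.\<close>

lemma cameron_martin:
  assumes T: "0 \<le> T" and f: "f \<in> borel_measurable F_inf"
  shows "(\<integral>\<^sup>+w. f (drift_upto lam T w) \<partial>P) = (\<integral>\<^sup>+w. f w * ennreal (exp (lam * w T - lam\<^sup>2 * T / 2)) \<partial>P)"
proof -
  define D where "D t w = exp (lam * w t - lam\<^sup>2 * t / 2)" for t and w :: "real \<Rightarrow> real"
  define B where "B t w = w t - lam * min t T" for t and w :: "real \<Rightarrow> real"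
  let ?M = "density P (\<lambda>w. ennreal (D T w))"
  have D_int: "integrable P (D t)" if "0 \<le> t" for t
    unfolding D_def exp_diff using integrable_exp[OF that] by simp
  have M: "is_BM ?M B"
  proof (rule girsanov[OF T])
    have ct: "(\<lambda>w. w t) \<in> borel_measurable (F_upto t)" if "0 \<le> t" for t
      using that by (intro measurable_coordinate) simp
    have Dt: "D t \<in> borel_measurable (F_upto t)" if "0 \<le> t" for t
      using ct[OF that] unfolding D_def by measurable
    show "D t \<in> borel_measurable (F_upto t)" if "0 \<le> t" for t by (rule Dt[OF that])
    show "B t \<in> borel_measurable (F_upto t)" if "0 \<le> t" for t
      using ct[OF that] unfolding B_def by measurable
    show "integrable P (D t)" if "0 \<le> t" for t by (rule D_int[OF that])
    have "(LINT w|P. D 0 w) = (LINT w|P. 1)"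
      using start_0 coord_P[of 0] by (intro integral_cong_AE) (auto simp: D_def elim: eventually_mono)
    then show "(LINT w|P. D 0 w) = 1" by (simp add: prob_space del: space_P)
    show "AE w in P. B 0 w = 0" using start_0 by eventually_elim (use T in \<open>simp add: B_def\<close>)
    show "B u w = B T w + (w u - w T)" if "T \<le> u" for u w using that by (simp add: B_def)
    show "0 \<le> D t w" for t w by (simp add: D_def)
    fix s t G u assume st: "0 \<le> s" "s \<le> t" "t \<le> T" and G: "G \<in> sets (F_upto s)"
    \<comment> \<open>The exponent of the increment: \<open>lam\<close> comes from the density and
      the imaginary part from the test exponential. The factor k collects what does not depend on
      the path.\<close>
    define a where "a = complex_of_real lam + \<i> * complex_of_real u"
    define k where "k = exp (complex_of_real (- lam\<^sup>2 * (t - s) / 2) - \<i> * complex_of_real (u * lam * (t - s)))"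
    define F where "F p = complex_of_real (indicator G (fst p) * D s (fst p)) * (exp (complex_of_real (snd p) * a) * k)"
      for p :: "(real \<Rightarrow> real) \<times> real"
    have eq: "complex_of_real (indicator G w * D t w) * iexp (u * (B t w - B s w)) = F (w, w t - w s)" for w
    proof -
      have "complex_of_real (D t w) * iexp (u * (B t w - B s w)) =
        exp (complex_of_real (lam * w t - lam\<^sup>2 * t / 2) + \<i> * complex_of_real (u * (B t w - B s w)))"
        unfolding D_def by (simp only: exp_of_real exp_add)
      also have "complex_of_real (lam * w t - lam\<^sup>2 * t / 2) + \<i> * complex_of_real (u * (B t w - B s w)) =
        complex_of_real (lam * w s - lam\<^sup>2 * s / 2) + (complex_of_real (w t - w s) * a +
          (complex_of_real (- lam\<^sup>2 * (t - s) / 2) - \<i> * complex_of_real (u * lam * (t - s))))"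
        using st by (simp add: B_def a_def field_simps)
      also have "exp \<dots> = complex_of_real (D s w) * (exp (complex_of_real (w t - w s) * a) * k)"
        unfolding D_def k_def by (simp only: exp_of_real exp_add)
      finally show ?thesis by (simp only: F_def fst_conv snd_conv of_real_mult mult.assoc)
    qed
    have Ds: "D s \<in> borel_measurable (F_upto s)" by (rule Dt[OF st(1)])
    have "(\<lambda>w. complex_of_real (indicator G w * D s w)) \<in> borel_measurable (F_upto s)"
      using Ds G by measurable
    from measurable_compose[OF measurable_fst this]
    have F: "F \<in> borel_measurable (F_upto s \<Otimes>\<^sub>M borel)"
      unfolding F_def by measurable
    have GP: "G \<in> sets P" by (rule F_upto_P[OF G])
    have "integrable P (\<lambda>w. complex_of_real (indicator G w * D t w) * iexp (u * (B t w - B s w)))"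
    proof (rule iexp_bounded_integrable)
      show "integrable P (\<lambda>w. indicator G w * D t w)"
        using integrable_mult_indicator[OF GP D_int[of t]] st by simp
      show "(\<lambda>w. u * (B t w - B s w)) \<in> borel_measurable P"
      proof -
        have [measurable]: "(\<lambda>w. w s) \<in> borel_measurable P" "(\<lambda>w. w t) \<in> borel_measurable P"
          using st by (auto intro!: coord_P)
        show ?thesis unfolding B_def by measurable
      qed
    qed
    then have i: "integrable P (\<lambda>w. F (w, w t - w s))" by (simp only: eq)
    have "(LINT w|P. F (w, w t - w s)) = (LINT w|P. LINT z|gauss. F (w, sqrt (t - s) * z))"
      by (rule integral_increment[OF st(1,2) F i])
    also have "\<dots> = (LINT w|P. complex_of_real (indicator G w * D s w) * (exp ((complex_of_real (sqrt (t - s)) * a)\<^sup>2 / 2) * k))"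
    proof (intro Bochner_Integration.integral_cong refl)
      fix w
      have e: "exp (complex_of_real (sqrt (t - s) * z) * a) = exp (complex_of_real z * (complex_of_real (sqrt (t - s)) * a))" for z
        by (simp add: mult.commute mult.left_commute)
      show "(LINT z|gauss. F (w, sqrt (t - s) * z)) =
        complex_of_real (indicator G w * D s w) * (exp ((complex_of_real (sqrt (t - s)) * a)\<^sup>2 / 2) * k)"
        unfolding F_def fst_conv snd_conv integral_mult_right_zero integral_mult_left_zero e
          gauss_complex_exp(2)[of "complex_of_real (sqrt (t - s)) * a"] ..
    qed
    also have "exp ((complex_of_real (sqrt (t - s)) * a)\<^sup>2 / 2) * k = complex_of_real (exp (- u\<^sup>2 * (t - s) / 2))"
    proof -
      have sq: "(complex_of_real (sqrt (t - s)))\<^sup>2 = complex_of_real (t - s)" using st by (simp flip: of_real_power)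
      have "(complex_of_real (sqrt (t - s)) * a)\<^sup>2 / 2 +
          (complex_of_real (- lam\<^sup>2 * (t - s) / 2) - \<i> * complex_of_real (u * lam * (t - s))) =
        complex_of_real (- u\<^sup>2 * (t - s) / 2)"
        unfolding power_mult_distrib sq a_def by (simp add: power2_eq_square field_simps)
      then show ?thesis unfolding k_def by (simp only: exp_add[symmetric] exp_of_real)
    qed
    also have "(LINT w|P. complex_of_real (indicator G w * D s w) * complex_of_real (exp (- u\<^sup>2 * (t - s) / 2))) =
      complex_of_real ((LINT w|P. indicator G w * D s w) * exp (- u\<^sup>2 * (t - s) / 2))"
      unfolding integral_mult_left_zero integral_complex_of_real by (simp only: of_real_mult)
    finally show "(LINT w|P. complex_of_real (indicator G w * D t w) * iexp (u * (B t w - B s w))) =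
      complex_of_real ((LINT w|P. indicator G w * D s w) * exp (- u\<^sup>2 * (t - s) / 2))"
      unfolding eq .
  qed
  have dm: "drift_upto l T \<in> measurable P F_inf" for l using measurable_drift_upto measurable_P by simp
  have dM: "drift_upto (- lam) T \<in> measurable ?M F_inf" using dm[of "- lam"] by simp
  have "distr ?M F_inf (drift_upto (- lam) T) = distr P F_inf (\<lambda>w. w)"
    by (rule is_BM_unique[OF M dM _ BM ident_P]) (auto simp: drift_upto_def B_def)
  also have "\<dots> = P" using distr_id2[OF sets_P[symmetric]] by simp
  finally have P: "distr ?M F_inf (drift_upto (- lam) T) = P" .
  have fd: "(\<lambda>w. f (drift_upto lam T w)) \<in> borel_measurable F_inf"
    by (rule measurable_compose[OF measurable_drift_upto f])
  have "(\<integral>\<^sup>+w. f (drift_upto lam T w) \<partial>P) = (\<integral>\<^sup>+w. f (drift_upto lam T w) \<partial>distr ?M F_inf (drift_upto (- lam) T))"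
    by (simp only: P)
  also have "\<dots> = (\<integral>\<^sup>+w. f (drift_upto lam T (drift_upto (- lam) T w)) \<partial>?M)"
    using fd by (intro nn_integral_distr[OF dM]) simp
  also have "\<dots> = (\<integral>\<^sup>+w. f w \<partial>?M)"
  proof (rule nn_integral_cong)
    fix w assume "w \<in> space ?M"
    then have "w \<in> extensional {0..}" by (simp add: paths_def)
    then have "drift_upto lam T (drift_upto (- lam) T w) = w"
      by (intro ext) (simp add: drift_upto_def extensional_def)
    then show "f (drift_upto lam T (drift_upto (- lam) T w)) = f w" by simp
  qed
  also have "\<dots> = (\<integral>\<^sup>+w. f w * ennreal (exp (lam * w T - lam\<^sup>2 * T / 2)) \<partial>P)"
    using f coord_P[OF T] measurable_P by (subst nn_integral_density) (auto simp: D_def mult.commute)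
  finally show ?thesis .
qed

end

section \<open>A Feynman--Kac identity for killed Brownian motion\<close>

lemma riemann_sum_tendsto:
  fixes g :: "real \<Rightarrow> real"
  assumes t: "0 < t" and g: "continuous_on {0..t} g"
  shows "(\<lambda>n. \<Sum>j<Suc n. t / real (Suc n) * g (real j * (t / real (Suc n)))) \<longlonglongrightarrow> integral {0..t} g"
proof (rule LIMSEQ_I)
  fix r :: real assume r: "0 < r"
  define F where "F s = integral {0..s} g" for s
  have "uniformly_continuous_on {0..t} g" using g by (rule compact_uniformly_continuous) simp
  then obtain d where d: "0 < d" "\<And>x y. x \<in> {0..t} \<Longrightarrow> y \<in> {0..t} \<Longrightarrow> dist y x < d \<Longrightarrow> dist (g y) (g x) < r / (2 * t)"
    using r t unfolding uniformly_continuous_on_def by (metis divide_pos_pos mult_pos_pos zero_less_numeral)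
  obtain N :: nat where N: "t / d < real N" using reals_Archimedean2 by blast
  have "norm ((\<Sum>j<Suc n. t / real (Suc n) * g (real j * (t / real (Suc n)))) - integral {0..t} g) < r" if n: "N \<le> n" for n
  proof -
    define h where "h = t / real (Suc n)"
    have h: "0 < h" "real (Suc n) * h = t" using t by (simp_all add: h_def)
    have "t / d < real (Suc n)" using N n by simp
    then have hd: "h < d" using d(1) by (simp add: h_def field_simps)
    have sub: "{real j * h..real (Suc j) * h} \<subseteq> {0..t}" if j: "j < Suc n" for j
    proof -
      have "real (Suc j) * h \<le> real (Suc n) * h" using j h by (intro mult_right_mono) auto
      then show ?thesis using h by auto
    qed
    \<comment> \<open>Each cell is compared with the increment of the primitive. The mean value
      theorem and uniform continuity bound its error by h r / (2 t), which sums to r / 2.\<close>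
    have step: "\<bar>h * g (real j * h) - (F (real (Suc j) * h) - F (real j * h))\<bar> \<le> h * (r / (2 * t))" if j: "j < Suc n" for j
    proof -
      have "\<exists>x\<in>{real j * h<..<real (Suc j) * h}. F (real (Suc j) * h) - F (real j * h) = g x * (real (Suc j) * h - real j * h)"
      proof (rule mvt_simple)
        show "real j * h < real (Suc j) * h" using h by simp
        fix x assume x: "real j * h \<le> x" "x \<le> real (Suc j) * h"
        then have "x \<in> {0..t}" using sub[OF j] by auto
        then have "(F has_real_derivative g x) (at x within {0..t})"
          unfolding F_def by (rule integral_has_real_derivative[OF g])
        then have "(F has_real_derivative g x) (at x within {real j * h..real (Suc j) * h})"
          by (rule has_field_derivative_subset[OF _ sub[OF j]])
        then show "(F has_derivative (\<lambda>y. g x * y)) (at x within {real j * h..real (Suc j) * h})"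
          by (simp add: has_field_derivative_def)
      qed
      then obtain x where x: "x \<in> {real j * h<..<real (Suc j) * h}" "F (real (Suc j) * h) - F (real j * h) = g x * h"
        by (auto simp: algebra_simps)
      have xt: "x \<in> {0..t}" "real j * h \<in> {0..t}" using sub[OF j] x h by (auto simp: subset_iff)
      have "dist (real j * h) x < d" using x hd by (auto simp: dist_real_def algebra_simps)
      then have "dist (g (real j * h)) (g x) < r / (2 * t)" by (rule d(2)[OF xt])
      then have "\<bar>g (real j * h) - g x\<bar> \<le> r / (2 * t)" by (simp add: dist_real_def)
      then have "h * \<bar>g (real j * h) - g x\<bar> \<le> h * (r / (2 * t))" using h by (intro mult_left_mono) auto
      moreover have "h * g (real j * h) - (F (real (Suc j) * h) - F (real j * h)) = h * (g (real j * h) - g x)"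
        unfolding x(2) by (simp add: algebra_simps)
      then have "\<bar>h * g (real j * h) - (F (real (Suc j) * h) - F (real j * h))\<bar> = h * \<bar>g (real j * h) - g x\<bar>"
        using h(1) by (simp only: abs_mult abs_of_pos)
      ultimately show ?thesis by (simp only:)
    qed
    have "(\<Sum>j<Suc n. F (real (Suc j) * h) - F (real j * h)) = F (real (Suc n) * h) - F (real 0 * h)"
      by (rule sum_lessThan_telescope)
    also have "\<dots> = integral {0..t} g" unfolding h(2) by (simp add: F_def)
    finally have "(\<Sum>j<Suc n. h * g (real j * h)) - integral {0..t} g =
      (\<Sum>j<Suc n. h * g (real j * h) - (F (real (Suc j) * h) - F (real j * h)))"
      by (simp only: sum_subtractf)
    then have "norm ((\<Sum>j<Suc n. h * g (real j * h)) - integral {0..t} g) \<le>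
      (\<Sum>j<Suc n. \<bar>h * g (real j * h) - (F (real (Suc j) * h) - F (real j * h))\<bar>)"
      by (simp only: real_norm_def sum_abs)
    also have "\<dots> \<le> (\<Sum>j<Suc n. h * (r / (2 * t)))" using step by (intro sum_mono) auto
    also have "\<dots> = real (Suc n) * h * (r / (2 * t))" by simp
    also have "\<dots> = r / 2" unfolding h(2) using t by simp
    finally show ?thesis using r by (simp add: h_def)
  qed
  then show "\<exists>no. \<forall>n\<ge>no. norm ((\<Sum>j<Suc n. t / real (Suc n) * g (real j * (t / real (Suc n)))) - integral {0..t} g) < r"
    by blast
qed

text \<open>The lower bound keeps the rotation factors outside the open unit disc, the upper one
  controls them on paths that stay away from the barrier. Monotonicity also drives the comparison of
  solutions.\<close>

lemma coth_bounds:
  assumes "0 < m" "m \<le> r"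
  shows "1 \<le> coth r" "coth r \<le> coth m"
proof -
  have s: "0 < sinh m" "0 < sinh r" using assms by auto
  show "1 \<le> coth r" using s sinh_le_cosh_real[of r] by (simp add: coth_def)
  have "0 \<le> sinh (r - m)" using assms by simp
  then have "cosh r * sinh m \<le> cosh m * sinh r" by (simp add: sinh_diff mult.commute)
  then show "coth r \<le> coth m" using s by (simp add: coth_def field_simps)
qed

lemma continuous_on_coth:
  "continuous_on A f \<Longrightarrow> (\<And>x. x \<in> A \<Longrightarrow> f x \<noteq> 0) \<Longrightarrow> continuous_on A (\<lambda>x. coth (f x))"
  unfolding coth_def by (intro continuous_intros) auto

lemma measurable_coth [measurable]: "coth \<in> borel_measurable borel"
  unfolding coth_def sinh_def cosh_def by measurable

text \<open>The drift collected by x - w, up to the factor \<lambda>. On paths that reach x the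
  integral may diverge, but there its value only meets vanishing weights.\<close>

definition coth_int :: "real \<Rightarrow> real \<Rightarrow> real \<Rightarrow> (real \<Rightarrow> real) \<Rightarrow> real" where
  "coth_int lam x t w = (LINT r:{0..t}|lborel. coth (lam * (x - w r)))"

lemma measurable_coth_int:
  assumes f: "f \<in> measurable N (path_algebra I)" and g: "g \<in> borel_measurable N"
    and t: "0 \<le> t" "{0..t} \<subseteq> I"
  shows "(\<lambda>p. coth_int lam (g p) t (f p)) \<in> borel_measurable N"
proof -
  \<comment> \<open>Clamping the time into {0..t} changes nothing on the domain of integration and
    keeps the evaluation inside I.\<close>
  have e: "(\<lambda>q. (f (fst q)) (min t (max 0 (snd q)))) \<in> borel_measurable (N \<Otimes>\<^sub>M lborel)"
  proof (rule measurable_eval[where f="\<lambda>q. f (fst q)" and g="\<lambda>q. min t (max 0 (snd q))"])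
    show "(\<lambda>q. f (fst q)) \<in> measurable (N \<Otimes>\<^sub>M lborel) (path_algebra I)"
      by (rule measurable_compose[OF measurable_fst f])
    show "0 \<le> min t (max 0 (snd q)) \<and> {0..min t (max 0 (snd q))} \<subseteq> I" for q :: "'a \<times> real"
      using t by (auto simp: subset_iff)
  qed measurable
  have "(\<lambda>(p, r). indicator {0..t} r *\<^sub>R coth (lam * (g p - f p (min t (max 0 r))))) \<in> borel_measurable (N \<Otimes>\<^sub>M lborel)"
    using e measurable_compose[OF measurable_fst g] unfolding split_beta' by measurable
  then have "(\<lambda>p. LINT r|lborel. indicator {0..t} r *\<^sub>R coth (lam * (g p - f p (min t (max 0 r))))) \<in> borel_measurable N"
    by (rule lborel.borel_measurable_lebesgue_integral)
  also have "(\<lambda>p. LINT r|lborel. indicator {0..t} r *\<^sub>R coth (lam * (g p - f p (min t (max 0 r))))) =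
    (\<lambda>p. coth_int lam (g p) t (f p))"
    unfolding coth_int_def set_lebesgue_integral_def
    by (intro ext Bochner_Integration.integral_cong) (auto simp: indicator_def)
  finally show ?thesis .
qed

lemma continuous_coth_path:
  assumes w: "w \<in> paths" and t: "0 \<le> t" and S: "running_sup t w < x" and lam: "0 < lam"
  shows "continuous_on {0..t} (\<lambda>r. coth (lam * (x - w r)))"
proof (rule continuous_on_coth)
  have "continuous_on {0..t} w" by (rule continuous_on_subset[OF paths_continuous[OF w]]) auto
  then show "continuous_on {0..t} (\<lambda>r. lam * (x - w r))" by (intro continuous_intros)
  show "lam * (x - w r) \<noteq> 0" if "r \<in> {0..t}" for r
    using S running_sup_less_iff[OF w t, of x] that lam by force
qed

lemma coth_int_eq_integral:
  assumes "w \<in> paths" "0 \<le> t" "running_sup t w < x" "0 < lam"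
  shows "set_integrable lborel {0..t} (\<lambda>r. coth (lam * (x - w r)))"
    and "coth_int lam x t w = integral {0..t} (\<lambda>r. coth (lam * (x - w r)))"
proof -
  show "set_integrable lborel {0..t} (\<lambda>r. coth (lam * (x - w r)))"
    by (rule borel_integrable_atLeastAtMost'[OF continuous_coth_path[OF assms]])
  then show "coth_int lam x t w = integral {0..t} (\<lambda>r. coth (lam * (x - w r)))"
    unfolding coth_int_def by (rule set_borel_integral_eq_integral)
qed

text \<open>\<open>rot a c = sinh (r + i a) / sinh r\<close> for \<open>c = coth r\<close>: the factor by which one Gaussian step multiplies
  \<open>sinh r\<close>, and to first order the exponential of \<open>i a c\<close>.\<close>

definition rot :: "real \<Rightarrow> real \<Rightarrow> complex" where
  "rot a c = complex_of_real (cos a) + \<i> * complex_of_real (c * sin a)"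

text \<open>For c = 1 the factor lies on the unit circle, and a larger c only lengthens its
  imaginary part. Hence products of 1 / rot have modulus at most 1 whatever the number of steps,
  which dominates the discretised functional.\<close>

lemma norm_rot:
  assumes "1 \<le> c" shows "1 \<le> norm (rot a c)"
proof -
  have "1 * (sin a)\<^sup>2 \<le> c\<^sup>2 * (sin a)\<^sup>2" using assms by (intro mult_right_mono one_le_power) auto
  then have "(cos a)\<^sup>2 + (sin a)\<^sup>2 \<le> (cos a)\<^sup>2 + (c * sin a)\<^sup>2" unfolding power_mult_distrib by linarith
  then have "1 \<le> (cos a)\<^sup>2 + (c * sin a)\<^sup>2" using sin_cos_squared_add[of a] by linarith
  then have "1 \<le> sqrt ((cos a)\<^sup>2 + (c * sin a)\<^sup>2)" by (simp only: real_sqrt_ge_1_iff)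
  then show ?thesis by (simp add: rot_def cmod_def)
qed

text \<open>\<open>rot a c\<close> and exp (i a c) agree to first order in a, and dividing by
  \<open>rot a c\<close> costs nothing since its modulus is at least 1. Errors of second order
  vanish when summed over n steps of size 1 / n.\<close>

lemma rot_approx:
  assumes c: "1 \<le> c"
  shows "norm (1 / rot a c - iexp (- (a * c))) \<le> 2 * c\<^sup>2 * a\<^sup>2"
proof -
  have e: "norm (iexp x - (1 + \<i> * complex_of_real x)) \<le> x\<^sup>2 / 2" for x
    using iexp_approx1[of x 1] by (simp add: power2_eq_square)
  have sc: "\<bar>cos a - 1\<bar> \<le> a\<^sup>2 / 2" "\<bar>sin a - a\<bar> \<le> a\<^sup>2 / 2"
  proof -
    have E: "iexp a = complex_of_real (cos a) + \<i> * complex_of_real (sin a)"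
      by (simp add: cis_conv_exp[symmetric] complex_eq_iff)
    show "\<bar>cos a - 1\<bar> \<le> a\<^sup>2 / 2"
      using order_trans[OF abs_Re_le_cmod e[of a]] by (simp add: E)
    show "\<bar>sin a - a\<bar> \<le> a\<^sup>2 / 2"
      using order_trans[OF abs_Im_le_cmod e[of a]] by (simp add: E)
  qed
  have n: "1 \<le> norm (rot a c)" by (rule norm_rot[OF c])
  then have n0: "rot a c \<noteq> 0" by auto
  have u: "iexp (a * c) * iexp (- (a * c)) = 1" by (simp add: exp_add[symmetric])
  have "1 / rot a c - iexp (- (a * c)) = (iexp (a * c) - rot a c) * (iexp (- (a * c)) / rot a c)"
    using n0 u by (simp add: field_simps)
  then have "norm (1 / rot a c - iexp (- (a * c))) = norm (iexp (a * c) - rot a c) * (1 / norm (rot a c))"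
    by (simp add: norm_mult norm_divide)
  also have "\<dots> \<le> norm (iexp (a * c) - rot a c) * 1" using n by (intro mult_left_mono) (simp_all add: divide_le_eq)
  also have "iexp (a * c) - rot a c =
    (iexp (a * c) - (1 + \<i> * complex_of_real (a * c))) + (complex_of_real (1 - cos a) + \<i> * complex_of_real (c * (a - sin a)))"
    by (simp add: rot_def algebra_simps)
  also have "norm \<dots> \<le> norm (iexp (a * c) - (1 + \<i> * complex_of_real (a * c))) +
      (norm (complex_of_real (1 - cos a)) + norm (\<i> * complex_of_real (c * (a - sin a))))"
    by (intro norm_triangle_le add_left_mono norm_triangle_ineq)
  also have "\<dots> \<le> (a * c)\<^sup>2 / 2 + (a\<^sup>2 / 2 + c * (a\<^sup>2 / 2))"
  proof (intro add_mono e)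
    show "norm (complex_of_real (1 - cos a)) \<le> a\<^sup>2 / 2" using sc(1) by (simp only: norm_of_real abs_minus_commute)
    have "norm (\<i> * complex_of_real (c * (a - sin a))) = c * \<bar>sin a - a\<bar>"
      using c by (simp add: norm_mult abs_mult abs_minus_commute[of a] flip: of_real_diff)
    also have "\<dots> \<le> c * (a\<^sup>2 / 2)" using c sc(2) by (intro mult_left_mono) auto
    finally show "norm (\<i> * complex_of_real (c * (a - sin a))) \<le> c * (a\<^sup>2 / 2)" .
  qed
  also have "\<dots> \<le> 2 * c\<^sup>2 * a\<^sup>2"
  proof -
    have "c * 1 \<le> c * c" using c by (intro mult_left_mono) auto
    then have "1 \<le> c\<^sup>2" "c \<le> c\<^sup>2" unfolding power2_eq_square using c by linarith+
    then have "a\<^sup>2 / 2 * 1 \<le> a\<^sup>2 / 2 * c\<^sup>2" by (intro mult_left_mono) auto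
    moreover have "a\<^sup>2 / 2 * c \<le> a\<^sup>2 / 2 * c\<^sup>2" using \<open>c \<le> c\<^sup>2\<close> by (intro mult_left_mono) auto
    moreover have "0 \<le> a\<^sup>2 * c\<^sup>2" by simp
    moreover have "(a * c)\<^sup>2 / 2 + (a\<^sup>2 / 2 + c * (a\<^sup>2 / 2)) = a\<^sup>2 / 2 * c\<^sup>2 + (a\<^sup>2 / 2 * 1 + a\<^sup>2 / 2 * c)"
      "2 * c\<^sup>2 * a\<^sup>2 = 4 * (a\<^sup>2 / 2 * c\<^sup>2)" "a\<^sup>2 * c\<^sup>2 = 2 * (a\<^sup>2 / 2 * c\<^sup>2)"
      by (simp_all add: power_mult_distrib)
    ultimately show ?thesis by linarith
  qed
  finally show ?thesis by simp
qed

text \<open>The bracket on the right is sinh (\<lambda> y + i u \<lambda> h): sinh is a difference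
  of two exponentials, and the Gaussian mean of each contributes a cross term of its own
  sign.\<close>

lemma gauss_sinh_step:
  fixes u lam y h :: real
  assumes h: "0 \<le> h"
  shows "integrable gauss (\<lambda>z. iexp (u * - (sqrt h * z)) * complex_of_real (sinh (lam * (y - sqrt h * z))))" (is "integrable gauss ?f")
    and "(LINT z|gauss. iexp (u * - (sqrt h * z)) * complex_of_real (sinh (lam * (y - sqrt h * z)))) =
      complex_of_real (exp ((lam\<^sup>2 - u\<^sup>2) * h / 2)) *
      (complex_of_real (sinh (lam * y) * cos (u * lam * h)) + \<i> * complex_of_real (cosh (lam * y) * sin (u * lam * h)))"
      (is "_ = ?r")
proof -
  define a where "a s = - complex_of_real (sqrt h) * (\<i> * complex_of_real u + complex_of_real (s * lam))" for s :: real
  have eq: "?f z = complex_of_real (exp (lam * y) / 2) * exp (complex_of_real z * a 1) -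
      complex_of_real (exp (- lam * y) / 2) * exp (complex_of_real z * a (- 1))" for z
  proof -
    have s: "sinh (lam * (y - sqrt h * z)) =
      exp (lam * y) / 2 * exp (- lam * sqrt h * z) - exp (- lam * y) / 2 * exp (lam * sqrt h * z)"
      by (simp add: sinh_field_def exp_add[symmetric] field_simps)
    have e: "iexp (u * - (sqrt h * z)) * complex_of_real (exp (- s * lam * sqrt h * z)) = exp (complex_of_real z * a s)" for s
      unfolding a_def exp_of_real[symmetric] exp_add[symmetric] by (simp add: algebra_simps)
    have "?f z = complex_of_real (exp (lam * y) / 2) * (iexp (u * - (sqrt h * z)) * complex_of_real (exp (- 1 * lam * sqrt h * z))) -
      complex_of_real (exp (- lam * y) / 2) * (iexp (u * - (sqrt h * z)) * complex_of_real (exp (- (- 1) * lam * sqrt h * z)))"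
      unfolding s by (simp add: algebra_simps)
    then show ?thesis unfolding e .
  qed
  have i: "integrable gauss (\<lambda>z. complex_of_real (exp (lam * y) / 2) * exp (complex_of_real z * a 1))"
    "integrable gauss (\<lambda>z. complex_of_real (exp (- lam * y) / 2) * exp (complex_of_real z * a (- 1)))"
    by (intro integrable_mult_right gauss_complex_exp)+
  show "integrable gauss ?f" unfolding eq by (rule Bochner_Integration.integrable_diff[OF i])
  have sq: "(complex_of_real (sqrt h))\<^sup>2 = complex_of_real h" using h by (simp flip: of_real_power)
  have a2: "(a s)\<^sup>2 / 2 = complex_of_real ((lam\<^sup>2 - u\<^sup>2) * h / 2) + s * (\<i> * complex_of_real (u * lam * h))" if "s\<^sup>2 = 1" for s :: real
  proof -
    have "(complex_of_real s)\<^sup>2 = 1" using that by (metis of_real_1 of_real_power)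
    then have "(\<i> * complex_of_real u + complex_of_real (s * lam))\<^sup>2 =
      complex_of_real (lam\<^sup>2 - u\<^sup>2) + 2 * (s * (\<i> * complex_of_real (u * lam)))"
      by (simp add: power2_sum power_mult_distrib)
    then have "(a s)\<^sup>2 = complex_of_real h * (complex_of_real (lam\<^sup>2 - u\<^sup>2) + 2 * (s * (\<i> * complex_of_real (u * lam))))"
      unfolding a_def power_mult_distrib power2_minus sq by simp
    then show ?thesis by (simp add: field_simps)
  qed
  have "integral\<^sup>L gauss ?f = complex_of_real (exp (lam * y) / 2) * exp ((a 1)\<^sup>2 / 2) -
      complex_of_real (exp (- lam * y) / 2) * exp ((a (- 1))\<^sup>2 / 2)"
    unfolding eq Bochner_Integration.integral_diff[OF i] integral_mult_right_zero gauss_complex_exp ..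
  also have "\<dots> = complex_of_real (exp ((lam\<^sup>2 - u\<^sup>2) * h / 2)) *
     (complex_of_real (exp (lam * y) / 2) * iexp (u * lam * h) - complex_of_real (exp (- lam * y) / 2) * iexp (- (u * lam * h)))"
  proof -
    have "(a 1)\<^sup>2 / 2 = complex_of_real ((lam\<^sup>2 - u\<^sup>2) * h / 2) + \<i> * complex_of_real (u * lam * h)"
      using a2[of 1] by simp
    then have 1: "exp ((a 1)\<^sup>2 / 2) = complex_of_real (exp ((lam\<^sup>2 - u\<^sup>2) * h / 2)) * iexp (u * lam * h)"
      by (simp only: exp_add exp_of_real)
    have "(a (- 1))\<^sup>2 / 2 = complex_of_real ((lam\<^sup>2 - u\<^sup>2) * h / 2) + \<i> * complex_of_real (- (u * lam * h))"
      using a2[of "- 1"] by simp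
    then have 2: "exp ((a (- 1))\<^sup>2 / 2) = complex_of_real (exp ((lam\<^sup>2 - u\<^sup>2) * h / 2)) * iexp (- (u * lam * h))"
      by (simp only: exp_add exp_of_real)
    show ?thesis unfolding 1 2 by (simp only: right_diff_distrib mult.left_commute)
  qed
  also have "complex_of_real (exp (lam * y) / 2) * iexp (u * lam * h) - complex_of_real (exp (- lam * y) / 2) * iexp (- (u * lam * h)) =
    complex_of_real (sinh (lam * y) * cos (u * lam * h)) + \<i> * complex_of_real (cosh (lam * y) * sin (u * lam * h))"
    unfolding cis_conv_exp[symmetric] by (simp add: complex_eq_iff sinh_field_def cosh_field_def field_simps)
  finally show "integral\<^sup>L gauss ?f = ?r" .
qed

context wiener
begin

section \<open>The discretised martingale, stopped at its first exit, and its limit\<close>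

context
  fixes lam x u :: real
  assumes lam: "0 < lam" and x: "0 < x"
begin

definition pos :: "real \<Rightarrow> nat \<Rightarrow> (real \<Rightarrow> real) \<Rightarrow> real" where
  "pos h k w = x - w (real k * h)"

definition alive :: "real \<Rightarrow> nat \<Rightarrow> (real \<Rightarrow> real) \<Rightarrow> bool" where
  "alive h k w \<longleftrightarrow> (\<forall>j\<le>k. 0 < pos h j w)"

text \<open>Each factor 1 / rot undoes the rotation that one Gaussian step puts on sinh, and the
  last exponential undoes its growth; the product with sinh is then a martingale as long as the
  positions are positive. In the limit the factors become the exponential of the coth
  integral.\<close>

definition weight :: "real \<Rightarrow> nat \<Rightarrow> (real \<Rightarrow> real) \<Rightarrow> complex" where
  "weight h k w = (\<Prod>j<k. 1 / rot (u * lam * h) (coth (lam * pos h j w))) * iexp (u * (pos h k w - x)) *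
     complex_of_real (exp ((u\<^sup>2 - lam\<^sup>2) * (real k * h) / 2))"

definition disc :: "real \<Rightarrow> nat \<Rightarrow> (real \<Rightarrow> real) \<Rightarrow> complex" where
  "disc h k w = weight h k w * complex_of_real (sinh (lam * pos h k w))"

text \<open>The process is frozen at the first grid time at or beyond the barrier and is not set to
  0 there, which keeps its mean exactly constant. The overshoot disappears in the limit because sinh
  vanishes at 0.\<close>

primrec stopped :: "real \<Rightarrow> nat \<Rightarrow> (real \<Rightarrow> real) \<Rightarrow> complex" where
  "stopped h 0 w = disc h 0 w"
| "stopped h (Suc k) w = (if alive h k w then disc h (Suc k) w else stopped h k w)"

lemma alive_Suc: "alive h (Suc k) w \<longleftrightarrow> alive h k w \<and> 0 < pos h (Suc k) w"
  by (auto simp: alive_def le_Suc_eq)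

lemma stopped_alive: "alive h k w \<Longrightarrow> stopped h k w = disc h k w"
  by (induction k) (auto simp: alive_Suc)

lemma stopped_dead:
  assumes "0 < pos h 0 w" "\<not> alive h k w"
  obtains j where "j < k" "alive h j w" "pos h (Suc j) w \<le> 0" "stopped h k w = disc h (Suc j) w"
  using assms(2)
proof (induction k arbitrary: thesis)
  case 0
  then show ?case using assms(1) by (simp add: alive_def)
next
  case (Suc k)
  show ?case
  proof (cases "alive h k w")
    case True
    then show ?thesis using Suc.prems by (intro Suc.prems(1)[of k]) (auto simp: alive_Suc)
  next
    case False
    obtain j where j: "j < k" "alive h j w" "pos h (Suc j) w \<le> 0" "stopped h k w = disc h (Suc j) w"
      using Suc.IH[OF _ False] by blast
    show ?thesis by (rule Suc.prems(1)[of j]) (use j False in auto)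
  qed
qed

lemma coth_ge_1: "0 < y \<Longrightarrow> 1 \<le> coth (lam * y)"
  using lam by (intro coth_bounds(1)[of "lam * y"]) auto

text \<open>The rotation factors read positions before step k only, so the bound also holds at the
  exit, where the last position may be negative.\<close>

lemma norm_weight:
  assumes "0 \<le> h" "k = 0 \<or> alive h (k - 1) w"
  shows "norm (weight h k w) \<le> exp (u\<^sup>2 * (real k * h) / 2)"
proof -
  have "norm (1 / rot (u * lam * h) (coth (lam * pos h j w))) \<le> 1" if "j < k" for j
  proof -
    have "0 < pos h j w" using assms(2) that by (auto simp: alive_def)
    from norm_rot[OF coth_ge_1[OF this], of "u * lam * h"] have "1 \<le> norm (rot (u * lam * h) (coth (lam * pos h j w)))" .
    then show ?thesis unfolding norm_divide norm_one by (simp only: divide_le_eq split: if_split) linarith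
  qed
  then have "(\<Prod>j<k. norm (1 / rot (u * lam * h) (coth (lam * pos h j w)))) \<le> 1"
    by (intro prod_le_1) auto
  then have "norm (weight h k w) \<le> 1 * exp ((u\<^sup>2 - lam\<^sup>2) * (real k * h) / 2)"
    unfolding weight_def norm_mult prod_norm[symmetric] by (intro mult_mono) (auto simp: norm_mult prod_nonneg)
  also have "\<dots> \<le> exp (u\<^sup>2 * (real k * h) / 2)"
    using assms(1) by (auto intro!: divide_right_mono mult_right_mono)
  finally show ?thesis .
qed

lemma abs_sinh_le: "\<bar>sinh r\<bar> \<le> exp \<bar>r :: real\<bar>"
proof -
  have "\<bar>sinh r\<bar> = sinh \<bar>r\<bar>" by (simp add: abs_if)
  also have "\<dots> \<le> exp \<bar>r\<bar>" by (simp add: sinh_field_def) (smt (verit) exp_gt_zero)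
  finally show ?thesis .
qed

lemma measurable_pos: "0 \<le> h \<Longrightarrow> j \<le> k \<Longrightarrow> pos h j \<in> borel_measurable (F_upto (real k * h))"
proof -
  assume "0 \<le> h" "j \<le> k"
  then have "(\<lambda>w. w (real j * h)) \<in> borel_measurable (F_upto (real k * h))"
    by (intro measurable_coordinate) (auto intro: mult_right_mono)
  then show ?thesis unfolding pos_def by measurable
qed

lemma measurable_rot:
  assumes [measurable]: "f \<in> borel_measurable M"
  shows "(\<lambda>w. rot a (f w)) \<in> borel_measurable M"
proof -
  define c s where "c = complex_of_real (cos a)" and "s = sin a"
  have "(\<lambda>w. c + \<i> * complex_of_real (f w * s)) \<in> borel_measurable M" by measurable
  then show ?thesis by (simp add: rot_def c_def s_def)
qed

lemma measurable_alive: "0 \<le> h \<Longrightarrow> {w \<in> paths. alive h k w} \<in> sets (F_upto (real k * h))"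
proof -
  assume h: "0 \<le> h"
  have "{w \<in> space (F_upto (real k * h)). \<forall>j\<in>{..k}. 0 < pos h j w} \<in> sets (F_upto (real k * h))"
  proof (intro sets.sets_Collect_finite_All)
    fix j assume "j \<in> {..k}"
    then have [measurable]: "pos h j \<in> borel_measurable (F_upto (real k * h))" using measurable_pos[OF h] by simp
    show "{w \<in> space (F_upto (real k * h)). 0 < pos h j w} \<in> sets (F_upto (real k * h))" by measurable
  qed simp
  moreover have "{w \<in> space (F_upto (real k * h)). \<forall>j\<in>{..k}. 0 < pos h j w} = {w \<in> paths. alive h k w}"
    unfolding alive_def space_path_algebra by blast
  ultimately show ?thesis by (simp only:)
qed

lemma measurable_rot_pos:
  "0 \<le> h \<Longrightarrow> j \<le> k \<Longrightarrow> (\<lambda>w. 1 / rot a (coth (lam * pos h j w))) \<in> borel_measurable (F_upto (real k * h))"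
proof -
  assume "0 \<le> h" "j \<le> k"
  from measurable_pos[OF this] have "(\<lambda>w. coth (lam * pos h j w)) \<in> borel_measurable (F_upto (real k * h))" by measurable
  from measurable_rot[OF this] show ?thesis by measurable
qed

lemma measurable_weight:
  assumes h: "0 \<le> h"
  shows "weight h k \<in> borel_measurable (F_upto (real k * h))"
proof -
  have 1: "(\<lambda>w. \<Prod>j<k. 1 / rot (u * lam * h) (coth (lam * pos h j w))) \<in> borel_measurable (F_upto (real k * h))"
    using h by (intro borel_measurable_prod measurable_rot_pos) auto
  have 2: "pos h k \<in> borel_measurable (F_upto (real k * h))" using measurable_pos[OF h, of k k] by simp
  show ?thesis unfolding weight_def using 1 2 by measurable
qed

lemma measurable_disc:
  assumes h: "0 \<le> h"
  shows "disc h k \<in> borel_measurable (F_upto (real k * h))"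
proof -
  have 2: "pos h k \<in> borel_measurable (F_upto (real k * h))" using measurable_pos[OF h, of k k] by simp
  show ?thesis unfolding disc_def sinh_field_def using measurable_weight[OF h, of k] 2 by measurable
qed

lemma integrable_alive_disc:
  assumes h: "0 \<le> h" and j: "k = j \<or> k = Suc j"
  shows "integrable P (\<lambda>w. indicator {w \<in> paths. alive h j w} w *\<^sub>R disc h k w)"
proof (rule Bochner_Integration.integrable_bound)
  let ?s = "real k * h"
  have s: "0 \<le> ?s" using h by simp
  let ?C = "exp (u\<^sup>2 * ?s / 2)"
  \<comment> \<open>At the exit the position may have either sign, hence both exponentials.\<close>
  show "integrable P (\<lambda>w. ?C * (exp (lam * x) * exp (- lam * w ?s) + exp (- lam * x) * exp (lam * w ?s)))"
    by (intro integrable_mult_right Bochner_Integration.integrable_add integrable_exp s)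
  have "disc h k \<in> borel_measurable P" by (rule measurable_F_P[OF measurable_disc[OF h]])
  moreover have "{w \<in> paths. alive h j w} \<in> sets P" by (rule F_upto_P[OF measurable_alive[OF h]])
  ultimately show "(\<lambda>w. indicator {w \<in> paths. alive h j w} w *\<^sub>R disc h k w) \<in> borel_measurable P" by measurable
  show "AE w in P. norm (indicator {w \<in> paths. alive h j w} w *\<^sub>R disc h k w) \<le>
    norm (?C * (exp (lam * x) * exp (- lam * w ?s) + exp (- lam * x) * exp (lam * w ?s)))"
  proof (rule AE_I2)
    fix w
    show "norm (indicator {w \<in> paths. alive h j w} w *\<^sub>R disc h k w) \<le>
      norm (?C * (exp (lam * x) * exp (- lam * w ?s) + exp (- lam * x) * exp (lam * w ?s)))"
    proof (cases "alive h j w")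
      case True
      have "k = 0 \<or> alive h (k - 1) w" using j True by (cases k) (auto simp: alive_Suc)
      then have "norm (disc h k w) \<le> ?C * \<bar>sinh (lam * pos h k w)\<bar>"
        unfolding disc_def norm_mult norm_of_real by (intro mult_right_mono norm_weight h) auto
      also have "\<bar>sinh (lam * pos h k w)\<bar> \<le> exp (lam * pos h k w) + exp (- lam * pos h k w)"
        by (rule order_trans[OF abs_sinh_le]) (simp add: abs_if)
      also have "\<dots> = exp (lam * x) * exp (- lam * w ?s) + exp (- lam * x) * exp (lam * w ?s)"
        by (simp add: pos_def exp_add[symmetric] algebra_simps)
      finally have "norm (disc h k w) \<le> ?C * (exp (lam * x) * exp (- lam * w ?s) + exp (- lam * x) * exp (lam * w ?s))" by simp
      then show ?thesis by (auto simp: indicator_def add_nonneg_nonneg)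
    qed simp
  qed
qed

text \<open>Given the path up to the k-th grid time, integrate out the Gaussian increment with
  \<open>gauss_sinh_step\<close>: sinh is multiplied by \<open>rot\<close> at the current position,
  and the new factor of the weight cancels it.\<close>

lemma disc_step:
  assumes h: "0 \<le> h"
  shows "(LINT w|P. indicator {w \<in> paths. alive h k w} w *\<^sub>R disc h (Suc k) w) =
    (LINT w|P. indicator {w \<in> paths. alive h k w} w *\<^sub>R disc h k w)"
proof -
  let ?s = "real k * h" and ?t = "real (Suc k) * h"
  have st: "0 \<le> ?s" "?s \<le> ?t" "?t - ?s = h" using h by (auto simp: algebra_simps)
  let ?A = "{w \<in> paths. alive h k w}"
  let ?C = "\<lambda>k. complex_of_real (exp ((u\<^sup>2 - lam\<^sup>2) * (real k * h) / 2))"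
  define g where "g w = indicator ?A w *\<^sub>R ((\<Prod>j<Suc k. 1 / rot (u * lam * h) (coth (lam * pos h j w))) *
    iexp (u * (pos h k w - x)) * ?C (Suc k))" for w
  define f where "f p = g (fst p) * (iexp (u * - snd p) * complex_of_real (sinh (lam * (pos h k (fst p) - snd p))))"
    for p :: "(real \<Rightarrow> real) \<times> real"
  have Am: "?A \<in> sets (F_upto ?s)" by (rule measurable_alive[OF h])
  have pm: "pos h k \<in> borel_measurable (F_upto ?s)" using measurable_pos[OF h, of k k] by simp
  have prm: "(\<lambda>w. \<Prod>j<Suc k. 1 / rot (u * lam * h) (coth (lam * pos h j w))) \<in> borel_measurable (F_upto ?s)"
    using h by (intro borel_measurable_prod measurable_rot_pos) auto
  have gm: "g \<in> borel_measurable (F_upto ?s)" unfolding g_def using Am pm prm by measurable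
  have f: "f \<in> borel_measurable (F_upto ?s \<Otimes>\<^sub>M borel)"
    unfolding f_def sinh_field_def using measurable_compose[OF measurable_fst gm] measurable_compose[OF measurable_fst pm] by measurable
  have eq: "indicator ?A w *\<^sub>R disc h (Suc k) w = f (w, w ?t - w ?s)" for w
  proof -
    have p: "pos h (Suc k) w = pos h k w - (w ?t - w ?s)" by (simp add: pos_def)
    have E: "iexp (u * (pos h (Suc k) w - x)) = iexp (u * (pos h k w - x)) * iexp (u * - (w ?t - w ?s))"
      unfolding p by (simp add: exp_add[symmetric] algebra_simps)
    show ?thesis
      unfolding disc_def weight_def E f_def g_def fst_conv snd_conv p[symmetric] mult_scaleR_left
      by (simp only: mult_ac)
  qed
  have i: "integrable P (\<lambda>w. f (w, w ?t - w ?s))"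
    using integrable_alive_disc[OF h, of "Suc k" k] unfolding eq by simp
  have "(LINT w|P. indicator ?A w *\<^sub>R disc h (Suc k) w) = (LINT w|P. LINT z|gauss. f (w, sqrt (?t - ?s) * z))"
    unfolding eq by (rule integral_increment[OF st(1,2) f i])
  also have "\<dots> = (LINT w|P. indicator ?A w *\<^sub>R disc h k w)"
  proof (rule Bochner_Integration.integral_cong[OF refl])
    fix w
    let ?y = "pos h k w" and ?a = "u * lam * h"
    have "(LINT z|gauss. f (w, sqrt (?t - ?s) * z)) =
      g w * (complex_of_real (exp ((lam\<^sup>2 - u\<^sup>2) * h / 2)) *
      (complex_of_real (sinh (lam * ?y) * cos ?a) + \<i> * complex_of_real (cosh (lam * ?y) * sin ?a)))"
      unfolding st(3) f_def fst_conv snd_conv integral_mult_right_zero gauss_sinh_step(2)[OF h] ..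
    also have "\<dots> = indicator ?A w *\<^sub>R disc h k w"
    proof (cases "w \<in> ?A")
      case True
      then have y: "0 < ?y" by (simp add: alive_def)
      then have s: "sinh (lam * ?y) \<noteq> 0" using lam by simp
      have r: "complex_of_real (sinh (lam * ?y) * cos ?a) + \<i> * complex_of_real (cosh (lam * ?y) * sin ?a) =
        complex_of_real (sinh (lam * ?y)) * rot ?a (coth (lam * ?y))"
        using s by (simp add: rot_def coth_def complex_eq_iff)
      have r0: "rot ?a (coth (lam * ?y)) \<noteq> 0" using norm_rot[OF coth_ge_1[OF y], of ?a] by auto
      have c: "?C (Suc k) * complex_of_real (exp ((lam\<^sup>2 - u\<^sup>2) * h / 2)) = ?C k"
        unfolding of_real_mult[symmetric] exp_add[symmetric] by (simp add: field_simps)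
      have "g w * (complex_of_real (exp ((lam\<^sup>2 - u\<^sup>2) * h / 2)) *
          (complex_of_real (sinh (lam * ?y)) * rot ?a (coth (lam * ?y)))) =
        (\<Prod>j<k. 1 / rot ?a (coth (lam * pos h j w))) * iexp (u * (?y - x)) *
        (?C (Suc k) * complex_of_real (exp ((lam\<^sup>2 - u\<^sup>2) * h / 2))) * complex_of_real (sinh (lam * ?y))"
        using True r0 by (simp add: g_def mult.assoc mult.left_commute del: of_nat_Suc)
      then show ?thesis unfolding r c using True by (simp add: disc_def weight_def)
    qed (simp add: g_def)
    finally show "(LINT z|gauss. f (w, sqrt (?t - ?s) * z)) = indicator ?A w *\<^sub>R disc h k w" .
  qed
  finally show ?thesis .
qed

text \<open>Optional stopping in discrete time: the stopped process moves by the martingale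
  increment on the paths that are still alive.\<close>

lemma integral_stopped:
  assumes h: "0 \<le> h"
  shows "integrable P (stopped h k) \<and> (LINT w|P. stopped h k w) = complex_of_real (sinh (lam * x))"
proof (induction k)
  case 0
  have a: "AE w in P. w \<in> paths \<and> alive h 0 w"
    using start_0 AE_paths by eventually_elim (use x in \<open>simp add: alive_def pos_def\<close>)
  have "integrable P (disc h 0)"
  proof (rule integrable_cong_AE_imp[OF integrable_alive_disc[OF h, of 0 0]])
    show "disc h 0 \<in> borel_measurable P" by (rule measurable_F_P[OF measurable_disc[OF h]])
    show "AE w in P. indicator {w \<in> paths. alive h 0 w} w *\<^sub>R disc h 0 w = disc h 0 w"
      using a by eventually_elim simp
  qed simp
  moreover have "(LINT w|P. disc h 0 w) = (LINT w|P. complex_of_real (sinh (lam * x)))"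
  proof (rule integral_cong_AE)
    show "disc h 0 \<in> borel_measurable P" by (rule measurable_F_P[OF measurable_disc[OF h]])
    show "AE w in P. disc h 0 w = complex_of_real (sinh (lam * x))"
      using start_0 by eventually_elim (simp add: disc_def weight_def pos_def)
  qed simp
  ultimately show ?case using emeasure_space_1 by (simp add: measure_def fun_eq_iff)
next
  case (Suc k)
  let ?A = "{w \<in> paths. alive h k w}"
  have eq: "stopped h (Suc k) w = stopped h k w + (indicator ?A w *\<^sub>R disc h (Suc k) w - indicator ?A w *\<^sub>R disc h k w)"
    if "w \<in> space P" for w
    using that by (auto simp: indicator_def stopped_alive)
  have i: "integrable P (\<lambda>w. indicator ?A w *\<^sub>R disc h (Suc k) w)" "integrable P (\<lambda>w. indicator ?A w *\<^sub>R disc h k w)"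
    using integrable_alive_disc[OF h] by auto
  note d = Bochner_Integration.integrable_diff[OF i]
  have "integrable P (stopped h (Suc k)) \<longleftrightarrow>
    integrable P (\<lambda>w. stopped h k w + (indicator ?A w *\<^sub>R disc h (Suc k) w - indicator ?A w *\<^sub>R disc h k w))"
    by (rule Bochner_Integration.integrable_cong[OF refl eq])
  moreover have "integrable P (\<lambda>w. stopped h k w + (indicator ?A w *\<^sub>R disc h (Suc k) w - indicator ?A w *\<^sub>R disc h k w))"
    using Suc by (intro Bochner_Integration.integrable_add d) auto
  moreover have "(LINT w|P. stopped h (Suc k) w) =
    (LINT w|P. stopped h k w + (indicator ?A w *\<^sub>R disc h (Suc k) w - indicator ?A w *\<^sub>R disc h k w))"
    by (rule Bochner_Integration.integral_cong[OF refl eq])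
  moreover have "\<dots> = (LINT w|P. stopped h k w)"
    using Suc d by (simp only: Bochner_Integration.integral_add Bochner_Integration.integral_diff[OF i] disc_step[OF h] diff_self add_0_right)
  ultimately show ?case using Suc by (simp del: stopped.simps)
qed

text \<open>A bound free of the number of steps. The first term serves the paths still below the
  barrier, the second the overshoot at the exit, which is at most S_t - x.\<close>

lemma stopped_bound:
  assumes w: "w \<in> paths" "w 0 = 0" and h: "0 \<le> h" and t: "real k * h = t"
  shows "norm (stopped h k w) \<le> exp (u\<^sup>2 * t / 2) * (exp (lam * x) * exp (- lam * w t) + exp (lam * running_sup t w))"
proof (cases "alive h k w")
  case True
  then have p: "0 < pos h k w" by (simp add: alive_def)
  have "k = 0 \<or> alive h (k - 1) w" using True by (cases k) (auto simp: alive_Suc)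
  then have "norm (disc h k w) \<le> exp (u\<^sup>2 * (real k * h) / 2) * \<bar>sinh (lam * pos h k w)\<bar>"
    unfolding disc_def norm_mult norm_of_real by (intro mult_right_mono norm_weight h) auto
  also have "\<dots> \<le> exp (u\<^sup>2 * t / 2) * (exp (lam * x) * exp (- lam * w t))"
    unfolding t
  proof (rule mult_left_mono)
    have "\<bar>sinh (lam * pos h k w)\<bar> \<le> exp (lam * pos h k w)"
      using abs_sinh_le[of "lam * pos h k w"] p lam by (simp add: abs_mult)
    also have "\<dots> = exp (lam * x) * exp (- lam * w t)"
      unfolding pos_def t by (simp add: exp_add[symmetric] algebra_simps)
    finally show "\<bar>sinh (lam * pos h k w)\<bar> \<le> exp (lam * x) * exp (- lam * w t)" .
  qed simp
  also have "\<dots> \<le> exp (u\<^sup>2 * t / 2) * (exp (lam * x) * exp (- lam * w t) + exp (lam * running_sup t w))"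
    by (intro mult_left_mono) auto
  finally show ?thesis using True by (simp add: stopped_alive)
next
  case False
  have "0 < pos h 0 w" using w x by (simp add: pos_def)
  from this False obtain j where j: "j < k" "alive h j w" "pos h (Suc j) w \<le> 0" "stopped h k w = disc h (Suc j) w"
    by (rule stopped_dead)
  have jt: "real (Suc j) * h \<le> t" unfolding t[symmetric] using j(1) h by (intro mult_right_mono) auto
  have "norm (disc h (Suc j) w) \<le> exp (u\<^sup>2 * (real (Suc j) * h) / 2) * \<bar>sinh (lam * pos h (Suc j) w)\<bar>"
    unfolding disc_def norm_mult norm_of_real using j by (intro mult_right_mono norm_weight h) auto
  also have "\<dots> \<le> exp (u\<^sup>2 * t / 2) * exp (lam * running_sup t w)"
  proof (rule mult_mono)
    show "exp (u\<^sup>2 * (real (Suc j) * h) / 2) \<le> exp (u\<^sup>2 * t / 2)"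
      using jt by (simp add: mult_left_mono del: of_nat_Suc)
    have "\<bar>sinh (lam * pos h (Suc j) w)\<bar> \<le> exp (lam * - pos h (Suc j) w)"
      using abs_sinh_le[of "lam * pos h (Suc j) w"] j(3) lam by (simp add: abs_mult)
    also have "\<dots> \<le> exp (lam * running_sup t w)"
    proof -
      have "w (real (Suc j) * h) \<le> running_sup t w" using h jt by (intro running_sup_ge w) auto
      then show ?thesis using lam x by (simp add: pos_def del: of_nat_Suc)
    qed
    finally show "\<bar>sinh (lam * pos h (Suc j) w)\<bar> \<le> exp (lam * running_sup t w)" .
  qed auto
  also have "\<dots> \<le> exp (u\<^sup>2 * t / 2) * (exp (lam * x) * exp (- lam * w t) + exp (lam * running_sup t w))"
    by (intro mult_left_mono) auto
  finally show ?thesis using j by simp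
qed

text \<open>The path keeps a distance m from the barrier, so all values of coth lie between 1 and C.
  Replacing every 1 / rot by an exponential costs O(1 / n) in total, and the exponents form a
  Riemann sum.\<close>

lemma stopped_tendsto_below:
  assumes w: "w \<in> paths" and t: "0 < t" and S: "running_sup t w < x"
  shows "(\<lambda>n. stopped (t / real (Suc n)) (Suc n) w) \<longlonglongrightarrow>
    iexp (- (u * lam) * coth_int lam x t w) * iexp (u * - w t) *
    complex_of_real (exp ((u\<^sup>2 - lam\<^sup>2) * t / 2)) * complex_of_real (sinh (lam * (x - w t)))"
proof -
  define m where "m = x - running_sup t w"
  have m: "0 < m" using S by (simp add: m_def)
  define C where "C = coth (lam * m)"
  define h where "h n = t / real (Suc n)" for n
  define c where "c n j = coth (lam * pos (h n) j w)" for n j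
  have h: "0 < h n" "real (Suc n) * h n = t" for n using t by (simp_all add: h_def)
  have pos_m: "m \<le> pos (h n) j w" if "j \<le> Suc n" for n j
  proof -
    have "real j * h n \<le> real (Suc n) * h n" using that h[of n] by (intro mult_right_mono) auto
    then have "real j * h n \<le> t" unfolding h(2) .
    then have "w (real j * h n) \<le> running_sup t w" using h(1)[of n] by (intro running_sup_ge[OF w]) auto
    then show ?thesis by (simp add: pos_def m_def)
  qed
  have c: "1 \<le> c n j" "c n j \<le> C" if "j \<le> Suc n" for n j
    unfolding c_def C_def using lam m pos_m[OF that]
    by (auto intro!: coth_bounds[of "lam * m" "lam * pos (h n) j w"] mult_left_mono)
  have alive: "alive (h n) (Suc n) w" for n
    using pos_m m unfolding alive_def by (meson less_le_trans)
  define pr where "pr n = (\<Prod>j<Suc n. 1 / rot (u * lam * h n) (c n j))" for n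
  define pe where "pe n = (\<Prod>j<Suc n. iexp (- (u * lam * h n * c n j)))" for n
  \<comment> \<open>All factors have modulus at most 1, so the errors of the single factors add up:
    n + 1 terms, each of second order in the step size.\<close>
  have diff: "norm (pr n - pe n) \<le> 2 * C\<^sup>2 * (u * lam * t)\<^sup>2 * (1 / real (Suc n))" for n
  proof -
    have "norm (pr n - pe n) \<le> (\<Sum>j<Suc n. norm (1 / rot (u * lam * h n) (c n j) - iexp (- (u * lam * h n * c n j))))"
      unfolding pr_def pe_def
    proof (rule norm_prod_diff)
      fix j assume "j \<in> {..<Suc n}"
      then have "1 \<le> norm (rot (u * lam * h n) (c n j))" by (intro norm_rot c) auto
      then show "norm (1 / rot (u * lam * h n) (c n j)) \<le> 1"
        unfolding norm_divide norm_one by (simp only: divide_le_eq split: if_split) linarith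
    qed simp
    also have "\<dots> \<le> (\<Sum>j<Suc n. 2 * C\<^sup>2 * (u * lam * h n)\<^sup>2)"
    proof (rule sum_mono)
      fix j assume "j \<in> {..<Suc n}"
      then have cj: "1 \<le> c n j" "c n j \<le> C" using c[of j n] by auto
      have "norm (1 / rot (u * lam * h n) (c n j) - iexp (- (u * lam * h n * c n j))) \<le> 2 * (c n j)\<^sup>2 * (u * lam * h n)\<^sup>2"
        by (rule rot_approx[OF cj(1)])
      also have "\<dots> \<le> 2 * C\<^sup>2 * (u * lam * h n)\<^sup>2"
        using cj by (intro mult_right_mono mult_left_mono power_mono) auto
      finally show "norm (1 / rot (u * lam * h n) (c n j) - iexp (- (u * lam * h n * c n j))) \<le> 2 * C\<^sup>2 * (u * lam * h n)\<^sup>2" .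
    qed
    also have "\<dots> = 2 * C\<^sup>2 * (u * lam * t)\<^sup>2 * (1 / real (Suc n))"
      by (simp add: h_def power2_eq_square del: of_nat_Suc)
    finally show ?thesis .
  qed
  have "(\<lambda>n. 2 * C\<^sup>2 * (u * lam * t)\<^sup>2 * (1 / real (Suc n))) \<longlonglongrightarrow> 2 * C\<^sup>2 * (u * lam * t)\<^sup>2 * 0"
    by (intro tendsto_mult tendsto_const LIMSEQ_inverse_real_of_nat[unfolded inverse_eq_divide])
  then have 0: "(\<lambda>n. 2 * C\<^sup>2 * (u * lam * t)\<^sup>2 * (1 / real (Suc n))) \<longlonglongrightarrow> 0" by (simp only: mult_zero_right)
  have d0: "(\<lambda>n. pr n - pe n) \<longlonglongrightarrow> 0"
    by (rule Lim_null_comparison[OF always_eventually[OF allI[OF diff]] 0])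
  have pe: "pe n = iexp (- (u * lam) * (\<Sum>j<Suc n. t / real (Suc n) * coth (lam * (x - w (real j * (t / real (Suc n)))))))" for n
  proof -
    have "pe n = exp (\<Sum>j<Suc n. \<i> * complex_of_real (- (u * lam * h n * c n j)))"
      unfolding pe_def by (simp only: exp_sum finite_lessThan)
    also have "(\<Sum>j<Suc n. \<i> * complex_of_real (- (u * lam * h n * c n j))) =
      \<i> * complex_of_real (\<Sum>j<Suc n. - (u * lam * h n * c n j))"
      by (simp only: sum_distrib_left of_real_sum)
    also have "(\<Sum>j<Suc n. - (u * lam * h n * c n j)) =
      - (u * lam) * (\<Sum>j<Suc n. t / real (Suc n) * coth (lam * (x - w (real j * (t / real (Suc n))))))"
      unfolding sum_distrib_left c_def pos_def h_def by (intro sum.cong refl) (simp only: mult_minus_left mult.assoc)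
    finally show ?thesis .
  qed
  have "(\<lambda>n. \<Sum>j<Suc n. t / real (Suc n) * coth (lam * (x - w (real j * (t / real (Suc n)))))) \<longlonglongrightarrow> coth_int lam x t w"
    unfolding coth_int_eq_integral(2)[OF w less_imp_le[OF t] S lam]
    by (rule riemann_sum_tendsto[OF t continuous_coth_path[OF w less_imp_le[OF t] S lam]])
  then have "pe \<longlonglongrightarrow> iexp (- (u * lam) * coth_int lam x t w)"
    unfolding pe by (intro tendsto_exp tendsto_mult tendsto_of_real tendsto_const)
  from tendsto_add[OF d0 this] have "pr \<longlonglongrightarrow> iexp (- (u * lam) * coth_int lam x t w)" by simp
  then have "(\<lambda>n. pr n * iexp (u * - w t) *
    complex_of_real (exp ((u\<^sup>2 - lam\<^sup>2) * t / 2)) * complex_of_real (sinh (lam * (x - w t)))) \<longlonglongrightarrow>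
    iexp (- (u * lam) * coth_int lam x t w) * iexp (u * - w t) *
    complex_of_real (exp ((u\<^sup>2 - lam\<^sup>2) * t / 2)) * complex_of_real (sinh (lam * (x - w t)))"
    by (intro tendsto_mult tendsto_const)
  also have "(\<lambda>n. pr n * iexp (u * - w t) *
    complex_of_real (exp ((u\<^sup>2 - lam\<^sup>2) * t / 2)) * complex_of_real (sinh (lam * (x - w t)))) =
    (\<lambda>n. stopped (t / real (Suc n)) (Suc n) w)"
  proof
    fix n
    have p: "pos (h n) (Suc n) w = x - w t" unfolding pos_def h(2) ..
    have "stopped (t / real (Suc n)) (Suc n) w = disc (h n) (Suc n) w"
      unfolding h_def[symmetric] by (rule stopped_alive[OF alive])
    also have "\<dots> = pr n * iexp (u * - w t) *
      complex_of_real (exp ((u\<^sup>2 - lam\<^sup>2) * t / 2)) * complex_of_real (sinh (lam * (x - w t)))"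
      unfolding disc_def weight_def p h(2) pr_def c_def by simp
    finally show "pr n * iexp (u * - w t) *
      complex_of_real (exp ((u\<^sup>2 - lam\<^sup>2) * t / 2)) * complex_of_real (sinh (lam * (x - w t))) =
      stopped (t / real (Suc n)) (Suc n) w" ..
  qed
  finally show ?thesis .
qed

text \<open>A fine grid sees the crossing, and by uniform continuity the exit position is close to
  the barrier, where sinh is small.\<close>

lemma stopped_tendsto_above:
  assumes w: "w \<in> paths" "w 0 = 0" and t: "0 < t" and S: "x < running_sup t w"
  shows "(\<lambda>n. stopped (t / real (Suc n)) (Suc n) w) \<longlonglongrightarrow> 0"
proof (rule LIMSEQ_I)
  fix r :: real assume r: "0 < r"
  define K where "K = exp (u\<^sup>2 * t / 2)"
  define e where "e = arsinh (r / (2 * K)) / lam"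
  have K: "0 < K" by (simp add: K_def)
  have se: "sinh (lam * e) = r / (2 * K)" using lam by (simp add: e_def)
  have e: "0 < e"
  proof -
    have "0 < sinh (lam * e)" unfolding se using r K by simp
    then show ?thesis using lam by (simp add: zero_less_mult_iff)
  qed
  have "uniformly_continuous_on {0..t} w"
    by (rule compact_uniformly_continuous[OF continuous_on_subset[OF paths_continuous[OF w(1)]]]) auto
  then obtain d where d: "0 < d" "\<And>a b. a \<in> {0..t} \<Longrightarrow> b \<in> {0..t} \<Longrightarrow> dist b a < d \<Longrightarrow> dist (w b) (w a) < e"
    using e unfolding uniformly_continuous_on_def by metis
  obtain N :: nat where N: "t / d < real N" using reals_Archimedean2 by blast
  obtain v where v: "v \<in> {0..t}" "x < w v"
    using S running_sup_le_iff[OF w(1), of t x] t by (force simp: not_le)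
  \<comment> \<open>At some time v the path is strictly above the barrier. Grid times converge to v,
    so on fine grids one of them is above the barrier as well.\<close>
  have "(\<lambda>n. t * (real_of_int \<lfloor>real (Suc n) * (v / t)\<rfloor> / real (Suc n))) \<longlonglongrightarrow> t * (v / t)"
    by (intro tendsto_mult tendsto_const floor_grid_tendsto)
  then have gr: "(\<lambda>n. t * (real_of_int \<lfloor>real (Suc n) * (v / t)\<rfloor> / real (Suc n))) \<longlonglongrightarrow> v" using t by simp
  have "(\<lambda>n. w (t * (real_of_int \<lfloor>real (Suc n) * (v / t)\<rfloor> / real (Suc n)))) \<longlonglongrightarrow> w v"
    by (rule paths_tendsto[OF w(1) _ gr]) (use t v in \<open>auto intro!: mult_nonneg_nonneg divide_nonneg_nonneg\<close>)
  then have "\<forall>\<^sub>F n in sequentially. x < w (t * (real_of_int \<lfloor>real (Suc n) * (v / t)\<rfloor> / real (Suc n)))"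
    by (rule order_tendstoD(1)[OF _ v(2)])
  then obtain N' where N': "\<And>n. N' \<le> n \<Longrightarrow> x < w (t * (real_of_int \<lfloor>real (Suc n) * (v / t)\<rfloor> / real (Suc n)))"
    unfolding eventually_sequentially by blast
  have "norm (stopped (t / real (Suc n)) (Suc n) w - 0) < r" if n: "max N N' \<le> n" for n
  proof -
    define h where "h = t / real (Suc n)"
    have h: "0 < h" "real (Suc n) * h = t" using t by (simp_all add: h_def)
    have "t / d < real (Suc n)" using N n by simp
    then have hd: "h < d" using d(1) by (simp add: h_def field_simps)
    have "\<not> alive h (Suc n) w"
    proof
      assume a: "alive h (Suc n) w"
      define j where "j = nat \<lfloor>real (Suc n) * (v / t)\<rfloor>"
      have j: "real j = real_of_int \<lfloor>real (Suc n) * (v / t)\<rfloor>" using v t by (simp add: j_def)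
      have "real (Suc n) * (v / t) \<le> real (Suc n) * 1" using v t by (intro mult_left_mono) auto
      then have "real_of_int \<lfloor>real (Suc n) * (v / t)\<rfloor> \<le> real (Suc n)"
        unfolding mult_1_right by (rule order_trans[OF of_int_floor_le])
      then have "real j \<le> real (Suc n)" unfolding j .
      then have "0 < pos h j w" using a unfolding alive_def by (simp only: of_nat_le_iff)
      moreover have "real j * h = t * (real_of_int \<lfloor>real (Suc n) * (v / t)\<rfloor> / real (Suc n))"
        unfolding j h_def by simp
      ultimately show False using N'[of n] n by (simp add: pos_def)
    qed
    moreover have "0 < pos h 0 w" using w x by (simp add: pos_def)
    ultimately obtain j where j: "j < Suc n" "alive h j w" "pos h (Suc j) w \<le> 0" "stopped h (Suc n) w = disc h (Suc j) w"
      by (metis stopped_dead)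
    have jt: "real (Suc j) * h \<le> t" unfolding h(2)[symmetric] using j(1) h by (intro mult_right_mono) auto
    have "dist (real (Suc j) * h) (real j * h) < d" using hd h(1) by (simp add: dist_real_def algebra_simps)
    then have "dist (w (real (Suc j) * h)) (w (real j * h)) < e"
      using jt h(1) by (intro d(2)) (auto simp: algebra_simps)
    moreover have "0 < pos h j w" using j(2) by (simp add: alive_def)
    \<comment> \<open>The position was positive one step earlier and is not positive now, so its
      size is at most the oscillation of the path over one step.\<close>
    ultimately have p: "\<bar>pos h (Suc j) w\<bar> \<le> e" using j(3) unfolding pos_def dist_real_def by linarith
    have "norm (disc h (Suc j) w) \<le> exp (u\<^sup>2 * (real (Suc j) * h) / 2) * \<bar>sinh (lam * pos h (Suc j) w)\<bar>"
      unfolding disc_def norm_mult norm_of_real using j h by (intro mult_right_mono norm_weight) auto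
    also have "\<dots> \<le> K * sinh (lam * e)"
    proof (rule mult_mono)
      show "exp (u\<^sup>2 * (real (Suc j) * h) / 2) \<le> K"
        unfolding K_def using jt by (simp add: mult_left_mono del: of_nat_Suc)
      have "\<bar>sinh (lam * pos h (Suc j) w)\<bar> = sinh (lam * \<bar>pos h (Suc j) w\<bar>)"
        using lam j(3) by (simp add: abs_if mult_less_0_iff mult_le_0_iff)
      also have "\<dots> \<le> sinh (lam * e)" using p lam by simp
      finally show "\<bar>sinh (lam * pos h (Suc j) w)\<bar> \<le> sinh (lam * e)" .
    qed (use K in auto)
    also have "\<dots> = r / 2" unfolding se using K by simp
    finally show ?thesis using j(4) r by (simp add: h_def)
  qed
  then show "\<exists>no. \<forall>n\<ge>no. norm (stopped (t / real (Suc n)) (Suc n) w - 0) < r" by blast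
qed

text \<open>Dominated convergence in the discrete identity; the event S_t = x, where neither
  pathwise limit applies, is null for t > 0. At u = 0 this normalises the transform by sinh, and for
  general u it is the characteristic function of the noise.\<close>

lemma feynman_kac:
  assumes t: "0 \<le> t"
  shows "integrable P (\<lambda>w. indicator {w \<in> paths. running_sup t w < x} w *\<^sub>R
      (complex_of_real (sinh (lam * (x - w t))) * iexp (u * (- w t - lam * coth_int lam x t w))))" (is "integrable P ?f")
    and "(LINT w|P. indicator {w \<in> paths. running_sup t w < x} w *\<^sub>R
      (complex_of_real (sinh (lam * (x - w t))) * iexp (u * (- w t - lam * coth_int lam x t w)))) =
      complex_of_real (sinh (lam * x) * exp ((lam\<^sup>2 - u\<^sup>2) * t / 2))"
proof -
  have wm: "(\<lambda>w. w t) \<in> borel_measurable P" by (rule coord_P[OF t])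
  have cm: "(\<lambda>w. coth_int lam x t w) \<in> borel_measurable P"
    using t by (intro measurable_coth_int[OF ident_P]) auto
  have Sm: "{w \<in> paths. running_sup t w < x} \<in> sets P"
    using sup_P[OF t] by (simp del: space_P add: space_P[symmetric])
  have f: "?f \<in> borel_measurable P" unfolding sinh_field_def using wm cm Sm by measurable
  have "integrable P ?f \<and> integral\<^sup>L P ?f = complex_of_real (sinh (lam * x) * exp ((lam\<^sup>2 - u\<^sup>2) * t / 2))"
  proof (cases "t = 0")
    case True
    have ae: "AE w in P. ?f w = complex_of_real (sinh (lam * x))"
      using start_0 AE_paths
    proof eventually_elim
      case (elim w)
      have "coth_int lam x 0 w = integral {0..0} (\<lambda>r. coth (lam * (x - w r)))"
        using elim x lam by (intro coth_int_eq_integral) (auto simp: running_sup_def)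
      then show ?case using True elim x by (simp add: running_sup_def)
    qed
    then have "integrable P ?f \<longleftrightarrow> integrable P (\<lambda>w. complex_of_real (sinh (lam * x)))"
      using f by (intro integrable_cong_AE) auto
    moreover have "integral\<^sup>L P ?f = integral\<^sup>L P (\<lambda>w. complex_of_real (sinh (lam * x)))"
      using f ae by (intro integral_cong_AE) auto
    ultimately show ?thesis using True emeasure_space_1 by (simp add: measure_def)
  next
    case False
    then have t: "0 < t" using t by simp
    define e where "e = complex_of_real (exp ((u\<^sup>2 - lam\<^sup>2) * t / 2))"
    define g where "g n w = stopped (t / real (Suc n)) (Suc n) w" for n w
    define b where "b w = exp (u\<^sup>2 * t / 2) * (exp (lam * x) * exp (- lam * w t) + exp (lam * running_sup t w))" for w
    have g: "integrable P (g n)" "integral\<^sup>L P (g n) = complex_of_real (sinh (lam * x))" for n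
      using integral_stopped[of "t / real (Suc n)" "Suc n"] t unfolding g_def[abs_def] by (auto simp del: stopped.simps)
    have b: "integrable P b"
      unfolding b_def[abs_def] using t lam
      by (intro integrable_mult_right Bochner_Integration.integrable_add integrable_exp integrable_exp_sup) auto
    have m1: "(\<lambda>w. e * ?f w) \<in> borel_measurable P" using f by measurable
    have lim: "AE w in P. (\<lambda>n. g n w) \<longlonglongrightarrow> e * ?f w"
      using start_0 AE_paths sup_no_atom[OF less_imp_le[OF t] x]
    proof eventually_elim
      case (elim w)
      show ?case
      proof (cases "running_sup t w < x")
        case True
        have "iexp (u * (- w t - lam * coth_int lam x t w)) =
          iexp (- (u * lam) * coth_int lam x t w) * iexp (u * - w t)"
          by (simp add: exp_add[symmetric] algebra_simps)
        then have "e * ?f w = iexp (- (u * lam) * coth_int lam x t w) * iexp (u * - w t) *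
          complex_of_real (exp ((u\<^sup>2 - lam\<^sup>2) * t / 2)) * complex_of_real (sinh (lam * (x - w t)))"
          using elim True by (simp add: e_def mult_ac)
        then show ?thesis unfolding g_def using stopped_tendsto_below[OF elim(2) t True] by (simp only:)
      next
        case False
        then have "e * ?f w = 0" by simp
        then show ?thesis unfolding g_def using stopped_tendsto_above[OF elim(2,1) t] False elim(3) by simp
      qed
    qed
    have bd: "AE w in P. norm (g n w) \<le> b w" for n
      using start_0 AE_paths
    proof eventually_elim
      case (elim w)
      show ?case unfolding g_def b_def using t by (intro stopped_bound elim) auto
    qed
    have gm: "g n \<in> borel_measurable P" for n using g(1) by (rule borel_measurable_integrable)
    have i: "integrable P (\<lambda>w. e * ?f w)" by (rule integrable_dominated_convergence[OF m1 gm b lim bd])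
    have "(\<lambda>n. integral\<^sup>L P (g n)) \<longlonglongrightarrow> (LINT w|P. e * ?f w)"
      by (rule integral_dominated_convergence[OF m1 gm b lim bd])
    then have "(LINT w|P. e * ?f w) = complex_of_real (sinh (lam * x))"
      unfolding g(2) by (rule LIMSEQ_unique[OF _ tendsto_const, symmetric, THEN sym])
    then have I: "e * integral\<^sup>L P ?f = complex_of_real (sinh (lam * x))" by (simp only: integral_mult_right_zero)
    have e': "complex_of_real (exp ((lam\<^sup>2 - u\<^sup>2) * t / 2)) * e = 1"
      unfolding e_def of_real_mult[symmetric] exp_add[symmetric] by (simp add: field_simps)
    have "integrable P (\<lambda>w. complex_of_real (exp ((lam\<^sup>2 - u\<^sup>2) * t / 2)) * (e * ?f w))"
      by (intro integrable_mult_right i)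
    then have "integrable P ?f" unfolding mult.assoc[symmetric] e' by (simp only: mult_1)
    moreover have "integral\<^sup>L P ?f = complex_of_real (exp ((lam\<^sup>2 - u\<^sup>2) * t / 2)) * (e * integral\<^sup>L P ?f)"
      unfolding mult.assoc[symmetric] e' by (simp only: mult_1)
    ultimately show ?thesis unfolding I by (simp add: mult.commute)
  qed
  then show "integrable P ?f"
    and "integral\<^sup>L P ?f = complex_of_real (sinh (lam * x) * exp ((lam\<^sup>2 - u\<^sup>2) * t / 2))" by auto
qed

end

end

section \<open>Comparison with the coth process\<close>

text \<open>Take the last time up to t at which the function is at most c. From there to t it stays
  above c, so it has not grown.\<close>

lemma le_if_no_upcrossing:
  fixes \<phi> :: "real \<Rightarrow> real"
  assumes cont: "continuous_on {0..r} \<phi>" and 0: "\<phi> 0 \<le> c"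
    and dec: "\<And>s t. 0 \<le> s \<Longrightarrow> s < t \<Longrightarrow> t \<le> r \<Longrightarrow> (\<And>u. s < u \<Longrightarrow> u \<le> t \<Longrightarrow> c < \<phi> u) \<Longrightarrow> \<phi> t \<le> \<phi> s"
    and t: "0 \<le> t" "t \<le> r"
  shows "\<phi> t \<le> c"
proof (rule ccontr)
  assume n: "\<not> \<phi> t \<le> c"
  let ?A = "{u \<in> {0..t}. \<phi> u \<le> c}"
  have "?A = {0..t} \<inter> \<phi> -` {..c}" by auto
  moreover have "continuous_on {0..t} \<phi>" by (rule continuous_on_subset[OF cont]) (use t in auto)
  ultimately have cl: "closed ?A" by (simp add: continuous_closed_preimage)
  have ne: "?A \<noteq> {}" "bdd_above ?A" using 0 t by (auto intro!: bdd_aboveI[where M=t])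
  have s: "Sup ?A \<in> ?A" by (rule closed_contains_Sup[OF ne cl])
  then have st: "0 \<le> Sup ?A" "Sup ?A \<le> t" "\<phi> (Sup ?A) \<le> c" by auto
  have "Sup ?A \<noteq> t" using st(3) n by auto
  then have lt: "Sup ?A < t" using st by simp
  have "c < \<phi> u" if u: "Sup ?A < u" "u \<le> t" for u
  proof (rule ccontr)
    assume "\<not> c < \<phi> u"
    then have "u \<in> ?A" using u st by auto
    then have "u \<le> Sup ?A" using ne(2) by (rule cSup_upper)
    then show False using u by simp
  qed
  then have "\<phi> t \<le> \<phi> (Sup ?A)" by (rule dec[OF st(1) lt t(2)])
  then show False using st(3) n by simp
qed

text \<open>The drift \<open>coth\<close> is decreasing, so the gap between two solutions with the same noise shrinks.\<close>

lemma coth_comparison: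
  fixes X Z b :: "real \<Rightarrow> real"
  assumes lam: "0 < lam" and x: "0 \<le> x"
    and cX: "continuous_on {0..r} X" and cZ: "continuous_on {0..r} Z"
    and X: "\<And>t. 0 \<le> t \<Longrightarrow> t \<le> r \<Longrightarrow> 0 < X t"
    and Z: "AE u in lborel. u \<ge> 0 \<longrightarrow> Z u > 0"
    and iX: "\<And>t. 0 \<le> t \<Longrightarrow> t \<le> r \<Longrightarrow> set_integrable lborel {0..t} (\<lambda>u. coth (lam * X u))"
    and iZ: "\<And>t. 0 \<le> t \<Longrightarrow> t \<le> r \<Longrightarrow> set_integrable lborel {0..t} (\<lambda>u. coth (lam * Z u))"
    and eX: "\<And>t. 0 \<le> t \<Longrightarrow> t \<le> r \<Longrightarrow> X t = x + b t + lam * (LINT u:{0..t}|lborel. coth (lam * X u))"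
    and eZ: "\<And>t. 0 \<le> t \<Longrightarrow> t \<le> r \<Longrightarrow> Z t = b t + lam * (LINT u:{0..t}|lborel. coth (lam * Z u))"
    and t: "0 \<le> t" "t \<le> r"
  shows "0 \<le> X t - Z t" "X t - Z t \<le> x"
proof -
  let ?f = "\<lambda>u. coth (lam * X u)" and ?g = "\<lambda>u. coth (lam * Z u)"
  have split: "(LINT u:{0..t}|lborel. h u) = (LINT u:{0..s}|lborel. h u) + (LINT u:{s<..t}|lborel. h u)"
    and sub: "set_integrable lborel {s<..t} h"
    if st: "0 \<le> s" "s \<le> t" and h: "set_integrable lborel {0..t} h" for s t and h :: "real \<Rightarrow> real"
  proof -
    have e: "{0..t} = {0..s} \<union> {s<..t}" using st by auto
    have 1: "set_integrable lborel {0..s} h" by (rule set_integrable_subset[OF h]) (use st in auto)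
    show 2: "set_integrable lborel {s<..t} h" by (rule set_integrable_subset[OF h]) (use st in auto)
    show "(LINT u:{0..t}|lborel. h u) = (LINT u:{0..s}|lborel. h u) + (LINT u:{s<..t}|lborel. h u)"
      unfolding e by (rule set_integral_Un[OF _ 1 2]) auto
  qed
  have D: "(X t - Z t) - (X s - Z s) = lam * ((LINT u:{s<..t}|lborel. ?f u) - (LINT u:{s<..t}|lborel. ?g u))"
    if st: "0 \<le> s" "s < t" "t \<le> r" for s t
  proof -
    have "X t - Z t = x + lam * ((LINT u:{0..t}|lborel. ?f u) - (LINT u:{0..t}|lborel. ?g u))"
      using eX[of t] eZ[of t] st by (simp add: algebra_simps)
    moreover have "X s - Z s = x + lam * ((LINT u:{0..s}|lborel. ?f u) - (LINT u:{0..s}|lborel. ?g u))"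
      using eX[of s] eZ[of s] st by (simp add: algebra_simps)
    moreover have "(LINT u:{0..t}|lborel. ?f u) = (LINT u:{0..s}|lborel. ?f u) + (LINT u:{s<..t}|lborel. ?f u)"
      using st by (intro split iX) auto
    moreover have "(LINT u:{0..t}|lborel. ?g u) = (LINT u:{0..s}|lborel. ?g u) + (LINT u:{s<..t}|lborel. ?g u)"
      using st by (intro split iZ) auto
    ultimately show ?thesis by (simp add: algebra_simps)
  qed
  have i: "set_integrable lborel {s<..t} ?f" "set_integrable lborel {s<..t} ?g" if "0 \<le> s" "s < t" "t \<le> r" for s t
    using that by (auto intro!: sub iX iZ)
  have X0: "X 0 - Z 0 = x"
  proof -
    have "(LINT u:{0..0}|lborel. h u) = 0" for h :: "real \<Rightarrow> real"
      unfolding set_lebesgue_integral_def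
      by (rule integral_eq_zero_AE) (use AE_lborel_singleton[of 0] in \<open>auto elim!: eventually_mono\<close>)
    then show ?thesis using eX[of 0] eZ[of 0] t by simp
  qed
  have cD: "continuous_on {0..r} (\<lambda>t. X t - Z t)" by (intro continuous_intros cX cZ)
  show "X t - Z t \<le> x"
  proof (rule le_if_no_upcrossing[OF cD _ _ t])
    fix s t assume st: "0 \<le> s" "s < t" "t \<le> r" and gt: "\<And>u. s < u \<Longrightarrow> u \<le> t \<Longrightarrow> x < X u - Z u"
    have "(LINT u:{s<..t}|lborel. ?f u) \<le> (LINT u:{s<..t}|lborel. ?g u)"
      unfolding set_lebesgue_integral_def
    proof (rule integral_mono_AE)
      \<comment> \<open>At a zero of Z the value of \<open>coth\<close> is 0 and the inequality
        would fail; Z is positive almost everywhere.\<close>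
      show "AE u in lborel. indicator {s<..t} u *\<^sub>R ?f u \<le> indicator {s<..t} u *\<^sub>R ?g u"
        using Z
      proof eventually_elim
        case (elim u)
        show ?case
        proof (cases "u \<in> {s<..t}")
          case True
          then have "0 < Z u" "Z u < X u" using elim st x gt[of u] by auto
          then have "?f u \<le> ?g u" using lam by (intro coth_bounds(2)) auto
          then show ?thesis using True by simp
        qed simp
      qed
    qed (use i[OF st] in \<open>auto simp: set_integrable_def\<close>)
    then show "X t - Z t \<le> X s - Z s"
      using D[OF st] lam by (smt (verit) mult_nonneg_nonpos)
  qed (use X0 in simp)
  have cD': "continuous_on {0..r} (\<lambda>t. Z t - X t)" by (intro continuous_intros cX cZ)
  have "Z t - X t \<le> 0"
  proof (rule le_if_no_upcrossing[OF cD' _ _ t])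
    fix s t assume st: "0 \<le> s" "s < t" "t \<le> r" and gt: "\<And>u. s < u \<Longrightarrow> u \<le> t \<Longrightarrow> 0 < Z u - X u"
    have "(LINT u:{s<..t}|lborel. ?g u) \<le> (LINT u:{s<..t}|lborel. ?f u)"
      unfolding set_lebesgue_integral_def
    proof (rule integral_mono)
      fix u
      show "indicator {s<..t} u *\<^sub>R ?g u \<le> indicator {s<..t} u *\<^sub>R ?f u"
      proof (cases "u \<in> {s<..t}")
        case True
        then have "0 < X u" "X u < Z u" using st gt[of u] X[of u] by auto
        then have "?g u \<le> ?f u" using lam by (intro coth_bounds(2)) auto
        then show ?thesis using True by simp
      qed simp
    qed (use i[OF st] in \<open>auto simp: set_integrable_def\<close>)
    then show "Z t - X t \<le> Z s - X s"
      using D[OF st] lam by (smt (verit) mult_nonneg_nonneg)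
  qed (use X0 x in simp)
  then show "0 \<le> X t - Z t" by simp
qed

text \<open>Induction over the generated \<sigma>-algebra: the generators read coordinates at times
  up to s, which stopping at s leaves alone.\<close>

lemma F_upto_stop:
  assumes s: "0 \<le> s" and G: "G \<in> sets (F_upto s)" and w: "w \<in> paths"
  shows "stop s w \<in> G \<longleftrightarrow> w \<in> G"
proof -
  have "G \<in> sigma_sets paths {{w \<in> paths. w s' \<in> A} | s' A. s' \<in> {0..s} \<and> A \<in> sets borel}"
    using G unfolding sets_path_algebra .
  then show ?thesis
  proof induction
    case (Basic a)
    then show ?case using s w by (auto simp: min_absorb1)
  next
    case (Compl a)
    then show ?case using s w by auto
  qed auto
qed

text \<open>Expresses the noise after s through the shifted path and the barrier at distance x - w
  s, the form to which the Markov property applies.\<close>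

lemma coth_int_shift:
  assumes w: "w \<in> paths" and s: "0 \<le> s" "s \<le> t" and S: "running_sup t w < x" and lam: "0 < lam"
  shows "coth_int lam x t w = coth_int lam x s w + coth_int lam (x - w s) (t - s) (shift s w)"
proof -
  let ?g = "\<lambda>r. coth (lam * (x - w r))"
  have t: "0 \<le> t" using s by simp
  have c: "continuous_on {0..t} ?g" by (rule continuous_coth_path[OF w t S lam])
  have S1: "running_sup s w < x" "running_sup (t - s) (shift s w) < x - w s"
    using sup_shift[OF w s] S by auto
  have 1: "coth_int lam x t w = integral {0..t} ?g" by (rule coth_int_eq_integral(2)[OF w t S lam])
  have 2: "coth_int lam x s w = integral {0..s} ?g" by (rule coth_int_eq_integral(2)[OF w s(1) S1(1) lam])
  have "coth_int lam (x - w s) (t - s) (shift s w) = integral {0..t - s} (\<lambda>r. coth (lam * (x - w s - shift s w r)))"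
    using s w S1(2) lam by (intro coth_int_eq_integral) auto
  also have "\<dots> = integral {0..t - s} (?g \<circ> (\<lambda>r. r + s))"
    by (rule integral_cong) (auto simp: algebra_simps)
  also have "\<dots> = integral {0 + s..(t - s) + s} ?g"
    by (rule integral_shift) (rule continuous_on_subset[OF c], use s in auto)
  also have "\<dots> = integral {s..t} ?g" by simp
  finally have 3: "coth_int lam (x - w s) (t - s) (shift s w) = integral {s..t} ?g" .
  have "integral {0..s} ?g + integral {s..t} ?g = integral {0..t} ?g"
    by (rule Henstock_Kurzweil_Integration.integral_combine[OF s integrable_continuous_interval[OF c]])
  then show ?thesis using 1 2 3 by simp
qed

section \<open>The Doob transform by sinh and its driving noise\<close>

context wiener
begin

text \<open>The function sinh (\<lambda> (x - .)) vanishes at the barrier and is an eigenfunction of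
  half the second derivative with eigenvalue \<open>lam\<^sup>2 / 2\<close>. This is the density of
  its Doob transform on killed paths, normalised to be 1 at time 0.\<close>

definition h_dens :: "real \<Rightarrow> real \<Rightarrow> real \<Rightarrow> (real \<Rightarrow> real) \<Rightarrow> real" where
  "h_dens lam x s w = indicator {w \<in> paths. running_sup s w < x} w *
     (sinh (lam * (x - w s)) / sinh (lam * x) * exp (- (lam\<^sup>2 * s / 2)))"

text \<open>The noise for which x - w solves the coth equation from x up to time r. Afterwards it
  follows the increments of w, as \<open>girsanov\<close> asks, and so becomes a Brownian motion on
  the whole half-line.\<close>

definition h_noise :: "real \<Rightarrow> real \<Rightarrow> real \<Rightarrow> real \<Rightarrow> (real \<Rightarrow> real) \<Rightarrow> real" where
  "h_noise lam x r t w = (if t \<le> r then - w t - lam * coth_int lam x t w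
     else - w r - lam * coth_int lam x r w + (w t - w r))"

lemma h_dens_nonneg:
  assumes "0 < lam" "0 < x" "0 \<le> s" "w \<in> paths"
  shows "0 \<le> h_dens lam x s w"
proof (cases "running_sup s w < x")
  case True
  then have "w s < x" using running_sup_ge[OF assms(4), of s s] assms(3) by simp
  then show ?thesis using assms by (simp add: h_dens_def)
qed (simp add: h_dens_def)

lemma h_dens_posD: "0 < h_dens lam x r w \<Longrightarrow> running_sup r w < x"
  by (cases "running_sup r w < x") (auto simp: h_dens_def)

text \<open>\<open>girsanov\<close> applies once \<open>mart\<close> is checked. By the Markov
  property at s the path afterwards is a fresh one with barrier at distance x - w s, and
  \<open>feynman_kac\<close> with this distance gives the value.\<close>

lemma h_transform_BM:
  assumes lam: "0 < lam" and x: "0 < x" and r: "0 \<le> r"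
  shows "is_BM (density P (\<lambda>w. ennreal (h_dens lam x r w))) (h_noise lam x r)"
proof (rule girsanov[OF r])
  have sx: "0 < sinh (lam * x)" using lam x by simp
  have Sm: "{w \<in> paths. running_sup s w < x} \<in> sets (F_upto s)" if "0 \<le> s" for s
  proof -
    have "(\<lambda>w. running_sup s w) \<in> borel_measurable (F_upto s)"
      using that by (intro measurable_running_sup[OF measurable_ident_sets[OF refl]]) auto
    then have "{w \<in> space (F_upto s). running_sup s w < x} \<in> sets (F_upto s)" by measurable
    then show ?thesis by simp
  qed
  have cm: "(\<lambda>w. w t) \<in> borel_measurable (F_upto t)" if "0 \<le> t" for t
    using that by (intro measurable_coordinate) simp
  have Im: "(\<lambda>w. coth_int lam x t w) \<in> borel_measurable (F_upto t)" if "0 \<le> t" for t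
    using that by (intro measurable_coth_int[OF measurable_ident_sets[OF refl]]) auto
  show dm: "h_dens lam x t \<in> borel_measurable (F_upto t)" if "0 \<le> t" for t
    unfolding h_dens_def sinh_field_def using Sm[OF that] cm[OF that] by measurable
  show "0 \<le> h_dens lam x t w" if "0 \<le> t" "w \<in> paths" for t w
    by (rule h_dens_nonneg[OF lam x that])
  \<comment> \<open>The case u = 0 of \<open>feynman_kac\<close>, up to a constant.\<close>
  show di: "integrable P (h_dens lam x t)" if t: "0 \<le> t" for t
  proof (rule Bochner_Integration.integrable_bound)
    show "integrable P (\<lambda>w. norm (indicator {w \<in> paths. running_sup t w < x} w *\<^sub>R
      (complex_of_real (sinh (lam * (x - w t))) * iexp (0 * (- w t - lam * coth_int lam x t w)))) *
      (exp (- (lam\<^sup>2 * t / 2)) / sinh (lam * x)))"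
      by (intro integrable_mult_left integrable_norm feynman_kac(1)[OF lam x t])
    show "h_dens lam x t \<in> borel_measurable P" by (rule measurable_F_P[OF dm[OF t]])
    show "AE w in P. norm (h_dens lam x t w) \<le> norm (norm (indicator {w \<in> paths. running_sup t w < x} w *\<^sub>R
      (complex_of_real (sinh (lam * (x - w t))) * iexp (0 * (- w t - lam * coth_int lam x t w)))) *
      (exp (- (lam\<^sup>2 * t / 2)) / sinh (lam * x)))"
      using sx by (intro AE_I2) (simp add: h_dens_def abs_mult norm_mult)
  qed
  have "AE w in P. h_dens lam x 0 w = 1"
    using start_0 AE_paths by eventually_elim (use lam x in \<open>simp add: h_dens_def running_sup_def\<close>)
  then have "(LINT w|P. h_dens lam x 0 w) = (LINT w|P. 1)"
    using measurable_F_P[OF dm[of 0]] by (intro integral_cong_AE) auto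
  then show "(LINT w|P. h_dens lam x 0 w) = 1" using emeasure_space_1 by (simp add: measure_def)
  show hm: "h_noise lam x r t \<in> borel_measurable (F_upto t)" if t: "0 \<le> t" for t
  proof (cases "t \<le> r")
    case True
    then have "h_noise lam x r t = (\<lambda>w. - w t - lam * coth_int lam x t w)" by (intro ext) (simp add: h_noise_def)
    then show ?thesis using cm[OF t] Im[OF t] by simp
  next
    case False
    then have "h_noise lam x r t = (\<lambda>w. - w r - lam * coth_int lam x r w + (w t - w r))" by (intro ext) (simp add: h_noise_def)
    moreover have "(\<lambda>w. w r) \<in> borel_measurable (F_upto t)" "(\<lambda>w. coth_int lam x r w) \<in> borel_measurable (F_upto t)"
      using F_upto_le[OF cm[OF r], of t] F_upto_le[OF Im[OF r], of t] False by auto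
    ultimately show ?thesis using cm[OF t] by simp
  qed
  show "AE w in P. h_noise lam x r 0 w = 0"
    using start_0 AE_paths
  proof eventually_elim
    case (elim w)
    have "coth_int lam x 0 w = integral {0..0} (\<lambda>r. coth (lam * (x - w r)))"
      using elim x lam by (intro coth_int_eq_integral) (auto simp: running_sup_def)
    then show ?case using elim r by (simp add: h_noise_def)
  qed
  show "h_noise lam x r t w = h_noise lam x r r w + (w t - w r)" if "r \<le> t" for t w
    using that by (simp add: h_noise_def)
  fix s t G u assume st: "0 \<le> s" "s \<le> t" "t \<le> r" and G: "G \<in> sets (F_upto s)"
  let ?d = "t - s"
  have d: "0 \<le> ?d" and t: "0 \<le> t" using st by auto
  define K where "K = exp (- (lam\<^sup>2 * t / 2)) / sinh (lam * x)"
  define fk where "fk y v = indicator {v \<in> paths. running_sup ?d v < y} v *\<^sub>R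
    (complex_of_real (sinh (lam * (y - v ?d))) * iexp (u * (- v ?d - lam * coth_int lam y ?d v)))" for y v
  define f where "f p = complex_of_real (indicator G (fst p) * indicator {a \<in> paths. running_sup s a < x} (fst p) * K) *
    fk (x - fst p s) (snd p)" for p
  have GP: "G \<in> sets P" by (rule F_upto_P[OF G])
  have GF: "G \<in> sets F_inf" using GP sets_P by simp
  have f: "f \<in> borel_measurable (F_inf \<Otimes>\<^sub>M F_inf)"
  proof -
    have 1: "(\<lambda>p. complex_of_real (indicator G (fst p) * indicator {a \<in> paths. running_sup s a < x} (fst p) * K)) \<in> borel_measurable (F_inf \<Otimes>\<^sub>M F_inf)"
    proof -
      have "{a \<in> paths. running_sup s a < x} \<in> sets F_inf" using F_upto_P[OF Sm[OF st(1)]] sets_P by simp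
      then have "(\<lambda>a. complex_of_real (indicator G a * indicator {a \<in> paths. running_sup s a < x} a * K)) \<in> borel_measurable F_inf"
        using GF by measurable
      from measurable_compose[OF measurable_fst this] show ?thesis .
    qed
    have y: "(\<lambda>p. x - fst p s) \<in> borel_measurable (F_inf \<Otimes>\<^sub>M F_inf)"
      using measurable_compose[OF measurable_fst measurable_F_inf_eval[OF st(1)]] by measurable
    have v: "(\<lambda>p. snd p ?d) \<in> borel_measurable (F_inf \<Otimes>\<^sub>M F_inf)"
      by (rule measurable_compose[OF measurable_snd measurable_F_inf_eval[OF d]])
    have S: "(\<lambda>p. running_sup ?d (snd p)) \<in> borel_measurable (F_inf \<Otimes>\<^sub>M F_inf)"
      using d by (intro measurable_running_sup_inf) auto
    have I: "(\<lambda>p. coth_int lam (x - fst p s) ?d (snd p)) \<in> borel_measurable (F_inf \<Otimes>\<^sub>M F_inf)"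
      using d by (intro measurable_coth_int[OF measurable_snd y]) auto
    have "(\<lambda>p. (if running_sup ?d (snd p) < x - fst p s then 1 else 0 :: real) *\<^sub>R
      (complex_of_real (sinh (lam * ((x - fst p s) - snd p ?d))) * iexp (u * (- snd p ?d - lam * coth_int lam (x - fst p s) ?d (snd p)))))
      \<in> borel_measurable (F_inf \<Otimes>\<^sub>M F_inf)"
      unfolding sinh_field_def using y v S I by measurable
    also have "?this \<longleftrightarrow> (\<lambda>p. fk (x - fst p s) (snd p)) \<in> borel_measurable (F_inf \<Otimes>\<^sub>M F_inf)"
      by (intro measurable_cong) (auto simp: fk_def space_pair_measure)
    finally show ?thesis unfolding f_def using 1 by measurable
  qed
  have eq: "f (stop s w, shift s w) = complex_of_real (indicator G w * h_dens lam x t w) *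
    iexp (u * (h_noise lam x r t w - h_noise lam x r s w))" if "w \<in> space P" for w
  proof -
    have w: "w \<in> paths" using that by simp
    have sh: "shift s w \<in> paths" "stop s w \<in> paths" using w st by auto
    have rs: "running_sup s (stop s w) = running_sup s w" using st by (intro running_sup_cong) simp
    have sup: "running_sup t w < x \<longleftrightarrow> running_sup s w < x \<and> running_sup ?d (shift s w) < x - w s"
      unfolding sup_shift[OF w st(1,2)] by auto
    have base: "stop s w s = w s" using st by simp
    have ind: "indicator G (stop s w) = (indicator G w :: real)" using F_upto_stop[OF st(1) G w] by (simp add: indicator_def)
    show ?thesis
    proof (cases "running_sup t w < x")
      case True
      have "h_noise lam x r t w - h_noise lam x r s w =
        - shift s w ?d - lam * coth_int lam (x - w s) ?d (shift s w)"
        using st d coth_int_shift[OF w st(1,2) True lam] by (simp add: h_noise_def algebra_simps)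
      then show ?thesis
        using True sup sh w d st
        by (simp add: f_def fk_def ind rs h_dens_def K_def)
    next
      case False
      then show ?thesis using sup sh w st by (auto simp: f_def fk_def ind rs h_dens_def indicator_def)
    qed
  qed
  have "integrable P (\<lambda>w. complex_of_real (indicator G w * h_dens lam x t w) *
    iexp (u * (h_noise lam x r t w - h_noise lam x r s w)))"
  proof (rule iexp_bounded_integrable)
    show "integrable P (\<lambda>w. indicator G w * h_dens lam x t w)"
      using integrable_mult_indicator[OF GP di[OF t]] by simp
    show "(\<lambda>w. u * (h_noise lam x r t w - h_noise lam x r s w)) \<in> borel_measurable P"
      using measurable_F_P[OF hm[OF t]] measurable_F_P[OF hm[OF st(1)]] by measurable
  qed
  moreover have "integrable P (\<lambda>w. f (stop s w, shift s w)) \<longleftrightarrow> integrable P (\<lambda>w. complex_of_real (indicator G w * h_dens lam x t w) *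
    iexp (u * (h_noise lam x r t w - h_noise lam x r s w)))"
    by (rule Bochner_Integration.integrable_cong[OF refl eq])
  ultimately have i: "integrable P (\<lambda>w. f (stop s w, shift s w))" by (simp only:)
  have "(LINT w|P. complex_of_real (indicator G w * h_dens lam x t w) *
    iexp (u * (h_noise lam x r t w - h_noise lam x r s w))) = (LINT w|P. f (stop s w, shift s w))"
    by (rule Bochner_Integration.integral_cong[OF refl eq[symmetric]])
  also have "\<dots> = (LINT w|P. LINT v|P. f (stop s w, v))"
    by (rule integral_markov[OF path_stopping_const[OF st(1)] f i])
  also have "\<dots> = (LINT w|P. complex_of_real ((indicator G w * h_dens lam x s w) * exp (- u\<^sup>2 * (t - s) / 2)))"
  proof (rule Bochner_Integration.integral_cong[OF refl])
    fix w assume "w \<in> space P"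
    then have w: "w \<in> paths" by simp
    have sh: "stop s w \<in> paths" using w st by auto
    have rs: "running_sup s (stop s w) = running_sup s w" using st by (intro running_sup_cong) simp
    have ind: "indicator G (stop s w) = (indicator G w :: real)" using F_upto_stop[OF st(1) G w] by (simp add: indicator_def)
    have base: "stop s w s = w s" using st by simp
    show "(LINT v|P. f (stop s w, v)) = complex_of_real ((indicator G w * h_dens lam x s w) * exp (- u\<^sup>2 * (t - s) / 2))"
    proof (cases "running_sup s w < x")
      case True
      then have y: "0 < x - w s" using running_sup_ge[OF w, of s s] st by simp
      have "(LINT v|P. f (stop s w, v)) = complex_of_real (indicator G w * K) * (LINT v|P. fk (x - w s) v)"
        using True sh by (simp add: f_def ind rs base)
      also have "(LINT v|P. fk (x - w s) v) = complex_of_real (sinh (lam * (x - w s)) * exp ((lam\<^sup>2 - u\<^sup>2) * ?d / 2))"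
        unfolding fk_def by (rule feynman_kac(2)[OF lam y d])
      also have "complex_of_real (indicator G w * K) * \<dots> =
        complex_of_real (indicator G w * (sinh (lam * (x - w s)) / sinh (lam * x)) *
          (exp (- (lam\<^sup>2 * t / 2)) * exp ((lam\<^sup>2 - u\<^sup>2) * ?d / 2)))"
        unfolding K_def of_real_mult[symmetric] by simp
      also have "exp (- (lam\<^sup>2 * t / 2)) * exp ((lam\<^sup>2 - u\<^sup>2) * ?d / 2) = exp (- (lam\<^sup>2 * s / 2)) * exp (- u\<^sup>2 * (t - s) / 2)"
        unfolding exp_add[symmetric] by (simp add: field_simps)
      finally show ?thesis using True w by (simp add: h_dens_def)
    next
      case False
      then show ?thesis using w sh by (simp add: f_def rs h_dens_def)
    qed
  qed
  also have "\<dots> = complex_of_real ((LINT w|P. indicator G w * h_dens lam x s w) * exp (- u\<^sup>2 * (t - s) / 2))"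
    by (simp only: integral_complex_of_real integral_mult_left_zero)
  finally show "(LINT w|P. complex_of_real (indicator G w * h_dens lam x t w) *
    iexp (u * (h_noise lam x r t w - h_noise lam x r s w))) =
    complex_of_real ((LINT w|P. indicator G w * h_dens lam x s w) * exp (- u\<^sup>2 * (t - s) / 2))" .
qed

text \<open>Off {S_r < x} the noise may fail to be continuous and the zero path takes its place; the
  transformed measure gives that set mass 0.\<close>

definition h_noise_path :: "real \<Rightarrow> real \<Rightarrow> real \<Rightarrow> (real \<Rightarrow> real) \<Rightarrow> (real \<Rightarrow> real)" where
  "h_noise_path lam x r w = (\<lambda>t\<in>{0..}. if running_sup r w < x then h_noise lam x r t w else 0)"

lemma h_noise_path_paths:
  assumes lam: "0 < lam" and r: "0 \<le> r" and w: "w \<in> paths"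
  shows "h_noise_path lam x r w \<in> paths"
proof (cases "running_sup r w < x")
  case True
  let ?g = "\<lambda>q. coth (lam * (x - w q))"
  have "continuous_on {0..r} (\<lambda>t. integral {0..t} ?g)"
    by (rule indefinite_integral_continuous_1[OF integrable_continuous_interval[OF continuous_coth_path[OF w r True lam]]])
  then have c1: "continuous_on {0..} (\<lambda>t. integral {0..min t r} ?g)"
    by (rule continuous_on_compose2[where g="\<lambda>t. integral {0..t} ?g"]) (use r in \<open>auto intro!: continuous_intros\<close>)
  have c2: "continuous_on {0..} (\<lambda>t. w (min t r))"
    by (rule continuous_on_compose2[OF paths_continuous[OF w]]) (use r in \<open>auto intro!: continuous_intros\<close>)
  have c: "continuous_on {0..} (\<lambda>t. - w (min t r) - lam * integral {0..min t r} ?g + (w t - w (min t r)))"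
    by (intro continuous_intros c1 c2 paths_continuous[OF w])
  have "continuous_on {0..} (h_noise_path lam x r w)"
  proof (rule continuous_on_eq[OF c])
    fix t :: real assume t: "t \<in> {0..}"
    have "running_sup (min t r) w \<le> running_sup r w"
      using running_sup_le_iff[OF w, of "min t r" "running_sup r w"] running_sup_ge[OF w, of _ r] t r by auto
    then have "coth_int lam x (min t r) w = integral {0..min t r} ?g"
      using t r True lam w by (intro coth_int_eq_integral) auto
    then show "- w (min t r) - lam * integral {0..min t r} ?g + (w t - w (min t r)) = h_noise_path lam x r w t"
      using t True by (cases "t \<le> r") (simp_all add: h_noise_path_def h_noise_def)
  qed
  then show ?thesis by (simp add: paths_def h_noise_path_def)
next
  case False
  have "continuous_on {0..} (h_noise_path lam x r w)"
    by (rule continuous_on_eq[OF continuous_on_const[of _ 0]]) (use False in \<open>simp add: h_noise_path_def\<close>)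
  then show ?thesis by (simp add: paths_def h_noise_path_def)
qed

lemma measurable_h_noise_path:
  assumes lam: "0 < lam" and x: "0 < x" and r: "0 \<le> r"
  shows "h_noise_path lam x r \<in> measurable P F_inf"
proof (rule measurable_path_algebraI)
  fix t :: real assume "t \<in> {0..}"
  then have t: "0 \<le> t" by simp
  have "h_noise lam x r t \<in> borel_measurable P"
    by (rule measurable_F_P[OF is_BM_basic(4)[OF h_transform_BM[OF lam x r] t]])
  then show "(\<lambda>w. h_noise_path lam x r w t) \<in> borel_measurable P"
    using sup_P[OF r] t by (simp add: h_noise_path_def)
qed (use h_noise_path_paths[OF lam r] in simp)

text \<open>The noise path is almost surely equal to a Brownian motion at all times, so uniqueness
  in law identifies its distribution with P.\<close>

lemma h_transform_law:
  assumes lam: "0 < lam" and x: "0 < x" and r: "0 \<le> r"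
  shows "distr (density P (\<lambda>w. ennreal (h_dens lam x r w))) F_inf (h_noise_path lam x r) = P"
proof -
  let ?M = "density P (\<lambda>w. ennreal (h_dens lam x r w))"
  have m: "h_noise_path lam x r \<in> measurable ?M F_inf" using measurable_h_noise_path[OF assms] by simp
  have hm: "h_dens lam x r \<in> borel_measurable P"
    unfolding h_dens_def sinh_field_def using coord_P[OF r] sup_P[OF r]
    by (simp del: space_P add: space_P[symmetric])
  have "AE w in ?M. \<forall>t\<ge>0. h_noise_path lam x r w t = h_noise lam x r t w"
    unfolding AE_density[OF measurable_compose[OF hm measurable_ennreal]]
    by (auto dest!: h_dens_posD simp: h_noise_path_def intro!: AE_I2)
  from is_BM_unique[OF h_transform_BM[OF assms] m this BM ident_P]
  have "distr ?M F_inf (h_noise_path lam x r) = distr P F_inf (\<lambda>w. w)" by simp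
  then show ?thesis using distr_id2[OF sets_P[symmetric]] by simp
qed

text \<open>A coupling. Under the transformed measure the noise path is Wiener, so \<open>Z\<close>
  applied to it solves the coth equation from 0, while x - v solves it from x with the same noise.
  The comparison keeps the two within x of each other, and the Lipschitz bound of the test
  functional turns this into the error e.\<close>

lemma killed_vs_coth:
  fixes a :: "real \<Rightarrow> real" and m :: nat and l :: "(real \<times> real) list" and s :: real
  assumes lam: "0 < lam" and Z: "coth_process P lam Z" and x: "0 < x" and r: "0 \<le> r"
    and l: "\<forall>p\<in>set l. fst p - s \<le> r"
  defines "I \<equiv> \<integral>\<^sup>+v. ennreal (test_fun m l (\<lambda>t. a t + v (max 0 (t - s)))) *
      (indicator {v \<in> paths. running_sup r v < x} v * ennreal (sinh (lam * (x - v r)) * exp (- (lam\<^sup>2 * r / 2)))) \<partial>P"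
    and "K \<equiv> \<integral>\<^sup>+v. ennreal (test_fun m l (\<lambda>t. a t - Z v (max 0 (t - s)))) \<partial>P"
    and "e \<equiv> real (length l) * real m * x"
  shows "I \<le> ennreal (sinh (lam * x)) * (K + ennreal e)"
    and "ennreal (sinh (lam * x)) * K \<le> I + ennreal (sinh (lam * x)) * ennreal e"
proof -
  let ?R = "density P (\<lambda>w. ennreal (h_dens lam x r w))"
  let ?B = "h_noise_path lam x r"
  let ?F = "\<lambda>v. ennreal (test_fun m l (\<lambda>t. a t + v (max 0 (t - s))))"
  let ?G = "\<lambda>v. ennreal (test_fun m l (\<lambda>t. a t - Z v (max 0 (t - s))))"
  interpret R: prob_space ?R by (rule is_BM_basic(1)[OF h_transform_BM[OF lam x r]])
  have sx: "0 < sinh (lam * x)" using lam x by simp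
  have e: "0 \<le> e" using x by (simp add: e_def)
  have hm: "h_dens lam x r \<in> borel_measurable P"
    unfolding h_dens_def sinh_field_def using coord_P[OF r] sup_P[OF r]
    by (simp del: space_P add: space_P[symmetric])
  have Zm: "Z \<in> measurable P F_inf" using Z by (simp add: coth_process_def)
  have Fm: "?F \<in> borel_measurable P"
  proof (rule measurable_compose[OF _ measurable_ennreal], rule measurable_test_fun)
    fix p
    show "(\<lambda>v. a (fst p) + v (max 0 (fst p - s))) \<in> borel_measurable P"
      by (intro borel_measurable_add borel_measurable_const coord_P) simp
  qed
  have Gm: "?G \<in> borel_measurable P"
  proof (rule measurable_compose[OF _ measurable_ennreal], rule measurable_test_fun)
    fix p
    show "(\<lambda>v. a (fst p) - Z v (max 0 (fst p - s))) \<in> borel_measurable P"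
      by (intro borel_measurable_diff borel_measurable_const measurable_compose[OF Zm measurable_F_inf_eval]) simp
  qed
  have Bm: "?B \<in> measurable ?R F_inf" using measurable_h_noise_path[OF lam x r] by simp
  have I: "I = ennreal (sinh (lam * x)) * (\<integral>\<^sup>+v. ?F v \<partial>?R)"
  proof -
    have "(\<integral>\<^sup>+v. ?F v \<partial>?R) = (\<integral>\<^sup>+v. ennreal (h_dens lam x r v) * ?F v \<partial>P)"
      using hm Fm by (intro nn_integral_density) auto
    then have "ennreal (sinh (lam * x)) * (\<integral>\<^sup>+v. ?F v \<partial>?R) =
      (\<integral>\<^sup>+v. ennreal (sinh (lam * x)) * (ennreal (h_dens lam x r v) * ?F v) \<partial>P)"
      using hm Fm by (simp add: nn_integral_cmult)
    also have "\<dots> = I"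
      unfolding I_def
    proof (rule nn_integral_cong)
      fix v assume "v \<in> space P"
      then have v: "v \<in> paths" by simp
      have "ennreal (sinh (lam * x)) * ennreal (h_dens lam x r v) = ennreal (sinh (lam * x) * h_dens lam x r v)"
        using sx by (simp add: ennreal_mult')
      also have "sinh (lam * x) * h_dens lam x r v =
        indicator {v \<in> paths. running_sup r v < x} v * (sinh (lam * (x - v r)) * exp (- (lam\<^sup>2 * r / 2)))"
        using lam x by (simp add: h_dens_def)
      finally have E: "ennreal (sinh (lam * x)) * ennreal (h_dens lam x r v) =
        indicator {v \<in> paths. running_sup r v < x} v * ennreal (sinh (lam * (x - v r)) * exp (- (lam\<^sup>2 * r / 2)))"
        by (simp add: indicator_def split: if_splits)
      show "ennreal (sinh (lam * x)) * (ennreal (h_dens lam x r v) * ?F v) =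
        ?F v * (indicator {v \<in> paths. running_sup r v < x} v * ennreal (sinh (lam * (x - v r)) * exp (- (lam\<^sup>2 * r / 2))))"
        unfolding mult.assoc[symmetric, of _ _ "?F v"] E by (rule mult.commute)
    qed
    finally show ?thesis by simp
  qed
  have K: "K = (\<integral>\<^sup>+v. ?G (?B v) \<partial>?R)"
  proof -
    have "K = (\<integral>\<^sup>+v. ?G v \<partial>distr ?R F_inf ?B)" unfolding K_def h_transform_law[OF lam x r] ..
    also have "\<dots> = (\<integral>\<^sup>+v. ?G (?B v) \<partial>?R)"
      using Gm measurable_P by (intro nn_integral_distr[OF Bm]) simp
    finally show ?thesis .
  qed
  have close: "AE v in ?R. \<bar>test_fun m l (\<lambda>t. a t + v (max 0 (t - s))) - test_fun m l (\<lambda>t. a t - Z (?B v) (max 0 (t - s)))\<bar> \<le> e"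
  proof -
    \<comment> \<open>The equation for \<open>Z\<close> holds almost surely under P, which is the
      law of the noise path; pulled back, it is driven by that path.\<close>
    have "AE w in distr ?R F_inf ?B. Z w \<in> paths \<and> (\<forall>t\<ge>0. Z w t \<ge> 0) \<and> (AE u in lborel. u \<ge> 0 \<longrightarrow> Z w u > 0) \<and>
      (\<forall>t\<ge>0. set_integrable lborel {0..t} (\<lambda>u. coth (lam * Z w u)) \<and>
               Z w t = w t + lam * (LINT u:{0..t}|lborel. coth (lam * Z w u)))"
      unfolding h_transform_law[OF lam x r]
      using Z measurable_space[OF Zm] AE_space by (auto simp: coth_process_def)
    from AE_distrD[OF Bm this]
    have 1: "AE v in ?R. Z (?B v) \<in> paths \<and> (\<forall>t\<ge>0. Z (?B v) t \<ge> 0) \<and> (AE u in lborel. u \<ge> 0 \<longrightarrow> Z (?B v) u > 0) \<and>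
      (\<forall>t\<ge>0. set_integrable lborel {0..t} (\<lambda>u. coth (lam * Z (?B v) u)) \<and>
               Z (?B v) t = ?B v t + lam * (LINT u:{0..t}|lborel. coth (lam * Z (?B v) u)))" .
    have 2: "AE v in ?R. running_sup r v < x"
      unfolding AE_density[OF measurable_compose[OF hm measurable_ennreal]]
      by (auto dest!: h_dens_posD intro!: AE_I2)
    have 3: "AE v in ?R. v \<in> paths" using AE_space[of ?R] by simp
    from 1 2 3 show ?thesis
    proof eventually_elim
      case (elim v)
      have near: "0 \<le> (x - v t) - Z (?B v) t \<and> (x - v t) - Z (?B v) t \<le> x" if t: "0 \<le> t" "t \<le> r" for t
      proof -
        have lt: "running_sup t v < x" if "t \<le> r" "0 \<le> t" for t
          using running_sup_less_iff[OF elim(3) that(2), of x] running_sup_less_iff[OF elim(3) r, of x] elim(2) that by auto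
        note c = coth_comparison[where X="\<lambda>t. x - v t" and Z="Z (?B v)" and b="?B v" and r=r and x=x and lam=lam and t=t]
        have cv: "continuous_on {0..r} (\<lambda>t. x - v t)" "continuous_on {0..r} (Z (?B v))"
        proof -
          have "Z (?B v) \<in> paths" using elim(1) by blast
          then show "continuous_on {0..r} (\<lambda>t. x - v t)" "continuous_on {0..r} (Z (?B v))"
            using elim(3) by (auto intro!: continuous_on_diff[OF continuous_on_const] intro: continuous_on_subset[OF paths_continuous])
        qed
        have pos: "0 < x - v t" if "0 \<le> t" "t \<le> r" for t
          using running_sup_ge[OF elim(3) that] elim(2) by simp
        have iX: "set_integrable lborel {0..t} (\<lambda>u. coth (lam * (x - v u)))" if "0 \<le> t" "t \<le> r" for t
          using coth_int_eq_integral(1)[OF elim(3) that(1) lt[OF that(2,1)] lam] .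
        have eX: "x - v t = x + ?B v t + lam * (LINT u:{0..t}|lborel. coth (lam * (x - v u)))" if "0 \<le> t" "t \<le> r" for t
          using that elim(2) by (simp add: h_noise_path_def h_noise_def coth_int_def)
        have x0: "0 \<le> x" using x by simp
        have Z1: "AE u in lborel. u \<ge> 0 \<longrightarrow> Z (?B v) u > 0" using elim(1) by blast
        have iZ: "set_integrable lborel {0..t} (\<lambda>u. coth (lam * Z (?B v) u))" if "0 \<le> t" "t \<le> r" for t
          using elim(1) that by blast
        have eZ: "Z (?B v) t = ?B v t + lam * (LINT u:{0..t}|lborel. coth (lam * Z (?B v) u))" if "0 \<le> t" "t \<le> r" for t
          using elim(1) that by blast
        have "0 \<le> x - v t - Z (?B v) t" "x - v t - Z (?B v) t \<le> x"
          by (rule c; fact lam x0 cv pos Z1 iX iZ eX eZ t)+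
        then show ?thesis by blast
      qed
      show ?case unfolding e_def
      proof (rule test_fun_lipschitz)
        fix p assume p: "p \<in> set l"
        let ?q = "max 0 (fst p - s)"
        have "?q \<le> r" using l p r by auto
        then show "\<bar>(a (fst p) + v ?q) - (a (fst p) - Z (?B v) ?q)\<bar> \<le> x"
          using near[of ?q] by auto
      qed
    qed
  qed
  have GBm: "(\<lambda>v. ?G (?B v)) \<in> borel_measurable ?R"
    by (rule measurable_compose[OF Bm, where g="?G"]) (use Gm measurable_P in simp)
  have "(\<integral>\<^sup>+v. ?F v \<partial>?R) \<le> (\<integral>\<^sup>+v. ?G (?B v) + ennreal e \<partial>?R)"
  proof (rule nn_integral_mono_AE)
    show "AE v in ?R. ?F v \<le> ?G (?B v) + ennreal e"
      using close
    proof eventually_elim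
      case (elim v)
      then have "test_fun m l (\<lambda>t. a t + v (max 0 (t - s))) \<le> test_fun m l (\<lambda>t. a t - Z (?B v) (max 0 (t - s))) + e" by linarith
      then show ?case using e test_fun_bounds by (simp add: ennreal_plus[symmetric] ennreal_leI del: ennreal_plus)
    qed
  qed
  also have "\<dots> = K + ennreal e" using GBm R.emeasure_space_1 K by (simp add: nn_integral_add)
  finally show "I \<le> ennreal (sinh (lam * x)) * (K + ennreal e)" unfolding I by (rule mult_left_mono) simp
  have "K \<le> (\<integral>\<^sup>+v. ?F v + ennreal e \<partial>?R)"
    unfolding K
  proof (rule nn_integral_mono_AE)
    show "AE v in ?R. ?G (?B v) \<le> ?F v + ennreal e"
      using close
    proof eventually_elim
      case (elim v)
      then have "test_fun m l (\<lambda>t. a t - Z (?B v) (max 0 (t - s))) \<le> test_fun m l (\<lambda>t. a t + v (max 0 (t - s))) + e" by linarith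
      then show ?case using e test_fun_bounds by (simp add: ennreal_plus[symmetric] ennreal_leI del: ennreal_plus)
    qed
  qed
  also have "\<dots> = (\<integral>\<^sup>+v. ?F v \<partial>?R) + ennreal e" using Fm R.emeasure_space_1 by (simp add: nn_integral_add)
  finally have "ennreal (sinh (lam * x)) * K \<le> ennreal (sinh (lam * x)) * ((\<integral>\<^sup>+v. ?F v \<partial>?R) + ennreal e)"
    by (rule mult_left_mono) simp
  then show "ennreal (sinh (lam * x)) * K \<le> I + ennreal (sinh (lam * x)) * ennreal e"
    unfolding I by (simp add: distrib_left)
qed

end

section \<open>Decomposition at the first passage to a level\<close>

lemma path_at_tau:
  assumes w: "w \<in> paths" "w 0 = 0" and T: "0 \<le> T" and y: "0 \<le> y" "y \<le> running_sup T w"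
  shows "w (tau T y w) = y" "running_sup (tau T y w) w = y"
proof -
  obtain u where u: "0 \<le> u" "u \<le> T" "y \<le> w u" using running_sup_ge_iff[OF w(1) T] y(2) by auto
  show wt: "w (tau T y w) = y" by (rule tau_hits[OF w(1) _ u]) (use w y in simp)
  note tb = tau_bounds[OF T]
  have "running_sup (tau T y w) w \<le> y"
    using running_sup_le_iff[OF w(1) tb(1)] wt before_tau[OF _ _ T] by (metis atLeastAtMost_iff less_eq_real_def)
  moreover have "y \<le> running_sup (tau T y w) w" using running_sup_ge[OF w(1) tb(1) order_refl] wt by metis
  ultimately show "running_sup (tau T y w) w = y" by simp
qed

lemma tau_stop: "w \<in> paths \<Longrightarrow> 0 \<le> T \<Longrightarrow> tau T y (stop (tau T y w) w) = tau T y w"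
  by (rule tau_cong[of "tau T y w"]) auto

lemma sup_stop_tau:
  assumes w: "w \<in> paths" and T: "0 \<le> T"
  shows "y \<le> running_sup T (stop (tau T y w) w) \<longleftrightarrow> y \<le> running_sup T w"
proof -
  note tb = tau_bounds[OF T, of y w]
  have sp: "stop (tau T y w) w \<in> paths" using w tb by auto
  show ?thesis
  proof
    assume "y \<le> running_sup T (stop (tau T y w) w)"
    then obtain u where u: "0 \<le> u" "u \<le> T" "y \<le> w (min u (tau T y w))"
      using running_sup_ge_iff[OF sp T] by auto
    have "w (min u (tau T y w)) \<le> running_sup T w" using u tb by (intro running_sup_ge[OF w]) auto
    then show "y \<le> running_sup T w" using u(3) by simp
  next
    assume "y \<le> running_sup T w"
    then obtain u where u: "0 \<le> u" "u \<le> T" "y \<le> w u" using running_sup_ge_iff[OF w T] by auto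
    have "y \<le> w (tau T y w)" by (rule tau_attained[OF w u])
    moreover have "stop (tau T y w) w T \<le> running_sup T (stop (tau T y w) w)"
      by (rule running_sup_ge[OF sp T order_refl])
    ultimately show "y \<le> running_sup T (stop (tau T y w) w)" using T tb by (simp add: min_absorb2)
  qed
qed

lemma hitting_time_nonneg: "0 \<le> hitting_time y w"
  unfolding hitting_time_def by (rule INF_greatest) auto

lemma hitting_time_eq_tau:
  assumes w: "w \<in> paths" "w 0 = 0" and T: "0 \<le> T" and y: "0 \<le> y" "y \<le> running_sup T w"
  shows "hitting_time y w = ereal (tau T y w)"
  unfolding hitting_time_def
proof (rule antisym)
  show "(INF t\<in>{t. 0 \<le> t \<and> w t = y}. ereal t) \<le> ereal (tau T y w)"
    using path_at_tau(1)[OF w T y] tau_bounds(1)[OF T] by (intro INF_lower) auto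
  show "ereal (tau T y w) \<le> (INF t\<in>{t. 0 \<le> t \<and> w t = y}. ereal t)"
  proof (rule INF_greatest)
    fix t assume "t \<in> {t. 0 \<le> t \<and> w t = y}"
    then have "\<not> t < tau T y w" using before_tau[of t T y w] T by auto
    then show "ereal (tau T y w) \<le> ereal t" by simp
  qed
qed

lemma hitting_time_ge:
  assumes w: "w \<in> paths" and T: "0 \<le> T" and y: "running_sup T w < y"
  shows "ereal T \<le> hitting_time y w"
  unfolding hitting_time_def
proof (rule INF_greatest)
  fix t assume "t \<in> {t. 0 \<le> t \<and> w t = y}"
  then have "\<not> t \<le> T" using running_sup_ge[OF w, of t T] y by auto
  then show "ereal T \<le> ereal t" by simp
qed

lemma stopped_path_0: "stopped_path y w 0 = w 0"
  unfolding stopped_path_def using hitting_time_nonneg[of y w]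
  by (simp add: min_def zero_ereal_def[symmetric])

lemma stopped_path_before:
  assumes "w \<in> paths" "0 \<le> T" "running_sup T w < y" "0 \<le> t" "t \<le> T"
  shows "stopped_path y w t = w t"
proof -
  have "ereal t \<le> hitting_time y w"
    using hitting_time_ge[OF assms(1-3)] assms(5) by (metis ereal_less_eq(3) order_trans)
  then show ?thesis using assms(4) by (simp add: stopped_path_def min_def)
qed

lemma stopped_path_after:
  assumes "w \<in> paths" "w 0 = 0" "0 \<le> T" "0 \<le> y" "y \<le> running_sup T w" "0 \<le> t"
  shows "stopped_path y w t = w (min t (tau T y w))" "post_hitting_path y w t = y - w (t + tau T y w)"
  using hitting_time_eq_tau[OF assms(1-5)] assms(6)
  by (simp_all add: stopped_path_def post_hitting_path_def min_def)

text \<open>Makes the event that the level is reached by time T a function of the stopped path,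
  whose law \<open>drift_coth_law\<close> prescribes.\<close>

lemma sup_stopped_path:
  assumes w: "w \<in> paths" "w 0 = 0" and T: "0 \<le> T" and y: "0 \<le> y"
  shows "y \<le> running_sup T (stopped_path y w) \<longleftrightarrow> y \<le> running_sup T w"
proof (cases "y \<le> running_sup T w")
  case True
  have "running_sup T (stopped_path y w) = running_sup T (stop (tau T y w) w)"
    using stopped_path_after(1)[OF w T y True] by (intro running_sup_cong) simp
  then show ?thesis using sup_stop_tau[OF w(1) T] by simp
next
  case False
  then have "running_sup T (stopped_path y w) = running_sup T w"
    using stopped_path_before[OF w(1) T] by (intro running_sup_cong) simp
  then show ?thesis by simp
qed

lemma tau_stopped_path:
  assumes w: "w \<in> paths" "w 0 = 0" and T: "0 \<le> T" and y: "0 \<le> y" "y \<le> running_sup T w"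
  shows "tau T y (stopped_path y w) = tau T y w"
  using w T stopped_path_after(1)[OF w T y] by (intro tau_cong[of "tau T y w"]) (auto simp: min_def)

lemma add_drift_paths:
  assumes "w \<in> paths" shows "add_drift lam w \<in> paths"
proof -
  have "continuous_on {0..} (\<lambda>t. w t + lam * t)" by (intro continuous_intros paths_continuous[OF assms])
  then have "continuous_on {0..} (add_drift lam w)" by (rule continuous_on_eq) (simp add: add_drift_def)
  then show ?thesis by (simp add: paths_def add_drift_def)
qed

lemma measurable_add_drift: "add_drift lam \<in> measurable F_inf F_inf"
proof (rule measurable_path_algebraI)
  fix s :: real assume "s \<in> {0..}"
  then show "(\<lambda>w. add_drift lam w s) \<in> borel_measurable F_inf"
    using measurable_F_inf_eval[of s] by (simp add: add_drift_def)
qed (simp add: add_drift_paths)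

text \<open>The derivative of sinh (\<lambda> h) at h = 0. This limit produces the factor 1 /
  \<lambda> in the second summand of the martingale.\<close>

lemma sinh_quotient_tendsto:
  assumes lam: "0 < (lam :: real)"
  shows "(\<lambda>n. 1 / real (Suc n) / sinh (lam * (1 / real (Suc n)))) \<longlonglongrightarrow> 1 / lam"
proof -
  have "((\<lambda>h. sinh (lam * h)) has_real_derivative cosh (lam * 0) * lam) (at 0)"
    by (auto intro!: derivative_eq_intros)
  then have "((\<lambda>h. sinh (lam * h) / h) \<longlongrightarrow> lam) (at 0)"
    unfolding has_field_derivative_iff by simp
  moreover have "filterlim (\<lambda>n. 1 / real (Suc n)) (at 0) sequentially"
    unfolding filterlim_at using LIMSEQ_inverse_real_of_nat by (auto simp: inverse_eq_divide)
  ultimately have "(\<lambda>n. sinh (lam * (1 / real (Suc n))) / (1 / real (Suc n))) \<longlonglongrightarrow> lam"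
    by (rule filterlim_compose)
  from tendsto_inverse[OF this] show ?thesis using lam by (simp add: inverse_eq_divide mult.commute)
qed

lemma sinh_ge_half:
  assumes "0 \<le> (x :: real)" shows "x / 2 \<le> sinh x"
proof -
  have "exp (- x) \<le> 1" using assms by simp
  then have "x \<le> exp x - exp (- x)" using exp_ge_add_one_self[of x] by linarith
  then show ?thesis by (simp add: sinh_field_def)
qed

lemma sinh_le_exp: "sinh (x :: real) \<le> exp x"
proof -
  have "0 < exp x" "0 < exp (- x)" by simp_all
  then have "exp x - exp (- x) \<le> 2 * exp x" by linarith
  then show ?thesis by (simp add: sinh_field_def)
qed

context wiener
begin

section \<open>Disintegration over the level of the supremum\<close>

context
  fixes lam T :: real and m :: nat and l :: "(real \<times> real) list" and Z :: "(real \<Rightarrow> real) \<Rightarrow> (real \<Rightarrow> real)"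
  assumes lam: "0 < lam" and T: "0 \<le> T" and l: "\<forall>p\<in>set l. 0 \<le> fst p \<and> fst p \<le> T"
    and Z: "coth_process P lam Z"
begin

text \<open>Mean of the test functional over paths that follow w up to the passage and then continue
  as y - Z, with Z driven by an independent path; when the level is reached, w is at y
  there.\<close>

definition after :: "real \<Rightarrow> (real \<Rightarrow> real) \<Rightarrow> ennreal" where
  "after y w = (\<integral>\<^sup>+v. ennreal (test_fun m l (\<lambda>t. w (min t (tau T y w)) - Z v (max 0 (t - tau T y w)))) \<partial>P)"

text \<open>By \<open>level_integral\<close> this is the density in y of \<open>excursion\<close>.
  Multiplied by exp (\<lambda> y) it is also the part of the law at level y carried by {S_T \<ge>
  y}. The theorem rests on this double role.\<close>

definition level :: "real \<Rightarrow> ennreal" where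
  "level y = (\<integral>\<^sup>+w. indicator {w \<in> paths. y \<le> running_sup T w} w * ennreal (exp (- (lam\<^sup>2 * tau T y w / 2))) * after y w \<partial>P)"

text \<open>The weight places the barrier at y + d: after the passage of y it is the weight of a
  motion killed at distance d.\<close>

definition near_level :: "real \<Rightarrow> real \<Rightarrow> ennreal" where
  "near_level d y = (\<integral>\<^sup>+w. ennreal (test_fun m l w) *
     (indicator {w \<in> paths. y \<le> running_sup T w \<and> running_sup T w < y + d} w *
      ennreal (sinh (lam * (y + d - w T)) * exp (- (lam\<^sup>2 * T / 2)))) \<partial>P)"

lemma Z_meas: "Z \<in> measurable P F_inf"
  using Z by (simp add: coth_process_def)

lemma measurable_after:
  assumes f: "f \<in> measurable N F_inf" and g: "g \<in> borel_measurable N"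
  shows "(\<lambda>x. after (g x) (f x)) \<in> borel_measurable N"
proof -
  have tm: "(\<lambda>x. tau T (g x) (f x)) \<in> borel_measurable N" by (rule measurable_tau[OF f g T])
  have tb: "0 \<le> tau T y w" for y w by (rule tau_bounds(1)[OF T])
  have f1: "(\<lambda>q. f (fst q)) \<in> measurable (N \<Otimes>\<^sub>M P) F_inf" by (rule measurable_compose[OF measurable_fst f])
  have Z1: "(\<lambda>q. Z (snd q)) \<in> measurable (N \<Otimes>\<^sub>M P) F_inf" by (rule measurable_compose[OF measurable_snd Z_meas])
  have t1: "(\<lambda>q. tau T (g (fst q)) (f (fst q))) \<in> borel_measurable (N \<Otimes>\<^sub>M P)"
    by (rule measurable_compose[OF measurable_fst tm])
  have "(\<lambda>q. test_fun m l (\<lambda>t. f (fst q) (min t (tau T (g (fst q)) (f (fst q)))) -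
      Z (snd q) (max 0 (t - tau T (g (fst q)) (f (fst q)))))) \<in> borel_measurable (N \<Otimes>\<^sub>M P)"
  proof (rule measurable_test_fun[where f="\<lambda>q t. f (fst q) (min t (tau T (g (fst q)) (f (fst q)))) -
      Z (snd q) (max 0 (t - tau T (g (fst q)) (f (fst q))))"])
    fix p assume p: "p \<in> set l"
    have 1: "(\<lambda>q. f (fst q) (min (fst p) (tau T (g (fst q)) (f (fst q))))) \<in> borel_measurable (N \<Otimes>\<^sub>M P)"
      by (rule measurable_eval_inf[OF f1, where g="\<lambda>q. min (fst p) (tau T (g (fst q)) (f (fst q)))"])
         (use t1 l p tb in auto)
    have 2: "(\<lambda>q. Z (snd q) (max 0 (fst p - tau T (g (fst q)) (f (fst q))))) \<in> borel_measurable (N \<Otimes>\<^sub>M P)"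
      by (rule measurable_eval_inf[OF Z1, where g="\<lambda>q. max 0 (fst p - tau T (g (fst q)) (f (fst q)))"])
         (use t1 in auto)
    show "(\<lambda>q. f (fst q) (min (fst p) (tau T (g (fst q)) (f (fst q)))) -
      Z (snd q) (max 0 (fst p - tau T (g (fst q)) (f (fst q))))) \<in> borel_measurable (N \<Otimes>\<^sub>M P)"
      by (rule borel_measurable_diff[OF 1 2])
  qed
  from measurable_compose[OF this measurable_ennreal] show ?thesis
    unfolding after_def by (intro borel_measurable_nn_integral) (simp add: split_beta')
qed

lemma measurable_level_integrand:
  assumes f: "f \<in> measurable N F_inf" and g: "g \<in> borel_measurable N"
  shows "(\<lambda>x. indicator {w \<in> paths. g x \<le> running_sup T w} (f x) *
    ennreal (exp (- (lam\<^sup>2 * tau T (g x) (f x) / 2))) * after (g x) (f x)) \<in> borel_measurable N"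
proof -
  have S: "(\<lambda>x. running_sup T (f x)) \<in> borel_measurable N" using T by (intro measurable_running_sup_inf f) auto
  note tm = measurable_tau[OF f g T] and am = measurable_after[OF f g]
  have "(\<lambda>x. (if g x \<le> running_sup T (f x) then 1 else 0) *
    ennreal (exp (- (lam\<^sup>2 * tau T (g x) (f x) / 2))) * after (g x) (f x)) \<in> borel_measurable N"
    using S g tm am by measurable
  also have "?this \<longleftrightarrow> ?thesis"
    using measurable_space[OF f] by (intro measurable_cong) (auto simp: indicator_def)
  finally show ?thesis .
qed

lemma measurable_level: "level \<in> borel_measurable borel"
proof -
  have "(\<lambda>x. indicator {w \<in> paths. fst x \<le> running_sup T w} (snd x) *
    ennreal (exp (- (lam\<^sup>2 * tau T (fst x) (snd x) / 2))) * after (fst x) (snd x)) \<in> borel_measurable (borel \<Otimes>\<^sub>M P)"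
    by (rule measurable_level_integrand[OF measurable_compose[OF measurable_snd ident_P] measurable_fst])
  then show ?thesis unfolding level_def[abs_def] by (intro borel_measurable_nn_integral) (simp add: split_beta')
qed

lemma after_le_1: "after y w \<le> 1"
proof -
  have "after y w \<le> (\<integral>\<^sup>+v. 1 \<partial>P)"
    unfolding after_def by (intro nn_integral_mono) (simp add: test_fun_bounds)
  then show ?thesis using emeasure_space_1 by simp
qed

lemma level_le_1: "level y \<le> 1"
proof -
  have "level y \<le> (\<integral>\<^sup>+v. 1 * 1 * 1 \<partial>P)"
    unfolding level_def using T lam tau_bounds(1)[OF T]
    by (intro nn_integral_mono mult_mono after_le_1) (auto simp: indicator_def)
  then show ?thesis using emeasure_space_1 by simp
qed

lemma path_split:
  assumes w: "w \<in> paths" and t: "0 \<le> t" and s: "0 \<le> s"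
  shows "w t = stop s w t + shift s w (max 0 (t - s))"
  using assms by (cases "t \<le> s") (auto simp: max_def)

text \<open>The strong Markov property at the passage of y. The path is then at its maximum, so
  staying below y + d means that the fresh path stays below d, and the exponential in T factorises
  at the passage.\<close>

lemma near_level_eq:
  assumes y: "0 \<le> y" and d: "0 < d"
  shows "near_level d y = (\<integral>\<^sup>+w. indicator {w \<in> paths. y \<le> running_sup T w} w * ennreal (exp (- (lam\<^sup>2 * tau T y w / 2))) *
    (\<integral>\<^sup>+v. ennreal (test_fun m l (\<lambda>t. w (min t (tau T y w)) + v (max 0 (t - tau T y w)))) *
      (indicator {v \<in> paths. running_sup (T - tau T y w) v < d} v *
       ennreal (sinh (lam * (d - v (T - tau T y w))) * exp (- (lam\<^sup>2 * (T - tau T y w) / 2)))) \<partial>P) \<partial>P)"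
    and "(\<lambda>w. indicator {w \<in> paths. y \<le> running_sup T w} w * ennreal (exp (- (lam\<^sup>2 * tau T y w / 2))) *
    (\<integral>\<^sup>+v. ennreal (test_fun m l (\<lambda>t. w (min t (tau T y w)) + v (max 0 (t - tau T y w)))) *
      (indicator {v \<in> paths. running_sup (T - tau T y w) v < d} v *
       ennreal (sinh (lam * (d - v (T - tau T y w))) * exp (- (lam\<^sup>2 * (T - tau T y w) / 2)))) \<partial>P)) \<in> borel_measurable P"
      (is "?G \<in> borel_measurable P")
proof -
  note tb = tau_bounds[OF T]
  define f where "f p = indicator {w \<in> paths. y \<le> running_sup T w} (fst p) * ennreal (exp (- (lam\<^sup>2 * tau T y (fst p) / 2))) *
    (ennreal (test_fun m l (\<lambda>t. fst p (min t (tau T y (fst p))) + snd p (max 0 (t - tau T y (fst p))))) *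
      (indicator {v \<in> paths. running_sup (T - tau T y (fst p)) v < d} (snd p) *
       ennreal (sinh (lam * (d - snd p (T - tau T y (fst p)))) * exp (- (lam\<^sup>2 * (T - tau T y (fst p)) / 2)))))"
    for p :: "(real \<Rightarrow> real) \<times> (real \<Rightarrow> real)"
  let ?N = "F_inf \<Otimes>\<^sub>M F_inf"
  have t1: "(\<lambda>p. tau T y (fst p)) \<in> borel_measurable ?N" by (rule measurable_tau[OF measurable_fst _ T]) simp
  have f: "f \<in> borel_measurable ?N"
  proof -
    have S1: "(\<lambda>p. running_sup T (fst p)) \<in> borel_measurable ?N" using T by (intro measurable_running_sup_inf) auto
    have S2: "(\<lambda>p. running_sup (T - tau T y (fst p)) (snd p)) \<in> borel_measurable ?N"
      using t1 tb by (intro measurable_running_sup_inf) auto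
    have v: "(\<lambda>p. snd p (T - tau T y (fst p))) \<in> borel_measurable ?N"
      by (rule measurable_eval_inf[OF measurable_snd, where g="\<lambda>p. T - tau T y (fst p)"]) (use t1 tb in auto)
    have F: "(\<lambda>p. test_fun m l (\<lambda>t. fst p (min t (tau T y (fst p))) + snd p (max 0 (t - tau T y (fst p))))) \<in> borel_measurable ?N"
    proof (rule measurable_test_fun[where f="\<lambda>p t. fst p (min t (tau T y (fst p))) + snd p (max 0 (t - tau T y (fst p)))"])
      fix q assume q: "q \<in> set l"
      have 1: "(\<lambda>p. fst p (min (fst q) (tau T y (fst p)))) \<in> borel_measurable ?N"
        by (rule measurable_eval_inf[OF measurable_fst, where g="\<lambda>p. min (fst q) (tau T y (fst p))"]) (use t1 tb q l in auto)
      have 2: "(\<lambda>p. snd p (max 0 (fst q - tau T y (fst p)))) \<in> borel_measurable ?N"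
        by (rule measurable_eval_inf[OF measurable_snd, where g="\<lambda>p. max 0 (fst q - tau T y (fst p))"]) (use t1 in auto)
      show "(\<lambda>p. fst p (min (fst q) (tau T y (fst p))) + snd p (max 0 (fst q - tau T y (fst p)))) \<in> borel_measurable ?N"
        by (rule borel_measurable_add[OF 1 2])
    qed
    have "(\<lambda>p. (if y \<le> running_sup T (fst p) then 1 else 0) * ennreal (exp (- (lam\<^sup>2 * tau T y (fst p) / 2))) *
      (ennreal (test_fun m l (\<lambda>t. fst p (min t (tau T y (fst p))) + snd p (max 0 (t - tau T y (fst p))))) *
      ((if running_sup (T - tau T y (fst p)) (snd p) < d then 1 else 0) *
       ennreal (sinh (lam * (d - snd p (T - tau T y (fst p)))) * exp (- (lam\<^sup>2 * (T - tau T y (fst p)) / 2)))))) \<in> borel_measurable ?N"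
      unfolding sinh_field_def using S1 S2 v F t1 by measurable
    also have "?this \<longleftrightarrow> f \<in> borel_measurable ?N"
      by (intro measurable_cong) (auto simp: f_def space_pair_measure indicator_def)
    finally show ?thesis .
  qed
  have ae: "AE w in P. ennreal (test_fun m l w) *
     (indicator {w \<in> paths. y \<le> running_sup T w \<and> running_sup T w < y + d} w *
      ennreal (sinh (lam * (y + d - w T)) * exp (- (lam\<^sup>2 * T / 2)))) = f (stop (tau T y w) w, shift (tau T y w) w)"
    using start_0 AE_paths
  proof eventually_elim
    case (elim w)
    let ?t = "tau T y w"
    have st: "stop ?t w \<in> paths" "shift ?t w \<in> paths" using elim tb by auto
    have ts: "tau T y (stop ?t w) = ?t" by (rule tau_stop[OF elim(2) T])
    have ss: "y \<le> running_sup T (stop ?t w) \<longleftrightarrow> y \<le> running_sup T w" by (rule sup_stop_tau[OF elim(2) T])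
    show ?case
    proof (cases "y \<le> running_sup T w")
      case True
      note pt = path_at_tau[OF elim(2,1) T y True]
      have sup: "running_sup T w < y + d \<longleftrightarrow> running_sup (T - ?t) (shift ?t w) < d"
        using sup_shift[OF elim(2) tb, of y w] pt d by auto
      have wT: "w T = y + shift ?t w (T - ?t)" using tb[of y w] pt by simp
      have F: "test_fun m l w = test_fun m l (\<lambda>t. stop ?t w (min t ?t) + shift ?t w (max 0 (t - ?t)))"
        using l tb path_split[OF elim(2) _ tb(1)] by (intro test_fun_cong) (auto simp: min_def)
      have e: "ennreal (exp (- (lam\<^sup>2 * ?t / 2))) * ennreal (sinh (lam * (d - shift ?t w (T - ?t))) * exp (- (lam\<^sup>2 * (T - ?t) / 2))) =
        ennreal (sinh (lam * (y + d - w T)) * exp (- (lam\<^sup>2 * T / 2)))"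
      proof -
        have "exp (- (lam\<^sup>2 * T / 2)) = exp (- (lam\<^sup>2 * ?t / 2)) * exp (- (lam\<^sup>2 * (T - ?t) / 2))"
          unfolding exp_add[symmetric] by (simp add: field_simps)
        then have "sinh (lam * (y + d - w T)) * exp (- (lam\<^sup>2 * T / 2)) =
          exp (- (lam\<^sup>2 * ?t / 2)) * (sinh (lam * (d - shift ?t w (T - ?t))) * exp (- (lam\<^sup>2 * (T - ?t) / 2)))"
          unfolding wT by (simp add: algebra_simps)
        then show ?thesis by (simp only: ennreal_mult' exp_ge_zero)
      qed
      show ?thesis
        unfolding f_def fst_conv snd_conv ts e[symmetric] F[symmetric]
        using True elim(2) st ss sup by (auto simp: indicator_def mult.left_commute)
    next
      case False
      then show ?thesis using ss by (simp add: f_def)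
    qed
  qed
  have "near_level d y = (\<integral>\<^sup>+w. f (stop (tau T y w) w, shift (tau T y w) w) \<partial>P)"
    unfolding near_level_def by (rule nn_integral_cong_AE[OF ae])
  also have "\<dots> = (\<integral>\<^sup>+w. \<integral>\<^sup>+v. f (stop (tau T y w) w, v) \<partial>P \<partial>P)"
    by (rule nn_integral_markov[OF path_stopping_tau[OF T] f])
  finally have N: "near_level d y = (\<integral>\<^sup>+w. \<integral>\<^sup>+v. f (stop (tau T y w) w, v) \<partial>P \<partial>P)" .
  have G: "(\<integral>\<^sup>+v. f (stop (tau T y w) w, v) \<partial>P) = ?G w" if "w \<in> space P" for w
  proof -
    have w: "w \<in> paths" using that by simp
    let ?t = "tau T y w"
    have st: "stop ?t w \<in> paths" using w tb by auto
    have ts: "tau T y (stop ?t w) = ?t" by (rule tau_stop[OF w T])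
    have ind: "indicator {w \<in> paths. y \<le> running_sup T w} (stop ?t w) = (indicator {w \<in> paths. y \<le> running_sup T w} w :: ennreal)"
      using sup_stop_tau[OF w T, of y] w st by (simp add: indicator_def)
    have F: "test_fun m l (\<lambda>t. stop ?t w (min t ?t) + v (max 0 (t - ?t))) = test_fun m l (\<lambda>t. w (min t ?t) + v (max 0 (t - ?t)))" for v
      using l tb by (intro test_fun_cong) auto
    have Fm: "(\<lambda>v. test_fun m l (\<lambda>t. w (min t ?t) + v (max 0 (t - ?t)))) \<in> borel_measurable P"
    proof (rule measurable_test_fun[where f="\<lambda>v t. w (min t ?t) + v (max 0 (t - ?t))"])
      fix p
      show "(\<lambda>v. w (min (fst p) ?t) + v (max 0 (fst p - ?t))) \<in> borel_measurable P"
        by (intro borel_measurable_add borel_measurable_const coord_P) simp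
    qed
    have r: "0 \<le> T - ?t" using tb by simp
    have Sm: "{v \<in> paths. running_sup (T - ?t) v < d} \<in> sets P"
      using sup_P[OF r] by (simp del: space_P add: space_P[symmetric])
    have m: "(\<lambda>v. ennreal (test_fun m l (\<lambda>t. w (min t ?t) + v (max 0 (t - ?t)))) *
      (indicator {v \<in> paths. running_sup (T - ?t) v < d} v *
       ennreal (sinh (lam * (d - v (T - ?t))) * exp (- (lam\<^sup>2 * (T - ?t) / 2))))) \<in> borel_measurable P"
      unfolding sinh_field_def using Fm Sm coord_P[OF r] by measurable
    show ?thesis
      unfolding f_def fst_conv snd_conv ts ind F by (rule nn_integral_cmult[OF m])
  qed
  have "(\<lambda>(x, v). f (x, v)) \<in> borel_measurable (F_inf \<Otimes>\<^sub>M P)"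
    using f sets_P by (simp cong: measurable_cong_sets sets_pair_measure_cong)
  from borel_measurable_nn_integral[OF this]
  have fm: "(\<lambda>x. \<integral>\<^sup>+v. f (x, v) \<partial>P) \<in> borel_measurable F_inf" .
  have st: "(\<lambda>w. stop (tau T y w) w) \<in> measurable P F_inf"
    by (rule measurable_stop_inf[OF ident_P measurable_tau[OF ident_P _ T]]) (use tb in auto)
  have "(\<lambda>w. \<integral>\<^sup>+v. f (stop (tau T y w) w, v) \<partial>P) \<in> borel_measurable P"
    by (rule measurable_compose[OF st fm])
  also have "?this \<longleftrightarrow> ?G \<in> borel_measurable P" by (rule measurable_cong[OF G])
  finally show "?G \<in> borel_measurable P" .
  show "near_level d y = integral\<^sup>N P ?G" unfolding N by (rule nn_integral_cong[OF G])
qed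

text \<open>\<open>killed_vs_coth\<close> with barrier distance d and remaining time T - \<tau>,
  integrated over the path before the passage. The prefactor is at most 1, so the error keeps its
  size.\<close>

lemma near_level_bounds:
  assumes y: "0 \<le> y" and d: "0 < d"
  defines "e \<equiv> real (length l) * real m * d"
  shows "near_level d y \<le> ennreal (sinh (lam * d)) * (level y + ennreal e)"
    and "ennreal (sinh (lam * d)) * level y \<le> near_level d y + ennreal (sinh (lam * d)) * ennreal e"
proof -
  note tb = tau_bounds[OF T]
  let ?s = "ennreal (sinh (lam * d))"
  let ?c = "\<lambda>w. indicator {w \<in> paths. y \<le> running_sup T w} w * ennreal (exp (- (lam\<^sup>2 * tau T y w / 2)))"
  let ?I = "\<lambda>w. \<integral>\<^sup>+v. ennreal (test_fun m l (\<lambda>t. w (min t (tau T y w)) + v (max 0 (t - tau T y w)))) *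
      (indicator {v \<in> paths. running_sup (T - tau T y w) v < d} v *
       ennreal (sinh (lam * (d - v (T - tau T y w))) * exp (- (lam\<^sup>2 * (T - tau T y w) / 2)))) \<partial>P"
  have c1: "?c w \<le> 1" for w
    using lam tb by (auto simp: indicator_def)
  have cm: "?c \<in> borel_measurable P"
  proof -
    have "{w \<in> paths. y \<le> running_sup T w} \<in> sets P" using sup_P[OF T] by (simp del: space_P add: space_P[symmetric])
    moreover have "(\<lambda>w. tau T y w) \<in> borel_measurable P" by (rule measurable_tau[OF ident_P _ T]) simp
    ultimately show ?thesis by measurable
  qed
  have am: "(\<lambda>w. ?c w * after y w) \<in> borel_measurable P"
    using cm measurable_after[OF ident_P, of "\<lambda>_. y"] by measurable
  have kv: "?I w \<le> ?s * (after y w + ennreal e)" "?s * after y w \<le> ?I w + ?s * ennreal e" for w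
  proof -
    have "0 \<le> T - tau T y w" "\<forall>p\<in>set l. fst p - tau T y w \<le> T - tau T y w" using tb l by auto
    note k = killed_vs_coth[OF lam Z d this, of m "\<lambda>t. w (min t (tau T y w))"]
    show "?I w \<le> ?s * (after y w + ennreal e)" unfolding after_def e_def by (rule k(1))
    show "?s * after y w \<le> ?I w + ?s * ennreal e" unfolding after_def e_def by (rule k(2))
  qed
  have "near_level d y \<le> (\<integral>\<^sup>+w. ?s * (?c w * after y w + ennreal e) \<partial>P)"
    unfolding near_level_eq(1)[OF y d]
  proof (rule nn_integral_mono)
    fix w
    have "?c w * ?I w \<le> ?c w * (?s * (after y w + ennreal e))" by (rule mult_left_mono[OF kv(1)]) simp
    also have "\<dots> = ?s * (?c w * after y w + ?c w * ennreal e)" by (simp add: distrib_left mult.left_commute)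
    also have "\<dots> \<le> ?s * (?c w * after y w + 1 * ennreal e)"
      by (intro mult_left_mono add_left_mono mult_right_mono c1) auto
    finally show "?c w * ?I w \<le> ?s * (?c w * after y w + ennreal e)" by simp
  qed
  also have "\<dots> = ?s * (level y + ennreal e)"
    unfolding level_def using am emeasure_space_1 by (simp add: nn_integral_cmult nn_integral_add)
  finally show "near_level d y \<le> ?s * (level y + ennreal e)" .
  have "?s * level y = (\<integral>\<^sup>+w. ?s * (?c w * after y w) \<partial>P)"
    unfolding level_def using am by (simp add: nn_integral_cmult)
  also have "\<dots> \<le> (\<integral>\<^sup>+w. ?c w * ?I w + ?s * ennreal e \<partial>P)"
  proof (rule nn_integral_mono)
    fix w
    have "?s * (?c w * after y w) = ?c w * (?s * after y w)" by (rule mult.left_commute)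
    also have "\<dots> \<le> ?c w * (?I w + ?s * ennreal e)" by (rule mult_left_mono[OF kv(2)]) simp
    also have "\<dots> = ?c w * ?I w + ?c w * (?s * ennreal e)" by (rule distrib_left)
    also have "\<dots> \<le> ?c w * ?I w + 1 * (?s * ennreal e)" by (intro add_left_mono mult_right_mono c1) simp
    finally show "?s * (?c w * after y w) \<le> ?c w * ?I w + ?s * ennreal e" by simp
  qed
  also have "\<dots> \<le> near_level d y + ?s * ennreal e"
    unfolding near_level_eq(1)[OF y d]
    using near_level_eq(2)[OF y d] emeasure_space_1 by (subst nn_integral_add) simp_all
  finally show "?s * level y \<le> near_level d y + ?s * ennreal e" .
qed

text \<open>The second summand of the martingale without its factor \<psi>, times the test
  functional.\<close>

definition excursion :: "(real \<Rightarrow> real) \<Rightarrow> ennreal" where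
  "excursion w = ennreal (test_fun m l w) *
     ennreal (sinh (lam * (running_sup T w - w T)) / lam * exp (- (lam\<^sup>2 * T / 2)))"

lemma test_fun_P: "(\<lambda>w. test_fun m l w) \<in> borel_measurable P"
  using l by (intro measurable_test_fun_inf[OF ident_P]) auto

lemma measurable_excursion: "excursion \<in> borel_measurable P"
  unfolding excursion_def sinh_field_def using test_fun_P sup_P[OF T] coord_P[OF T] by measurable

text \<open>Integrate the normalised windows over y and over the path in both orders. For fixed y a
  window is \<open>level y\<close> up to O(d), by \<open>near_level_bounds\<close>; for a fixed path
  the admissible y fill an interval of length d below S_T, on which the weight is nearly
  constant.\<close>

lemma level_interval:
  assumes ab: "0 \<le> a" "a < b"
  shows "(\<integral>\<^sup>+w. excursion w * indicator {a<..b} (running_sup T w) \<partial>P) = (\<integral>\<^sup>+y. level y * indicator {a<..b} y \<partial>lborel)"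
proof -
  define d where "d n = 1 / real (Suc n)" for n
  \<comment> \<open>Normalisation of the windows: d / s tends to 1 / \<lambda> and, since sinh x
    \<ge> x / 2 for x \<ge> 0, never exceeds 2 / \<lambda>.\<close>
  define s where "s n = sinh (lam * d n)" for n
  have d: "0 < d n" "d n \<le> 1" for n by (auto simp: d_def)
  have s: "0 < s n" for n using lam d[of n] by (simp add: s_def)
  have ds: "d n / s n \<le> 2 / lam" for n
  proof -
    have "lam * d n / 2 \<le> s n" unfolding s_def using lam d[of n] by (intro sinh_ge_half) simp
    then show ?thesis using lam s[of n] by (simp add: field_simps)
  qed
  have ds_lim: "(\<lambda>n. d n / s n) \<longlonglongrightarrow> 1 / lam"
    unfolding d_def s_def by (rule sinh_quotient_tendsto[OF lam])
  have d_lim: "d \<longlonglongrightarrow> 0"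
    unfolding d_def[abs_def] by (rule LIMSEQ_inverse_real_of_nat[unfolded inverse_eq_divide])
  define e where "e = exp (- (lam\<^sup>2 * T / 2))"
  have e: "0 < e" "e \<le> 1" using T lam by (auto simp: e_def)
  define h where "h n w y = indicator {y. a < y \<and> y \<le> b \<and> y \<le> running_sup T w \<and> running_sup T w < y + d n} y *
    ennreal (sinh (lam * (y + d n - w T)) * e / s n)" for n w y
  define A where "A n w = (\<integral>\<^sup>+y. h n w y \<partial>lborel)" for n w
  have hm: "(\<lambda>p. h n (fst p) (snd p)) \<in> borel_measurable (P \<Otimes>\<^sub>M lborel)" for n
  proof -
    have S: "(\<lambda>p. running_sup T (fst p)) \<in> borel_measurable (P \<Otimes>\<^sub>M lborel)"
      by (rule measurable_compose[OF measurable_fst sup_P[OF T]])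
    have wT: "(\<lambda>p. fst p T) \<in> borel_measurable (P \<Otimes>\<^sub>M lborel)"
      by (rule measurable_compose[OF measurable_fst coord_P[OF T]])
    have "(\<lambda>p. (if a < snd p \<and> snd p \<le> b \<and> snd p \<le> running_sup T (fst p) \<and> running_sup T (fst p) < snd p + d n then 1 else 0) *
      ennreal (sinh (lam * (snd p + d n - fst p T)) * e / s n)) \<in> borel_measurable (P \<Otimes>\<^sub>M lborel)"
      unfolding sinh_field_def using S wT by measurable
    also have "?this \<longleftrightarrow> ?thesis" by (intro measurable_cong) (auto simp: h_def indicator_def)
    finally show ?thesis .
  qed
  have Am: "A n \<in> borel_measurable P" for n
    unfolding A_def using hm[of n] by (intro lborel.borel_measurable_nn_integral) (simp add: split_beta')
  have h_sec: "h n w \<in> borel_measurable lborel" for n w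
    unfolding h_def sinh_field_def by measurable
  have fubini: "ennreal (1 / s n) * (\<integral>\<^sup>+y. near_level (d n) y * indicator {a<..b} y \<partial>lborel) =
    (\<integral>\<^sup>+w. ennreal (test_fun m l w) * A n w \<partial>P)"
    and near_level_meas: "(\<lambda>y. near_level (d n) y * indicator {a<..b} y) \<in> borel_measurable lborel" for n
  proof -
    have psf: "pair_sigma_finite P lborel" ..
    have Sm: "{w \<in> paths. y \<le> running_sup T w \<and> running_sup T w < y + d n} \<in> sets P" for y
      using sup_P[OF T] by (simp del: space_P add: space_P[symmetric])
    have nlm: "(\<lambda>w. ennreal (test_fun m l w) *
      (indicator {w \<in> paths. y \<le> running_sup T w \<and> running_sup T w < y + d n} w *
      ennreal (sinh (lam * (y + d n - w T)) * exp (- (lam\<^sup>2 * T / 2))))) \<in> borel_measurable P" for y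
      unfolding sinh_field_def using test_fun_P Sm coord_P[OF T] by measurable
    have pt: "ennreal (1 / s n) * (near_level (d n) y * indicator {a<..b} y) = (\<integral>\<^sup>+w. ennreal (test_fun m l w) * h n w y \<partial>P)" for y
    proof -
      have "ennreal (1 / s n) * (near_level (d n) y * indicator {a<..b} y) =
        (ennreal (1 / s n) * indicator {a<..b} y) * near_level (d n) y" by (simp only: mult_ac)
      also have "\<dots> = (\<integral>\<^sup>+w. (ennreal (1 / s n) * indicator {a<..b} y) * (ennreal (test_fun m l w) *
        (indicator {w \<in> paths. y \<le> running_sup T w \<and> running_sup T w < y + d n} w *
        ennreal (sinh (lam * (y + d n - w T)) * exp (- (lam\<^sup>2 * T / 2))))) \<partial>P)"
        unfolding near_level_def by (rule nn_integral_cmult[OF nlm, symmetric])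
      also have "\<dots> = (\<integral>\<^sup>+w. ennreal (test_fun m l w) * h n w y \<partial>P)"
      proof (rule nn_integral_cong)
        fix w assume "w \<in> space P"
        then have w: "w \<in> paths" by simp
        have "ennreal (1 / s n) * ennreal (sinh (lam * (y + d n - w T)) * exp (- (lam\<^sup>2 * T / 2))) =
          ennreal (sinh (lam * (y + d n - w T)) * e / s n)"
          using s[of n] by (simp add: ennreal_mult'[symmetric] e_def)
        then have "ennreal (1 / s n) * (ennreal (test_fun m l w) * ennreal (sinh (lam * (y + d n - w T)) * exp (- (lam\<^sup>2 * T / 2)))) =
          ennreal (test_fun m l w) * ennreal (sinh (lam * (y + d n - w T)) * e / s n)"
          by (metis mult.left_commute)
        then show "(ennreal (1 / s n) * indicator {a<..b} y) * (ennreal (test_fun m l w) *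
          (indicator {w \<in> paths. y \<le> running_sup T w \<and> running_sup T w < y + d n} w *
          ennreal (sinh (lam * (y + d n - w T)) * exp (- (lam\<^sup>2 * T / 2))))) = ennreal (test_fun m l w) * h n w y"
          using w by (auto simp: h_def indicator_def)
      qed
      finally show ?thesis .
    qed
    have fm: "(\<lambda>(w, y). ennreal (test_fun m l w) * h n w y) \<in> borel_measurable (P \<Otimes>\<^sub>M lborel)"
      using hm[of n] measurable_compose[OF measurable_fst test_fun_P] unfolding split_beta' by measurable
    have pm: "(\<lambda>y. \<integral>\<^sup>+w. ennreal (test_fun m l w) * h n w y \<partial>P) \<in> borel_measurable lborel"
      using measurable_pair_swap[OF fm] by (intro borel_measurable_nn_integral) (simp add: split_beta')
    \<comment> \<open>Measurability in y comes from the Fubini integrand, of which the window is a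
      constant multiple.\<close>
    show nm: "(\<lambda>y. near_level (d n) y * indicator {a<..b} y) \<in> borel_measurable lborel"
    proof -
      have "near_level (d n) y * indicator {a<..b} y = ennreal (s n) * (\<integral>\<^sup>+w. ennreal (test_fun m l w) * h n w y \<partial>P)" for y
      proof -
        have "ennreal (s n) * ennreal (1 / s n) = 1" using s[of n] by (simp add: ennreal_mult'[symmetric])
        then show ?thesis unfolding pt[symmetric] mult.assoc[symmetric] by simp
      qed
      then show ?thesis using pm by simp
    qed
    have "ennreal (1 / s n) * (\<integral>\<^sup>+y. near_level (d n) y * indicator {a<..b} y \<partial>lborel) =
      (\<integral>\<^sup>+y. ennreal (1 / s n) * (near_level (d n) y * indicator {a<..b} y) \<partial>lborel)"
      by (rule nn_integral_cmult[OF nm, symmetric])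
    also have "\<dots> = (\<integral>\<^sup>+y. \<integral>\<^sup>+w. ennreal (test_fun m l w) * h n w y \<partial>P \<partial>lborel)" unfolding pt ..
    also have "\<dots> = (\<integral>\<^sup>+w. \<integral>\<^sup>+y. ennreal (test_fun m l w) * h n w y \<partial>lborel \<partial>P)"
      by (rule pair_sigma_finite.Fubini'[OF psf fm])
    also have "\<dots> = (\<integral>\<^sup>+w. ennreal (test_fun m l w) * A n w \<partial>P)"
      unfolding A_def using h_sec by (intro nn_integral_cong nn_integral_cmult) auto
    finally show "ennreal (1 / s n) * (\<integral>\<^sup>+y. near_level (d n) y * indicator {a<..b} y \<partial>lborel) =
      (\<integral>\<^sup>+w. ennreal (test_fun m l w) * A n w \<partial>P)" .
  qed
  have seg: "(\<integral>\<^sup>+y. indicator {S - d n<..S} y * ennreal c \<partial>lborel) = ennreal (d n) * ennreal c" for S c n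
    using d[of n] by (simp add: nn_integral_multc)
  have lim: "(\<lambda>n. A n w) \<longlonglongrightarrow> indicator {a<..b} (running_sup T w) * ennreal (sinh (lam * (running_sup T w - w T)) / lam * e)"
    if w: "w \<in> paths" for w
  proof -
    let ?S = "running_sup T w"
    have ST: "w T \<le> ?S" by (rule running_sup_ge[OF w T order_refl])
    consider "?S \<le> a" | "b < ?S" | "a < ?S" "?S \<le> b" by linarith
    then show ?thesis
    proof cases
      case 1
      then have "h n w y = 0" for n y by (auto simp: h_def indicator_def)
      then have "A n w = 0" for n by (simp add: A_def)
      then show ?thesis using 1 by simp
    next
      case 2
      have "\<forall>\<^sub>F n in sequentially. d n < ?S - b" by (rule order_tendstoD(2)[OF d_lim]) (use 2 in simp)
      then have "\<forall>\<^sub>F n in sequentially. A n w = 0"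
      proof eventually_elim
        case (elim n)
        then have "h n w y = 0" for y by (auto simp: h_def indicator_def)
        then show ?case by (simp add: A_def)
      qed
      then show ?thesis using 2 by (simp add: tendsto_eventually)
    next
      case 3
      \<comment> \<open>The weight increases in y. Its values at the ends y = S - d and y = S of the
        admissible interval enclose the integral.\<close>
      let ?lo = "\<lambda>n. d n * (sinh (lam * (?S - w T)) * e / s n)" and ?hi = "\<lambda>n. d n * (sinh (lam * (?S + d n - w T)) * e / s n)"
      have "(\<lambda>n. d n / s n * (sinh (lam * (?S - w T)) * e)) \<longlonglongrightarrow> 1 / lam * (sinh (lam * (?S - w T)) * e)"
        by (intro tendsto_mult ds_lim tendsto_const)
      then have lo: "?lo \<longlonglongrightarrow> sinh (lam * (?S - w T)) / lam * e" by (simp add: field_simps)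
      have "(\<lambda>n. d n / s n * (sinh (lam * (?S + d n - w T)) * e)) \<longlonglongrightarrow> 1 / lam * (sinh (lam * (?S + 0 - w T)) * e)"
        by (intro tendsto_intros ds_lim d_lim)
      then have hi: "?hi \<longlonglongrightarrow> sinh (lam * (?S - w T)) / lam * e" by (simp add: field_simps)
      \<comment> \<open>Once d < S - a the whole interval {S - d<..S} lies in {a<..b}, so nothing is
        lost at the ends.\<close>
      have "\<forall>\<^sub>F n in sequentially. d n < ?S - a" by (rule order_tendstoD(2)[OF d_lim]) (use 3 in simp)
      then have hh: "\<forall>\<^sub>F n in sequentially. ennreal (?lo n) \<le> A n w \<and> A n w \<le> ennreal (?hi n)"
      proof eventually_elim
        case (elim n)
        have hy: "h n w y = indicator {?S - d n<..?S} y * ennreal (sinh (lam * (y + d n - w T)) * e / s n)" for y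
          using elim 3 by (auto simp: h_def indicator_def)
        have "ennreal (?lo n) = (\<integral>\<^sup>+y. indicator {?S - d n<..?S} y * ennreal (sinh (lam * (?S - w T)) * e / s n) \<partial>lborel)"
          unfolding seg by (rule ennreal_mult'[OF less_imp_le[OF d(1)]])
        also have "\<dots> \<le> A n w"
          unfolding A_def hy
        proof (rule nn_integral_mono)
          fix y
          show "indicator {?S - d n<..?S} y * ennreal (sinh (lam * (?S - w T)) * e / s n) \<le>
            indicator {?S - d n<..?S} y * ennreal (sinh (lam * (y + d n - w T)) * e / s n)"
          proof (cases "y \<in> {?S - d n<..?S}")
            case True
            then have "sinh (lam * (?S - w T)) \<le> sinh (lam * (y + d n - w T))" using lam by simp
            then show ?thesis using True e s[of n] by (auto intro!: ennreal_leI divide_right_mono mult_right_mono)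
          qed simp
        qed
        finally have 1: "ennreal (?lo n) \<le> A n w" .
        have "A n w \<le> (\<integral>\<^sup>+y. indicator {?S - d n<..?S} y * ennreal (sinh (lam * (?S + d n - w T)) * e / s n) \<partial>lborel)"
          unfolding A_def hy
        proof (rule nn_integral_mono)
          fix y
          show "indicator {?S - d n<..?S} y * ennreal (sinh (lam * (y + d n - w T)) * e / s n) \<le>
            indicator {?S - d n<..?S} y * ennreal (sinh (lam * (?S + d n - w T)) * e / s n)"
          proof (cases "y \<in> {?S - d n<..?S}")
            case True
            then have "sinh (lam * (y + d n - w T)) \<le> sinh (lam * (?S + d n - w T))" using lam by simp
            then show ?thesis using True e s[of n] by (auto intro!: ennreal_leI divide_right_mono mult_right_mono)
          qed simp
        qed
        also have "\<dots> = ennreal (?hi n)" unfolding seg by (rule ennreal_mult'[OF less_imp_le[OF d(1)], symmetric])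
        finally show ?case using 1 by simp
      qed
      have "(\<lambda>n. A n w) \<longlonglongrightarrow> ennreal (sinh (lam * (?S - w T)) / lam * e)"
        by (rule tendsto_sandwich[OF _ _ tendsto_ennrealI[OF lo] tendsto_ennrealI[OF hi]])
           (use hh in \<open>auto elim: eventually_mono\<close>)
      then show ?thesis using 3 by simp
    qed
  qed
  \<comment> \<open>A dominating function free of n: y \<le> b and d \<le> 1 bound the argument of
    sinh, and d / s \<le> 2 / \<lambda>.\<close>
  have bound: "A n w \<le> ennreal (2 / lam * (exp (lam * (b + 1)) * exp (- lam * w T)))" for n w
  proof -
    let ?S = "running_sup T w" and ?c = "exp (lam * (b + 1)) * exp (- lam * w T) / s n"
    have "A n w \<le> (\<integral>\<^sup>+y. indicator {?S - d n<..?S} y * ennreal ?c \<partial>lborel)"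
      unfolding A_def
    proof (rule nn_integral_mono)
      fix y
      show "h n w y \<le> indicator {?S - d n<..?S} y * ennreal ?c"
      proof (cases "a < y \<and> y \<le> b \<and> y \<le> ?S \<and> ?S < y + d n")
        case True
        have "sinh (lam * (y + d n - w T)) \<le> exp (lam * (y + d n - w T))" by (rule sinh_le_exp)
        also have "\<dots> \<le> exp (lam * (b + 1 - w T))" using True d[of n] lam by simp
        also have "\<dots> = exp (lam * (b + 1)) * exp (- lam * w T)" by (simp add: exp_add[symmetric] algebra_simps)
        finally have s1: "sinh (lam * (y + d n - w T)) \<le> exp (lam * (b + 1)) * exp (- lam * w T)" .
        have "sinh (lam * (y + d n - w T)) * e \<le> exp (lam * (b + 1)) * exp (- lam * w T) * e"
          using s1 e by (intro mult_right_mono) auto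
        also have "\<dots> \<le> exp (lam * (b + 1)) * exp (- lam * w T) * 1" using e by (intro mult_left_mono) auto
        finally have "sinh (lam * (y + d n - w T)) * e / s n \<le> ?c" using s[of n] by (intro divide_right_mono) auto
        then show ?thesis using True by (auto simp: h_def intro!: ennreal_leI)
      qed (auto simp: h_def indicator_def)
    qed
    also have "\<dots> = ennreal (d n * ?c)" unfolding seg by (rule ennreal_mult'[OF less_imp_le[OF d(1)], symmetric])
    also have "d n * ?c = d n / s n * (exp (lam * (b + 1)) * exp (- lam * w T))" by simp
    also have "ennreal \<dots> \<le> ennreal (2 / lam * (exp (lam * (b + 1)) * exp (- lam * w T)))"
      using ds[of n] by (intro ennreal_leI mult_right_mono) auto
    finally show ?thesis .
  qed
  have target_m: "(\<lambda>w. ennreal (test_fun m l w) * (indicator {a<..b} (running_sup T w) * ennreal (sinh (lam * (running_sup T w - w T)) / lam * e))) \<in> borel_measurable P"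
    unfolding sinh_field_def using test_fun_P sup_P[OF T] coord_P[OF T] by measurable
  have X: "(\<lambda>n. \<integral>\<^sup>+w. ennreal (test_fun m l w) * A n w \<partial>P) \<longlonglongrightarrow>
    (\<integral>\<^sup>+w. ennreal (test_fun m l w) * (indicator {a<..b} (running_sup T w) * ennreal (sinh (lam * (running_sup T w - w T)) / lam * e)) \<partial>P)"
  proof (rule nn_integral_dominated_convergence[where w="\<lambda>w. ennreal (2 / lam * (exp (lam * (b + 1)) * exp (- lam * w T)))"])
    show "(\<lambda>w. ennreal (test_fun m l w) * A n w) \<in> borel_measurable P" for n
      using test_fun_P Am[of n] by measurable
    show "(\<lambda>w. ennreal (2 / lam * (exp (lam * (b + 1)) * exp (- lam * w T)))) \<in> borel_measurable P"
      using coord_P[OF T] by measurable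
    have "(\<integral>\<^sup>+w. ennreal (2 / lam * (exp (lam * (b + 1)) * exp (- lam * w T))) \<partial>P) =
      ennreal (2 / lam * exp (lam * (b + 1))) * ennreal (exp ((- lam)\<^sup>2 * T / 2))"
    proof -
      have "(\<integral>\<^sup>+w. ennreal (2 / lam * (exp (lam * (b + 1)) * exp (- lam * w T))) \<partial>P) =
        (\<integral>\<^sup>+w. ennreal (2 / lam * exp (lam * (b + 1))) * ennreal (exp (- lam * w T)) \<partial>P)"
        using lam by (simp add: ennreal_mult'[symmetric] mult.assoc)
      also have "\<dots> = ennreal (2 / lam * exp (lam * (b + 1))) * (\<integral>\<^sup>+w. ennreal (exp (- lam * w T)) \<partial>P)"
        by (rule nn_integral_cmult) (rule measurable_compose[OF coord_P[OF T], where g="\<lambda>x. ennreal (exp (- lam * x))"], simp)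
      finally show ?thesis unfolding nn_integral_exp[OF T] .
    qed
    then show "(\<integral>\<^sup>+w. ennreal (2 / lam * (exp (lam * (b + 1)) * exp (- lam * w T))) \<partial>P) < \<infinity>"
      by (simp add: ennreal_mult_less_top)
    show "AE w in P. ennreal (test_fun m l w) * A n w \<le> ennreal (2 / lam * (exp (lam * (b + 1)) * exp (- lam * w T)))" for n
    proof (rule AE_I2)
      fix w
      have "ennreal (test_fun m l w) * A n w \<le> 1 * A n w" using test_fun_bounds by (intro mult_right_mono) auto
      then show "ennreal (test_fun m l w) * A n w \<le> ennreal (2 / lam * (exp (lam * (b + 1)) * exp (- lam * w T)))"
        using bound[of n w] by simp
    qed
    show "AE w in P. (\<lambda>n. ennreal (test_fun m l w) * A n w) \<longlonglongrightarrow>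
      ennreal (test_fun m l w) * (indicator {a<..b} (running_sup T w) * ennreal (sinh (lam * (running_sup T w - w T)) / lam * e))"
      using AE_paths by eventually_elim (intro ennreal_tendsto_cmult lim, auto)
  qed (rule target_m)
  define G where "G = (\<integral>\<^sup>+y. level y * indicator {a<..b} y \<partial>lborel)"
  define c where "c n = ennreal (real (length l) * real m * d n * (b - a))" for n
  have ind_int: "(\<integral>\<^sup>+y. k * indicator {a<..b} y \<partial>lborel) = k * ennreal (b - a)" for k :: ennreal
    using ab by (simp add: nn_integral_cmult_indicator)
  have lm: "(\<lambda>y. level y * indicator {a<..b} y) \<in> borel_measurable lborel"
    using measurable_level by simp
  have one: "ennreal (1 / s n) * ennreal (s n) = 1" for n using s[of n] by (simp add: ennreal_mult'[symmetric])
  have c_eq: "(\<integral>\<^sup>+y. ennreal (real (length l) * real m * d n) * indicator {a<..b} y \<partial>lborel) = c n" for n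
    unfolding ind_int c_def using d[of n] ab by (simp add: ennreal_mult')
  have up: "(\<integral>\<^sup>+w. ennreal (test_fun m l w) * A n w \<partial>P) \<le> G + c n" for n
  proof -
    have "(\<integral>\<^sup>+y. near_level (d n) y * indicator {a<..b} y \<partial>lborel) \<le>
      (\<integral>\<^sup>+y. ennreal (s n) * (level y * indicator {a<..b} y + ennreal (real (length l) * real m * d n) * indicator {a<..b} y) \<partial>lborel)"
      using near_level_bounds(1)[OF _ d(1)[of n]] ab
      by (intro nn_integral_mono) (auto simp: indicator_def s_def)
    also have "\<dots> = ennreal (s n) * (G + c n)"
      unfolding G_def c_eq[symmetric] using lm by (subst nn_integral_cmult) (simp_all add: nn_integral_add)
    finally have "ennreal (1 / s n) * (\<integral>\<^sup>+y. near_level (d n) y * indicator {a<..b} y \<partial>lborel) \<le>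
      ennreal (1 / s n) * (ennreal (s n) * (G + c n))" by (rule mult_left_mono) simp
    then show ?thesis unfolding fubini mult.assoc[symmetric] one by simp
  qed
  have lw: "G \<le> (\<integral>\<^sup>+w. ennreal (test_fun m l w) * A n w \<partial>P) + c n" for n
  proof (cases "(\<integral>\<^sup>+y. near_level (d n) y * indicator {a<..b} y \<partial>lborel) = \<infinity>")
    case True
    then show ?thesis unfolding fubini[symmetric] using s[of n] by (simp add: ennreal_mult_top)
  next
    case False
    have "ennreal (s n) * G = (\<integral>\<^sup>+y. ennreal (s n) * (level y * indicator {a<..b} y) \<partial>lborel)"
      unfolding G_def using lm by (simp add: nn_integral_cmult)
    also have "\<dots> \<le> (\<integral>\<^sup>+y. ennreal (s n) * (ennreal (real (length l) * real m * d n) * indicator {a<..b} y) + near_level (d n) y * indicator {a<..b} y \<partial>lborel)"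
      using near_level_bounds(2)[OF _ d(1)[of n]] ab
      by (intro nn_integral_mono) (auto simp: indicator_def s_def add.commute)
    also have "\<dots> = ennreal (s n) * c n + (\<integral>\<^sup>+y. near_level (d n) y * indicator {a<..b} y \<partial>lborel)"
      unfolding c_eq[symmetric] using near_level_meas[of n] by (subst nn_integral_add) (simp_all add: nn_integral_cmult)
    finally have "ennreal (1 / s n) * (ennreal (s n) * G) \<le>
      ennreal (1 / s n) * (ennreal (s n) * c n + (\<integral>\<^sup>+y. near_level (d n) y * indicator {a<..b} y \<partial>lborel))"
      by (rule mult_left_mono) simp
    then show ?thesis unfolding distrib_left fubini[symmetric] mult.assoc[symmetric] one by (simp add: add.commute)
  qed
  have "(\<lambda>n. real (length l) * real m * d n * (b - a)) \<longlonglongrightarrow> real (length l) * real m * 0 * (b - a)"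
    by (intro tendsto_mult tendsto_const d_lim)
  from tendsto_ennrealI[OF this] have c0: "c \<longlonglongrightarrow> 0" unfolding c_def[abs_def] by simp
  let ?X = "\<integral>\<^sup>+w. ennreal (test_fun m l w) * (indicator {a<..b} (running_sup T w) * ennreal (sinh (lam * (running_sup T w - w T)) / lam * e)) \<partial>P"
  \<comment> \<open>The error terms c n tend to 0, and the upper and the lower estimate
    meet.\<close>
  have "?X \<le> G + 0"
    by (rule LIMSEQ_le[OF X tendsto_add[OF tendsto_const c0]]) (use up in blast)
  moreover have "G \<le> ?X + 0"
    by (rule LIMSEQ_le_const[OF tendsto_add[OF X c0]]) (use lw in blast)
  ultimately have "?X = G" by simp
  moreover have "?X = (\<integral>\<^sup>+w. excursion w * indicator {a<..b} (running_sup T w) \<partial>P)"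
    by (intro nn_integral_cong) (simp add: excursion_def e_def mult_ac)
  ultimately show ?thesis by (simp add: G_def)
qed

text \<open>Both sides integrate g against measures in the level that agree on intervals {a<..b}, a
  generator on which they are finite because \<open>level\<close> is at most 1. Only positive levels
  enter, as \<open>level_interval\<close> asks for 0 \<le> a.\<close>

lemma level_integral:
  assumes g: "g \<in> borel_measurable borel"
  shows "(\<integral>\<^sup>+w. excursion w * indicator {0<..} (running_sup T w) * g (running_sup T w) \<partial>P) =
    (\<integral>\<^sup>+y. level y * indicator {0<..} y * g y \<partial>lborel)"
proof -
  let ?S = "\<lambda>w. running_sup T w"
  define q where "q w = excursion w * indicator {0<..} (?S w)" for w
  have S: "?S \<in> borel_measurable P" by (rule sup_P[OF T])
  have q: "q \<in> borel_measurable P" unfolding q_def[abs_def] using measurable_excursion S by measurable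
  have lv: "(\<lambda>y. level y * indicator {0<..} y) \<in> borel_measurable lborel" using measurable_level by simp
  have Sd: "?S \<in> borel_measurable (density P q)" using S by simp
  have eq: "emeasure (distr (density P q) borel ?S) {a<..b} = emeasure (density lborel (\<lambda>y. level y * indicator {0<..} y)) {a<..b}" for a b
  proof -
    have 1: "emeasure (distr (density P q) borel ?S) {a<..b} = (\<integral>\<^sup>+w. q w * indicator {a<..b} (?S w) \<partial>P)"
    proof -
      have Sv: "?S -` {a<..b} \<inter> space P \<in> sets P" using S by (rule measurable_sets) simp
      have "emeasure (distr (density P q) borel ?S) {a<..b} = emeasure (density P q) (?S -` {a<..b} \<inter> space P)"
        by (subst emeasure_distr[OF Sd]) auto
      also have "\<dots> = (\<integral>\<^sup>+w. q w * indicator (?S -` {a<..b} \<inter> space P) w \<partial>P)"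
        by (rule emeasure_density[OF q Sv])
      also have "\<dots> = (\<integral>\<^sup>+w. q w * indicator {a<..b} (?S w) \<partial>P)"
        by (intro nn_integral_cong) (auto simp: indicator_def)
      finally show ?thesis .
    qed
    also have "\<dots> = (\<integral>\<^sup>+w. excursion w * indicator {max a 0<..b} (?S w) \<partial>P)"
      by (intro nn_integral_cong) (auto simp: q_def indicator_def)
    also have "\<dots> = (\<integral>\<^sup>+y. level y * indicator {max a 0<..b} y \<partial>lborel)"
    proof (cases "max a 0 < b")
      case True
      then show ?thesis by (intro level_interval) auto
    next
      case False
      then have e: "{max a 0<..b} = {}" by simp
      show ?thesis unfolding e by simp
    qed
    also have "\<dots> = (\<integral>\<^sup>+y. level y * indicator {0<..} y * indicator {a<..b} y \<partial>lborel)"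
      by (intro nn_integral_cong) (auto simp: indicator_def)
    also have "\<dots> = emeasure (density lborel (\<lambda>y. level y * indicator {0<..} y)) {a<..b}"
      by (rule emeasure_density[OF lv, symmetric]) simp
    finally show ?thesis .
  qed
  have "distr (density P q) borel ?S = density lborel (\<lambda>y. level y * indicator {0<..} y)"
  proof (rule measure_eqI_generator_eq[where E="range (\<lambda>(a, b). {a<..b :: real})" and \<Omega>=UNIV and A="\<lambda>i. {- real i<..real i}"])
    show "Int_stable (range (\<lambda>(a, b). {a<..b :: real}))"
    proof (rule Int_stableI)
      fix A B assume "A \<in> range (\<lambda>(a, b). {a<..b :: real})" "B \<in> range (\<lambda>(a, b). {a<..b :: real})"
      then obtain a b c d where "A = {a<..b}" "B = {c<..d}" by auto
      then have "A \<inter> B = (\<lambda>(a, b). {a<..b}) (max a c, min b d)" by auto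
      then show "A \<inter> B \<in> range (\<lambda>(a, b). {a<..b :: real})" by blast
    qed
    show "(\<Union>i. {- real i<..real i}) = UNIV"
    proof (intro set_eqI iffI UNIV_I)
      fix x :: real
      obtain n :: nat where "\<bar>x\<bar> < real n" using reals_Archimedean2 by blast
      then have "x \<in> {- real n<..real n}" by auto
      then show "x \<in> (\<Union>i. {- real i<..real i})" by blast
    qed
    show "emeasure (distr (density P q) borel ?S) {- real i<..real i} \<noteq> \<infinity>" for i
    proof -
      have "emeasure (distr (density P q) borel ?S) {- real i<..real i} =
        (\<integral>\<^sup>+y. level y * indicator {0<..} y * indicator {- real i<..real i} y \<partial>lborel)"
        unfolding eq by (rule emeasure_density[OF lv]) simp
      also have "\<dots> \<le> (\<integral>\<^sup>+y. 1 * indicator {- real i<..real i} y \<partial>lborel)"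
        using level_le_1 by (intro nn_integral_mono) (auto simp: indicator_def)
      also have "\<dots> < \<infinity>" by (simp add: emeasure_lborel_Ioc)
      finally show ?thesis by simp
    qed
    show "sets (distr (density P q) borel ?S) = sigma_sets UNIV (range (\<lambda>(a, b). {a<..b}))"
      "sets (density lborel (\<lambda>y. level y * indicator {0<..} y)) = sigma_sets UNIV (range (\<lambda>(a, b). {a<..b}))"
      by (simp_all add: borel_sigma_sets_Ioc)
  qed (use eq in auto)
  then have "integral\<^sup>N (distr (density P q) borel ?S) g = integral\<^sup>N (density lborel (\<lambda>y. level y * indicator {0<..} y)) g" by simp
  moreover have "integral\<^sup>N (distr (density P q) borel ?S) g = (\<integral>\<^sup>+w. q w * g (?S w) \<partial>P)"
  proof -
    have "integral\<^sup>N (distr (density P q) borel ?S) g = (\<integral>\<^sup>+w. g (?S w) \<partial>density P q)"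
      using g by (intro nn_integral_distr[OF Sd]) simp
    also have "\<dots> = (\<integral>\<^sup>+w. q w * g (?S w) \<partial>P)"
      using measurable_compose[OF S g] by (rule nn_integral_density[OF q])
    finally show ?thesis .
  qed
  moreover have "integral\<^sup>N (density lborel (\<lambda>y. level y * indicator {0<..} y)) g = (\<integral>\<^sup>+y. level y * indicator {0<..} y * g y \<partial>lborel)"
    using g by (intro nn_integral_density lv) simp
  ultimately show ?thesis unfolding q_def by simp
qed

section \<open>The law attached to one level, evaluated on test functionals\<close>

definition hit_after :: "real \<Rightarrow> (real \<Rightarrow> real) \<Rightarrow> ennreal" where
  "hit_after y w = of_bool (y \<le> running_sup T w) * after y w"

lemma after_cong:
  assumes "tau T y w = tau T y w'" "\<And>t. 0 \<le> t \<Longrightarrow> t \<le> tau T y w \<Longrightarrow> w t = w' t"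
  shows "after y w = after y w'"
  unfolding after_def assms(1)[symmetric]
proof (intro nn_integral_cong arg_cong[where f=ennreal] test_fun_cong)
  fix v p assume "p \<in> set l"
  then have "w (min (fst p) (tau T y w)) = w' (min (fst p) (tau T y w))"
    using l tau_bounds(1)[OF T] by (intro assms(2)) auto
  then show "w (min (fst p) (tau T y w)) - Z v (max 0 (fst p - tau T y w)) =
    w' (min (fst p) (tau T y w)) - Z v (max 0 (fst p - tau T y w))" by simp
qed

lemma measurable_hit_after: "hit_after y \<in> borel_measurable F_inf"
proof -
  have id: "(\<lambda>w. w) \<in> measurable F_inf F_inf" by simp
  have S: "(\<lambda>w. running_sup T w) \<in> borel_measurable F_inf" using T by (intro measurable_running_sup_inf id) auto
  have a: "(\<lambda>w. after y w) \<in> borel_measurable F_inf" by (rule measurable_after[OF id]) simp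
  have "(\<lambda>w. (if y \<le> running_sup T w then 1 else 0) * after y w) \<in> borel_measurable F_inf"
    using S a by measurable
  then show ?thesis by (simp add: hit_after_def[abs_def] of_bool_def)
qed

lemma hit_after_stopped:
  assumes w: "w \<in> paths" "w 0 = 0" and y: "0 \<le> y"
  shows "hit_after y (stopped_path y w) = hit_after y w"
proof (cases "y \<le> running_sup T w")
  case True
  have "after y (stopped_path y w) = after y w"
    using tau_stopped_path[OF w T y True] stopped_path_after(1)[OF w T y True] by (intro after_cong) auto
  then show ?thesis using sup_stopped_path[OF w T y] by (simp add: hit_after_def)
next
  case False
  then show ?thesis using sup_stopped_path[OF w T y] by (simp add: hit_after_def)
qed

lemma hit_after_cong:
  assumes "w \<in> paths" "\<And>t. 0 \<le> t \<Longrightarrow> t \<le> T \<Longrightarrow> w t = w' t"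
  shows "hit_after y w = hit_after y w'"
proof -
  have "tau T y w = tau T y w'"
    using assms tau_bounds(2)[OF T, of y w] T by (intro tau_cong[of T, symmetric]) auto
  then have "after y w = after y w'"
    using assms(2) tau_bounds(2)[OF T, of y w] by (intro after_cong) auto
  moreover have "running_sup T w = running_sup T w'" using assms(2) by (intro running_sup_cong) simp
  ultimately show ?thesis by (simp add: hit_after_def)
qed

text \<open>Optional sampling: given the path up to the passage, the mean of the exponential
  martingale at T is its value there, \<open>exp (lam * y - lam\<^sup>2 * tau T y w / 2)\<close>,
  and \<open>hit_after\<close> depends on that part of the path only.\<close>

lemma hit_after_exp:
  assumes y: "0 \<le> y"
  shows "(\<integral>\<^sup>+w. hit_after y w * ennreal (exp (lam * w T - lam\<^sup>2 * T / 2)) \<partial>P) = ennreal (exp (lam * y)) * level y"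
proof -
  note tb = tau_bounds[OF T]
  define f where "f p = hit_after y (fst p) * ennreal (exp (lam * (y + snd p (T - tau T y (fst p))) - lam\<^sup>2 * T / 2))"
    for p :: "(real \<Rightarrow> real) \<times> (real \<Rightarrow> real)"
  have t1: "(\<lambda>p. tau T y (fst p)) \<in> borel_measurable (F_inf \<Otimes>\<^sub>M F_inf)" by (rule measurable_tau[OF measurable_fst _ T]) simp
  have v: "(\<lambda>p. snd p (T - tau T y (fst p))) \<in> borel_measurable (F_inf \<Otimes>\<^sub>M F_inf)"
    by (rule measurable_eval_inf[OF measurable_snd, where g="\<lambda>p. T - tau T y (fst p)"]) (use t1 tb in auto)
  have f: "f \<in> borel_measurable (F_inf \<Otimes>\<^sub>M F_inf)"
    unfolding f_def using measurable_compose[OF measurable_fst measurable_hit_after[of y]] v by measurable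
  have hs: "hit_after y (stop (tau T y w) w) = hit_after y w" if w: "w \<in> paths" for w
  proof -
    have "after y (stop (tau T y w) w) = after y w"
      by (rule after_cong) (use tau_stop[OF w T, of y] in auto)
    then show ?thesis using sup_stop_tau[OF w T, of y] by (simp add: hit_after_def)
  qed
  have "(\<integral>\<^sup>+w. hit_after y w * ennreal (exp (lam * w T - lam\<^sup>2 * T / 2)) \<partial>P) = (\<integral>\<^sup>+w. f (stop (tau T y w) w, shift (tau T y w) w) \<partial>P)"
  proof (rule nn_integral_cong_AE)
    show "AE w in P. hit_after y w * ennreal (exp (lam * w T - lam\<^sup>2 * T / 2)) = f (stop (tau T y w) w, shift (tau T y w) w)"
      using start_0 AE_paths
    proof eventually_elim
      case (elim w)
      show ?case
      proof (cases "y \<le> running_sup T w")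
        case True
        have "y + shift (tau T y w) w (T - tau T y w) = w T"
          using path_at_tau(1)[OF elim(2,1) T y True] tb[of y w] by simp
        then show ?thesis unfolding f_def fst_conv snd_conv tau_stop[OF elim(2) T] hs[OF elim(2)] by (simp only:)
      next
        case False
        then have "hit_after y w = 0" by (simp add: hit_after_def)
        then show ?thesis unfolding f_def fst_conv hs[OF elim(2)] by simp
      qed
    qed
  qed
  also have "\<dots> = (\<integral>\<^sup>+w. \<integral>\<^sup>+v. f (stop (tau T y w) w, v) \<partial>P \<partial>P)"
    by (rule nn_integral_markov[OF path_stopping_tau[OF T] f])
  also have "\<dots> = (\<integral>\<^sup>+w. ennreal (exp (lam * y)) * (indicator {w \<in> paths. y \<le> running_sup T w} w * ennreal (exp (- (lam\<^sup>2 * tau T y w / 2))) * after y w) \<partial>P)"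
  proof (rule nn_integral_cong)
    fix w assume "w \<in> space P"
    then have w: "w \<in> paths" by simp
    let ?r = "T - tau T y w"
    have r: "0 \<le> ?r" using tb by simp
    have "(\<integral>\<^sup>+v. f (stop (tau T y w) w, v) \<partial>P) = (\<integral>\<^sup>+v. hit_after y w * ennreal (exp (lam * y - lam\<^sup>2 * T / 2)) * ennreal (exp (lam * v ?r)) \<partial>P)"
      unfolding f_def fst_conv snd_conv tau_stop[OF w T] hs[OF w] mult.assoc
      by (intro nn_integral_cong) (simp add: ennreal_mult'[symmetric] exp_add[symmetric] algebra_simps)
    also have "\<dots> = hit_after y w * ennreal (exp (lam * y - lam\<^sup>2 * T / 2)) * ennreal (exp (lam\<^sup>2 * ?r / 2))"
      unfolding nn_integral_exp[OF r, symmetric]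
      by (rule nn_integral_cmult) (rule measurable_compose[OF coord_P[OF r], where g="\<lambda>x. ennreal (exp (lam * x))"], simp)
    also have "\<dots> = hit_after y w * (ennreal (exp (lam * y)) * ennreal (exp (- (lam\<^sup>2 * tau T y w / 2))))"
      unfolding mult.assoc by (simp add: ennreal_mult'[symmetric] exp_add[symmetric] field_simps)
    also have "\<dots> = ennreal (exp (lam * y)) * (indicator {w \<in> paths. y \<le> running_sup T w} w * ennreal (exp (- (lam\<^sup>2 * tau T y w / 2))) * after y w)"
      using w by (simp add: hit_after_def indicator_def mult_ac)
    finally show "(\<integral>\<^sup>+v. f (stop (tau T y w) w, v) \<partial>P) =
      ennreal (exp (lam * y)) * (indicator {w \<in> paths. y \<le> running_sup T w} w * ennreal (exp (- (lam\<^sup>2 * tau T y w / 2))) * after y w)" .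
  qed
  also have "\<dots> = ennreal (exp (lam * y)) * level y"
    unfolding level_def by (rule nn_integral_cmult) (rule measurable_level_integrand[OF ident_P], simp)
  finally show ?thesis .
qed

text \<open>Split at {S_T < y}. On it the path up to T equals its stopped version, a Brownian motion
  with drift, and Cameron-Martin applies. On the complement the path is glued from the two
  independent pieces that the law prescribes.\<close>

lemma drift_coth_law_test_fun:
  assumes y: "0 < y" and Q: "drift_coth_law P Z lam y Q"
  shows "(\<integral>\<^sup>+w. ennreal (test_fun m l w) \<partial>Q) =
    (\<integral>\<^sup>+w. ennreal (test_fun m l w) * of_bool (running_sup T w < y) * ennreal (exp (lam * w T - lam\<^sup>2 * T / 2)) \<partial>P) +
    ennreal (exp (lam * y)) * level y"
proof -
  note tb = tau_bounds[OF T]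
  have y0: "0 \<le> y" using y by simp
  have sQ: "sets Q = sets F_inf" and spQ: "space Q = paths" using Q by (auto simp: drift_coth_law_def dest: sets_eq_imp_space_eq)
  have mQ: "measurable Q N = measurable F_inf N" for N :: "'b measure" by (rule measurable_cong_sets[OF sQ refl])
  interpret Q: prob_space Q using Q by (simp add: drift_coth_law_def)
  have ind: "Q.indep_var F_inf (stopped_path y) F_inf (post_hitting_path y)"
    and e1: "distr Q F_inf (stopped_path y) = distr P F_inf (\<lambda>w. stopped_path y (add_drift lam w))"
    and e2: "distr Q F_inf (post_hitting_path y) = distr P F_inf Z"
    using Q by (auto simp: drift_coth_law_def)
  \<comment> \<open>Independence of random variables includes their measurability, which is how
    \<open>stopped_path\<close> and \<open>post_hitting_path\<close> become measurable.\<close>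
  have sm: "stopped_path y \<in> measurable Q F_inf" and pm: "post_hitting_path y \<in> measurable Q F_inf"
    and joint: "distr Q F_inf (stopped_path y) \<Otimes>\<^sub>M distr Q F_inf (post_hitting_path y) =
      distr Q (F_inf \<Otimes>\<^sub>M F_inf) (\<lambda>w. (stopped_path y w, post_hitting_path y w))"
    using ind unfolding Q.indep_var_distribution_eq by auto
  have smF: "stopped_path y \<in> measurable F_inf F_inf" using sm unfolding mQ .
  have stp: "stopped_path y w \<in> paths" if "w \<in> paths" for w using measurable_space[OF smF, of w] that by simp
  have sa: "(\<lambda>w. stopped_path y (add_drift lam w)) \<in> measurable P F_inf"
    unfolding measurable_P by (rule measurable_compose[OF measurable_add_drift smF])
  have ad: "add_drift lam w \<in> paths" if "w \<in> paths" for w using that by (rule add_drift_paths)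
  \<comment> \<open>A path and its stopped version have the same starting point, and the law of the
    stopped version is that of a motion from 0.\<close>
  have start_Q: "AE w in Q. w 0 = 0"
  proof -
    have m: "{a \<in> space F_inf. a 0 = 0} \<in> sets F_inf"
    proof -
      have "(\<lambda>a. a 0) \<in> borel_measurable F_inf" by (rule measurable_F_inf_eval) simp
      then have "(\<lambda>a. a 0) -` {0} \<inter> space F_inf \<in> sets F_inf" by (rule measurable_sets) simp
      moreover have "(\<lambda>a. a 0) -` {0} \<inter> space F_inf = {a \<in> space F_inf. a 0 = 0}" by auto
      ultimately show ?thesis by (simp only:)
    qed
    have "AE a in distr P F_inf (\<lambda>w. stopped_path y (add_drift lam w)). a 0 = 0"
      unfolding AE_distr_iff[OF sa m] stopped_path_0
      using start_0 by eventually_elim (simp add: add_drift_def)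
    then have "AE a in distr Q F_inf (stopped_path y). a 0 = 0" unfolding e1 .
    from AE_distrD[OF sm this] show ?thesis unfolding stopped_path_0 .
  qed
  have paths_Q: "AE w in Q. w \<in> paths" using AE_space[of Q] unfolding spQ .

  have idF: "(\<lambda>w. w) \<in> measurable F_inf F_inf" by simp
  have SF: "(\<lambda>w. running_sup T w) \<in> borel_measurable F_inf" using T by (intro measurable_running_sup_inf idF) auto
  have tF: "(\<lambda>w. ennreal (test_fun m l w)) \<in> borel_measurable F_inf"
    using measurable_test_fun_inf[OF idF, of l m] l by auto
  define \<Phi> where "\<Phi> w = ennreal (test_fun m l w) * of_bool (running_sup T w < y)" for w
  have \<Phi>m: "\<Phi> \<in> borel_measurable F_inf"
  proof -
    have "(\<lambda>w. ennreal (test_fun m l w) * (if running_sup T w < y then 1 else 0)) \<in> borel_measurable F_inf"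
      using tF SF by measurable
    then show ?thesis by (simp add: \<Phi>_def[abs_def] of_bool_def)
  qed
  have \<Phi>_cong: "\<Phi> w = \<Phi> w'" if "\<And>t. 0 \<le> t \<Longrightarrow> t \<le> T \<Longrightarrow> w t = w' t" for w w'
  proof -
    have "test_fun m l w = test_fun m l w'" using that l by (intro test_fun_cong) auto
    moreover have "running_sup T w = running_sup T w'" using that by (intro running_sup_cong) simp
    ultimately show ?thesis by (simp add: \<Phi>_def)
  qed
  have \<Phi>_stopped: "\<Phi> (stopped_path y w) = \<Phi> w" if w: "w \<in> paths" "w 0 = 0" for w
  proof (cases "running_sup T w < y")
    case True
    then show ?thesis using stopped_path_before[OF w(1) T] by (intro \<Phi>_cong) auto
  next
    case False
    then show ?thesis using sup_stopped_path[OF w T y0] by (simp add: \<Phi>_def)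
  qed
  have drift_eq: "add_drift lam w t = drift_upto lam T w t" if "0 \<le> t" "t \<le> T" for w t
    using that by (simp add: add_drift_def drift_upto_def)
  \<comment> \<open>A functional that sees neither the path after the passage nor the path after T
    cannot distinguish the stopped motion with drift from one whose drift ends at T; for the latter
    the drift is a density.\<close>
  have transfer: "(\<integral>\<^sup>+w. h w \<partial>distr Q F_inf (stopped_path y)) = (\<integral>\<^sup>+w. h w * ennreal (exp (lam * w T - lam\<^sup>2 * T / 2)) \<partial>P)"
    if h: "h \<in> borel_measurable F_inf" and hs: "\<And>w. w \<in> paths \<Longrightarrow> w 0 = 0 \<Longrightarrow> h (stopped_path y w) = h w"
      and hc: "\<And>w w'. w \<in> paths \<Longrightarrow> (\<And>t. 0 \<le> t \<Longrightarrow> t \<le> T \<Longrightarrow> w t = w' t) \<Longrightarrow> h w = h w'" for h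
  proof -
    have "(\<integral>\<^sup>+w. h w \<partial>distr Q F_inf (stopped_path y)) = (\<integral>\<^sup>+w. h (stopped_path y (add_drift lam w)) \<partial>P)"
      unfolding e1 using h by (intro nn_integral_distr[OF sa]) simp
    also have "\<dots> = (\<integral>\<^sup>+w. h (drift_upto lam T w) \<partial>P)"
    proof (rule nn_integral_cong_AE)
      show "AE w in P. h (stopped_path y (add_drift lam w)) = h (drift_upto lam T w)"
        using start_0 AE_paths
      proof eventually_elim
        case (elim w)
        have "h (stopped_path y (add_drift lam w)) = h (add_drift lam w)"
          using elim by (intro hs ad) (auto simp: add_drift_def)
        also have "\<dots> = h (drift_upto lam T w)" by (rule hc[OF ad[OF elim(2)] drift_eq])
        finally show ?case .
      qed
    qed
    also have "\<dots> = (\<integral>\<^sup>+w. h w * ennreal (exp (lam * w T - lam\<^sup>2 * T / 2)) \<partial>P)"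
      by (rule cameron_martin[OF T h])
    finally show ?thesis .
  qed
  have first: "(\<integral>\<^sup>+w. \<Phi> w \<partial>Q) = (\<integral>\<^sup>+w. \<Phi> w * ennreal (exp (lam * w T - lam\<^sup>2 * T / 2)) \<partial>P)"
  proof -
    have "(\<integral>\<^sup>+w. \<Phi> w \<partial>Q) = (\<integral>\<^sup>+w. \<Phi> (stopped_path y w) \<partial>Q)"
      using start_Q paths_Q by (intro nn_integral_cong_AE, eventually_elim) (simp add: \<Phi>_stopped)
    also have "\<dots> = (\<integral>\<^sup>+w. \<Phi> w \<partial>distr Q F_inf (stopped_path y))"
      using \<Phi>m by (intro nn_integral_distr[OF sm, symmetric]) simp
    also have "\<dots> = (\<integral>\<^sup>+w. \<Phi> w * ennreal (exp (lam * w T - lam\<^sup>2 * T / 2)) \<partial>P)"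
      by (rule transfer[OF \<Phi>m \<Phi>_stopped \<Phi>_cong])
    finally show ?thesis .
  qed
  \<comment> \<open>Rebuilds the test functional from the two pieces; the passage time is computed
    from the stopped path alone.\<close>
  define \<Psi> where "\<Psi> p = of_bool (y \<le> running_sup T (fst p)) *
    ennreal (test_fun m l (\<lambda>t. fst p (min t (tau T y (fst p))) - snd p (max 0 (t - tau T y (fst p)))))"
    for p :: "(real \<Rightarrow> real) \<times> (real \<Rightarrow> real)"
  let ?N = "F_inf \<Otimes>\<^sub>M F_inf"
  have t1: "(\<lambda>p. tau T y (fst p)) \<in> borel_measurable ?N" by (rule measurable_tau[OF measurable_fst _ T]) simp
  have \<Psi>m: "\<Psi> \<in> borel_measurable ?N"
  proof -
    have S1: "(\<lambda>p. running_sup T (fst p)) \<in> borel_measurable ?N" by (rule measurable_compose[OF measurable_fst SF])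
    have F: "(\<lambda>p. test_fun m l (\<lambda>t. fst p (min t (tau T y (fst p))) - snd p (max 0 (t - tau T y (fst p))))) \<in> borel_measurable ?N"
    proof (rule measurable_test_fun[where f="\<lambda>p t. fst p (min t (tau T y (fst p))) - snd p (max 0 (t - tau T y (fst p)))"])
      fix q assume q: "q \<in> set l"
      have 1: "(\<lambda>p. fst p (min (fst q) (tau T y (fst p)))) \<in> borel_measurable ?N"
        by (rule measurable_eval_inf[OF measurable_fst, where g="\<lambda>p. min (fst q) (tau T y (fst p))"]) (use t1 tb q l in auto)
      have 2: "(\<lambda>p. snd p (max 0 (fst q - tau T y (fst p)))) \<in> borel_measurable ?N"
        by (rule measurable_eval_inf[OF measurable_snd, where g="\<lambda>p. max 0 (fst q - tau T y (fst p))"]) (use t1 in auto)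
      show "(\<lambda>p. fst p (min (fst q) (tau T y (fst p))) - snd p (max 0 (fst q - tau T y (fst p)))) \<in> borel_measurable ?N"
        by (rule borel_measurable_diff[OF 1 2])
    qed
    have "(\<lambda>p. (if y \<le> running_sup T (fst p) then 1 else 0) * ennreal (test_fun m l (\<lambda>t. fst p (min t (tau T y (fst p))) - snd p (max 0 (t - tau T y (fst p)))))) \<in> borel_measurable ?N"
      using S1 F by measurable
    then show ?thesis by (simp add: \<Psi>_def[abs_def] of_bool_def)
  qed
  have \<Psi>_eq: "ennreal (test_fun m l w) * of_bool (y \<le> running_sup T w) = \<Psi> (stopped_path y w, post_hitting_path y w)"
    if w: "w \<in> paths" "w 0 = 0" for w
  proof (cases "y \<le> running_sup T w")
    case True
    let ?t = "tau T y w"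
    have tt: "tau T y (stopped_path y w) = ?t" by (rule tau_stopped_path[OF w T y0 True])
    have wt: "w ?t = y" by (rule path_at_tau(1)[OF w T y0 True])
    have "test_fun m l w = test_fun m l (\<lambda>t. stopped_path y w (min t ?t) - post_hitting_path y w (max 0 (t - ?t)))"
    proof (rule test_fun_cong)
      fix p assume "p \<in> set l"
      then have p: "0 \<le> fst p" using l by auto
      show "w (fst p) = stopped_path y w (min (fst p) ?t) - post_hitting_path y w (max 0 (fst p - ?t))"
        using p tb[of y w] stopped_path_after[OF w T y0 True] wt by (cases "fst p \<le> ?t") (auto simp: min_def max_def)
    qed
    then show ?thesis using sup_stopped_path[OF w T y0] tt by (simp add: \<Psi>_def mult.commute)
  next
    case False
    then show ?thesis using sup_stopped_path[OF w T y0] by (simp add: \<Psi>_def)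
  qed
  have second: "(\<integral>\<^sup>+w. ennreal (test_fun m l w) * of_bool (y \<le> running_sup T w) \<partial>Q) = ennreal (exp (lam * y)) * level y"
  proof -
    interpret D2: prob_space "distr P F_inf Z" by (rule prob_space_distr[OF Z_meas])
    have \<Psi>m': "\<Psi> \<in> borel_measurable (distr Q F_inf (stopped_path y) \<Otimes>\<^sub>M distr P F_inf Z)"
      using \<Psi>m by (simp cong: measurable_cong_sets sets_pair_measure_cong)
    have "(\<integral>\<^sup>+w. ennreal (test_fun m l w) * of_bool (y \<le> running_sup T w) \<partial>Q) =
      (\<integral>\<^sup>+w. \<Psi> (stopped_path y w, post_hitting_path y w) \<partial>Q)"
      using start_Q paths_Q by (intro nn_integral_cong_AE, eventually_elim) (simp add: \<Psi>_eq)
    also have "\<dots> = integral\<^sup>N (distr Q ?N (\<lambda>w. (stopped_path y w, post_hitting_path y w))) \<Psi>"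
      using \<Psi>m by (intro nn_integral_distr[symmetric] measurable_Pair sm pm) simp
    also have "\<dots> = integral\<^sup>N (distr Q F_inf (stopped_path y) \<Otimes>\<^sub>M distr P F_inf Z) \<Psi>"
      unfolding joint[symmetric] e2 ..
    also have "\<dots> = (\<integral>\<^sup>+a. \<integral>\<^sup>+z. \<Psi> (a, z) \<partial>distr P F_inf Z \<partial>distr Q F_inf (stopped_path y))"
      by (rule D2.nn_integral_fst[OF \<Psi>m', symmetric])
    also have "\<dots> = (\<integral>\<^sup>+a. hit_after y a \<partial>distr Q F_inf (stopped_path y))"
    proof (rule nn_integral_cong)
      fix a assume "a \<in> space (distr Q F_inf (stopped_path y))"
      then have a: "a \<in> space F_inf" by simp
      have "(\<integral>\<^sup>+z. \<Psi> (a, z) \<partial>distr P F_inf Z) = (\<integral>\<^sup>+v. \<Psi> (a, Z v) \<partial>P)"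
        using measurable_Pair2[OF \<Psi>m a] by (intro nn_integral_distr[OF Z_meas]) simp
      also have "\<dots> = hit_after y a"
      proof (cases "y \<le> running_sup T a")
        case True
        then show ?thesis by (simp add: \<Psi>_def hit_after_def after_def)
      qed (simp add: \<Psi>_def hit_after_def)
      finally show "(\<integral>\<^sup>+z. \<Psi> (a, z) \<partial>distr P F_inf Z) = hit_after y a" .
    qed
    also have "\<dots> = (\<integral>\<^sup>+w. hit_after y w * ennreal (exp (lam * w T - lam\<^sup>2 * T / 2)) \<partial>P)"
      by (rule transfer[OF measurable_hit_after hit_after_stopped[OF _ _ y0] hit_after_cong])
    also have "\<dots> = ennreal (exp (lam * y)) * level y" by (rule hit_after_exp[OF y0])
    finally show ?thesis .
  qed
  have "(\<integral>\<^sup>+w. ennreal (test_fun m l w) \<partial>Q) =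
    (\<integral>\<^sup>+w. \<Phi> w + ennreal (test_fun m l w) * of_bool (y \<le> running_sup T w) \<partial>Q)"
    by (intro nn_integral_cong) (auto simp: \<Phi>_def indicator_def)
  also have "\<dots> = (\<integral>\<^sup>+w. \<Phi> w \<partial>Q) + (\<integral>\<^sup>+w. ennreal (test_fun m l w) * of_bool (y \<le> running_sup T w) \<partial>Q)"
  proof (rule nn_integral_add)
    show "\<Phi> \<in> borel_measurable Q" unfolding mQ by (rule \<Phi>m)
    have "(\<lambda>w. ennreal (test_fun m l w) * (if y \<le> running_sup T w then 1 else 0)) \<in> borel_measurable F_inf"
      using tF SF by measurable
    then show "(\<lambda>w. ennreal (test_fun m l w) * of_bool (y \<le> running_sup T w)) \<in> borel_measurable Q"
      unfolding mQ by (simp add: of_bool_def)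
  qed
  finally show ?thesis unfolding first second unfolding \<Phi>_def .
qed

end

end

section \<open>The mixture\<close>

text \<open>The tail integral enters through \<open>Phi_of\<close> with cosh and through
  \<open>phi_of\<close> with minus sinh. As cosh r - sinh r = exp (- r), the factor exp (\<lambda>
  S) cancels and an exponential martingale remains in front of the tail.\<close>

lemma sup_martingale_eq:
  assumes lam: "0 < lam"
  shows "sup_martingale lam (Phi_of lam psi) (phi_of lam psi) T w =
    exp (lam * w T - lam\<^sup>2 * T / 2) * (LINT z:{running_sup T w..}|lborel. psi z * exp (- lam * z)) +
    psi (running_sup T w) * (sinh (lam * (running_sup T w - w T)) / lam * exp (- (lam\<^sup>2 * T / 2)))"
proof -
  define S I where "S = running_sup T w" and "I = (LINT z:{running_sup T w..}|lborel. psi z * exp (- lam * z))"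
  have e: "cosh (lam * (S - w T)) - sinh (lam * (S - w T)) = exp (lam * w T) * exp (- lam * S)"
    by (simp add: cosh_minus_sinh exp_add[symmetric] algebra_simps)
  have e1: "exp (lam * S) * exp (- lam * S) = 1" by (simp add: exp_add[symmetric])
  have "sup_martingale lam (Phi_of lam psi) (phi_of lam psi) T w =
    (exp (lam * S) * I * (cosh (lam * (S - w T)) - sinh (lam * (S - w T))) + psi S * (sinh (lam * (S - w T)) / lam)) *
      exp (- (lam\<^sup>2 * T / 2))"
    using lam by (simp add: sup_martingale_def Phi_of_def phi_of_def S_def I_def field_simps)
  also have "exp (lam * S) * I * (cosh (lam * (S - w T)) - sinh (lam * (S - w T))) = exp (lam * w T) * I * (exp (lam * S) * exp (- lam * S))"
    unfolding e by (simp only: mult_ac)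
  also have "(exp (lam * w T) * I * (exp (lam * S) * exp (- lam * S)) + psi S * (sinh (lam * (S - w T)) / lam)) * exp (- (lam\<^sup>2 * T / 2)) =
    (exp (lam * w T) * exp (- (lam\<^sup>2 * T / 2))) * I + psi S * (sinh (lam * (S - w T)) / lam * exp (- (lam\<^sup>2 * T / 2)))"
    unfolding e1 by (simp add: algebra_simps)
  also have "exp (lam * w T) * exp (- (lam\<^sup>2 * T / 2)) = exp (lam * w T - lam\<^sup>2 * T / 2)"
    by (simp add: exp_add[symmetric])
  finally show ?thesis by (simp only: S_def I_def)
qed

context wiener
begin

lemma nn_integral_martingale_density:
  assumes Q: "has_martingale_density P M Q" and T: "0 \<le> T" and M0: "\<And>w. w \<in> paths \<Longrightarrow> 0 \<le> M T w"
    and f: "f \<in> borel_measurable (F_upto T)"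
  shows "(\<integral>\<^sup>+w. f w \<partial>Q) = (\<integral>\<^sup>+w. f w * ennreal (M T w) \<partial>P)"
proof -
  have sQ: "sets Q = sets F_inf" using Q by (simp add: has_martingale_density_def)
  interpret Q: prob_space Q using Q by (simp add: has_martingale_density_def)
  have spQ: "space Q = paths" using sets_eq_imp_space_eq[OF sQ] by simp
  have dens: "measure Q G = (LINT w|P. indicator G w * M T w)" if "G \<in> sets (F_upto T)" for G
    using Q T that by (simp add: has_martingale_density_def)
  have top: "paths \<in> sets (F_upto T)" using sets.top[of "F_upto T"] by simp
  have "(LINT w|P. indicator paths w * M T w) = 1"
    using dens[OF top] Q.prob_space spQ by simp
  \<comment> \<open>A non-integrable function would have integral 0 instead of 1.\<close>
  then have "integrable P (\<lambda>w. indicator paths w * M T w)"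
    using not_integrable_integral_eq by force
  moreover have "integrable P (\<lambda>w. indicator paths w * M T w) \<longleftrightarrow> integrable P (M T)"
    by (rule Bochner_Integration.integrable_cong) auto
  ultimately have MI: "integrable P (M T)" by simp
  have Mm: "M T \<in> borel_measurable P" by (rule borel_measurable_integrable[OF MI])
  let ?M = "density P (\<lambda>w. ennreal (M T w))"
  have id1: "(\<lambda>w. w) \<in> measurable Q (F_upto T)" by (rule F_upto_F_inf[OF measurable_ident_sets[OF refl] sQ])
  have id2: "(\<lambda>w. w) \<in> measurable ?M (F_upto T)"
    by (rule F_upto_F_inf[OF measurable_ident_sets[OF refl]]) (simp add: sets_P)
  have eq: "distr Q (F_upto T) (\<lambda>w. w) = distr ?M (F_upto T) (\<lambda>w. w)"
  proof (rule measure_eqI)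
    fix A assume "A \<in> sets (distr Q (F_upto T) (\<lambda>w. w))"
    then have A: "A \<in> sets (F_upto T)" by simp
    have Ap: "A \<inter> paths = A" using sets.sets_into_space[OF A] by auto
    have AP: "A \<in> sets P" by (rule F_upto_P[OF A])
    have "emeasure (distr Q (F_upto T) (\<lambda>w. w)) A = emeasure Q A"
      using A by (subst emeasure_distr[OF id1]) (auto simp: Ap spQ)
    also have "\<dots> = ennreal (LINT w|P. indicator A w * M T w)"
      unfolding Q.emeasure_eq_measure dens[OF A] ..
    also have "\<dots> = (\<integral>\<^sup>+w. ennreal (indicator A w * M T w) \<partial>P)"
      using integrable_mult_indicator[OF AP MI] M0 by (intro nn_integral_eq_integral[symmetric] AE_I2) auto
    also have "\<dots> = (\<integral>\<^sup>+w. ennreal (M T w) * indicator A w \<partial>P)"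
      by (intro nn_integral_cong) (auto simp: indicator_def)
    also have "\<dots> = emeasure ?M A" using Mm AP by (intro emeasure_density[symmetric]) auto
    also have "\<dots> = emeasure (distr ?M (F_upto T) (\<lambda>w. w)) A"
      using A by (subst emeasure_distr[OF id2]) (auto simp: Ap)
    finally show "emeasure (distr Q (F_upto T) (\<lambda>w. w)) A = emeasure (distr ?M (F_upto T) (\<lambda>w. w)) A" .
  qed simp
  have "(\<integral>\<^sup>+w. f w \<partial>Q) = (\<integral>\<^sup>+w. f w \<partial>distr Q (F_upto T) (\<lambda>w. w))"
    using f by (intro nn_integral_distr[OF id1, symmetric]) simp
  also have "\<dots> = (\<integral>\<^sup>+w. f w \<partial>?M)"
    unfolding eq using f by (intro nn_integral_distr[OF id2]) simp
  also have "\<dots> = (\<integral>\<^sup>+w. ennreal (M T w) * f w \<partial>P)"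
    using Mm measurable_F_P[OF f] by (intro nn_integral_density) auto
  finally show ?thesis by (simp add: mult.commute)
qed

section \<open>Averaging over the level\<close>

context
  fixes lam :: real and psi :: "real \<Rightarrow> real" and Q0 :: "(real \<Rightarrow> real) measure"
    and Z :: "(real \<Rightarrow> real) \<Rightarrow> (real \<Rightarrow> real)" and Qlev :: "real \<Rightarrow> (real \<Rightarrow> real) measure"
  assumes lam: "lam > 0"
    and psi: "psi \<in> borel_measurable borel"
    and psi_pos: "\<And>z. psi z > 0"
    and psi_int: "\<And>x. set_integrable lborel {x..} (\<lambda>z. psi z * exp (- lam * z))"
    and psi_1: "(LINT z:{0..}|lborel. psi z * exp (- lam * z)) = 1"
    and Q0: "has_martingale_density P (sup_martingale lam (Phi_of lam psi) (phi_of lam psi)) Q0"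
    and Z: "coth_process P lam Z"
    and Qlev: "\<And>x. x > 0 \<Longrightarrow> drift_coth_law P Z lam x (Qlev x)"
begin

definition mix :: "real \<Rightarrow> ennreal" where
  "mix y = ennreal (exp (- lam * y) * psi y)"

lemma measurable_mix [measurable]: "mix \<in> borel_measurable borel"
  unfolding mix_def[abs_def] using psi by measurable

text \<open>Passing from z \<ge> s to z > s changes a null set only, and matches the event S_T < y
  on which the law at level y is a motion with drift.\<close>

lemma mix_tail: "ennreal (LINT z:{s..}|lborel. psi z * exp (- lam * z)) = (\<integral>\<^sup>+z. mix z * of_bool (s < z) \<partial>lborel)"
proof -
  have i: "integrable lborel (\<lambda>z. indicator {s..} z * (psi z * exp (- lam * z)))"
    using psi_int[of s] by (simp add: set_integrable_def)
  have "ennreal (LINT z:{s..}|lborel. psi z * exp (- lam * z)) = ennreal (LINT z|lborel. indicator {s..} z * (psi z * exp (- lam * z)))"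
    by (simp add: set_lebesgue_integral_def)
  also have "\<dots> = (\<integral>\<^sup>+z. ennreal (indicator {s..} z * (psi z * exp (- lam * z))) \<partial>lborel)"
    using psi_pos by (intro nn_integral_eq_integral[symmetric] i AE_I2) (simp add: less_imp_le)
  also have "\<dots> = (\<integral>\<^sup>+z. mix z * of_bool (s < z) \<partial>lborel)"
  proof (rule nn_integral_cong_AE)
    show "AE z in lborel. ennreal (indicator {s..} z * (psi z * exp (- lam * z))) = mix z * of_bool (s < z)"
      using AE_lborel_singleton[of s] by eventually_elim (auto simp: mix_def indicator_def mult.commute)
  qed
  finally show ?thesis .
qed

lemma mix_total: "(\<integral>\<^sup>+z. mix z * indicator {0<..} z \<partial>lborel) = 1"
proof -
  have "(\<integral>\<^sup>+z. mix z * indicator {0<..} z \<partial>lborel) = (\<integral>\<^sup>+z. mix z * of_bool (0 < z) \<partial>lborel)"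
    by (intro nn_integral_cong) (auto simp: indicator_def)
  also have "\<dots> = 1" unfolding mix_tail[symmetric] psi_1 by simp
  finally show ?thesis .
qed

definition before :: "real \<Rightarrow> nat \<Rightarrow> (real \<times> real) list \<Rightarrow> real \<Rightarrow> ennreal" where
  "before T m l y = (\<integral>\<^sup>+w. ennreal (test_fun m l w) * of_bool (running_sup T w < y) *
     ennreal (exp (lam * w T - lam\<^sup>2 * T / 2)) \<partial>P)"

context
  fixes T :: real and m :: nat and l :: "(real \<times> real) list"
  assumes T: "0 \<le> T" and l: "\<forall>p\<in>set l. 0 \<le> fst p \<and> fst p \<le> T"
begin

lemma measurable_before_integrand:
  "(\<lambda>p. ennreal (test_fun m l (snd p)) * of_bool (running_sup T (snd p) < fst p) *
     ennreal (exp (lam * snd p T - lam\<^sup>2 * T / 2))) \<in> borel_measurable (lborel \<Otimes>\<^sub>M P)"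
proof -
  have 1: "(\<lambda>p. test_fun m l (snd p)) \<in> borel_measurable (lborel \<Otimes>\<^sub>M P)"
    by (rule measurable_compose[OF measurable_snd test_fun_P[OF lam T l Z]])
  have 2: "(\<lambda>p. running_sup T (snd p)) \<in> borel_measurable (lborel \<Otimes>\<^sub>M P)"
    by (rule measurable_compose[OF measurable_snd sup_P[OF T]])
  have 3: "(\<lambda>p. snd p T) \<in> borel_measurable (lborel \<Otimes>\<^sub>M P)"
    by (rule measurable_compose[OF measurable_snd coord_P[OF T]])
  show ?thesis unfolding of_bool_def using 1 2 3 by measurable
qed

lemma measurable_before: "before T m l \<in> borel_measurable borel"
proof -
  have "(\<lambda>y. \<integral>\<^sup>+w. ennreal (test_fun m l w) * of_bool (running_sup T w < y) *
     ennreal (exp (lam * w T - lam\<^sup>2 * T / 2)) \<partial>P) \<in> borel_measurable lborel"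
    using measurable_before_integrand by (intro borel_measurable_nn_integral) (simp add: split_beta')
  then show ?thesis by (simp add: before_def[abs_def])
qed

lemma Qlev_test_fun:
  assumes "0 < y"
  shows "(\<integral>\<^sup>+w. ennreal (test_fun m l w) \<partial>Qlev y) = before T m l y + ennreal (exp (lam * y)) * level lam T m l Z y"
  unfolding before_def by (rule drift_coth_law_test_fun[OF lam T l Z assms Qlev[OF assms]])

text \<open>Fubini: for a fixed path the levels above S_T contribute the tail of the mixing density
  at S_T, which is the first summand of the martingale.\<close>

lemma mix_before:
  "(\<integral>\<^sup>+y. mix y * indicator {0<..} y * before T m l y \<partial>lborel) =
   (\<integral>\<^sup>+w. ennreal (test_fun m l w) * ennreal (exp (lam * w T - lam\<^sup>2 * T / 2) *
      (LINT z:{running_sup T w..}|lborel. psi z * exp (- lam * z))) \<partial>P)"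
proof -
  have psf: "pair_sigma_finite lborel P" ..
  let ?k = "\<lambda>y w. ennreal (test_fun m l w) * of_bool (running_sup T w < y) * ennreal (exp (lam * w T - lam\<^sup>2 * T / 2))"
  have km: "(\<lambda>w. ?k y w) \<in> borel_measurable P" for y
  proof -
    have 1: "(\<lambda>w. test_fun m l w) \<in> borel_measurable P" by (rule test_fun_P[OF lam T l Z])
    have 2: "(\<lambda>w. ennreal (exp (lam * w T - lam\<^sup>2 * T / 2))) \<in> borel_measurable P"
      by (rule measurable_compose[OF coord_P[OF T], where g="\<lambda>x. ennreal (exp (lam * x - lam\<^sup>2 * T / 2))"]) measurable
    show ?thesis unfolding of_bool_def using 1 2 sup_P[OF T] by measurable
  qed
  have jm: "(\<lambda>(y, w). mix y * indicator {0<..} y * ?k y w) \<in> borel_measurable (lborel \<Otimes>\<^sub>M P)"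
  proof -
    have "(\<lambda>p. mix (fst p) * indicator {0<..} (fst p)) \<in> borel_measurable (lborel \<Otimes>\<^sub>M P)" by measurable
    from borel_measurable_times_ennreal[OF this measurable_before_integrand] show ?thesis by (simp add: split_beta')
  qed
  have "(\<integral>\<^sup>+y. mix y * indicator {0<..} y * before T m l y \<partial>lborel) =
    (\<integral>\<^sup>+y. \<integral>\<^sup>+w. mix y * indicator {0<..} y * ?k y w \<partial>P \<partial>lborel)"
    unfolding before_def by (intro nn_integral_cong nn_integral_cmult[symmetric] km)
  also have "\<dots> = (\<integral>\<^sup>+w. \<integral>\<^sup>+y. mix y * indicator {0<..} y * ?k y w \<partial>lborel \<partial>P)"
    by (rule pair_sigma_finite.Fubini'[OF psf jm, symmetric])
  also have "\<dots> = (\<integral>\<^sup>+w. ennreal (test_fun m l w) * ennreal (exp (lam * w T - lam\<^sup>2 * T / 2) *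
      (LINT z:{running_sup T w..}|lborel. psi z * exp (- lam * z))) \<partial>P)"
  proof (rule nn_integral_cong_AE)
    show "AE w in P. (\<integral>\<^sup>+y. mix y * indicator {0<..} y * ?k y w \<partial>lborel) = ennreal (test_fun m l w) * ennreal (exp (lam * w T - lam\<^sup>2 * T / 2) *
      (LINT z:{running_sup T w..}|lborel. psi z * exp (- lam * z)))"
      using start_0 AE_paths
    proof eventually_elim
      case (elim w)
      \<comment> \<open>Levels above S_T are positive, which absorbs the indicator of
        {0<..}.\<close>
      have S: "0 \<le> running_sup T w" using running_sup_ge[OF elim(2), of 0 T] T elim(1) by simp
      let ?c = "ennreal (test_fun m l w) * ennreal (exp (lam * w T - lam\<^sup>2 * T / 2))"
      have "(\<integral>\<^sup>+y. mix y * indicator {0<..} y * ?k y w \<partial>lborel) = (\<integral>\<^sup>+y. ?c * (mix y * of_bool (running_sup T w < y)) \<partial>lborel)"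
        using S by (intro nn_integral_cong) (auto simp: indicator_def mult_ac)
      also have "\<dots> = ?c * (\<integral>\<^sup>+y. mix y * of_bool (running_sup T w < y) \<partial>lborel)"
        unfolding of_bool_def by (rule nn_integral_cmult) measurable
      finally show ?case unfolding mix_tail[symmetric] by (simp add: ennreal_mult' mult.assoc)
    qed
  qed
  finally show ?thesis .
qed

text \<open>Equality up to the contribution of \<open>{S\<^sub>T \<le> 0}\<close>; that one turns out to vanish because
  both sides have total mass 1.\<close>

lemma Q0_test_fun_aux:
  "(\<integral>\<^sup>+w. ennreal (test_fun m l w) \<partial>Q0) =
   (\<integral>\<^sup>+y. mix y * indicator {0<..} y * (\<integral>\<^sup>+w. ennreal (test_fun m l w) \<partial>Qlev y) \<partial>lborel) +
   (\<integral>\<^sup>+w. excursion lam T m l w * of_bool (running_sup T w \<le> 0) * ennreal (psi (running_sup T w)) \<partial>P)"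
proof -
  let ?S = "running_sup T" and ?M = "sup_martingale lam (Phi_of lam psi) (phi_of lam psi) T"
  let ?A = "\<lambda>w. exp (lam * w T - lam\<^sup>2 * T / 2) * (LINT z:{?S w..}|lborel. psi z * exp (- lam * z))"
  let ?B = "\<lambda>w. psi (?S w) * (sinh (lam * (?S w - w T)) / lam * exp (- (lam\<^sup>2 * T / 2)))"
  let ?F = "\<lambda>w. ennreal (test_fun m l w)"
  let ?x = "excursion lam T m l"
  have I0: "0 \<le> (LINT z:{s..}|lborel. psi z * exp (- lam * z))" for s
    unfolding set_lebesgue_integral_def using psi_pos
    by (intro Bochner_Integration.integral_nonneg) (simp add: less_imp_le)
  have A0: "0 \<le> ?A w" for w using I0 by simp
  have B0: "0 \<le> ?B w" if "w \<in> paths" for w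
    using lam psi_pos[of "?S w"] running_sup_ge[OF that T order_refl] by simp
  have M0: "0 \<le> ?M w" if "w \<in> paths" for w
    unfolding sup_martingale_eq[OF lam] using A0[of w] B0[OF that] by linarith
  have xm: "?x \<in> borel_measurable P" by (rule measurable_excursion[OF lam T l Z])
  have Fm: "?F \<in> borel_measurable P"
    by (rule measurable_compose[OF test_fun_P[OF lam T l Z] measurable_ennreal])
  have Sm: "?S \<in> borel_measurable P" by (rule sup_P[OF T])
  have pm: "(\<lambda>w. ennreal (psi (?S w))) \<in> borel_measurable P" using measurable_compose[OF Sm psi] by measurable
  have Am: "(\<lambda>w. ennreal (?A w)) \<in> borel_measurable P"
  proof -
    have "(\<lambda>s. \<integral>\<^sup>+z. mix z * of_bool (s < z) \<partial>lborel) \<in> borel_measurable borel"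
    proof (rule lborel.borel_measurable_nn_integral)
      show "(\<lambda>(s, z). mix z * of_bool (s < z)) \<in> borel_measurable (borel \<Otimes>\<^sub>M lborel)"
        unfolding of_bool_def by measurable
    qed
    from measurable_compose[OF Sm this]
    have "(\<lambda>w. ennreal (LINT z:{?S w..}|lborel. psi z * exp (- lam * z))) \<in> borel_measurable P"
      unfolding mix_tail .
    moreover have "(\<lambda>w. ennreal (exp (lam * w T - lam\<^sup>2 * T / 2))) \<in> borel_measurable P"
      by (rule measurable_compose[OF coord_P[OF T], where g="\<lambda>x. ennreal (exp (lam * x - lam\<^sup>2 * T / 2))"]) measurable
    ultimately have "(\<lambda>w. ennreal (exp (lam * w T - lam\<^sup>2 * T / 2)) * ennreal (LINT z:{?S w..}|lborel. psi z * exp (- lam * z))) \<in> borel_measurable P"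
      by measurable
    then show ?thesis by (simp add: ennreal_mult')
  qed
  have Ff: "?F \<in> borel_measurable (F_upto T)"
  proof -
    have "(\<lambda>w. test_fun m l w) \<in> borel_measurable (F_upto T)"
    proof (rule measurable_test_fun[where f="\<lambda>w. w"])
      fix p assume "p \<in> set l"
      then show "(\<lambda>w. w (fst p)) \<in> borel_measurable (F_upto T)" using l by (intro measurable_coordinate) auto
    qed
    then show ?thesis by measurable
  qed
  have "(\<integral>\<^sup>+w. ?F w \<partial>Q0) = (\<integral>\<^sup>+w. ?F w * ennreal (?M w) \<partial>P)"
    by (rule nn_integral_martingale_density[OF Q0 T M0 Ff])
  \<comment> \<open>The second summand is split at S_T = 0 because the disintegration covers
    positive levels.\<close>
  also have "\<dots> = (\<integral>\<^sup>+w. ?F w * ennreal (?A w) + (?x w * indicator {0<..} (?S w) * ennreal (psi (?S w)) + ?x w * of_bool (?S w \<le> 0) * ennreal (psi (?S w))) \<partial>P)"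
  proof (rule nn_integral_cong)
    fix w assume "w \<in> space P"
    then have w: "w \<in> paths" by simp
    have "ennreal (?M w) = ennreal (?A w) + ennreal (?B w)"
      unfolding sup_martingale_eq[OF lam] by (rule ennreal_plus[OF A0 B0[OF w]])
    moreover have "?F w * ennreal (?B w) = ?x w * ennreal (psi (?S w))"
    proof -
      have "ennreal (?B w) = ennreal (psi (?S w)) * ennreal (sinh (lam * (?S w - w T)) / lam * exp (- (lam\<^sup>2 * T / 2)))"
        by (rule ennreal_mult'[OF less_imp_le[OF psi_pos]])
      then show ?thesis unfolding excursion_def[OF lam T l Z] by (simp only: mult_ac)
    qed
    moreover have "?x w * ennreal (psi (?S w)) = ?x w * indicator {0<..} (?S w) * ennreal (psi (?S w)) + ?x w * of_bool (?S w \<le> 0) * ennreal (psi (?S w))"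
      by (cases "?S w \<le> 0") auto
    ultimately show "?F w * ennreal (?M w) = ?F w * ennreal (?A w) + (?x w * indicator {0<..} (?S w) * ennreal (psi (?S w)) + ?x w * of_bool (?S w \<le> 0) * ennreal (psi (?S w)))"
      by (simp only: distrib_left)
  qed
  also have "\<dots> = (\<integral>\<^sup>+w. ?F w * ennreal (?A w) \<partial>P) + ((\<integral>\<^sup>+w. ?x w * indicator {0<..} (?S w) * ennreal (psi (?S w)) \<partial>P) +
    (\<integral>\<^sup>+w. ?x w * of_bool (?S w \<le> 0) * ennreal (psi (?S w)) \<partial>P))"
    unfolding of_bool_def using Fm Am xm Sm pm by (simp add: nn_integral_add)
  also have "(\<integral>\<^sup>+w. ?F w * ennreal (?A w) \<partial>P) = (\<integral>\<^sup>+y. mix y * indicator {0<..} y * before T m l y \<partial>lborel)"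
    by (rule mix_before[symmetric])
  also have "(\<integral>\<^sup>+w. ?x w * indicator {0<..} (?S w) * ennreal (psi (?S w)) \<partial>P) =
    (\<integral>\<^sup>+y. level lam T m l Z y * indicator {0<..} y * ennreal (psi y) \<partial>lborel)"
    using psi by (intro level_integral[OF lam T l Z]) measurable
  also have "(\<integral>\<^sup>+y. mix y * indicator {0<..} y * before T m l y \<partial>lborel) +
     ((\<integral>\<^sup>+y. level lam T m l Z y * indicator {0<..} y * ennreal (psi y) \<partial>lborel) +
      (\<integral>\<^sup>+w. ?x w * of_bool (?S w \<le> 0) * ennreal (psi (?S w)) \<partial>P)) =
    (\<integral>\<^sup>+y. mix y * indicator {0<..} y * before T m l y + level lam T m l Z y * indicator {0<..} y * ennreal (psi y) \<partial>lborel) +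
      (\<integral>\<^sup>+w. ?x w * of_bool (?S w \<le> 0) * ennreal (psi (?S w)) \<partial>P)"
    using measurable_before measurable_level[OF lam T l Z] psi by (subst nn_integral_add) (simp_all add: add.assoc)
  also have "(\<integral>\<^sup>+y. mix y * indicator {0<..} y * before T m l y + level lam T m l Z y * indicator {0<..} y * ennreal (psi y) \<partial>lborel) =
    (\<integral>\<^sup>+y. mix y * indicator {0<..} y * (\<integral>\<^sup>+w. ?F w \<partial>Qlev y) \<partial>lborel)"
  proof (rule nn_integral_cong)
    fix y :: real
    show "mix y * indicator {0<..} y * before T m l y + level lam T m l Z y * indicator {0<..} y * ennreal (psi y) =
      mix y * indicator {0<..} y * (\<integral>\<^sup>+w. ?F w \<partial>Qlev y)"
    proof (cases "0 < y")
      case True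
      \<comment> \<open>The factor exp (- \<lambda> y) of the mixture cancels the factor exp
        (\<lambda> y) with which \<open>level\<close> enters the law at level y.\<close>
      have "mix y * ennreal (exp (lam * y)) = ennreal (psi y)"
      proof -
        have "mix y * ennreal (exp (lam * y)) = ennreal (exp (- lam * y) * psi y * exp (lam * y))"
          unfolding mix_def using psi_pos[of y] by (intro ennreal_mult[symmetric]) (simp_all add: less_imp_le)
        also have "exp (- lam * y) * psi y * exp (lam * y) = psi y"
          by (simp add: exp_minus)
        finally show ?thesis .
      qed
      then show ?thesis using True by (simp add: Qlev_test_fun distrib_left mult.assoc[symmetric]) (simp add: mult.commute)
    qed simp
  qed
  finally show ?thesis .
qed

end

lemma Qlev_prob: "0 < y \<Longrightarrow> prob_space (Qlev y)" and Qlev_sets: "0 < y \<Longrightarrow> sets (Qlev y) = sets F_inf"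
  using Qlev by (auto simp: drift_coth_law_def)

text \<open>For the empty list the test functional is 1 and both total masses are 1, so the
  contribution of {S_T \<le> 0} vanishes. For any other list it is no larger, because test
  functionals are at most 1.\<close>

lemma Q0_test_fun:
  assumes T: "0 \<le> T" and l: "\<forall>p\<in>set l. 0 \<le> fst p \<and> fst p \<le> T"
  shows "(\<integral>\<^sup>+w. ennreal (test_fun m l w) \<partial>Q0) =
    (\<integral>\<^sup>+y. mix y * indicator {0<..} y * (\<integral>\<^sup>+w. ennreal (test_fun m l w) \<partial>Qlev y) \<partial>lborel)"
proof -
  interpret Q0: prob_space Q0 using Q0 by (simp add: has_martingale_density_def)
  let ?R = "\<lambda>l. \<integral>\<^sup>+w. excursion lam T m l w * of_bool (running_sup T w \<le> 0) * ennreal (psi (running_sup T w)) \<partial>P"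
  have n: "\<forall>p\<in>set []. 0 \<le> fst p \<and> fst p \<le> T" by simp
  have "(\<integral>\<^sup>+y. mix y * indicator {0<..} y * (\<integral>\<^sup>+w. ennreal (test_fun m [] w) \<partial>Qlev y) \<partial>lborel) = (\<integral>\<^sup>+y. mix y * indicator {0<..} y \<partial>lborel)"
  proof (rule nn_integral_cong)
    fix y :: real
    show "mix y * indicator {0<..} y * (\<integral>\<^sup>+w. ennreal (test_fun m [] w) \<partial>Qlev y) = mix y * indicator {0<..} y"
      using prob_space.emeasure_space_1[OF Qlev_prob[of y]] by (cases "0 < y") auto
  qed
  then have "1 = 1 + ?R []"
    using Q0_test_fun_aux[OF T n, of m] Q0.emeasure_space_1 by (simp add: mix_total)
  \<comment> \<open>Cancelling in \<open>ennreal\<close> is legitimate because 1 is finite.\<close>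
  then have R: "?R [] = 0"
    using ennreal_add_left_cancel[of 1 "?R []" 0] by simp
  have "excursion lam T m l w \<le> excursion lam T m [] w" for w
    unfolding excursion_def[OF lam T l Z] excursion_def[OF lam T n Z]
    using test_fun_bounds[of m l] by (intro mult_right_mono ennreal_leI) simp_all
  then have "?R l \<le> ?R []"
    by (intro nn_integral_mono mult_right_mono) simp_all
  then have "?R l = 0" using R by simp
  then show ?thesis using Q0_test_fun_aux[OF T l, of m] by simp
qed

text \<open>A total extension of \<open>Qlev\<close>. For y \<le> 0 some probability law has to
  stand there; the mixing measure gives these levels mass 0.\<close>

definition kernel :: "real \<Rightarrow> (real \<Rightarrow> real) measure" where
  "kernel y = (if 0 < y then Qlev y else Q0)"

lemma horizon:
  assumes "sorted (0 # map fst (l :: (real \<times> real) list))"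
  obtains T where "0 \<le> T" "\<forall>p\<in>set l. 0 \<le> fst p \<and> fst p \<le> T"
proof
  show "0 \<le> Max (insert 0 (fst ` set l))" by (rule Max_ge) auto
  show "\<forall>p\<in>set l. 0 \<le> fst p \<and> fst p \<le> Max (insert 0 (fst ` set l))" using assms by (auto intro!: Max_ge)
qed

lemma Q0_prob: "prob_space Q0" and Q0_sets: "sets Q0 = sets F_inf"
  using Q0 by (auto simp: has_martingale_density_def)

text \<open>The mass of a cylinder set is a limit of integrals of test functionals, and these depend
  measurably on y by the formula with \<open>before\<close> and \<open>level\<close>. Cylinder sets
  generate and are stable under intersection.\<close>

lemma measurable_kernel: "kernel \<in> measurable borel (prob_algebra F_inf)"
proof (rule measurable_prob_algebra_generated[OF sets_F_inf_cyls Int_stable_cyls cyls_Pow])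
  show pk: "prob_space (kernel y)" for y using Qlev_prob[of y] Q0_prob by (simp add: kernel_def)
  show sk: "sets (kernel y) = sets F_inf" for y using Qlev_sets[of y] Q0_sets by (simp add: kernel_def)
  fix A assume "A \<in> cyls"
  then obtain l where l: "A = cyl l" "sorted (0 # map fst l)" by (rule cyls_sorted)
  have l0: "\<forall>p\<in>set l. 0 \<le> fst p" using l(2) by auto
  obtain T where T: "0 \<le> T" "\<forall>p\<in>set l. 0 \<le> fst p \<and> fst p \<le> T" using horizon[OF l(2)] by blast
  show "(\<lambda>y. emeasure (kernel y) A) \<in> borel_measurable borel"
    unfolding l(1)
  proof (rule borel_measurable_LIMSEQ_order)
    fix y
    interpret K: prob_space "kernel y" by (rule pk)
    show "(\<lambda>m. \<integral>\<^sup>+w. ennreal (test_fun m l w) \<partial>kernel y) \<longlonglongrightarrow> emeasure (kernel y) (cyl l)"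
      by (rule nn_integral_test_fun_tendsto[OF sk _ l0]) unfold_locales
  next
    fix m
    have "(\<lambda>y. if 0 < y then before T m l y + ennreal (exp (lam * y)) * level lam T m l Z y else (\<integral>\<^sup>+w. ennreal (test_fun m l w) \<partial>Q0)) \<in> borel_measurable borel"
      using measurable_before[OF T] measurable_level[OF lam T Z] by measurable
    also have "(\<lambda>y. if 0 < y then before T m l y + ennreal (exp (lam * y)) * level lam T m l Z y else (\<integral>\<^sup>+w. ennreal (test_fun m l w) \<partial>Q0)) =
      (\<lambda>y. \<integral>\<^sup>+w. ennreal (test_fun m l w) \<partial>kernel y)"
      by (auto simp: kernel_def Qlev_test_fun[OF T])
    finally show "(\<lambda>y. \<integral>\<^sup>+w. ennreal (test_fun m l w) \<partial>kernel y) \<in> borel_measurable borel" .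
  qed
qed

text \<open>The mixture is the bind of the mixing law with \<open>kernel\<close>. It is a
  probability measure that agrees with \<open>Q0\<close> on all test functionals, hence on all
  events.\<close>

lemma mixture:
  assumes G: "G \<in> sets F_inf"
  shows "(\<lambda>y. emeasure (Qlev y) G) \<in> borel_measurable (restrict_space borel {0<..})"
    and "emeasure Q0 G = (\<integral>\<^sup>+y\<in>{0<..}. emeasure (Qlev y) G * ennreal (exp (- lam * y) * psi y) \<partial>lborel)"
proof -
  define \<mu> where "\<mu> = density lborel (\<lambda>y. mix y * indicator {0<..} y)"
  have mk: "kernel \<in> measurable borel (subprob_algebra F_inf)"
    by (rule measurable_prob_algebraD[OF measurable_kernel])
  have mk\<mu>: "kernel \<in> measurable \<mu> (subprob_algebra F_inf)"
    using mk by (simp add: \<mu>_def cong: measurable_cong_sets)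
  have em: "(\<lambda>y. emeasure (kernel y) G) \<in> borel_measurable borel"
    by (rule measurable_compose[OF mk measurable_emeasure_subprob_algebra[OF G]])
  have "(\<lambda>y. emeasure (kernel y) G) \<in> borel_measurable (restrict_space borel {0<..})"
    by (rule measurable_restrict_space1[OF em])
  also have "?this \<longleftrightarrow> (\<lambda>y. emeasure (Qlev y) G) \<in> borel_measurable (restrict_space borel {0<..})"
    by (rule measurable_cong) (simp add: kernel_def space_restrict_space)
  finally show "(\<lambda>y. emeasure (Qlev y) G) \<in> borel_measurable (restrict_space borel {0<..})" .
  have nn: "(\<integral>\<^sup>+y. f y \<partial>\<mu>) = (\<integral>\<^sup>+y. mix y * indicator {0<..} y * f y \<partial>lborel)" if "f \<in> borel_measurable borel" for f
    unfolding \<mu>_def using that by (intro nn_integral_density) auto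
  have prob_\<mu>: "prob_space \<mu>"
  proof (rule prob_spaceI)
    have "emeasure \<mu> (space \<mu>) = (\<integral>\<^sup>+y. 1 \<partial>\<mu>)" by simp
    also have "\<dots> = 1" by (subst nn) (simp_all add: mix_total)
    finally show "emeasure \<mu> (space \<mu>) = 1" .
  qed
  interpret \<mu>: prob_space \<mu> by (rule prob_\<mu>)
  interpret Q0: prob_space Q0 by (rule Q0_prob)
  have sb: "sets (\<mu> \<bind> kernel) = sets F_inf"
    by (rule sets_bind[of _ _ F_inf]) (use mk\<mu> \<mu>.not_empty in \<open>auto dest: subprob_measurableD(2)\<close>)
  interpret B: prob_space "\<mu> \<bind> kernel"
  proof (rule \<mu>.prob_space_bind[OF _ mk\<mu>])
    show "AE y in \<mu>. prob_space (kernel y)" using Qlev_prob Q0_prob by (simp add: kernel_def)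
  qed
  have eq: "Q0 = \<mu> \<bind> kernel"
  proof (rule measure_eqI_test_fun[OF Q0_sets sb])
    show "finite_measure Q0" "finite_measure (\<mu> \<bind> kernel)" by unfold_locales
    fix m and l :: "(real \<times> real) list" assume l: "sorted (0 # map fst l)"
    obtain T where T: "0 \<le> T" "\<forall>p\<in>set l. 0 \<le> fst p \<and> fst p \<le> T" using horizon[OF l] by blast
    have tm: "(\<lambda>w. ennreal (test_fun m l w)) \<in> borel_measurable F_inf"
      using measurable_test_fun_inf[OF measurable_ident_sets[OF refl], of l m] l by auto
    have km: "(\<lambda>y. \<integral>\<^sup>+w. ennreal (test_fun m l w) \<partial>kernel y) \<in> borel_measurable borel"
      by (rule measurable_compose[OF mk nn_integral_measurable_subprob_algebra[OF tm]])
    have "(\<integral>\<^sup>+w. ennreal (test_fun m l w) \<partial>(\<mu> \<bind> kernel)) = (\<integral>\<^sup>+y. \<integral>\<^sup>+w. ennreal (test_fun m l w) \<partial>kernel y \<partial>\<mu>)"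
      by (rule nn_integral_bind[OF tm mk\<mu>])
    also have "\<dots> = (\<integral>\<^sup>+y. mix y * indicator {0<..} y * (\<integral>\<^sup>+w. ennreal (test_fun m l w) \<partial>kernel y) \<partial>lborel)"
      by (rule nn[OF km])
    also have "\<dots> = (\<integral>\<^sup>+y. mix y * indicator {0<..} y * (\<integral>\<^sup>+w. ennreal (test_fun m l w) \<partial>Qlev y) \<partial>lborel)"
      by (intro nn_integral_cong) (simp add: kernel_def indicator_def)
    also have "\<dots> = (\<integral>\<^sup>+w. ennreal (test_fun m l w) \<partial>Q0)" by (rule Q0_test_fun[OF T, symmetric])
    finally show "(\<integral>\<^sup>+w. ennreal (test_fun m l w) \<partial>Q0) = (\<integral>\<^sup>+w. ennreal (test_fun m l w) \<partial>(\<mu> \<bind> kernel))" by simp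
  qed
  have "emeasure Q0 G = emeasure (\<mu> \<bind> kernel) G" by (rule arg_cong[OF eq])
  also have "\<dots> = (\<integral>\<^sup>+y. emeasure (kernel y) G \<partial>\<mu>)"
    by (rule emeasure_bind[OF \<mu>.not_empty mk\<mu> G])
  also have "\<dots> = (\<integral>\<^sup>+y. mix y * indicator {0<..} y * emeasure (kernel y) G \<partial>lborel)" by (rule nn[OF em])
  also have "\<dots> = (\<integral>\<^sup>+y\<in>{0<..}. emeasure (Qlev y) G * ennreal (exp (- lam * y) * psi y) \<partial>lborel)"
    by (intro nn_integral_cong) (auto simp: kernel_def mix_def indicator_def mult_ac)
  finally show "emeasure Q0 G = (\<integral>\<^sup>+y\<in>{0<..}. emeasure (Qlev y) G * ennreal (exp (- lam * y) * psi y) \<partial>lborel)" .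
qed

end

end

theorem proposition5p2:
  fixes lam :: real and psi :: "real \<Rightarrow> real"
    and P0 Q0 :: "(real \<Rightarrow> real) measure"
    and Z :: "(real \<Rightarrow> real) \<Rightarrow> (real \<Rightarrow> real)"
    and Qlev :: "real \<Rightarrow> (real \<Rightarrow> real) measure"
  assumes "lam > 0"
    and "psi \<in> borel_measurable borel"
    and "\<And>z. psi z > 0"
    and "\<And>x. set_integrable lborel {x..} (\<lambda>z. psi z * exp (- lam * z))"
    and "(LINT z:{0..}|lborel. psi z * exp (- lam * z)) = 1"
    and "wiener_measure P0"
    and "has_martingale_density P0 (sup_martingale lam (Phi_of lam psi) (phi_of lam psi)) Q0"
    and "coth_process P0 lam Z"
    and "\<And>x. x > 0 \<Longrightarrow> drift_coth_law P0 Z lam x (Qlev x)"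
  shows "\<forall>G\<in>sets F_inf.
           (\<lambda>y. emeasure (Qlev y) G) \<in> borel_measurable (restrict_space borel {0<..}) \<and>
           emeasure Q0 G =
             (\<integral>\<^sup>+y\<in>{0<..}. emeasure (Qlev y) G * ennreal (exp (- lam * y) * psi y) \<partial>lborel)"
proof -
  interpret wiener P0 by (rule wiener.intro) fact
  show ?thesis using mixture[OF assms(1-5,7-9)] by blast
qed

end
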